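(* Consider the planar $\mathbb Z^2$-periodic infinite horizon billiard of the context and assume that $\partial Q$ is $C^4$ at every point $q\in\partial Q$ such that the tangent line to $\partial Q$ at $q$ is contained in $Q$. Let $w\in\mathbb Z^2$ have coprime coordinates and let $L\in\mathbb Z^2$. Then, as $N\to+\infty$, $$\bar\mu(\kappa=L+Nw)=\sum_{(A,B)\in E_{L,w}}\left(\frac{d_A^2\,\mathfrak a_{(A,B)}}{2|\partial\bar Q|\,|w|N^3}+\frac{\mathfrak a'_{(A,B)}}{2|\partial\bar Q|\,(|w|N)^4}\right)+o(N^{-4}),$$ with $\mathfrak a_{(A,B)}:=\frac{AA'\;B''B}{|w|^2}$ and $$\mathfrak a'_{(A,B)}:=\frac{3d_A^2\,AA'\,B''B\left(AA'+B''B-2\frac{w\cdot\overrightarrow{A(B+L)}}{|w|}\right)}2+\frac{d_A^3}2\left(B''B\left(\frac1{\mathfrak c_A}-\frac1{\mathfrak c_{A'}}\right)+AA'\left(\frac1{\mathfrak c_B}-\frac1{\mathfrak c_{B''}}\right)\right),$$ where $B''$ is the first point of $\partial Q$ (other than $B$) met by the half-line $B-\mathbb R_+w$, $A'$ is the first point of $\partial Q$ (other than $A$) met by the half-line $A+\mathbb R_+w$, $AA'$ and $B''B$ denote distances, and $\mathfrak c_E$ is the curvature of $\partial Q$ at $E\in\partial Q$.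
   Context: $\mathcal J$ is a nonempty finite set and $(\mathcal O_j)_{j\in\mathcal J}$ are open convex subsets of $\mathbb R^2$ with $C^3$ boundary of nonzero curvature, such that the sets $\mathcal O_j+\ell$ ($j\in\mathcal J,\ell\in\mathbb Z^2$) have pairwise disjoint closures. $Q:=\mathbb R^2\setminus\bigcup_{j,\ell}(\mathcal O_j+\ell)$ is assumed to contain at least one line (infinite horizon). $(\bar M,\bar T,\bar\mu)$ is the billiard map (acting on post-collisional unit vectors) in $\bar Q=Q/\mathbb Z^2$, with invariant probability $\bar\mu$ of density proportional to $\cos\varphi$ ($\varphi$ the angle of the reflected vector with the inward normal). $|\partial\bar Q|$ is the total length of $\partial\bar Q$. $\kappa:\bar M\to\mathbb Z^2$ is the cell change: lifting to $Q$, a particle leaving an obstacle of the cell $N$ (obstacles $\mathcal O_j+N$, $j\in\mathcal J$) has its next collision in the cell $N+\kappa$. A corridor is a strip contained in $Q$ delimited by $(A+\mathbb Rw)\cup(B+L+\mathbb Rw)$ for some $A,B\in\bigcup_j\partial\mathcal O_j$ and $L,w\in\mathbb Z^2$. $E_{L,w}$ is the (finite, possibly empty) set of couples $(A,B)\in(\bigcup_j\partial\mathcal O_j)^2$ such that the lines $A+\mathbb Rw$ and $B+L+\mathbb Rw$ are the two lines delimiting a corridor; $d_A$ is the width of that corridor (which is determined by $A$). *)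

theory Defs
  imports "HOL-Analysis.Analysis" "HOL-Library.Landau_Symbols"
begin

definition lat :: "int ^ 2 \<Rightarrow> real ^ 2" where
  "lat z = (\<chi> i. real_of_int (z $ i))"

definition vderiv :: "(real \<Rightarrow> real ^ 2) \<Rightarrow> real \<Rightarrow> real ^ 2" where
  "vderiv f = (\<lambda>s. vector_derivative f (at s))"

(* Class C^k on an open set S of parameters. *)
definition Ck_on :: "nat \<Rightarrow> (real \<Rightarrow> real ^ 2) \<Rightarrow> real set \<Rightarrow> bool" where
  "Ck_on k f S \<longleftrightarrow>
     (\<forall>m<k. \<forall>s\<in>S. (vderiv ^^ m) f differentiable (at s)) \<and> continuous_on S ((vderiv ^^ k) f)"

(* A convex domain whose boundary is a closed curve of class C^3 is handled through an arclength
   parametrization g of its boundary, of period l (the length of the boundary).  An arclength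
   parametrization of a regular curve is as smooth as the curve, so smoothness of the boundary
   near a point is smoothness of g near the corresponding parameter. *)
definition arclength_param :: "(real ^ 2) set \<Rightarrow> (real \<Rightarrow> real ^ 2) \<Rightarrow> real \<Rightarrow> bool" where
  "arclength_param K g l \<longleftrightarrow>
     0 < l \<and> (\<forall>s. norm (vderiv g s) = 1) \<and> (\<forall>s. g (s + l) = g s) \<and>
     inj_on g {0..<l} \<and> g ` {0..<l} = frontier K"

definition obstacle :: "('j \<Rightarrow> (real ^ 2) set) \<Rightarrow> 'j \<Rightarrow> int ^ 2 \<Rightarrow> (real ^ 2) set" where
  "obstacle Ob j z = (+) (lat z) ` Ob j"

definition table :: "'j set \<Rightarrow> ('j \<Rightarrow> (real ^ 2) set) \<Rightarrow> (real ^ 2) set" where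
  "table J Ob = - (\<Union>j\<in>J. \<Union>z. obstacle Ob j z)"

definition line :: "real ^ 2 \<Rightarrow> real ^ 2 \<Rightarrow> (real ^ 2) set" where
  "line p v = range (\<lambda>t. p + t *\<^sub>R v)"

(* Unit normal at a boundary point q of the convex obstacle K, pointing out of K, that is, into
   the billiard table. *)
definition table_normal :: "(real ^ 2) set \<Rightarrow> real ^ 2 \<Rightarrow> real ^ 2" where
  "table_normal K q = (THE n. norm n = 1 \<and> (\<forall>y\<in>K. n \<bullet> (y - q) \<le> 0))"

(* Post-collisional unit vectors modulo the lattice, each represented by its base point on the
   obstacles of the cell 0. *)
definition phase_space :: "'j set \<Rightarrow> ('j \<Rightarrow> (real ^ 2) set) \<Rightarrow> ((real ^ 2) \<times> (real ^ 2)) set" where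
  "phase_space J Ob =
     {(q, v). norm v = 1 \<and> (\<exists>j\<in>J. q \<in> frontier (Ob j) \<and> 0 \<le> table_normal (Ob j) q \<bullet> v)}"

definition perimeter :: "'j set \<Rightarrow> ('j \<Rightarrow> real) \<Rightarrow> real" where
  "perimeter J len = (\<Sum>j\<in>J. len j)"

(* The probability cos phi dr dphi / (2 perimeter), r being arclength and phi the angle of the
   vector with the normal pointing into the table. *)
definition billiard_measure ::
    "'j set \<Rightarrow> ('j \<Rightarrow> (real ^ 2) set) \<Rightarrow> ('j \<Rightarrow> real \<Rightarrow> real ^ 2) \<Rightarrow> ('j \<Rightarrow> real) \<Rightarrow>
      ((real ^ 2) \<times> (real ^ 2)) measure" where
  "billiard_measure J Ob \<gamma> len =
     distr
       (density (count_space J \<Otimes>\<^sub>M (lborel \<Otimes>\<^sub>M lborel))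
         (\<lambda>(j, r, \<phi>). if 0 \<le> r \<and> r < len j \<and> \<bar>\<phi>\<bar> \<le> pi / 2
            then ennreal (cos \<phi> / (2 * perimeter J len)) else 0))
       borel
       (\<lambda>(j, r, \<phi>). (\<gamma> j r, cos \<phi> *\<^sub>R table_normal (Ob j) (\<gamma> j r) + sin \<phi> *\<^sub>R vderiv (\<gamma> j) r))"

definition flight_time :: "'j set \<Rightarrow> ('j \<Rightarrow> (real ^ 2) set) \<Rightarrow> real ^ 2 \<Rightarrow> real ^ 2 \<Rightarrow> real" where
  "flight_time J Ob q v = Inf {t. 0 < t \<and> q + t *\<^sub>R v \<in> frontier (table J Ob)}"

(* First point of the boundary of the table, other than q, met by the half-line from q in the
   direction v; v need not be a unit vector. *)
definition next_point :: "'j set \<Rightarrow> ('j \<Rightarrow> (real ^ 2) set) \<Rightarrow> real ^ 2 \<Rightarrow> real ^ 2 \<Rightarrow> real ^ 2" where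
  "next_point J Ob q v = q + flight_time J Ob q v *\<^sub>R v"

(* The value is irrelevant on the vectors without further collision, which form a null set. *)
definition cell_change :: "'j set \<Rightarrow> ('j \<Rightarrow> (real ^ 2) set) \<Rightarrow> (real ^ 2) \<times> (real ^ 2) \<Rightarrow> int ^ 2" where
  "cell_change J Ob = (\<lambda>(q, v). THE z. \<exists>j\<in>J. next_point J Ob q v \<in> frontier (obstacle Ob j z))"

(* Couples (A, B) of boundary points in the cell 0 such that the lines A + R w and B + L + R w
   delimit a corridor; the lines must be distinct, so that the strip is not degenerate. *)
definition corridor_pairs ::
    "'j set \<Rightarrow> ('j \<Rightarrow> (real ^ 2) set) \<Rightarrow> int ^ 2 \<Rightarrow> int ^ 2 \<Rightarrow> ((real ^ 2) \<times> (real ^ 2)) set" where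
  "corridor_pairs J Ob L w =
     {(A, B). A \<in> (\<Union>j\<in>J. frontier (Ob j)) \<and> B \<in> (\<Union>j\<in>J. frontier (Ob j)) \<and>
        line A (lat w) \<noteq> line (B + lat L) (lat w) \<and>
        convex hull (line A (lat w) \<union> line (B + lat L) (lat w)) \<subseteq> table J Ob}"

definition corridor_width :: "int ^ 2 \<Rightarrow> int ^ 2 \<Rightarrow> real ^ 2 \<Rightarrow> real ^ 2 \<Rightarrow> real" where
  "corridor_width L w A B = setdist (line A (lat w)) (line (B + lat L) (lat w))"

(* Curvature of the boundary of the table at E, positive by convention. *)
definition curvature :: "'j set \<Rightarrow> ('j \<Rightarrow> real \<Rightarrow> real ^ 2) \<Rightarrow> real ^ 2 \<Rightarrow> real" where
  "curvature J \<gamma> E =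
     (THE c. \<exists>j\<in>J. \<exists>z s. E = \<gamma> j s + lat z \<and> c = norm (vderiv (vderiv (\<gamma> j)) s))"

definition coeff_a :: "'j set \<Rightarrow> ('j \<Rightarrow> (real ^ 2) set) \<Rightarrow> int ^ 2 \<Rightarrow> real ^ 2 \<Rightarrow> real ^ 2 \<Rightarrow> real" where
  "coeff_a J Ob w A B =
     dist A (next_point J Ob A (lat w)) * dist (next_point J Ob B (- lat w)) B / (norm (lat w))\<^sup>2"

definition coeff_a' ::
    "'j set \<Rightarrow> ('j \<Rightarrow> (real ^ 2) set) \<Rightarrow> ('j \<Rightarrow> real \<Rightarrow> real ^ 2) \<Rightarrow> int ^ 2 \<Rightarrow> int ^ 2 \<Rightarrow>
      real ^ 2 \<Rightarrow> real ^ 2 \<Rightarrow> real" where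
  "coeff_a' J Ob \<gamma> L w A B =
     (let A' = next_point J Ob A (lat w);
          B'' = next_point J Ob B (- lat w);
          d = corridor_width L w A B;
          c = curvature J \<gamma>
      in 3 * d\<^sup>2 * dist A A' * dist B'' B *
           (dist A A' + dist B'' B - 2 * ((lat w \<bullet> (B + lat L - A)) / norm (lat w))) / 2
         + d ^ 3 / 2 * (dist B'' B * (1 / c A - 1 / c A') + dist A A' * (1 / c B - 1 / c B'')))"

end

theory Submission
  imports Defs
begin

text \<open>
  The invariant measure is the measure \<open>dp d\<theta>\<close> on oriented lines, \<open>\<theta>\<close> being the angle of the line
  with \<open>w\<close> and \<open>p\<close> its offset: leaving a convex obstacle is a bijection onto the lines that meet
  it.  A flight with cell change \<open>L + N w\<close>, \<open>N\<close> large, makes an angle \<open>O(1/N)\<close> with \<open>\<plusminus> w\<close>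
  and crosses a corridor from an obstacle tangent to one side to an obstacle tangent to the other.
  Its lines are those that are blocked at both ends and pass the next obstacles on both sides, so that,
  for fixed \<open>\<theta>\<close>, the admissible offsets form the intersection of two intervals whose ends are
  support functions of four obstacles.

  At an obstacle touching the corridor at \<open>A\<close> with curvature \<open>c\<close>, the support function in the
  direction \<open>v'\<close> orthogonal to the line is \<open>A \<bullet> v' + \<theta>\<^sup>2 / (2 c) + o(\<theta>\<^sup>2)\<close>.  With \<open>d\<close> the width
  of the corridor, the substitution \<open>\<theta> = arctan (d / (M - \<sigma>))\<close>, \<open>M = N \<bar>w\<bar>\<close>, turns the length of the
  intersection into a second difference of ramps in \<open>\<sigma>\<close>, which is integrated exactly.  The moments of
  order 0 and 1 give the terms in \<open>N\<^sup>-\<^sup>3\<close> and \<open>N\<^sup>-\<^sup>4\<close>.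
\<close>

subsection \<open>Overlaps of moving intervals\<close>

text \<open>A line of slope d / (M - \<sigma>) crosses the corridor within a horizontal distance M -
  \<sigma>. In units of sin \<theta>, each bound on the offset is then a constant or a constant
  minus \<sigma>, up to O(1 / M), and d\<theta> times the width becomes d^2 M^-3 (1 + 3 \<sigma> / M
  + o(1 / M)) d\<sigma> times the rescaled width, on a bounded range of \<sigma>. Curvature moves
  each bound by about d / (2 c M), also of relative order 1 / M, so an error
  \<open>o(\<theta>\<^sup>2)\<close> in the support functions is affordable.

  The hard direction is that every flight to a distant cell has this form, with thresholds valid for
  all obstacles at once. The uniformity rests on three facts: up to translation there are finitely
  many obstacles; heights of lattice points above w are multiples of 1 / |w|, so extremal heights
  are discrete; nonzero curvature makes extremal points unique.

  Two symmetries save work. Reversing w and the normal n together reads a flight backwards;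
  reversing n alone exchanges rising and descending flights.\<close>

lemma has_integral_ramp:
  fixes c R :: real
  assumes "\<bar>c\<bar> \<le> R"
  shows "((\<lambda>\<sigma>. max 0 (- \<sigma> - c)) has_integral (R - c)\<^sup>2 / 2) {-R..R}"
    and "((\<lambda>\<sigma>. \<sigma> * max 0 (- \<sigma> - c)) has_integral (- (c ^ 3) / 6 - R ^ 3 / 3 + c * R\<^sup>2 / 2)) {-R..R}"
proof -
  have c: "- R \<le> - c" "- c \<le> R" using assms by auto
  have "((\<lambda>\<sigma>. - \<sigma> - c) has_integral (- ((- c)\<^sup>2) / 2 - c * (- c)) - (- ((- R)\<^sup>2) / 2 - c * (- R))) {-R..-c}"
    using c by (intro fundamental_theorem_of_calculus)
      (auto intro!: derivative_eq_intros simp flip: has_real_derivative_iff_has_vector_derivative)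
  then have 1: "((\<lambda>\<sigma>. max 0 (- \<sigma> - c)) has_integral (- ((- c)\<^sup>2) / 2 - c * (- c)) - (- ((- R)\<^sup>2) / 2 - c * (- R))) {-R..-c}"
    by (rule has_integral_eq[rotated]) auto
  have 2: "((\<lambda>\<sigma>. max 0 (- \<sigma> - c)) has_integral 0) {-c..R}"
    by (rule has_integral_is_0) auto
  show "((\<lambda>\<sigma>. max 0 (- \<sigma> - c)) has_integral (R - c)\<^sup>2 / 2) {-R..R}"
    using has_integral_combine[OF c 1 2] by (rule back_subst[where P = "\<lambda>i. (_ has_integral i) _"]) (simp add: power2_eq_square field_simps)
  have "((\<lambda>\<sigma>. \<sigma> * (- \<sigma> - c)) has_integral (- ((- c) ^ 3) / 3 - c * (- c)\<^sup>2 / 2) - (- ((- R) ^ 3) / 3 - c * (- R)\<^sup>2 / 2)) {-R..-c}"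
    using c by (intro fundamental_theorem_of_calculus)
      (auto intro!: derivative_eq_intros simp: algebra_simps power2_eq_square simp flip: has_real_derivative_iff_has_vector_derivative)
  then have 1: "((\<lambda>\<sigma>. \<sigma> * max 0 (- \<sigma> - c)) has_integral (- ((- c) ^ 3) / 3 - c * (- c)\<^sup>2 / 2) - (- ((- R) ^ 3) / 3 - c * (- R)\<^sup>2 / 2)) {-R..-c}"
    by (rule has_integral_eq[rotated]) auto
  have 2: "((\<lambda>\<sigma>. \<sigma> * max 0 (- \<sigma> - c)) has_integral 0) {-c..R}"
    by (rule has_integral_is_0) auto
  show "((\<lambda>\<sigma>. \<sigma> * max 0 (- \<sigma> - c)) has_integral (- (c ^ 3) / 6 - R ^ 3 / 3 + c * R\<^sup>2 / 2)) {-R..R}"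
    using has_integral_combine[OF c 1 2] by (rule back_subst[where P = "\<lambda>i. (_ has_integral i) _"]) (simp add: power2_eq_square power3_eq_cube field_simps)
qed

text \<open>The length of the intersection of two intervals, one of them moving, is the second difference
  of a ramp.\<close>

lemma overlap_as_ramps:
  fixes P1 P2 Q1 Q2 \<sigma> :: real
  assumes "P1 \<le> P2" "Q1 \<le> Q2"
  shows "max 0 (min P2 (- \<sigma> - Q1) - max P1 (- \<sigma> - Q2)) =
    max 0 (- \<sigma> - (P1 + Q1)) - max 0 (- \<sigma> - (P2 + Q1)) - max 0 (- \<sigma> - (P1 + Q2)) + max 0 (- \<sigma> - (P2 + Q2))"
  using assms unfolding max_def min_def by (simp split: if_splits)

text \<open>Let c be the sum of one end of each interval. Every term of the ramp integrals that
  involves \<open>R\<close> is at most linear in c, so it cancels in the second difference over the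
  four sums. What survives are the mixed differences of c^2 / 2 and -c^3 / 6; \<open>R\<close> only
  has to enclose the four breakpoints.\<close>

lemma has_integral_overlap:
  fixes P1 P2 Q1 Q2 R :: real
  assumes PQ: "P1 \<le> P2" "Q1 \<le> Q2" and R: "- R \<le> P1 + Q1" "P2 + Q2 \<le> R"
  shows "((\<lambda>\<sigma>. max 0 (min P2 (- \<sigma> - Q1) - max P1 (- \<sigma> - Q2))) has_integral (P2 - P1) * (Q2 - Q1)) {-R..R}"
    and "((\<lambda>\<sigma>. \<sigma> * max 0 (min P2 (- \<sigma> - Q1) - max P1 (- \<sigma> - Q2))) has_integral
       - ((P2 - P1) * (Q2 - Q1) * (P1 + P2 + Q1 + Q2) / 2)) {-R..R}"
proof -
  have b: "\<bar>P1 + Q1\<bar> \<le> R" "\<bar>P2 + Q1\<bar> \<le> R" "\<bar>P1 + Q2\<bar> \<le> R" "\<bar>P2 + Q2\<bar> \<le> R" using assms by auto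
  note r = b[THEN has_integral_ramp(1)] and s = b[THEN has_integral_ramp(2)]
  have "((\<lambda>\<sigma>. max 0 (- \<sigma> - (P1 + Q1)) - max 0 (- \<sigma> - (P2 + Q1)) - max 0 (- \<sigma> - (P1 + Q2)) + max 0 (- \<sigma> - (P2 + Q2))) has_integral
    (R - (P1 + Q1))\<^sup>2 / 2 - (R - (P2 + Q1))\<^sup>2 / 2 - (R - (P1 + Q2))\<^sup>2 / 2 + (R - (P2 + Q2))\<^sup>2 / 2) {-R..R}"
    by (intro has_integral_add has_integral_diff r)
  then show "((\<lambda>\<sigma>. max 0 (min P2 (- \<sigma> - Q1) - max P1 (- \<sigma> - Q2))) has_integral (P2 - P1) * (Q2 - Q1)) {-R..R}"
    unfolding overlap_as_ramps[OF PQ]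
    by (rule back_subst[where P = "\<lambda>i. (_ has_integral i) _"]) (simp add: power2_eq_square field_simps)
  have "((\<lambda>\<sigma>. \<sigma> * max 0 (- \<sigma> - (P1 + Q1)) - \<sigma> * max 0 (- \<sigma> - (P2 + Q1)) - \<sigma> * max 0 (- \<sigma> - (P1 + Q2)) + \<sigma> * max 0 (- \<sigma> - (P2 + Q2))) has_integral
    (- ((P1 + Q1) ^ 3) / 6 - R ^ 3 / 3 + (P1 + Q1) * R\<^sup>2 / 2) - (- ((P2 + Q1) ^ 3) / 6 - R ^ 3 / 3 + (P2 + Q1) * R\<^sup>2 / 2) -
    (- ((P1 + Q2) ^ 3) / 6 - R ^ 3 / 3 + (P1 + Q2) * R\<^sup>2 / 2) + (- ((P2 + Q2) ^ 3) / 6 - R ^ 3 / 3 + (P2 + Q2) * R\<^sup>2 / 2)) {-R..R}"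
    by (intro has_integral_add has_integral_diff s)
  then show "((\<lambda>\<sigma>. \<sigma> * max 0 (min P2 (- \<sigma> - Q1) - max P1 (- \<sigma> - Q2))) has_integral
       - ((P2 - P1) * (Q2 - Q1) * (P1 + P2 + Q1 + Q2) / 2)) {-R..R}"
    unfolding overlap_as_ramps[OF PQ] distrib_left right_diff_distrib
    by (rule back_subst[where P = "\<lambda>i. (_ has_integral i) _"]) (simp add: power2_eq_square power3_eq_cube field_simps)
qed

text \<open>Carries estimates of the interval ends over to the length of the intersection, also
  where the intersection is empty and the length is cut off at 0.\<close>

lemma overlap_lipschitz:
  fixes a b c e :: real
  shows "\<bar>max 0 (min a b - max c e) - max 0 (min a' b' - max c' e')\<bar> \<le> \<bar>a - a'\<bar> + \<bar>b - b'\<bar> + \<bar>c - c'\<bar> + \<bar>e - e'\<bar>"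
proof -
  have "\<bar>min a b - min a' b'\<bar> \<le> \<bar>a - a'\<bar> + \<bar>b - b'\<bar>" by (auto simp: min_def)
  moreover have "\<bar>max c e - max c' e'\<bar> \<le> \<bar>c - c'\<bar> + \<bar>e - e'\<bar>" by (auto simp: max_def)
  moreover have "\<bar>max 0 x - max 0 y\<bar> \<le> \<bar>x - y\<bar>" for x y :: real by (auto simp: max_def)
  ultimately show ?thesis
    by (smt (verit) abs_triangle_ineq4)
qed

section \<open>Asymptotics of the slope, uniform in a bounded parameter\<close>

text \<open>Convergence along this filter is convergence as M tends to infinity, uniformly for
  \<sigma> in the interval. The usual limit rules apply to it, and its conclusions can be integrated
  over \<sigma>.\<close>

definition strip_filter :: "real \<Rightarrow> (real \<times> real) filter" where
  "strip_filter R = at_top \<times>\<^sub>F principal {-R..R}"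

lemma eventually_strip_filter:
  "eventually P (strip_filter R) \<longleftrightarrow> (\<forall>\<^sub>F M in at_top. \<forall>\<sigma>\<in>{-R..R}. P (M, \<sigma>))"
proof
  assume "eventually P (strip_filter R)"
  then obtain A B where "eventually A at_top" "\<forall>\<sigma>\<in>{-R..R}. B \<sigma>" "\<And>M \<sigma>. A M \<Longrightarrow> B \<sigma> \<Longrightarrow> P (M, \<sigma>)"
    unfolding strip_filter_def eventually_prod_filter eventually_principal by blast
  then show "\<forall>\<^sub>F M in at_top. \<forall>\<sigma>\<in>{-R..R}. P (M, \<sigma>)" by (auto elim: eventually_mono)
next
  assume "\<forall>\<^sub>F M in at_top. \<forall>\<sigma>\<in>{-R..R}. P (M, \<sigma>)"
  then show "eventually P (strip_filter R)"
    unfolding strip_filter_def eventually_prod_filter eventually_principal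
    by (intro exI[of _ "\<lambda>M. \<forall>\<sigma>\<in>{-R..R}. P (M, \<sigma>)"] exI[of _ "\<lambda>\<sigma>. \<sigma> \<in> {-R..R}"]) auto
qed

text \<open>With \<open>\<theta> = arctan (d / (M - \<sigma>))\<close> one has \<open>M sin \<theta> = d / sqrt (1 + \<xi>)\<close>.\<close>

definition slope_defect :: "real \<Rightarrow> real \<times> real \<Rightarrow> real" where
  "slope_defect d p = - 2 * snd p / fst p + ((snd p)\<^sup>2 + d\<^sup>2) / (fst p)\<^sup>2"

definition slope_of :: "real \<Rightarrow> real \<times> real \<Rightarrow> real" where
  "slope_of d p = arctan (d / (fst p - snd p))"

context
  fixes R d :: real
  assumes R: "0 < R" and d: "0 < d"
begin

abbreviation "FR \<equiv> strip_filter R"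

lemma fst_at_top: "filterlim fst at_top FR"
  unfolding strip_filter_def by (rule filterlim_fst)

lemma inverse_fst: "((\<lambda>p. 1 / fst p) \<longlongrightarrow> 0) FR"
  using tendsto_inverse_0_at_top[OF fst_at_top] by (simp add: inverse_eq_divide)

lemma snd_bounded: "\<forall>\<^sub>F p in FR. \<bar>snd p\<bar> \<le> R"
  unfolding eventually_strip_filter by (intro always_eventually) auto

lemma bounded_times_null:
  assumes "(f \<longlongrightarrow> (0::real)) FR" "\<forall>\<^sub>F p in FR. \<bar>b p\<bar> \<le> K"
  shows "((\<lambda>p. f p * b p) \<longlongrightarrow> 0) FR"
  using assms by (intro tendsto_0_le[OF assms(1), of _ K]) (auto elim!: eventually_mono simp: abs_mult mult_left_mono)

lemma fst_large: "\<forall>\<^sub>F p in FR. K \<le> fst p"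
  using fst_at_top by (simp add: filterlim_at_top)

abbreviation "\<xi> \<equiv> slope_defect d"
abbreviation "slope \<equiv> slope_of d"

text \<open>\<xi> = -2 \<sigma> / M + O(1 / M^2): the remainder is a bounded quantity divided by
  M^2.\<close>

lemma fst_xi: "((\<lambda>p. fst p * \<xi> p + 2 * snd p) \<longlongrightarrow> 0) FR"
proof -
  have "((\<lambda>p. 1 / fst p * ((snd p)\<^sup>2 + d\<^sup>2)) \<longlongrightarrow> 0) FR"
  proof (rule bounded_times_null[OF inverse_fst, where K = "R\<^sup>2 + d\<^sup>2"])
    show "\<forall>\<^sub>F p in FR. \<bar>(snd p)\<^sup>2 + d\<^sup>2\<bar> \<le> R\<^sup>2 + d\<^sup>2"
      using snd_bounded
    proof eventually_elim
      case (elim p)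
      then have "(snd p)\<^sup>2 \<le> R\<^sup>2" using R by (simp add: abs_le_square_iff[symmetric])
      then show ?case by simp
    qed
  qed
  moreover have "\<forall>\<^sub>F p in FR. 1 / fst p * ((snd p)\<^sup>2 + d\<^sup>2) = fst p * \<xi> p + 2 * snd p"
    using fst_large[of 1] by eventually_elim (simp add: slope_defect_def field_simps power2_eq_square)
  ultimately show ?thesis using tendsto_cong by fastforce
qed

lemma xi_null: "(\<xi> \<longlongrightarrow> 0) FR"
proof -
  have "((\<lambda>p. 1 / fst p * (fst p * \<xi> p + 2 * snd p) - 2 * (1 / fst p * snd p)) \<longlongrightarrow> 0 * 0 - 2 * 0) FR"
    using snd_bounded by (intro tendsto_intros inverse_fst fst_xi bounded_times_null[OF inverse_fst])
  moreover have "\<forall>\<^sub>F p in FR. 1 / fst p * (fst p * \<xi> p + 2 * snd p) - 2 * (1 / fst p * snd p) = \<xi> p"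
    using fst_large[of 1] by eventually_elim (simp add: field_simps)
  ultimately show ?thesis using tendsto_cong by fastforce
qed

text \<open>Trigonometry of the right triangle with legs M - \<sigma> and d. The last quotient is
  the derivative of the slope with respect to \<sigma>, that is, the Jacobian of the
  substitution.\<close>

lemma sin_slope: "\<forall>\<^sub>F p in FR. fst p * sin (slope p) = d * (1 / sqrt (1 + \<xi> p)) \<and> 0 < sin (slope p) \<and> 0 < slope p \<and>
    d * cos (slope p) = (fst p - snd p) * sin (slope p) \<and> d / ((fst p - snd p)\<^sup>2 + d\<^sup>2) = (sin (slope p))\<^sup>2 / d"
  using fst_large[of "R + 1"] snd_bounded
proof eventually_elim
  case (elim p)
  define M where "M = fst p" define m where "m = fst p - snd p"
  have m: "0 < m" "0 < M" using elim R by (auto simp: m_def M_def)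
  have xi: "1 + \<xi> p = (m\<^sup>2 + d\<^sup>2) / M\<^sup>2"
    using m(2) by (simp add: slope_defect_def m_def M_def field_simps power2_eq_square)
  have q: "sqrt (1 + (d / m)\<^sup>2) = sqrt (m\<^sup>2 + d\<^sup>2) / m"
  proof -
    have "1 + (d / m)\<^sup>2 = (m\<^sup>2 + d\<^sup>2) / m\<^sup>2" using m by (simp add: field_simps)
    then show ?thesis using m by (simp add: real_sqrt_divide)
  qed
  have pos: "0 < sqrt (m\<^sup>2 + d\<^sup>2)" using d by (simp add: add_nonneg_pos)
  have s: "sin (slope p) = d / sqrt (m\<^sup>2 + d\<^sup>2)" "cos (slope p) = m / sqrt (m\<^sup>2 + d\<^sup>2)"
    using m unfolding slope_of_def m_def[symmetric] sin_arctan cos_arctan q by auto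
  have "fst p * sin (slope p) = d * (1 / sqrt (1 + \<xi> p))"
    unfolding xi s using m pos by (simp add: real_sqrt_divide M_def)
  moreover have "0 < slope p" using m d by (simp add: slope_of_def m_def zero_less_arctan_iff)
  moreover have "d / ((fst p - snd p)\<^sup>2 + d\<^sup>2) = (sin (slope p))\<^sup>2 / d"
    unfolding s m_def[symmetric] using d by (simp add: power_divide power2_eq_square)
  ultimately show ?case using d pos unfolding s m_def[symmetric] by simp
qed

lemma slope_null: "filterlim slope (at_right 0) FR"
proof (rule tendsto_imp_filterlim_at_right)
  show "\<forall>\<^sub>F p in FR. 0 < slope p" using sin_slope by eventually_elim simp
  have "filterlim (\<lambda>p. - R + fst p) at_top FR" by (rule filterlim_tendsto_add_at_top[OF tendsto_const fst_at_top])
  then have "filterlim (\<lambda>p. fst p - snd p) at_top FR"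
    by (rule filterlim_at_top_mono) (use snd_bounded in eventually_elim, auto)
  then have "((\<lambda>p. d / (fst p - snd p)) \<longlongrightarrow> 0) FR"
    by (intro real_tendsto_divide_at_top[OF tendsto_const])
  then have "((\<lambda>p. arctan (d / (fst p - snd p))) \<longlongrightarrow> arctan 0) FR" by (rule tendsto_arctan)
  then show "(slope \<longlongrightarrow> 0) FR" unfolding slope_of_def by simp
qed

lemma fst_sin_slope: "((\<lambda>p. fst p * sin (slope p)) \<longlongrightarrow> d) FR"
proof -
  have "((\<lambda>p. d * (1 / sqrt (1 + \<xi> p))) \<longlongrightarrow> d * (1 / sqrt (1 + 0))) FR"
    by (intro tendsto_intros xi_null) auto
  moreover have "\<forall>\<^sub>F p in FR. d * (1 / sqrt (1 + \<xi> p)) = fst p * sin (slope p)" using sin_slope by eventually_elim simp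
  ultimately show ?thesis using tendsto_cong by fastforce
qed

text \<open>The first-order expansion of (1 + \<xi>)^(-3/2) combined with M \<xi> = -2 \<sigma> +
  o(1). It yields the factor 1 + 3 \<sigma> / M that turns the moment of order 1 into a correction
  of the main term.\<close>

lemma cubed_sin_slope: "((\<lambda>p. fst p * ((fst p * sin (slope p) / d) ^ 3 - 1) - 3 * snd p) \<longlongrightarrow> 0) FR"
proof -
  let ?\<phi> = "\<lambda>x::real. (1 / sqrt (1 + x)) ^ 3"
  have "(?\<phi> has_real_derivative (- 3 / 2)) (at 0)" by (auto intro!: derivative_eq_intros)
  \<comment> \<open>Caratheodory's form of the derivative avoids dividing by \<xi>, which may
    vanish.\<close>
  then obtain \<psi> where \<psi>: "\<And>z. ?\<phi> z - ?\<phi> 0 = \<psi> z * (z - 0)" "isCont \<psi> 0" "\<psi> 0 = - 3 / 2"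
    unfolding CARAT_DERIV by blast
  have "((\<lambda>p. \<psi> (\<xi> p) + 3 / 2) \<longlongrightarrow> \<psi> 0 + 3 / 2) FR"
    by (intro tendsto_intros isCont_tendsto_compose[OF \<psi>(2)] xi_null)
  then have "((\<lambda>p. \<psi> (\<xi> p) + 3 / 2) \<longlongrightarrow> 0) FR" by (simp add: \<psi>(3))
  moreover have "\<forall>\<^sub>F p in FR. \<bar>fst p * \<xi> p\<bar> \<le> 2 * R + 1"
  proof -
    have "\<forall>\<^sub>F p in FR. \<bar>fst p * \<xi> p + 2 * snd p\<bar> < 1"
      using tendstoD[OF fst_xi, of 1] by (simp add: dist_real_def)
    then show ?thesis using snd_bounded by eventually_elim linarith
  qed
  ultimately have "((\<lambda>p. (\<psi> (\<xi> p) + 3 / 2) * (fst p * \<xi> p)) \<longlongrightarrow> 0) FR" by (rule bounded_times_null)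
  then have "((\<lambda>p. (\<psi> (\<xi> p) + 3 / 2) * (fst p * \<xi> p) - 3 / 2 * (fst p * \<xi> p + 2 * snd p)) \<longlongrightarrow> 0 - 3 / 2 * 0) FR"
    by (intro tendsto_intros fst_xi)
  moreover have "\<forall>\<^sub>F p in FR. (\<psi> (\<xi> p) + 3 / 2) * (fst p * \<xi> p) - 3 / 2 * (fst p * \<xi> p + 2 * snd p) =
      fst p * ((fst p * sin (slope p) / d) ^ 3 - 1) - 3 * snd p"
    using sin_slope
  proof eventually_elim
    case (elim p)
    have "fst p * sin (slope p) / d = 1 / sqrt (1 + \<xi> p)" using elim d by simp
    then have "(fst p * sin (slope p) / d) ^ 3 - 1 = \<psi> (\<xi> p) * \<xi> p" using \<psi>(1)[of "\<xi> p"] by simp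
    then show ?case by (simp add: algebra_simps)
  qed
  ultimately show ?thesis using tendsto_cong by fastforce
qed

text \<open>Since sin \<theta> is asymptotic to \<theta> and M sin \<theta> tends to d, a quadratic
  excess \<open>\<kappa> \<theta>\<^sup>2\<close> becomes, in units of sin \<theta>, a displacement
  \<kappa> d / M + o(1 / M).\<close>

lemma excess_slope:
  assumes "((\<lambda>\<theta>. e \<theta> / \<theta>\<^sup>2) \<longlongrightarrow> \<kappa>) (at_right 0)"
  shows "((\<lambda>p. fst p * (e (slope p) / sin (slope p)) - \<kappa> * d) \<longlongrightarrow> 0) FR"
proof -
  have "((\<lambda>\<theta>::real. sin \<theta> / \<theta>) \<longlongrightarrow> 1) (at_right 0)"
    using DERIV_sin[of "0::real"] by (auto simp: has_field_derivative_iff intro: tendsto_mono[OF at_le])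
  from filterlim_compose[OF this slope_null] have 1: "((\<lambda>p. sin (slope p) / slope p) \<longlongrightarrow> 1) FR" .
  have "((\<lambda>p. e (slope p) / (slope p)\<^sup>2 * (1 / (sin (slope p) / slope p)\<^sup>2) * (fst p * sin (slope p)) - \<kappa> * d) \<longlongrightarrow> \<kappa> * (1 / 1\<^sup>2) * d - \<kappa> * d) FR"
    by (intro tendsto_intros fst_sin_slope 1 filterlim_compose[OF assms slope_null]) auto
  moreover have "\<forall>\<^sub>F p in FR. e (slope p) / (slope p)\<^sup>2 * (1 / (sin (slope p) / slope p)\<^sup>2) * (fst p * sin (slope p)) - \<kappa> * d =
      fst p * (e (slope p) / sin (slope p)) - \<kappa> * d"
    using sin_slope
  proof eventually_elim
    case (elim p)
    have gen: "E / t\<^sup>2 * (1 / (s / t)\<^sup>2) * (M * s) = M * (E / s)" if "0 < s" "0 < t" for s t E M :: real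
      using that by (simp add: power2_eq_square)
    have "0 < sin (slope p)" "0 < slope p" using elim by auto
    from gen[OF this, of "e (slope p)" "fst p"] show ?case by (simp only:)
  qed
  ultimately show ?thesis using tendsto_cong by fastforce
qed

end

section \<open>The integral of the width of a beam crossing a strip\<close>

lemma overlap_affine:
  fixes s :: real
  assumes "0 < s"
  shows "max 0 (min (k + s * a) (k + s * b) - max (k + s * c) (k + s * e)) = s * max 0 (min a b - max c e)"
proof -
  have "min (k + s * a) (k + s * b) = k + s * min a b" "max (k + s * c) (k + s * e) = k + s * max c e"
    using assms by (auto simp: min_def max_def)
  then show ?thesis
    using assms by (auto simp: max_def zero_le_mult_iff simp flip: right_diff_distrib)
qed

text \<open>The length of the set of offsets of lines at angle \<theta> that cross a strip of width
  \<open>d\<close> with lower side at height \<open>h\<close>. On the lower side the line leaves the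
  obstacle touching at abscissa \<open>xa\<close> and passes above the next one, at
  \<open>xc\<close>. On the upper side, displaced by \<open>M\<close>, it hits the obstacle at
  \<open>xb\<close> and passes below the preceding one, at \<open>xd\<close>. The functions
  \<open>ea\<close> to \<open>ed\<close> are the excesses of the support functions over these
  contact points.\<close>

definition strip_width where
  "strip_width h d xa xc xb xd ea ec eb ed M \<theta> =
     max 0 (min (h * cos \<theta> - xa * sin \<theta> + ea \<theta>) ((h + d) * cos \<theta> - (xd + M) * sin \<theta> - ed \<theta>) -
       max (h * cos \<theta> - xc * sin \<theta> + ec \<theta>) ((h + d) * cos \<theta> - (xb + M) * sin \<theta> - eb \<theta> :: real))"

context
  fixes ea ec eb ed :: "real \<Rightarrow> real" and \<kappa>a \<kappa>c \<kappa>b \<kappa>d xa xc xb xd h d \<theta>1 :: real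
  assumes cont: "continuous_on UNIV ea" "continuous_on UNIV ec" "continuous_on UNIV eb" "continuous_on UNIV ed"
    and lim: "((\<lambda>\<theta>. ea \<theta> / \<theta>\<^sup>2) \<longlongrightarrow> \<kappa>a) (at_right 0)" "((\<lambda>\<theta>. ec \<theta> / \<theta>\<^sup>2) \<longlongrightarrow> \<kappa>c) (at_right 0)"
      "((\<lambda>\<theta>. eb \<theta> / \<theta>\<^sup>2) \<longlongrightarrow> \<kappa>b) (at_right 0)" "((\<lambda>\<theta>. ed \<theta> / \<theta>\<^sup>2) \<longlongrightarrow> \<kappa>d) (at_right 0)"
    and small: "\<And>\<theta> e. 0 < \<theta> \<Longrightarrow> \<theta> < \<theta>1 \<Longrightarrow> e \<in> {ea, ec, eb, ed} \<Longrightarrow> 0 \<le> e \<theta> \<and> e \<theta> \<le> sin \<theta>"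
    and d: "0 < d" and x: "xa < xc" "xd < xb" and \<theta>1: "0 < \<theta>1" "\<theta>1 \<le> 1"
begin

abbreviation "width \<equiv> strip_width h d xa xc xb xd ea ec eb ed"

text \<open>Nonzero width forces xd - xc < -\<sigma> < xb - xa + 2, the 2 accounting for two
  excesses of at most sin \<theta> each. The constant encloses this range with a margin, so all of
  the integral is seen in the \<sigma> variable.\<close>

definition R0 :: real where "R0 = \<bar>xd - xc\<bar> + \<bar>xb - xa\<bar> + 3"

lemma R0_pos: "0 < R0" by (simp add: R0_def add_nonneg_pos)

lemmas slp = R0_pos d

abbreviation "sF \<equiv> strip_filter R0"
abbreviation "sl \<equiv> slope_of d"

text \<open>The width divided by sin \<theta>, with offsets counted from h cos \<theta>.\<close>

definition ell :: "real \<times> real \<Rightarrow> real" where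
  "ell p = max 0 (min (ea (sl p) / sin (sl p) - xa) (- snd p - xd - ed (sl p) / sin (sl p)) -
     max (ec (sl p) / sin (sl p) - xc) (- snd p - xb - eb (sl p) / sin (sl p)))"

definition P1 where "P1 M = \<kappa>c * d / M - xc"
definition P2 where "P2 M = \<kappa>a * d / M - xa"
definition Q1 where "Q1 M = xd + \<kappa>d * d / M"
definition Q2 where "Q2 M = xb + \<kappa>b * d / M"

text \<open>The leading part of \<open>ell\<close>: each excess over sin \<theta> is replaced by its
  limit value \<kappa> d / M. For fixed M this is the overlap of a fixed interval with one moving
  rigidly in \<sigma>, so its moments are known exactly.\<close>

definition ell0 :: "real \<times> real \<Rightarrow> real" where
  "ell0 p = max 0 (min (P2 (fst p)) (- snd p - Q1 (fst p)) - max (P1 (fst p)) (- snd p - Q2 (fst p)))"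

lemma continuous_width: "continuous_on A (width M)"
  unfolding strip_width_def
  by (intro continuous_intros continuous_on_subset[OF cont(1)] continuous_on_subset[OF cont(2)]
      continuous_on_subset[OF cont(3)] continuous_on_subset[OF cont(4)]) auto

text \<open>The width contributes one factor sin \<theta> and the Jacobian two; together they make
  the cube expanded above.\<close>

lemma width_slope:
  "\<forall>\<^sub>F p in sF. fst p ^ 4 * (d / ((fst p - snd p)\<^sup>2 + d\<^sup>2) * width (fst p) (sl p)) =
     d\<^sup>2 * (fst p * (fst p * sin (sl p) / d) ^ 3 * ell p)"
  using sin_slope[OF slp]
proof eventually_elim
  case (elim p)
  define M s where "M = fst p" and "s = sin (sl p)"
  have s: "0 < s" and dc: "d * cos (sl p) = (M - snd p) * s" and g: "d / ((M - snd p)\<^sup>2 + d\<^sup>2) = s\<^sup>2 / d"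
    using elim by (auto simp: M_def s_def)
  have 1: "(h + d) * cos (sl p) - (y + M) * s - e = h * cos (sl p) + s * (- snd p - y - e / s)" for y e
  proof -
    have "(h + d) * cos (sl p) = h * cos (sl p) + (M - snd p) * s" using dc by (simp add: distrib_right)
    moreover have "s * (e / s) = e" using s by simp
    ultimately show ?thesis by (simp add: algebra_simps)
  qed
  have 2: "h * cos (sl p) - y * s + e = h * cos (sl p) + s * (e / s - y)" for y e
    using s by (simp add: algebra_simps)
  have "width M (sl p) = s * ell p"
    unfolding strip_width_def ell_def s_def[symmetric] 1 2 by (rule overlap_affine[OF s])
  then show ?case
    unfolding M_def[symmetric] s_def[symmetric] g using d s
    by (simp add: power2_eq_square power3_eq_cube power4_eq_xxxx)
qed

text \<open>Each of the four ends is approximated with error o(1 / M), uniformly in \<sigma>; the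
  overlap is Lipschitz in its ends.\<close>

lemma ell_close: "((\<lambda>p. fst p * (ell p - ell0 p)) \<longlongrightarrow> 0) sF"
proof -
  let ?E = "\<lambda>e \<kappa> p. \<bar>fst p * (e (sl p) / sin (sl p)) - \<kappa> * d\<bar>"
  have z: "(?E e \<kappa> \<longlongrightarrow> 0) sF" if "((\<lambda>\<theta>. e \<theta> / \<theta>\<^sup>2) \<longlongrightarrow> \<kappa>) (at_right 0)" for e \<kappa>
    using tendsto_rabs[OF excess_slope[OF slp that]] by simp
  have sum: "((\<lambda>p. ?E ea \<kappa>a p + ?E ed \<kappa>d p + ?E ec \<kappa>c p + ?E eb \<kappa>b p) \<longlongrightarrow> 0 + 0 + 0 + 0) sF"
    by (intro tendsto_add z lim)
  show ?thesis
  proof (rule tendsto_0_le[where K = 1])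
    show "((\<lambda>p. ?E ea \<kappa>a p + ?E ed \<kappa>d p + ?E ec \<kappa>c p + ?E eb \<kappa>b p) \<longlongrightarrow> 0) sF" using sum by simp
    show "\<forall>\<^sub>F p in sF. norm (fst p * (ell p - ell0 p)) \<le> norm (?E ea \<kappa>a p + ?E ed \<kappa>d p + ?E ec \<kappa>c p + ?E eb \<kappa>b p) * 1"
      using fst_large[OF slp, of 1]
    proof eventually_elim
      case (elim p)
      define M s where "M = fst p" and "s = sin (sl p)"
      have M: "0 < M" using elim by (simp add: M_def)
      have "\<bar>ell p - ell0 p\<bar> \<le> \<bar>(ea (sl p) / s - xa) - P2 M\<bar> + \<bar>(- snd p - xd - ed (sl p) / s) - (- snd p - Q1 M)\<bar>
        + \<bar>(ec (sl p) / s - xc) - P1 M\<bar> + \<bar>(- snd p - xb - eb (sl p) / s) - (- snd p - Q2 M)\<bar>"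
        unfolding ell_def ell0_def M_def[symmetric] s_def[symmetric] by (rule overlap_lipschitz)
      also have "\<dots> = \<bar>ea (sl p) / s - \<kappa>a * d / M\<bar> + \<bar>ed (sl p) / s - \<kappa>d * d / M\<bar> + \<bar>ec (sl p) / s - \<kappa>c * d / M\<bar> + \<bar>eb (sl p) / s - \<kappa>b * d / M\<bar>"
        unfolding P1_def P2_def Q1_def Q2_def by (simp add: abs_minus_commute)
      finally have "M * \<bar>ell p - ell0 p\<bar> \<le> M * (\<bar>ea (sl p) / s - \<kappa>a * d / M\<bar> + \<bar>ed (sl p) / s - \<kappa>d * d / M\<bar> + \<bar>ec (sl p) / s - \<kappa>c * d / M\<bar> + \<bar>eb (sl p) / s - \<kappa>b * d / M\<bar>)"
        using M by (intro mult_left_mono) auto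
      also have "\<dots> = ?E ea \<kappa>a p + ?E ed \<kappa>d p + ?E ec \<kappa>c p + ?E eb \<kappa>b p"
      proof -
        have "M * \<bar>y - k / M\<bar> = \<bar>M * y - k\<bar>" for y k
        proof -
          have "M * y - k = M * (y - k / M)" using M by (simp add: right_diff_distrib)
          then show ?thesis using M by (simp add: abs_mult)
        qed
        then show ?thesis unfolding M_def[symmetric] s_def[symmetric] by (simp add: distrib_left)
      qed
      finally show ?case using M by (simp add: abs_mult M_def)
    qed
  qed
qed

lemma ell0_bounded: "\<forall>\<^sub>F p in sF. \<bar>ell0 p\<bar> \<le> \<bar>xc - xa\<bar> + \<bar>(\<kappa>a - \<kappa>c) * d\<bar>"
  using fst_large[OF slp, of 1]
proof eventually_elim
  case (elim p)
  have "\<bar>ell0 p\<bar> \<le> \<bar>P2 (fst p) - P1 (fst p)\<bar>" unfolding ell0_def by (auto simp: max_def min_def)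
  also have "P2 (fst p) - P1 (fst p) = (xc - xa) + (\<kappa>a - \<kappa>c) * d / fst p"
    by (simp add: P1_def P2_def algebra_simps diff_divide_distrib)
  also have "\<bar>\<dots>\<bar> \<le> \<bar>xc - xa\<bar> + \<bar>(\<kappa>a - \<kappa>c) * d / fst p\<bar>" by (rule abs_triangle_ineq)
  also have "\<bar>(\<kappa>a - \<kappa>c) * d / fst p\<bar> \<le> \<bar>(\<kappa>a - \<kappa>c) * d\<bar>"
  proof -
    have "\<bar>(\<kappa>a - \<kappa>c) * d\<bar> / fst p \<le> \<bar>(\<kappa>a - \<kappa>c) * d\<bar> / 1" using elim by (intro divide_left_mono) auto
    then show ?thesis using elim by (simp add: abs_divide)
  qed
  finally show ?case by simp
qed

text \<open>With X = M sin \<theta> / d, the term M X^3 \<open>ell\<close> equals (M + 3 \<sigma>)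
  \<open>ell0\<close> plus M X^3 (\<open>ell\<close> - \<open>ell0\<close>) plus (M (X^3 - 1) - 3
  \<sigma>) \<open>ell0\<close>. The last two terms tend to 0 because X tends to 1 and
  \<open>ell0\<close> is bounded.\<close>

lemma integrand_close:
  "((\<lambda>p. fst p ^ 4 * (d / ((fst p - snd p)\<^sup>2 + d\<^sup>2) * width (fst p) (sl p)) - d\<^sup>2 * ((fst p + 3 * snd p) * ell0 p)) \<longlongrightarrow> 0) sF"
proof -
  have 1: "((\<lambda>p. (fst p * sin (sl p) / d) ^ 3 * (fst p * (ell p - ell0 p))) \<longlongrightarrow> (d / d) ^ 3 * 0) sF"
    using d by (intro tendsto_intros fst_sin_slope[OF slp] ell_close) auto
  have 2: "((\<lambda>p. (fst p * ((fst p * sin (sl p) / d) ^ 3 - 1) - 3 * snd p) * ell0 p) \<longlongrightarrow> 0) sF"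
    by (rule bounded_times_null[OF slp cubed_sin_slope[OF slp] ell0_bounded])
  have "((\<lambda>p. d\<^sup>2 * ((fst p * sin (sl p) / d) ^ 3 * (fst p * (ell p - ell0 p)) + (fst p * ((fst p * sin (sl p) / d) ^ 3 - 1) - 3 * snd p) * ell0 p)) \<longlongrightarrow> d\<^sup>2 * ((d / d) ^ 3 * 0 + 0)) sF"
    by (intro tendsto_mult tendsto_add tendsto_const 1 2)
  moreover have "\<forall>\<^sub>F p in sF. d\<^sup>2 * ((fst p * sin (sl p) / d) ^ 3 * (fst p * (ell p - ell0 p)) + (fst p * ((fst p * sin (sl p) / d) ^ 3 - 1) - 3 * snd p) * ell0 p) =
    fst p ^ 4 * (d / ((fst p - snd p)\<^sup>2 + d\<^sup>2) * width (fst p) (sl p)) - d\<^sup>2 * ((fst p + 3 * snd p) * ell0 p)"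
    using width_slope
  proof eventually_elim
    case (elim p)
    show ?case unfolding elim by (simp add: algebra_simps)
  qed
  ultimately show ?thesis using tendsto_cong by fastforce
qed

text \<open>For large M the image of the \<sigma>-interval lies inside the angular interval, and
  outside that image the width vanishes, so the substitution loses nothing.\<close>

lemma width_substitution:
  "\<forall>\<^sub>F M in at_top. ((\<lambda>\<sigma>. d / ((M - \<sigma>)\<^sup>2 + d\<^sup>2) * width M (sl (M, \<sigma>))) has_integral (integral {0..\<theta>1} (width M))) {-R0..R0}"
proof -
  have "\<forall>\<^sub>F p in sF. 0 < sl p \<and> sl p < \<theta>1"
    using slope_null[OF slp] \<theta>1(1) unfolding filterlim_at
    by (auto intro: eventually_conj elim: eventually_mono dest: order_tendstoD(2))
  then have "\<forall>\<^sub>F M in at_top. \<forall>\<sigma>\<in>{-R0..R0}. 0 < sl (M, \<sigma>) \<and> sl (M, \<sigma>) < \<theta>1"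
    unfolding eventually_strip_filter .
  then show ?thesis using eventually_ge_at_top[of "R0 + 1"]
  proof eventually_elim
    case (elim M)
    let ?g = "\<lambda>\<sigma>. sl (M, \<sigma>)"
    have der: "(?g has_real_derivative d / ((M - \<sigma>)\<^sup>2 + d\<^sup>2)) (at \<sigma>)" if "\<sigma> \<in> {-R0..R0}" for \<sigma>
    proof -
      have m: "0 < M - \<sigma>" using that elim by auto
      have "((\<lambda>\<sigma>. arctan (d / (M - \<sigma>))) has_real_derivative inverse (1 + (d / (M - \<sigma>))\<^sup>2) * (d / (M - \<sigma>)\<^sup>2)) (at \<sigma>)"
        using m by (auto intro!: derivative_eq_intros simp: power2_eq_square)
      moreover have "inverse (1 + (d / m)\<^sup>2) * (d / m\<^sup>2) = d / (m\<^sup>2 + d\<^sup>2)" if "0 < m" for m :: real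
      proof -
        have "1 + (d / m)\<^sup>2 = (m\<^sup>2 + d\<^sup>2) / m\<^sup>2" using that by (simp add: field_simps)
        then show ?thesis using that by (simp add: divide_simps)
      qed
      ultimately have "((\<lambda>\<sigma>. arctan (d / (M - \<sigma>))) has_real_derivative d / ((M - \<sigma>)\<^sup>2 + d\<^sup>2)) (at \<sigma>)"
        using m by metis
      then show ?thesis unfolding slope_of_def fst_conv snd_conv .
    qed
    have mono: "?g (-R0) \<le> ?g R0"
      unfolding slope_of_def using elim R0_pos d by (simp add: arctan_le_iff frac_le)
    have sub: "((\<lambda>\<sigma>. (d / ((M - \<sigma>)\<^sup>2 + d\<^sup>2)) *\<^sub>R width M (?g \<sigma>)) has_integral
       (integral {?g (-R0)..?g R0} (width M))) {-R0..R0}"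
    proof -
      have "?g ` {-R0..R0} \<subseteq> {0..\<theta>1}" using elim by (auto intro: less_imp_le)
      moreover have "(?g has_field_derivative d / ((M - \<sigma>)\<^sup>2 + d\<^sup>2)) (at \<sigma> within {-R0..R0})" if "\<sigma> \<in> {-R0..R0}" for \<sigma>
        by (rule has_field_derivative_at_within[OF der[OF that]])
      moreover have "- R0 \<le> R0" using R0_pos by simp
      ultimately show ?thesis
        using has_integral_substitution[of "-R0" R0 ?g 0 \<theta>1 "width M" "\<lambda>\<sigma>. d / ((M - \<sigma>)\<^sup>2 + d\<^sup>2)", OF _ mono _ continuous_width] by simp
    qed
    have "integral {?g (-R0)..?g R0} (width M) = integral {0..\<theta>1} (width M)"
    proof (rule integral_spike_set)
      have "- R0 \<in> {-R0..R0}" "R0 \<in> {-R0..R0}" using R0_pos by auto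
      then have "0 < ?g (-R0)" "?g R0 < \<theta>1" using elim(1) by blast+
      then have "{?g (-R0)..?g R0} - {0..\<theta>1} = {}" by auto
      then have "{\<theta> \<in> {?g (-R0)..?g R0} - {0..\<theta>1}. width M \<theta> \<noteq> 0} = {}" by blast
      then show "negligible {\<theta> \<in> {?g (-R0)..?g R0} - {0..\<theta>1}. width M \<theta> \<noteq> 0}" by (simp only: negligible_empty)
      \<comment> \<open>The bounds on the excesses hold only strictly between 0 and
        \<open>\<theta>1\<close>; the two end points are negligible.\<close>
      have "{\<theta> \<in> {0..\<theta>1} - {?g (-R0)..?g R0}. width M \<theta> \<noteq> 0} \<subseteq> {0, \<theta>1}"
      proof (intro subsetI, rule ccontr)
        fix \<theta> assume m: "\<theta> \<in> {\<theta> \<in> {0..\<theta>1} - {?g (-R0)..?g R0}. width M \<theta> \<noteq> 0}" and "\<theta> \<notin> {0, \<theta>1}"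
        then have "0 \<le> \<theta>" "\<theta> \<le> \<theta>1" "\<theta> \<noteq> 0" "\<theta> \<noteq> \<theta>1" by simp_all
        then have \<theta>12: "0 < \<theta>" "\<theta> < \<theta>1" by linarith+
        have \<theta>34: "\<theta> \<notin> {?g (-R0)..?g R0}" "width M \<theta> \<noteq> 0" using m by blast+
        note \<theta> = \<theta>12 \<theta>34
        have sc: "0 < sin \<theta>" "0 < cos \<theta>" "\<theta> < pi / 2"
          using \<theta> \<theta>1 pi_gt3 by (auto intro!: sin_gt_zero cos_gt_zero)
        \<comment> \<open>This \<open>t\<close> is -\<sigma> for the angle at hand: d cot \<theta> =
          M + t. A positive width confines it to the range enclosed by \<open>R0\<close>, which
          contradicts the choice of an angle outside the image.\<close>
        define t where "t = d * cos \<theta> / sin \<theta> - M"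
        have dc: "d * cos \<theta> = (t + M) * sin \<theta>" using sc by (simp add: t_def)
        have pos: "0 < y" if "max 0 y \<noteq> 0" for y :: real using that by (auto simp: max_def split: if_splits)
        have e: "0 \<le> ec \<theta>" "0 \<le> ed \<theta>" "ea \<theta> \<le> sin \<theta>" "eb \<theta> \<le> sin \<theta>" using small[OF \<theta>(1,2)] by auto
        have "0 < min (h * cos \<theta> - xa * sin \<theta> + ea \<theta>) ((h + d) * cos \<theta> - (xd + M) * sin \<theta> - ed \<theta>) -
          max (h * cos \<theta> - xc * sin \<theta> + ec \<theta>) ((h + d) * cos \<theta> - (xb + M) * sin \<theta> - eb \<theta>)"
          by (rule pos) (use \<theta>(4) in \<open>simp only: strip_width_def not_False_eq_True\<close>)
        then have i: "h * cos \<theta> - xc * sin \<theta> + ec \<theta> < (h + d) * cos \<theta> - (xd + M) * sin \<theta> - ed \<theta>"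
          "(h + d) * cos \<theta> - (xb + M) * sin \<theta> - eb \<theta> < h * cos \<theta> - xa * sin \<theta> + ea \<theta>" by auto
        have "0 < (t - (xd - xc)) * sin \<theta>" using i(1) e dc by (simp add: algebra_simps)
        moreover have "0 < (xb - xa + 2 - t) * sin \<theta>" using i(2) e dc by (simp add: algebra_simps)
        ultimately have "xd - xc < t" "t < xb - xa + 2" using sc by (auto simp: zero_less_mult_iff)
        then have t: "- R0 \<le> t" "t \<le> R0" unfolding R0_def by linarith+
        have tm: "0 < t + M" using t elim by linarith
        have "tan \<theta> = d / (M - (- t))" using dc sc tm by (simp add: tan_def field_simps)
        then have "\<theta> = ?g (- t)" using arctan_tan[of \<theta>] \<theta>(1) sc(3) by (simp add: slope_of_def)
        moreover have "?g (- R0) \<le> ?g (- t)" "?g (- t) \<le> ?g R0"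
          unfolding slope_of_def using t elim d by (simp_all add: arctan_le_iff frac_le)
        ultimately show False using \<theta>(3) by auto
      qed
      then show "negligible {\<theta> \<in> {0..\<theta>1} - {?g (-R0)..?g R0}. width M \<theta> \<noteq> 0}"
        using negligible_subset negligible_finite[of "{0, \<theta>1}"] by blast
    qed
    then show ?case using sub by simp
  qed
qed

theorem width_integral_asymptotics:
  "((\<lambda>M. M ^ 4 * integral {0..\<theta>1} (width M) - M * (d\<^sup>2 * (xc - xa) * (xb - xd))) \<longlongrightarrow>
     d\<^sup>2 * (d * ((xb - xd) * (\<kappa>a - \<kappa>c) + (xc - xa) * (\<kappa>b - \<kappa>d)) + 3 * (xc - xa) * (xb - xd) * (xa + xc - xb - xd) / 2)) at_top"
proof -
  \<comment> \<open>The exact integral over \<sigma> of \<open>d\<^sup>2\<close> (M + 3 \<sigma>)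
    \<open>ell0\<close>, read off from the two moments of the overlap.\<close>
  define A where "A M = d\<^sup>2 * (M * ((P2 M - P1 M) * (Q2 M - Q1 M)) - 3 * ((P2 M - P1 M) * (Q2 M - Q1 M) * (P1 M + P2 M + Q1 M + Q2 M) / 2))" for M
  have inv: "((\<lambda>M. k * d / M) \<longlongrightarrow> 0) at_top" for k :: real
    by (intro real_tendsto_divide_at_top[OF tendsto_const] filterlim_ident)
  have Plim: "(P1 \<longlongrightarrow> - xc) at_top" "(P2 \<longlongrightarrow> - xa) at_top" "(Q1 \<longlongrightarrow> xd) at_top" "(Q2 \<longlongrightarrow> xb) at_top"
    unfolding P1_def P2_def Q1_def Q2_def
    using tendsto_diff[OF inv[of \<kappa>c] tendsto_const[of xc]] tendsto_diff[OF inv[of \<kappa>a] tendsto_const[of xa]]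
      tendsto_add[OF tendsto_const[of xd] inv[of \<kappa>d]] tendsto_add[OF tendsto_const[of xb] inv[of \<kappa>b]] by simp_all
  have evPQ: "\<forall>\<^sub>F M in at_top. P1 M \<le> P2 M \<and> Q1 M \<le> Q2 M \<and> - R0 \<le> P1 M + Q1 M \<and> P2 M + Q2 M \<le> R0"
  proof -
    have "\<forall>\<^sub>F M in at_top. 0 < P2 M - P1 M" using x by (intro order_tendstoD(1)[OF tendsto_diff[OF Plim(2,1)]]) auto
    moreover have "\<forall>\<^sub>F M in at_top. 0 < Q2 M - Q1 M" using x by (intro order_tendstoD(1)[OF tendsto_diff[OF Plim(4,3)]]) auto
    moreover have "\<forall>\<^sub>F M in at_top. - R0 < P1 M + Q1 M" by (intro order_tendstoD(1)[OF tendsto_add[OF Plim(1,3)]]) (auto simp: R0_def)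
    moreover have "\<forall>\<^sub>F M in at_top. P2 M + Q2 M < R0" by (intro order_tendstoD(2)[OF tendsto_add[OF Plim(2,4)]]) (auto simp: R0_def)
    ultimately show ?thesis by eventually_elim auto
  qed
  have close: "((\<lambda>M. M ^ 4 * integral {0..\<theta>1} (width M) - A M) \<longlongrightarrow> 0) at_top"
  proof (rule tendstoI)
    fix e :: real assume e: "0 < e"
    \<comment> \<open>The interval of integration has length 2 \<open>R0\<close>, so this pointwise
      error integrates to e / 2.\<close>
    define \<epsilon> where "\<epsilon> = e / (4 * R0)"
    have eps: "0 < \<epsilon>" using e R0_pos by (simp add: \<epsilon>_def)
    have "\<forall>\<^sub>F p in sF. \<bar>fst p ^ 4 * (d / ((fst p - snd p)\<^sup>2 + d\<^sup>2) * width (fst p) (sl p)) - d\<^sup>2 * ((fst p + 3 * snd p) * ell0 p)\<bar> < \<epsilon>"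
      using tendstoD[OF integrand_close eps] by (simp add: dist_real_def)
    then have "\<forall>\<^sub>F M in at_top. \<forall>\<sigma>\<in>{-R0..R0}. \<bar>M ^ 4 * (d / ((M - \<sigma>)\<^sup>2 + d\<^sup>2) * width M (sl (M, \<sigma>))) - d\<^sup>2 * ((M + 3 * \<sigma>) * ell0 (M, \<sigma>))\<bar> < \<epsilon>"
      unfolding eventually_strip_filter by simp
    then show "\<forall>\<^sub>F M in at_top. dist (M ^ 4 * integral {0..\<theta>1} (width M) - A M) 0 < e"
      using width_substitution evPQ
    proof eventually_elim
      case (elim M)
      have PQ: "P1 M \<le> P2 M" "Q1 M \<le> Q2 M" "- R0 \<le> P1 M + Q1 M" "P2 M + Q2 M \<le> R0" using elim by auto
      have "((\<lambda>\<sigma>. d\<^sup>2 * (M * ell0 (M, \<sigma>) + 3 * (\<sigma> * ell0 (M, \<sigma>)))) has_integral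
         d\<^sup>2 * (M * ((P2 M - P1 M) * (Q2 M - Q1 M)) + 3 * (- ((P2 M - P1 M) * (Q2 M - Q1 M) * (P1 M + P2 M + Q1 M + Q2 M) / 2)))) {-R0..R0}"
        unfolding ell0_def fst_conv snd_conv
        by (intro has_integral_mult_right has_integral_add has_integral_overlap PQ)
      then have i0: "((\<lambda>\<sigma>. d\<^sup>2 * ((M + 3 * \<sigma>) * ell0 (M, \<sigma>))) has_integral A M) {-R0..R0}"
        by (simp add: A_def algebra_simps)
      have "((\<lambda>\<sigma>. M ^ 4 * (d / ((M - \<sigma>)\<^sup>2 + d\<^sup>2) * width M (sl (M, \<sigma>))) - d\<^sup>2 * ((M + 3 * \<sigma>) * ell0 (M, \<sigma>))) has_integral
         (M ^ 4 * integral {0..\<theta>1} (width M) - A M)) {-R0..R0}"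
        using elim i0 by (intro has_integral_diff has_integral_mult_right) auto
      then have "norm (M ^ 4 * integral {0..\<theta>1} (width M) - A M) \<le> \<epsilon> * measure lborel {-R0..R0}"
        using elim(1) eps by (intro has_integral_bound_real) (auto intro: less_imp_le)
      also have "\<dots> = e / 2" using R0_pos by (simp add: \<epsilon>_def)
      finally show ?case using e by (simp add: dist_real_def)
    qed
  qed
  have "((\<lambda>M. d\<^sup>2 * (d * ((\<kappa>a - \<kappa>c) * (Q2 M - Q1 M) + (xc - xa) * (\<kappa>b - \<kappa>d)) - 3 * ((P2 M - P1 M) * (Q2 M - Q1 M) * (P1 M + P2 M + Q1 M + Q2 M) / 2))) \<longlongrightarrow>
     d\<^sup>2 * (d * ((\<kappa>a - \<kappa>c) * (xb - xd) + (xc - xa) * (\<kappa>b - \<kappa>d)) - 3 * ((- xa - - xc) * (xb - xd) * (- xc + - xa + xd + xb) / 2))) at_top"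
    by (intro tendsto_intros Plim) auto
  moreover have "\<forall>\<^sub>F M in at_top. d\<^sup>2 * (d * ((\<kappa>a - \<kappa>c) * (Q2 M - Q1 M) + (xc - xa) * (\<kappa>b - \<kappa>d)) - 3 * ((P2 M - P1 M) * (Q2 M - Q1 M) * (P1 M + P2 M + Q1 M + Q2 M) / 2)) =
     A M - M * (d\<^sup>2 * (xc - xa) * (xb - xd))"
    using eventually_gt_at_top[of 0]
  proof eventually_elim
    case (elim M)
    have p: "M * (P2 M - P1 M) = M * (xc - xa) + (\<kappa>a - \<kappa>c) * d" and q: "M * (Q2 M - Q1 M) = M * (xb - xd) + (\<kappa>b - \<kappa>d) * d"
      using elim by (simp_all add: P1_def P2_def Q1_def Q2_def field_simps)
    have "M * ((P2 M - P1 M) * (Q2 M - Q1 M)) = (M * (P2 M - P1 M)) * (Q2 M - Q1 M)" by simp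
    also have "\<dots> = (xc - xa) * (M * (Q2 M - Q1 M)) + (\<kappa>a - \<kappa>c) * d * (Q2 M - Q1 M)" unfolding p by (simp add: algebra_simps)
    also have "\<dots> = M * ((xc - xa) * (xb - xd)) + d * ((\<kappa>a - \<kappa>c) * (Q2 M - Q1 M) + (xc - xa) * (\<kappa>b - \<kappa>d))"
      unfolding q by (simp add: algebra_simps)
    finally have e: "M * ((P2 M - P1 M) * (Q2 M - Q1 M)) =
      M * ((xc - xa) * (xb - xd)) + d * ((\<kappa>a - \<kappa>c) * (Q2 M - Q1 M) + (xc - xa) * (\<kappa>b - \<kappa>d))" .
    show ?case unfolding A_def e by (simp add: algebra_simps)
  qed
  ultimately have "((\<lambda>M. A M - M * (d\<^sup>2 * (xc - xa) * (xb - xd))) \<longlongrightarrow>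
     d\<^sup>2 * (d * ((\<kappa>a - \<kappa>c) * (xb - xd) + (xc - xa) * (\<kappa>b - \<kappa>d)) - 3 * ((- xa - - xc) * (xb - xd) * (- xc + - xa + xd + xb) / 2))) at_top"
    using tendsto_cong by fastforce
  from tendsto_add[OF close this] show ?thesis
    by (rule back_subst[where P = "\<lambda>f. (f \<longlongrightarrow> _) at_top", OF back_subst[where P = "\<lambda>l. (_ \<longlongrightarrow> l) at_top"]])
      (auto simp: field_simps)
qed

end

subsection \<open>Convex obstacles with curved boundary\<close>

lemma lat_add: "lat (y + z) = lat y + lat z"
  by (simp add: lat_def vec_eq_iff)

lemma lat_minus: "lat (- z) = - lat z"
  by (simp add: lat_def vec_eq_iff)

lemma lat_diff: "lat (y - z) = lat y - lat z"
  by (simp add: lat_def vec_eq_iff)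

lemma lat_scale: "lat (k *s z) = real_of_int k *\<^sub>R lat z"
  by (simp add: lat_def vec_eq_iff)

lemma lat_zero [simp]: "lat 0 = 0"
  by (simp add: lat_def vec_eq_iff)

lemma lat_eq_iff: "lat y = lat z \<longleftrightarrow> y = z"
  by (simp add: lat_def vec_eq_iff)

lemma finite_lat_bounded: "finite {z. norm (lat z) \<le> M}"
proof -
  let ?I = "{- \<lceil>M\<rceil> .. \<lceil>M\<rceil>}"
  have "{z. norm (lat z) \<le> M} \<subseteq> (\<lambda>(a, b). vector [a, b]) ` (?I \<times> ?I)"
  proof
    fix z assume "z \<in> {z. norm (lat z) \<le> M}"
    then have *: "norm (lat z) \<le> M" by simp
    have bd: "\<bar>real_of_int (z $ i)\<bar> \<le> M" for i
      using component_le_norm_cart[of "lat z" i] * by (simp add: lat_def)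
    have "z $ i \<in> ?I" for i
    proof -
      have "real_of_int (z $ i) \<le> of_int \<lceil>M\<rceil>" "- of_int \<lceil>M\<rceil> \<le> real_of_int (z $ i)"
        using bd[of i] le_of_int_ceiling[of M] by linarith+
      then show ?thesis by (simp flip: of_int_minus)
    qed
    moreover have "z = vector [z $ 1, z $ 2]"
      by (simp add: vec_eq_iff forall_2)
    ultimately show "z \<in> (\<lambda>(a, b). vector [a, b]) ` (?I \<times> ?I)"
      by (intro image_eqI[where x = "(z $ 1, z $ 2)"]) auto
  qed
  then show ?thesis
    by (rule finite_subset) simp
qed

lemma mem_obstacle_iff: "x \<in> obstacle Ob j z \<longleftrightarrow> x - lat z \<in> Ob j"
  by (force simp: obstacle_def image_iff algebra_simps)

lemma closure_obstacle: "closure (obstacle Ob j z) = (+) (lat z) ` closure (Ob j)"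
  unfolding obstacle_def by (rule closure_translation)

lemma frontier_obstacle: "frontier (obstacle Ob j z) = (+) (lat z) ` frontier (Ob j)"
  unfolding obstacle_def by (rule frontier_translation)

lemma mem_closure_obstacle_iff: "x \<in> closure (obstacle Ob j z) \<longleftrightarrow> x - lat z \<in> closure (Ob j)"
  by (force simp: closure_obstacle image_iff algebra_simps)

lemma mem_frontier_obstacle_iff: "x \<in> frontier (obstacle Ob j z) \<longleftrightarrow> x - lat z \<in> frontier (Ob j)"
  by (force simp: frontier_obstacle image_iff algebra_simps)

lemma obstacle_zero [simp]: "obstacle Ob j 0 = Ob j"
  by (simp add: obstacle_def)

text \<open>An arclength parametrization only shows that the boundary is bounded; a convex set could
  still be the unbounded side of it. From dimension 2 on, the complement of a large ball is
  connected, so a set that meets it without having frontier there contains all of it. A convex set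
  containing it is the whole space, since every point is the midpoint of two far points, and then
  the frontier is empty.\<close>

lemma bounded_convex_of_frontier:
  fixes K :: "'a::euclidean_space set"
  assumes "2 \<le> DIM('a)" "convex K" "open K" "frontier K \<noteq> {}" "bounded (frontier K)"
  shows "bounded K"
proof -
  obtain D where D: "frontier K \<subseteq> ball 0 D"
    using bounded_subset_ballD[OF assms(5), of 0] by auto
  have conn: "connected (- ball (0::'a) D)"
    by (rule connected_complement_bounded_convex) (auto simp: assms(1))
  show ?thesis
  proof (cases "- ball 0 D \<inter> K = {}")
    case True
    then have "K \<subseteq> ball 0 D" by blast
    then show ?thesis using bounded_subset bounded_ball by blast
  next
    case False
    have sub: "- ball 0 D \<subseteq> K"
    proof (rule ccontr)
      assume "\<not> - ball 0 D \<subseteq> K"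
      then have "- ball 0 D \<inter> frontier K \<noteq> {}"
        using connected_Int_frontier[OF conn, of K] False by blast
      then show False using D by blast
    qed
    have "K = UNIV"
    proof -
      have "x \<in> K" for x
      proof -
        obtain b :: 'a where b: "norm b = 1"
          using norm_Basis nonempty_Basis by blast
        define c where "c = \<bar>D\<bar> + norm x + 1"
        have n1: "norm (x + c *\<^sub>R b) \<ge> c - norm x"
          using norm_triangle_ineq2[of "c *\<^sub>R b" "- x"] b by (simp add: c_def add.commute)
        have n2: "norm (x - c *\<^sub>R b) \<ge> c - norm x"
          using norm_triangle_ineq2[of "c *\<^sub>R b" x] b
          by (simp add: c_def norm_minus_commute)
        have "x + c *\<^sub>R b \<in> K" "x - c *\<^sub>R b \<in> K"
          using n1 n2 sub by (auto simp: c_def subset_iff dist_norm)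
        then have "(1/2) *\<^sub>R (x + c *\<^sub>R b) + (1/2) *\<^sub>R (x - c *\<^sub>R b) \<in> K"
          using assms(2) by (intro convexD) auto
        also have "(1/2) *\<^sub>R (x + c *\<^sub>R b) + (1/2) *\<^sub>R (x - c *\<^sub>R b) = x"
          by (simp add: algebra_simps flip: scaleR_left_distrib)
        finally show ?thesis .
      qed
      then show ?thesis by blast
    qed
    then show ?thesis using assms(4) by simp
  qed
qed

section \<open>Support functions\<close>

text \<open>The support function of convex geometry. For unit \<open>x\<close> it is the largest
  offset, measured along \<open>x\<close>, of a line orthogonal to \<open>x\<close> that meets the
  closure of a bounded planar set.\<close>

definition supp :: "'a::euclidean_space set \<Rightarrow> 'a \<Rightarrow> real" where
  "supp K x = (SUP y\<in>K. y \<bullet> x)"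

lemma bdd_above_inner:
  fixes K :: "'a::euclidean_space set"
  assumes "bounded K" shows "bdd_above ((\<lambda>y. y \<bullet> x) ` K)"
proof -
  obtain D where D: "\<And>y. y \<in> K \<Longrightarrow> norm y \<le> D"
    using assms by (auto simp: bounded_iff)
  have "y \<bullet> x \<le> D * norm x" if "y \<in> K" for y
    using norm_cauchy_schwarz[of y x] D[OF that]
    by (meson mult_right_mono norm_ge_zero order_trans)
  then show ?thesis by (auto intro!: bdd_aboveI2)
qed

lemma supp_upper: "bounded K \<Longrightarrow> y \<in> K \<Longrightarrow> y \<bullet> x \<le> supp K x"
  unfolding supp_def by (rule cSUP_upper[OF _ bdd_above_inner])

lemma supp_upper_closure:
  assumes "bounded K" "y \<in> closure K" shows "y \<bullet> x \<le> supp K x"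
proof -
  have "closure K \<subseteq> {y. y \<bullet> x \<le> supp K x}"
    using supp_upper[OF assms(1), of _ x] closed_halfspace_le[of x "supp K x"]
    by (intro closure_minimal) (auto simp: inner_commute)
  then show ?thesis using assms(2) by blast
qed

lemma supp_least: "K \<noteq> {} \<Longrightarrow> (\<And>y. y \<in> K \<Longrightarrow> y \<bullet> x \<le> c) \<Longrightarrow> supp K x \<le> c"
  unfolding supp_def by (rule cSUP_least)

lemma less_suppD:
  assumes "K \<noteq> {}" "bounded K" "p < supp K x"
  obtains y where "y \<in> K" "p < y \<bullet> x"
  using assms less_cSUP_iff[OF assms(1) bdd_above_inner[OF assms(2)]] unfolding supp_def by blast

lemma supp_translation:
  assumes "K \<noteq> {}" "bounded K"
  shows "supp ((+) a ` K) x = a \<bullet> x + supp K x"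
proof (rule antisym)
  show "supp ((+) a ` K) x \<le> a \<bullet> x + supp K x"
    using assms supp_upper[OF assms(2)] by (intro supp_least) (auto simp: inner_add_left)
  have "supp K x \<le> supp ((+) a ` K) x - a \<bullet> x"
  proof (rule supp_least[OF assms(1)])
    fix y assume "y \<in> K"
    then have "(a + y) \<bullet> x \<le> supp ((+) a ` K) x"
      using assms(2) by (intro supp_upper) (auto intro: bounded_translation)
    then show "y \<bullet> x \<le> supp ((+) a ` K) x - a \<bullet> x" by (simp add: inner_add_left)
  qed
  then show "a \<bullet> x + supp K x \<le> supp ((+) a ` K) x" by simp
qed

lemma continuous_on_supp:
  assumes "K \<noteq> {}" "bounded K"
  shows "continuous_on UNIV (supp K)"
proof -
  obtain D where D: "D > 0" "\<And>y. y \<in> K \<Longrightarrow> norm y \<le> D"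
    using assms(2) by (auto simp: bounded_pos)
  have le: "supp K x \<le> supp K x' + D * dist x x'" for x x'
  proof (rule supp_least[OF assms(1)])
    fix y assume y: "y \<in> K"
    have "y \<bullet> x = y \<bullet> x' + y \<bullet> (x - x')" by (simp add: inner_diff_right)
    also have "\<dots> \<le> supp K x' + norm y * norm (x - x')"
      using supp_upper[OF assms(2) y] norm_cauchy_schwarz[of y "x - x'"] by (intro add_mono)
    also have "\<dots> \<le> supp K x' + D * dist x x'"
      using D(2)[OF y] by (simp add: dist_norm mult_right_mono)
    finally show "y \<bullet> x \<le> supp K x' + D * dist x x'" .
  qed
  have "D-lipschitz_on UNIV (supp K)"
  proof (rule lipschitz_onI)
    fix x x'
    show "dist (supp K x) (supp K x') \<le> D * dist x x'"
      using le[of x x'] le[of x' x] by (simp add: dist_real_def dist_commute abs_le_iff)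
  qed (use D in simp)
  then show ?thesis by (rule lipschitz_on_continuous_on)
qed

text \<open>The values of a linear form on a convex set form an interval. The lower witness is only
  asked to lie in the closure because in the applications it is a boundary point, mostly a point of
  contact.\<close>

lemma open_convex_meets_level:
  fixes K :: "'a::euclidean_space set"
  assumes "convex K" "bounded K" "y1 \<in> closure K" "y1 \<bullet> x < p" "p < supp K x"
  obtains y where "y \<in> K" "y \<bullet> x = p"
proof -
  have ne: "K \<noteq> {}" using assms(3) by auto
  obtain y2 where y2: "y2 \<in> K" "p < y2 \<bullet> x"
    using less_suppD[OF ne assms(2,5)] .
  have "\<exists>y\<in>K. y \<bullet> x < p"
  proof (rule ccontr)
    assume "\<not> ?thesis"
    then have "K \<subseteq> {y. p \<le> y \<bullet> x}" by auto
    moreover have "closed {y. p \<le> y \<bullet> x}"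
      using closed_halfspace_ge[of p x] by (simp add: inner_commute)
    ultimately have "closure K \<subseteq> {y. p \<le> y \<bullet> x}" by (rule closure_minimal)
    then show False using assms(3,4) by auto
  qed
  then obtain y0 where y0: "y0 \<in> K" "y0 \<bullet> x < p" by blast
  have "connected ((\<lambda>y. y \<bullet> x) ` K)"
    by (intro connected_continuous_image convex_connected assms continuous_intros)
  then have "p \<in> (\<lambda>y. y \<bullet> x) ` K"
    using y0 y2 unfolding connected_iff_interval by (meson image_eqI less_imp_le)
  then show ?thesis using that by blast
qed

section \<open>Orthonormal frames in the plane and second-order expansions\<close>

lemma orthonormal2_decomp:
  fixes u n x :: "real ^ 2"
  assumes "norm u = 1" "norm n = 1" "u \<bullet> n = 0"
  shows "x = (x \<bullet> u) *\<^sub>R u + (x \<bullet> n) *\<^sub>R n"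
proof -
  have "u \<noteq> n" using assms by (auto simp: norm_eq_1)
  have "u \<noteq> 0" "n \<noteq> 0" using assms by auto
  have "pairwise orthogonal {u, n}"
    using assms(3) by (auto simp: pairwise_def orthogonal_def inner_commute)
  then have "independent {u, n}"
    using pairwise_orthogonal_independent \<open>u \<noteq> 0\<close> \<open>n \<noteq> 0\<close> by blast
  then have "span {u, n} = UNIV"
    using \<open>u \<noteq> n\<close> by (intro card_ge_dim_independent[THEN subset_antisym, OF _ _ _ subset_UNIV, symmetric]) auto
  then have "x \<in> span {u, n}" by simp
  then obtain a b where x: "x = a *\<^sub>R u + b *\<^sub>R n"
    by (auto simp: span_insert span_singleton algebra_simps)
  then have "x \<bullet> u = a" "x \<bullet> n = b"
    using assms by (simp_all add: inner_add_left norm_eq_1 inner_commute[of n u])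
  then show ?thesis using x by simp
qed

lemma orth_unit_cases:
  fixes u n x :: "real ^ 2"
  assumes "norm u = 1" "norm n = 1" "u \<bullet> n = 0" "norm x = 1" "x \<bullet> u = 0"
  shows "x = n \<or> x = - n"
proof -
  have x: "x = (x \<bullet> n) *\<^sub>R n" using orthonormal2_decomp[OF assms(1-3), of x] assms(5) by simp
  then have "norm x = \<bar>x \<bullet> n\<bar> * norm n" by (metis norm_scaleR)
  then have "x \<bullet> n = 1 \<or> x \<bullet> n = - 1" using assms by auto
  then show ?thesis
  proof
    assume "x \<bullet> n = 1" with x show ?thesis by simp
  next
    assume "x \<bullet> n = - 1" with x show ?thesis by simp
  qed
qed

definition rot :: "real ^ 2 \<Rightarrow> real ^ 2" where
  "rot x = vector [- x $ 2, x $ 1]"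

lemma rot_simps [simp]: "rot x $ 1 = - x $ 2" "rot x $ 2 = x $ 1"
  by (simp_all add: rot_def)

lemma norm_rot [simp]: "norm (rot x) = norm x"
  by (simp add: norm_vec_def L2_set_def sum_2 add.commute)

lemma inner_rot [simp]: "x \<bullet> rot x = 0" "rot x \<bullet> x = 0"
  by (simp_all add: inner_vec_def sum_2)

text \<open>Together with \<open>dir\<close> below, the frame \<open>(u, n)\<close> turned by
  \<theta> from \<open>u\<close> towards \<open>n\<close>. A line of direction
  \<open>dir u n \<theta>\<close> is determined by its offset, the inner product of its points with
  \<open>perp_dir u n \<theta>\<close>.\<close>

definition perp_dir :: "real ^ 2 \<Rightarrow> real ^ 2 \<Rightarrow> real \<Rightarrow> real ^ 2" where
  "perp_dir u n \<theta> = - sin \<theta> *\<^sub>R u + cos \<theta> *\<^sub>R n"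

definition dir :: "real ^ 2 \<Rightarrow> real ^ 2 \<Rightarrow> real \<Rightarrow> real ^ 2" where
  "dir u n \<theta> = cos \<theta> *\<^sub>R u + sin \<theta> *\<^sub>R n"

lemma dir_perp_orthonormal:
  assumes "norm u = 1" "norm n = 1" "u \<bullet> n = 0"
  shows "norm (dir u n \<theta>) = 1" "norm (perp_dir u n \<theta>) = 1" "dir u n \<theta> \<bullet> perp_dir u n \<theta> = 0"
proof -
  have *: "u \<bullet> u = 1" "n \<bullet> n = 1" "n \<bullet> u = 0" using assms by (simp_all add: norm_eq_1 inner_commute)
  have sc: "cos \<theta> * cos \<theta> + sin \<theta> * sin \<theta> = 1" "sin \<theta> * sin \<theta> + cos \<theta> * cos \<theta> = 1"
    using sin_cos_squared_add[of \<theta>] by (simp_all add: power2_eq_square)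
  show "norm (dir u n \<theta>) = 1"
    by (simp add: norm_eq_1 dir_def inner_add_left inner_add_right * assms(3) sc)
  show "norm (perp_dir u n \<theta>) = 1"
    by (simp add: norm_eq_1 perp_dir_def inner_add_left inner_add_right inner_diff_left inner_diff_right * assms(3) sc)
  show "dir u n \<theta> \<bullet> perp_dir u n \<theta> = 0"
    by (simp add: dir_def perp_dir_def inner_add_left inner_add_right inner_diff_left inner_diff_right * assms(3))
qed

text \<open>Second-order Taylor expansion at a critical point. L'Hopital's rule needs the second
  derivative only at \<open>r\<close> itself.\<close>

lemma sqrt_rate_limit:
  fixes f :: "real \<Rightarrow> real"
  assumes f: "\<And>s. (f has_real_derivative f' s) (at s)" and f0: "f' r = 0"
    and f2: "(f' has_real_derivative D) (at r)"
  shows "((\<lambda>s. (f s - f r) / (s - r)\<^sup>2) \<longlongrightarrow> D / 2) (at r)"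
proof (rule lhopital[where f' = f' and g' = "\<lambda>s. 2 * (s - r)"])
  have "isCont f r" using f DERIV_isCont by blast
  then have "(f \<longlongrightarrow> f r) (at r)" by (simp add: isCont_def)
  then show "((\<lambda>s. f s - f r) \<longlongrightarrow> 0) (at r)" by (simp add: LIM_zero)
  show "((\<lambda>s. (s - r)\<^sup>2) \<longlongrightarrow> 0) (at r)" by (auto intro!: tendsto_eq_intros)
  show "\<forall>\<^sub>F s in at r. (s - r)\<^sup>2 \<noteq> 0" "\<forall>\<^sub>F s in at r. 2 * (s - r) \<noteq> 0"
    by (auto simp: eventually_at_filter)
  show "\<forall>\<^sub>F s in at r. ((\<lambda>s. f s - f r) has_real_derivative f' s) (at s)"
    using f by (auto intro!: always_eventually derivative_eq_intros)
  show "\<forall>\<^sub>F s in at r. ((\<lambda>s. (s - r)\<^sup>2) has_real_derivative 2 * (s - r)) (at s)"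
    by (auto intro!: always_eventually derivative_eq_intros)
  have "((\<lambda>s. (f' s - f' r) / (s - r) / 2) \<longlongrightarrow> D / 2) (at r)"
    using f2 by (intro tendsto_divide) (auto simp: has_field_derivative_iff)
  then show "((\<lambda>s. f' s / (2 * (s - r))) \<longlongrightarrow> D / 2) (at r)"
    by (simp add: f0 mult.commute)
qed

lemma vderiv_shift:
  assumes "\<And>s. f (s + c) = f s"
  shows "vderiv f (s + c) = vderiv f s"
proof -
  have *: "(f has_vector_derivative D) (at (s + c)) \<longleftrightarrow> (f has_vector_derivative D) (at s)" for D
  proof
    assume "(f has_vector_derivative D) (at (s + c))"
    then have "(f \<circ> (\<lambda>x. x + c) has_vector_derivative 1 *\<^sub>R D) (at s)"
      by (intro vector_diff_chain_at) (auto intro!: derivative_eq_intros)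
    then show "(f has_vector_derivative D) (at s)" by (simp add: comp_def assms)
  next
    assume "(f has_vector_derivative D) (at s)"
    then have "(f \<circ> (\<lambda>x. x - c) has_vector_derivative 1 *\<^sub>R D) (at (s + c))"
      by (intro vector_diff_chain_at) (auto intro!: derivative_eq_intros)
    moreover have "f \<circ> (\<lambda>x. x - c) = f"
    proof
      fix x
      show "(f \<circ> (\<lambda>x. x - c)) x = f x" using assms[of "x - c"] by simp
    qed
    ultimately show "(f has_vector_derivative D) (at (s + c))" by simp
  qed
  show ?thesis unfolding vderiv_def vector_derivative_def * ..
qed

section \<open>Obstacles, their normals and their extremal points\<close>

locale billiard_table =
  fixes J :: "'j set" and Ob :: "'j \<Rightarrow> (real ^ 2) set"
    and \<gamma> :: "'j \<Rightarrow> real \<Rightarrow> real ^ 2" and len :: "'j \<Rightarrow> real"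
  assumes finite_J: "finite J" and J_nonempty: "J \<noteq> {}"
    and open_convex: "\<And>j. j \<in> J \<Longrightarrow> open (Ob j) \<and> convex (Ob j)"
    and param: "\<And>j. j \<in> J \<Longrightarrow> arclength_param (Ob j) (\<gamma> j) (len j) \<and> Ck_on 3 (\<gamma> j) UNIV"
    and nonzero_curvature: "\<And>j s. j \<in> J \<Longrightarrow> vderiv (vderiv (\<gamma> j)) s \<noteq> 0"
    and disjoint: "disjoint_family_on (\<lambda>(j, z). closure (obstacle Ob j z)) (J \<times> UNIV)"
begin

definition idx :: "('j \<times> (int ^ 2)) set" where "idx = J \<times> UNIV"

abbreviation obs :: "'j \<times> (int ^ 2) \<Rightarrow> (real ^ 2) set" where
  "obs a \<equiv> obstacle Ob (fst a) (snd a)"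

lemma mem_idx [simp]: "(j, z) \<in> idx \<longleftrightarrow> j \<in> J" by (simp add: idx_def)
lemma idx_fst: "a \<in> idx \<Longrightarrow> fst a \<in> J" by (auto simp: idx_def)
lemma mem_idx_iff: "a \<in> idx \<longleftrightarrow> fst a \<in> J" by (cases a) simp

lemma gamma_deriv: "j \<in> J \<Longrightarrow> (\<gamma> j has_vector_derivative vderiv (\<gamma> j) s) (at s)"
proof -
  assume "j \<in> J"
  then have "\<forall>m<3. (vderiv ^^ m) (\<gamma> j) differentiable (at s)"
    using param[of j] by (auto simp: Ck_on_def)
  from spec[OF this, of 0] show ?thesis
    by (simp add: vderiv_def vector_derivative_works)
qed

lemma gamma_deriv2: "j \<in> J \<Longrightarrow>
  (vderiv (\<gamma> j) has_vector_derivative vderiv (vderiv (\<gamma> j)) s) (at s)"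
proof -
  assume "j \<in> J"
  then have "\<forall>m<3. (vderiv ^^ m) (\<gamma> j) differentiable (at s)"
    using param[of j] by (auto simp: Ck_on_def)
  from spec[OF this, of 1] show ?thesis
    by (simp add: vderiv_def[of "vderiv (\<gamma> j)"] vector_derivative_works)
qed

lemma len_pos: "j \<in> J \<Longrightarrow> 0 < len j"
  and norm_gamma': "j \<in> J \<Longrightarrow> norm (vderiv (\<gamma> j) s) = 1"
  and gamma_period: "j \<in> J \<Longrightarrow> \<gamma> j (s + len j) = \<gamma> j s"
  and gamma_inj: "j \<in> J \<Longrightarrow> inj_on (\<gamma> j) {0..<len j}"
  and gamma_image: "j \<in> J \<Longrightarrow> \<gamma> j ` {0..<len j} = frontier (Ob j)"
  using param by (auto simp: arclength_param_def)

lemma continuous_gamma: "j \<in> J \<Longrightarrow> continuous_on S (\<gamma> j)"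
  using gamma_deriv by (meson continuous_at_imp_continuous_on has_vector_derivative_continuous)

lemma continuous_gamma': "j \<in> J \<Longrightarrow> continuous_on S (vderiv (\<gamma> j))"
  using gamma_deriv2 by (meson continuous_at_imp_continuous_on has_vector_derivative_continuous)

lemma gamma_period_int: "j \<in> J \<Longrightarrow> \<gamma> j (s + of_int m * len j) = \<gamma> j s"
proof -
  assume j: "j \<in> J"
  have nat: "\<gamma> j (s + real n * len j) = \<gamma> j s" for n s
  proof (induction n)
    case (Suc n)
    have "s + real (Suc n) * len j = (s + real n * len j) + len j" by (simp add: algebra_simps)
    then show ?case using gamma_period[OF j] Suc by metis
  qed simp
  show ?thesis
  proof (cases "m \<ge> 0")
    case True
    then show ?thesis using nat[of s "nat m"] by simp
  next
    case False
    then show ?thesis using nat[of "s + of_int m * len j" "nat (- m)"] by (simp add: algebra_simps)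
  qed
qed

lemma period_reduce:
  assumes "j \<in> J" obtains m :: int where "c \<le> s + of_int m * len j" "s + of_int m * len j < c + len j"
proof -
  define m where "m = - \<lfloor>(s - c) / len j\<rfloor>"
  have "of_int \<lfloor>(s - c) / len j\<rfloor> * len j \<le> s - c" "s - c < (of_int \<lfloor>(s - c) / len j\<rfloor> + 1) * len j"
    using len_pos[OF assms] floor_divide_lower floor_divide_upper by blast+
  then show ?thesis using that[of m] by (simp add: m_def algebra_simps)
qed

lemma gamma_frontier: "j \<in> J \<Longrightarrow> \<gamma> j s \<in> frontier (Ob j)"
proof -
  assume j: "j \<in> J"
  obtain m where m: "0 \<le> s + of_int m * len j" "s + of_int m * len j < 0 + len j"
    using period_reduce[OF j] .
  then have "\<gamma> j (s + of_int m * len j) \<in> frontier (Ob j)"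
    unfolding gamma_image[OF j, symmetric] by (intro imageI) simp
  then show ?thesis by (simp add: gamma_period_int[OF j])
qed

lemma gamma_eq_imp:
  assumes "j \<in> J" "\<gamma> j s = \<gamma> j t" obtains m :: int where "t = s + of_int m * len j"
proof -
  obtain m where m: "0 \<le> s + of_int m * len j" "s + of_int m * len j < 0 + len j"
    using period_reduce[OF assms(1)] .
  obtain m' where m': "0 \<le> t + of_int m' * len j" "t + of_int m' * len j < 0 + len j"
    using period_reduce[OF assms(1)] .
  have "s + of_int m * len j = t + of_int m' * len j"
    using inj_onD[OF gamma_inj[OF assms(1)]] m m' assms gamma_period_int[OF assms(1)] by simp
  then have "t = s + of_int (m - m') * len j" by (simp add: algebra_simps)
  then show ?thesis using that by blast
qed

lemma Ob_nonempty: "j \<in> J \<Longrightarrow> Ob j \<noteq> {}"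
  using gamma_frontier[of j 0] by auto

lemma bounded_Ob: "j \<in> J \<Longrightarrow> bounded (Ob j)"
proof -
  assume j: "j \<in> J"
  have "\<gamma> j ` {0..len j} \<supseteq> frontier (Ob j)" using gamma_image[OF j] by fastforce
  moreover have "compact (\<gamma> j ` {0..len j})"
    by (intro compact_continuous_image continuous_gamma j) simp
  ultimately have bf: "bounded (frontier (Ob j))" using bounded_subset compact_imp_bounded by blast
  show ?thesis
  proof (rule bounded_convex_of_frontier)
    show "bounded (frontier (Ob j))" by (rule bf)
    show "frontier (Ob j) \<noteq> {}" using gamma_frontier[OF j, of 0] by blast
  qed (use open_convex[OF j] in auto)
qed

lemma compact_closure_Ob: "j \<in> J \<Longrightarrow> compact (closure (Ob j))"
  using bounded_Ob compact_closure by blast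

lemma open_obs: "a \<in> idx \<Longrightarrow> open (obs a)"
  unfolding obstacle_def by (intro open_translation conjunct1[OF open_convex] idx_fst)

lemma convex_obs: "a \<in> idx \<Longrightarrow> convex (obs a)"
  unfolding obstacle_def by (intro convex_translation conjunct2[OF open_convex] idx_fst)

lemma bounded_obs: "a \<in> idx \<Longrightarrow> bounded (obs a)"
  unfolding obstacle_def by (intro bounded_translation bounded_Ob idx_fst)

lemma obs_nonempty: "a \<in> idx \<Longrightarrow> obs a \<noteq> {}"
  using Ob_nonempty[of "fst a"] by (simp add: idx_fst obstacle_def)

lemma disjoint_closures:
  "a \<in> idx \<Longrightarrow> b \<in> idx \<Longrightarrow> x \<in> closure (obs a) \<Longrightarrow> x \<in> closure (obs b) \<Longrightarrow> a = b"
  using disjoint unfolding disjoint_family_on_def idx_def case_prod_unfold by blast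

lemma diameter_bound: "\<exists>D>0. \<forall>j\<in>J. closure (Ob j) \<subseteq> ball 0 D"
proof -
  have "bounded (\<Union>j\<in>J. closure (Ob j))"
    using finite_J bounded_Ob by (auto intro!: bounded_UN)
  then show ?thesis using bounded_subset_ballD[of _ 0] by (fastforce simp: UN_subset_iff)
qed

lemma finite_near: "finite {a \<in> idx. closure (obs a) \<inter> cball x R \<noteq> {}}"
proof -
  obtain D where D: "D > 0" "\<And>j. j \<in> J \<Longrightarrow> closure (Ob j) \<subseteq> ball 0 D" using diameter_bound by blast
  have "{a \<in> idx. closure (obs a) \<inter> cball x R \<noteq> {}} \<subseteq> J \<times> {z. norm (lat z) \<le> D + norm x + R}"
  proof clarsimp
    fix j z assume j: "j \<in> J" and "closure (obstacle Ob j z) \<inter> cball x R \<noteq> {}"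
    then obtain y where y: "y - lat z \<in> closure (Ob j)" "dist x y \<le> R"
      by (auto simp: mem_closure_obstacle_iff)
    then have "norm (y - lat z) < D" using D(2)[OF j] by (auto simp: subset_iff)
    moreover have "norm (lat z) \<le> norm (y - lat z) + norm y"
      using norm_triangle_ineq4[of y "y - lat z"] by (simp add: add.commute)
    moreover have "norm y \<le> norm x + dist x y"
      using norm_triangle_ineq4[of x "x - y"] by (simp add: dist_norm)
    ultimately show "norm (lat z) \<le> D + norm x + R" using y by linarith
  qed
  then show ?thesis
    by (rule finite_subset) (intro finite_cartesian_product finite_J finite_lat_bounded)
qed

text \<open>A unit ball meets only finitely many obstacles, so a limit point of the union is a limit
  point of a finite subunion.\<close>

lemma closed_locally_finite_union:
  assumes "A \<subseteq> idx" "\<And>a. a \<in> A \<Longrightarrow> closed (F a)" "\<And>a. a \<in> A \<Longrightarrow> F a \<subseteq> closure (obs a)"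
  shows "closed (\<Union>a\<in>A. F a)"
  unfolding closed_limpt
proof (intro allI impI)
  fix x assume x: "x islimpt (\<Union>a\<in>A. F a)"
  define B where "B = {a \<in> A. F a \<inter> cball x 1 \<noteq> {}}"
  have "finite B"
  proof (rule finite_subset[OF _ finite_near[of x 1]])
    show "B \<subseteq> {a \<in> idx. closure (obs a) \<inter> cball x 1 \<noteq> {}}"
      using assms(1,3) unfolding B_def by blast
  qed
  then have "closed (\<Union>a\<in>B. F a)" using assms by (intro closed_UN) (auto simp: B_def)
  moreover have "x islimpt (\<Union>a\<in>B. F a)"
  proof (rule islimptI)
    fix T assume "x \<in> T" "open T"
    then obtain y where "y \<in> (\<Union>a\<in>A. F a)" "y \<in> T \<inter> ball x 1" "y \<noteq> x"
      using x by (elim islimptE[where T = "T \<inter> ball x 1"]) auto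
    then show "\<exists>y\<in>\<Union> (F ` B). y \<in> T \<and> y \<noteq> x" by (force simp: B_def)
  qed
  ultimately have "x \<in> (\<Union>a\<in>B. F a)" by (metis closed_limpt)
  then show "x \<in> (\<Union>a\<in>A. F a)" by (auto simp: B_def)
qed

lemma mem_table: "x \<in> table J Ob \<longleftrightarrow> (\<forall>a\<in>idx. x \<notin> obs a)"
  by (auto simp: table_def idx_def)

lemma frontier_obs_eq: "a \<in> idx \<Longrightarrow> frontier (obs a) = closure (obs a) - obs a"
  using open_obs by (simp add: frontier_def interior_open)

text \<open>Local finiteness makes the closure of the union equal to the union of the closures, and
  disjointness of the closures keeps a boundary point of one obstacle out of all others.\<close>

lemma frontier_table: "frontier (table J Ob) = (\<Union>a\<in>idx. frontier (obs a))"
proof -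
  let ?U = "\<Union>a\<in>idx. obs a"
  have t: "table J Ob = - ?U" by (auto simp: table_def idx_def)
  have cl: "closure ?U = (\<Union>a\<in>idx. closure (obs a))"
  proof
    show "closure ?U \<subseteq> (\<Union>a\<in>idx. closure (obs a))"
    proof (rule closure_minimal)
      show "?U \<subseteq> (\<Union>a\<in>idx. closure (obs a))" using closure_subset by blast
      show "closed (\<Union>a\<in>idx. closure (obs a))" by (rule closed_locally_finite_union) auto
    qed
    show "(\<Union>a\<in>idx. closure (obs a)) \<subseteq> closure ?U"
      by (auto intro: closure_mono[THEN subsetD, rotated])
  qed
  have "frontier ?U = closure ?U - ?U"
    using open_obs by (simp add: frontier_def interior_open open_UN)
  also have "\<dots> = (\<Union>a\<in>idx. frontier (obs a))"
    unfolding cl using disjoint_closures closure_subset by (auto simp: frontier_obs_eq) blast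
  finally show ?thesis unfolding t frontier_complement .
qed

text \<open>An obstacle of the cell 0 has compact closure, disjoint from the closed union of all the
  others, hence at positive distance from it. The minimum over the finitely many shapes serves every
  cell by translation.\<close>

lemma gap: "\<exists>g>0. \<forall>a\<in>idx. \<forall>b\<in>idx. a \<noteq> b \<longrightarrow> (\<forall>x\<in>closure (obs a). \<forall>y\<in>closure (obs b). g \<le> dist x y)"
proof -
  have "\<exists>g>0. \<forall>b\<in>idx. (j, 0) \<noteq> b \<longrightarrow> (\<forall>x\<in>closure (Ob j). \<forall>y\<in>closure (obs b). g \<le> dist x y)"
    if j: "j \<in> J" for j
  proof -
    let ?C = "\<Union>b\<in>idx - {(j, 0)}. closure (obs b)"
    have "closed ?C" by (intro closed_locally_finite_union) auto
    moreover have "closure (Ob j) \<inter> ?C = {}"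
      using disjoint_closures[of "(j, 0)"] j by fastforce
    ultimately have "\<exists>g>0. \<forall>x\<in>closure (Ob j). \<forall>y\<in>?C. g \<le> dist x y"
      by (rule separate_compact_closed[OF compact_closure_Ob[OF j]])
    then obtain g where g: "g > 0" "\<forall>x\<in>closure (Ob j). \<forall>y\<in>?C. g \<le> dist x y"
      by (elim exE conjE)
    show ?thesis
    proof (intro exI[of _ g] conjI ballI impI)
      fix b x y assume "b \<in> idx" "(j, 0) \<noteq> b" "x \<in> closure (Ob j)" "y \<in> closure (obs b)"
      then show "g \<le> dist x y" using g(2) by blast
    qed (rule g)
  qed
  then obtain g where g: "\<And>j. j \<in> J \<Longrightarrow> 0 < g j"
    "\<And>j b x y. j \<in> J \<Longrightarrow> b \<in> idx \<Longrightarrow> (j, 0) \<noteq> b \<Longrightarrow> x \<in> closure (Ob j) \<Longrightarrow> y \<in> closure (obs b) \<Longrightarrow> g j \<le> dist x y"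
    by metis
  define G where "G = Min (g ` J)"
  have G: "G > 0" "\<And>j. j \<in> J \<Longrightarrow> G \<le> g j"
    using finite_J J_nonempty g(1) by (auto simp: G_def)
  show ?thesis
  proof (intro exI[of _ G] conjI ballI impI)
    fix a b x y assume ab: "a \<in> idx" "b \<in> idx" "a \<noteq> b" "x \<in> closure (obs a)" "y \<in> closure (obs b)"
    obtain j z k z' where e: "a = (j, z)" "b = (k, z')" by fastforce
    have "g j \<le> dist (x - lat z) (y - lat z)"
      using ab by (intro g(2)[of _ "(k, z' - z)"]) (auto simp: e mem_closure_obstacle_iff lat_diff)
    then show "G \<le> dist x y" using G(2)[of j] ab by (auto simp: e dist_norm)
  qed (rule G)
qed

text \<open>A hyperplane separates the boundary point from the obstacle. The inequality is strict
  because, the obstacle being open, any of its points can be pushed a little further along the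
  normal.\<close>

lemma normal_exists:
  assumes j: "j \<in> J"
  obtains n where "norm n = 1" "\<And>y. y \<in> Ob j \<Longrightarrow> n \<bullet> (y - \<gamma> j r) < 0"
proof -
  have q: "\<gamma> j r \<notin> Ob j" using gamma_frontier[OF j, of r] open_convex[OF j] by (auto simp: frontier_def interior_open)
  obtain a b where ab: "a \<noteq> 0" "\<forall>x\<in>Ob j. a \<bullet> x \<le> b" "\<forall>x\<in>{\<gamma> j r}. b \<le> a \<bullet> x"
    using separating_hyperplane_sets[of "Ob j" "{\<gamma> j r}"] open_convex[OF j] Ob_nonempty[OF j] q by auto
  have neg: "a \<bullet> (y - \<gamma> j r) < 0" if y: "y \<in> Ob j" for y
  proof -
    obtain e where e: "e > 0" "ball y e \<subseteq> Ob j" using open_convex[OF j] y open_contains_ball by blast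
    define y' where "y' = y + (e / (2 * norm a)) *\<^sub>R a"
    have "y' \<in> ball y e" using e ab(1) by (simp add: y'_def dist_norm)
    then have "a \<bullet> y' \<le> a \<bullet> \<gamma> j r" using e ab by force
    moreover have "a \<bullet> y' > a \<bullet> y" using e ab(1) by (simp add: y'_def inner_add_right)
    ultimately show ?thesis by (simp add: inner_diff_right)
  qed
  show ?thesis
  proof (rule that[of "sgn a"])
    show "norm (sgn a) = 1" using ab(1) by (simp add: norm_sgn)
    fix y assume "y \<in> Ob j"
    from neg[OF this] ab(1) show "sgn a \<bullet> (y - \<gamma> j r) < 0"
      by (simp add: sgn_div_norm divide_less_0_iff mult_less_0_iff)
  qed
qed

lemma support_orth:
  assumes j: "j \<in> J" and "\<And>y. y \<in> Ob j \<Longrightarrow> y \<bullet> x \<le> \<gamma> j r \<bullet> x"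
  shows "x \<bullet> vderiv (\<gamma> j) r = 0"
proof -
  have "y \<bullet> x \<le> \<gamma> j r \<bullet> x" if "y \<in> closure (Ob j)" for y
  proof -
    have "closure (Ob j) \<subseteq> {y. x \<bullet> y \<le> \<gamma> j r \<bullet> x}"
      using assms(2) closed_halfspace_le[of x] by (intro closure_minimal) (auto simp: inner_commute)
    then show ?thesis using that by (auto simp: inner_commute)
  qed
  then have mx: "\<gamma> j s \<bullet> x \<le> \<gamma> j r \<bullet> x" for s
    using gamma_frontier[OF j] by (auto simp: frontier_def)
  have "((\<lambda>s. \<gamma> j s \<bullet> x) has_real_derivative vderiv (\<gamma> j) r \<bullet> x) (at r)"
    using bounded_linear.has_vector_derivative[OF bounded_linear_inner_left gamma_deriv[OF j]]
    by (simp add: has_real_derivative_iff_has_vector_derivative)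
  then have "vderiv (\<gamma> j) r \<bullet> x = 0"
    by (rule DERIV_local_max[of _ _ _ 1]) (use mx in auto)
  then show ?thesis by (simp add: inner_commute)
qed

text \<open>The boundary curve maximises a supporting form at its contact point, so any supporting
  normal is orthogonal to the tangent. Two unit candidates remain, and a point of the obstacle
  decides between them: the description in \<open>table_normal\<close> is meaningful.\<close>

lemma table_normal_unique:
  assumes j: "j \<in> J" and n: "norm n = 1" "\<And>y. y \<in> Ob j \<Longrightarrow> n \<bullet> (y - \<gamma> j r) \<le> 0"
  shows "table_normal (Ob j) (\<gamma> j r) = n"
    and "n \<bullet> vderiv (\<gamma> j) r = 0"
    and "y \<in> Ob j \<Longrightarrow> n \<bullet> (y - \<gamma> j r) < 0"
proof -
  let ?t = "vderiv (\<gamma> j) r"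
  obtain m where m: "norm m = 1" "\<And>y. y \<in> Ob j \<Longrightarrow> m \<bullet> (y - \<gamma> j r) < 0"
    by (rule normal_exists[OF j, of r]) blast
  have orth: "k \<bullet> ?t = 0" if "\<And>y. y \<in> Ob j \<Longrightarrow> k \<bullet> (y - \<gamma> j r) \<le> 0" for k
    using that by (intro support_orth[OF j]) (auto simp: inner_diff_right inner_commute)
  have mt: "m \<bullet> ?t = 0" by (rule orth) (use m in \<open>auto intro: less_imp_le\<close>)
  have eq: "k = m" if k: "norm k = 1" "\<And>y. y \<in> Ob j \<Longrightarrow> k \<bullet> (y - \<gamma> j r) \<le> 0" for k
  proof -
    have "k = m \<or> k = - m"
      using orth_unit_cases[OF norm_gamma'[OF j] m(1) _ k(1) orth[OF k(2)]] mt by (simp add: inner_commute)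
    moreover obtain y where y: "y \<in> Ob j" using Ob_nonempty[OF j] by blast
    ultimately show ?thesis using k(2)[OF y] m(2)[OF y] by auto
  qed
  have nm: "n = m" using eq n by blast
  show "table_normal (Ob j) (\<gamma> j r) = n"
    unfolding table_normal_def
  proof (rule the_equality)
    show "norm n = 1 \<and> (\<forall>y\<in>Ob j. n \<bullet> (y - \<gamma> j r) \<le> 0)" using n by blast
    fix k assume "norm k = 1 \<and> (\<forall>y\<in>Ob j. k \<bullet> (y - \<gamma> j r) \<le> 0)"
    then have "k = m" using eq[of k] by blast
    then show "k = n" using nm by simp
  qed
  show "n \<bullet> ?t = 0" "y \<in> Ob j \<Longrightarrow> n \<bullet> (y - \<gamma> j r) < 0" unfolding nm by (rule mt, rule m(2))
qed

abbreviation nrm :: "'j \<Rightarrow> real \<Rightarrow> real ^ 2" where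
  "nrm j r \<equiv> table_normal (Ob j) (\<gamma> j r)"

lemma normal:
  assumes j: "j \<in> J"
  shows norm_normal: "norm (nrm j r) = 1"
    and normal_orth: "nrm j r \<bullet> vderiv (\<gamma> j) r = 0"
    and normal_neg: "y \<in> Ob j \<Longrightarrow> nrm j r \<bullet> (y - \<gamma> j r) < 0"
proof -
  obtain n where n: "norm n = 1" "\<And>y. y \<in> Ob j \<Longrightarrow> n \<bullet> (y - \<gamma> j r) < 0"
    by (rule normal_exists[OF j, of r]) blast
  note * = table_normal_unique[OF j n(1) less_imp_le[OF n(2)]]
  show "norm (nrm j r) = 1" "nrm j r \<bullet> vderiv (\<gamma> j) r = 0" using * n by auto
  show "y \<in> Ob j \<Longrightarrow> nrm j r \<bullet> (y - \<gamma> j r) < 0" using * n by auto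
qed

lemma vderiv_gamma_period:
  assumes j: "j \<in> J" shows "vderiv (\<gamma> j) (s + of_int m * len j) = vderiv (\<gamma> j) s"
    "vderiv (vderiv (\<gamma> j)) (s + of_int m * len j) = vderiv (vderiv (\<gamma> j)) s"
proof -
  show "vderiv (\<gamma> j) (s + of_int m * len j) = vderiv (\<gamma> j) s" for s
    by (rule vderiv_shift) (rule gamma_period_int[OF j])
  then show "vderiv (vderiv (\<gamma> j)) (s + of_int m * len j) = vderiv (vderiv (\<gamma> j)) s"
    by (rule vderiv_shift)
qed

text \<open>The description in \<open>curvature\<close> is meaningful: disjoint closures determine
  the obstacle through a point, injectivity determines the parameter up to a multiple of the period,
  and the second derivative is periodic.\<close>

lemma curvature_eq:
  assumes j: "j \<in> J"
  shows "curvature J \<gamma> (\<gamma> j s + lat z) = norm (vderiv (vderiv (\<gamma> j)) s)"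
  unfolding curvature_def
proof (rule the_equality)
  show "\<exists>i\<in>J. \<exists>y t. \<gamma> j s + lat z = \<gamma> i t + lat y \<and>
      norm (vderiv (vderiv (\<gamma> j)) s) = norm (vderiv (vderiv (\<gamma> i)) t)"
    using j by blast
  fix c assume "\<exists>i\<in>J. \<exists>y t. \<gamma> j s + lat z = \<gamma> i t + lat y \<and> c = norm (vderiv (vderiv (\<gamma> i)) t)"
  then obtain i y t where i: "i \<in> J" "\<gamma> j s + lat z = \<gamma> i t + lat y" "c = norm (vderiv (vderiv (\<gamma> i)) t)"
    by blast
  have "\<gamma> j s + lat z \<in> closure (obs (j, z))" "\<gamma> i t + lat y \<in> closure (obs (i, y))"
    using gamma_frontier i(1) j by (auto simp: mem_closure_obstacle_iff frontier_def)
  then have "(j, z) = (i, y)" using i j by (intro disjoint_closures[of _ _ "\<gamma> j s + lat z"]) auto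
  then obtain m where "t = s + of_int m * len j"
    using i(2) j by (auto elim: gamma_eq_imp)
  then show "c = norm (vderiv (vderiv (\<gamma> j)) s)"
    using i \<open>(j, z) = (i, y)\<close> vderiv_gamma_period(2)[OF j] by simp
qed

lemma gamma_inner_deriv:
  assumes "j \<in> J"
  shows "((\<lambda>s. \<gamma> j s \<bullet> x) has_real_derivative vderiv (\<gamma> j) s \<bullet> x) (at s)"
    and "((\<lambda>s. vderiv (\<gamma> j) s \<bullet> x) has_real_derivative vderiv (vderiv (\<gamma> j)) s \<bullet> x) (at s)"
  using bounded_linear.has_vector_derivative[OF bounded_linear_inner_left gamma_deriv[OF assms]]
    bounded_linear.has_vector_derivative[OF bounded_linear_inner_left gamma_deriv2[OF assms]]
  by (simp_all add: has_real_derivative_iff_has_vector_derivative)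

lemma gamma''_orth: "j \<in> J \<Longrightarrow> vderiv (vderiv (\<gamma> j)) s \<bullet> vderiv (\<gamma> j) s = 0"
proof -
  assume j: "j \<in> J"
  have "((\<lambda>s. vderiv (\<gamma> j) s \<bullet> vderiv (\<gamma> j) s) has_vector_derivative
     (vderiv (\<gamma> j) s \<bullet> vderiv (vderiv (\<gamma> j)) s + vderiv (vderiv (\<gamma> j)) s \<bullet> vderiv (\<gamma> j) s)) (at s)"
    by (rule bounded_bilinear.has_vector_derivative[OF bounded_bilinear_inner gamma_deriv2[OF j] gamma_deriv2[OF j]])
  moreover have "(\<lambda>s. vderiv (\<gamma> j) s \<bullet> vderiv (\<gamma> j) s) = (\<lambda>s. 1)"
    using norm_gamma'[OF j] by (simp add: dot_square_norm)
  ultimately have "((\<lambda>s. 1::real) has_vector_derivative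
     (vderiv (\<gamma> j) s \<bullet> vderiv (vderiv (\<gamma> j)) s + vderiv (vderiv (\<gamma> j)) s \<bullet> vderiv (\<gamma> j) s)) (at s)"
    by simp
  from vector_derivative_unique_at[OF this has_vector_derivative_const] show ?thesis
    by (simp add: inner_commute)
qed

text \<open>At unit speed the second derivative is orthogonal to the tangent, so in the plane it is
  carried entirely by the normal direction.\<close>

lemma gamma''_at_orth:
  assumes j: "j \<in> J" and x: "norm x = 1" "vderiv (\<gamma> j) r \<bullet> x = 0"
  shows "\<bar>vderiv (vderiv (\<gamma> j)) r \<bullet> x\<bar> = norm (vderiv (vderiv (\<gamma> j)) r)"
proof -
  have "vderiv (vderiv (\<gamma> j)) r = (vderiv (vderiv (\<gamma> j)) r \<bullet> x) *\<^sub>R x"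
    using orthonormal2_decomp[OF norm_gamma'[OF j] x, of "vderiv (vderiv (\<gamma> j)) r"] gamma''_orth[OF j] by simp
  then have "norm (vderiv (vderiv (\<gamma> j)) r) = \<bar>vderiv (vderiv (\<gamma> j)) r \<bullet> x\<bar> * norm x"
    by (metis norm_scaleR)
  then show ?thesis using x by simp
qed

text \<open>Nonzero curvature makes every boundary point that is extremal in a direction isolated.\<close>

lemma extremal_isolated:
  assumes j: "j \<in> J" and x: "norm x = 1" "vderiv (\<gamma> j) r \<bullet> x = 0"
  obtains e where "e > 0" "\<And>s. s \<noteq> r \<Longrightarrow> \<bar>s - r\<bar> < e \<Longrightarrow> \<gamma> j s \<bullet> x \<noteq> \<gamma> j r \<bullet> x"
proof -
  let ?D = "vderiv (vderiv (\<gamma> j)) r \<bullet> x"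
  have D: "?D \<noteq> 0" using gamma''_at_orth[OF assms] nonzero_curvature[OF j, of r] by auto
  have "((\<lambda>s. (\<gamma> j s \<bullet> x - \<gamma> j r \<bullet> x) / (s - r)\<^sup>2) \<longlongrightarrow> ?D / 2) (at r)"
    by (rule sqrt_rate_limit[OF gamma_inner_deriv(1)[OF j] x(2) gamma_inner_deriv(2)[OF j]])
  then have "\<forall>\<^sub>F s in at r. (\<gamma> j s \<bullet> x - \<gamma> j r \<bullet> x) / (s - r)\<^sup>2 \<noteq> 0"
    by (rule tendsto_imp_eventually_ne) (use D in auto)
  then obtain e where "e > 0" "\<forall>s. s \<noteq> r \<and> dist s r < e \<longrightarrow> (\<gamma> j s \<bullet> x - \<gamma> j r \<bullet> x) / (s - r)\<^sup>2 \<noteq> 0"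
    unfolding eventually_at by blast
  then show ?thesis by (intro that[of e]) (auto simp: dist_real_def)
qed

lemma closure_support:
  assumes "\<And>y. y \<in> K \<Longrightarrow> y \<bullet> x \<le> c" "y \<in> closure K"
  shows "y \<bullet> (x :: 'x::euclidean_space) \<le> c"
proof -
  have "closure K \<subseteq> {y. y \<bullet> x \<le> c}"
    using assms(1) closed_halfspace_le[of x] by (intro closure_minimal) (auto simp: inner_commute)
  then show ?thesis using assms(2) by auto
qed

lemma maximal_in_frontier:
  assumes j: "j \<in> J" and x: "norm x = 1" and y: "y \<in> closure (Ob j)" "\<And>y'. y' \<in> closure (Ob j) \<Longrightarrow> y' \<bullet> x \<le> y \<bullet> x"
  shows "y \<in> frontier (Ob j)"
proof (rule ccontr)
  assume "y \<notin> frontier (Ob j)"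
  then have "y \<in> Ob j" using y(1) open_convex[OF j] by (simp add: frontier_def interior_open)
  then obtain e where e: "e > 0" "ball y e \<subseteq> Ob j" using open_convex[OF j] open_contains_ball by blast
  have "y + (e/2) *\<^sub>R x \<in> ball y e" using e x by (simp add: dist_norm)
  then have "(y + (e/2) *\<^sub>R x) \<bullet> x \<le> y \<bullet> x" using y(2) e closure_subset by blast
  moreover have "x \<bullet> x = 1" using x by (simp add: dot_square_norm)
  ultimately show False using e by (simp add: inner_add_left)
qed

definition top0 :: "real ^ 2 \<Rightarrow> 'j \<Rightarrow> real ^ 2" where
  "top0 x j = (SOME y. y \<in> closure (Ob j) \<and> (\<forall>y'\<in>closure (Ob j). y' \<bullet> x \<le> y \<bullet> x))"

lemma top0:
  assumes "j \<in> J"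
  shows "top0 x j \<in> closure (Ob j)" "y \<in> closure (Ob j) \<Longrightarrow> y \<bullet> x \<le> top0 x j \<bullet> x"
proof -
  have "\<exists>y\<in>closure (Ob j). \<forall>y'\<in>closure (Ob j). y' \<bullet> x \<le> y \<bullet> x"
    using compact_closure_Ob[OF assms] Ob_nonempty[OF assms]
    by (intro continuous_attains_sup continuous_intros) auto
  then have "\<exists>y. y \<in> closure (Ob j) \<and> (\<forall>y'\<in>closure (Ob j). y' \<bullet> x \<le> y \<bullet> x)" by blast
  from someI_ex[OF this] show "top0 x j \<in> closure (Ob j)" "y \<in> closure (Ob j) \<Longrightarrow> y \<bullet> x \<le> top0 x j \<bullet> x"
    unfolding top0_def by blast+
qed

text \<open>If two points attained the maximum, so would the whole segment between them, which lies
  in the boundary. Its infinitely many points have parameters that accumulate at some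
  \<open>r\<close>; by continuity \<open>r\<close> is extremal too, and it is not isolated.\<close>

lemma top0_unique:
  assumes j: "j \<in> J" and x: "norm x = 1" and y: "y \<in> closure (Ob j)" "y \<bullet> x = top0 x j \<bullet> x"
  shows "y = top0 x j"
proof (rule ccontr)
  assume ne: "y \<noteq> top0 x j"
  let ?m = "top0 x j \<bullet> x"
  define S where "S = closed_segment y (top0 x j)"
  have S: "z \<in> closure (Ob j)" "z \<bullet> x = ?m" if "z \<in> S" for z
  proof -
    have "convex (closure (Ob j))" using open_convex[OF j] convex_closure by blast
    then show "z \<in> closure (Ob j)"
      using that y(1) top0(1)[OF j] closed_segment_subset unfolding S_def by blast
    from that obtain t where "z = (1 - t) *\<^sub>R y + t *\<^sub>R top0 x j" unfolding S_def by (auto simp: in_segment)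
    then have "z \<bullet> x = (1 - t) * (y \<bullet> x) + t * ?m" by (simp add: inner_add_left)
    then show "z \<bullet> x = ?m" using y(2) by (simp add: algebra_simps)
  qed
  define R where "R = {r \<in> {0..len j}. \<gamma> j r \<bullet> x = ?m}"
  have "S \<subseteq> \<gamma> j ` R"
  proof
    fix z assume z: "z \<in> S"
    then have "z \<in> frontier (Ob j)"
      using S top0(2)[OF j] by (intro maximal_in_frontier[OF j x]) auto
    then obtain r where "r \<in> {0..<len j}" "z = \<gamma> j r" using gamma_image[OF j] by blast
    then show "z \<in> \<gamma> j ` R" using S[OF z] by (auto simp: R_def)
  qed
  moreover have "infinite S" unfolding S_def using ne by simp
  ultimately have infR: "infinite R" using finite_surj by blast
  have cR: "closed R"
  proof -
    have "R = {0..len j} \<inter> (\<lambda>r. \<gamma> j r \<bullet> x) -` {?m}" by (auto simp: R_def)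
    then show ?thesis
      using continuous_gamma[OF j] by (auto intro!: continuous_closed_preimage continuous_intros)
  qed
  have "bounded R" by (rule bounded_subset[of "{0..len j}"]) (auto simp: R_def)
  then obtain r where r: "r islimpt R"
    using infR bounded_infinite_imp_islimpt[of R R] by blast
  then have "r \<in> R" using cR by (simp add: closed_limpt)
  then have rm: "\<gamma> j r \<bullet> x = ?m" by (simp add: R_def)
  have "x \<bullet> vderiv (\<gamma> j) r = 0"
    using rm top0(2)[OF j] closure_subset by (intro support_orth[OF j]) auto
  then obtain e where e: "e > 0" "\<And>s. s \<noteq> r \<Longrightarrow> \<bar>s - r\<bar> < e \<Longrightarrow> \<gamma> j s \<bullet> x \<noteq> \<gamma> j r \<bullet> x"
    using extremal_isolated[OF j x, of r] by (metis inner_commute)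
  obtain s where "s \<in> R" "s \<noteq> r" "dist s r < e" using r e(1) unfolding islimpt_approachable by blast
  then show False using e(2)[of s] rm by (auto simp: R_def dist_real_def)
qed

lemma supp_top0: "j \<in> J \<Longrightarrow> supp (Ob j) x = top0 x j \<bullet> x"
  using top0(2)[of j _ x] closure_subset[of "Ob j"] supp_upper_closure[OF bounded_Ob top0(1)]
  by (intro antisym supp_least Ob_nonempty) auto

lemma top0_gamma:
  assumes j: "j \<in> J" and x: "norm x = 1"
  obtains r where "r \<in> {0..<len j}" "\<gamma> j r = top0 x j" "vderiv (\<gamma> j) r \<bullet> x = 0"
proof -
  have "top0 x j \<in> frontier (Ob j)" by (rule maximal_in_frontier[OF j x]) (use top0[OF j] in auto)
  then obtain r where r: "r \<in> {0..<len j}" "\<gamma> j r = top0 x j" using gamma_image[OF j] by (metis imageE)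
  have "x \<bullet> vderiv (\<gamma> j) r = 0"
    using r top0(2)[OF j] closure_subset by (intro support_orth[OF j]) auto
  then show ?thesis using r that by (simp add: inner_commute)
qed

lemma gamma_lipschitz: "j \<in> J \<Longrightarrow> norm (\<gamma> j s - \<gamma> j t) \<le> \<bar>s - t\<bar>"
proof -
  assume j: "j \<in> J"
  have "norm (\<gamma> j s - \<gamma> j t) \<le> 1 * norm (s - t)"
    using gamma_deriv[OF j] norm_gamma'[OF j]
    by (intro differentiable_bound[of UNIV "\<gamma> j" "\<lambda>s h. h *\<^sub>R vderiv (\<gamma> j) s"])
       (auto simp: has_vector_derivative_def onorm_scaleR_left onorm_id intro!: onorm_le)
  then show ?thesis by simp
qed

context
  fixes j :: 'j and u n :: "real ^ 2" and r :: real
  assumes j: "j \<in> J" and u: "norm u = 1" and n: "norm n = 1" and un: "u \<bullet> n = 0"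
    and r: "\<gamma> j r = top0 n j"
begin

lemma gamma'_top: "vderiv (\<gamma> j) r \<bullet> n = 0"
  using support_orth[OF j, of n r] r top0(2)[OF j] closure_subset by (metis inner_commute subsetD)

lemma gamma'_u_top: "\<bar>vderiv (\<gamma> j) r \<bullet> u\<bar> = 1"
proof -
  have "vderiv (\<gamma> j) r = u \<or> vderiv (\<gamma> j) r = - u"
    using orth_unit_cases[OF n u _ norm_gamma'[OF j] gamma'_top] un by (simp add: inner_commute)
  then show ?thesis using u by (auto simp: dot_square_norm)
qed

abbreviation "curv \<equiv> norm (vderiv (vderiv (\<gamma> j)) r)"

lemma curv_pos: "0 < curv" using nonzero_curvature[OF j, of r] by simp

lemma height_rate: "((\<lambda>s. (\<gamma> j s \<bullet> n - \<gamma> j r \<bullet> n) / (s - r)\<^sup>2) \<longlongrightarrow> - curv / 2) (at r)"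
proof -
  let ?D = "vderiv (vderiv (\<gamma> j)) r \<bullet> n"
  have lim: "((\<lambda>s. (\<gamma> j s \<bullet> n - \<gamma> j r \<bullet> n) / (s - r)\<^sup>2) \<longlongrightarrow> ?D / 2) (at r)"
    by (rule sqrt_rate_limit[OF gamma_inner_deriv(1)[OF j] gamma'_top gamma_inner_deriv(2)[OF j]])
  have "\<gamma> j s \<bullet> n - \<gamma> j r \<bullet> n \<le> 0" for s
    using r top0(2)[OF j] gamma_frontier[OF j] by (simp add: frontier_def)
  then have "?D / 2 \<le> 0"
    by (intro tendsto_upperbound[OF lim]) (auto intro!: always_eventually divide_nonpos_nonneg)
  moreover have "\<bar>?D\<bar> = curv" by (rule gamma''_at_orth[OF j n gamma'_top])
  ultimately have "?D = - curv" by simp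
  then show ?thesis using lim by simp
qed

text \<open>Within half a period around \<open>r\<close> the curve does not return to its top, and
  the top is the only point of maximal height.\<close>

lemma height_drop:
  assumes "s \<noteq> r" "\<bar>s - r\<bar> \<le> len j / 2"
  shows "\<gamma> j s \<bullet> n < \<gamma> j r \<bullet> n"
proof -
  have le: "\<gamma> j s \<bullet> n \<le> \<gamma> j r \<bullet> n"
    using r top0(2)[OF j] gamma_frontier[OF j] by (simp add: frontier_def)
  have "\<gamma> j s \<noteq> \<gamma> j r"
  proof
    assume "\<gamma> j s = \<gamma> j r"
    then obtain m where m: "r = s + of_int m * len j" using gamma_eq_imp[OF j] by metis
    then have "\<bar>of_int m\<bar> * len j \<le> len j / 2" using assms len_pos[OF j] by (auto simp: abs_mult)
    then have "\<bar>real_of_int m\<bar> \<le> 1/2" using len_pos[OF j] by (simp add: field_simps)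
    then have "m = 0" by linarith
    then show False using m assms by simp
  qed
  then have "\<gamma> j s \<bullet> n \<noteq> \<gamma> j r \<bullet> n"
    using r gamma_frontier[OF j, of s] top0_unique[OF j n] by (auto simp: frontier_def)
  then show ?thesis using le by simp
qed

abbreviation "perp \<theta> \<equiv> perp_dir u n \<theta>"

text \<open>The concave profile lies below a parabola of opening \<open>c'\<close> near the top and definitely below
  the top elsewhere; maximising \<open>\<bar>t\<bar> \<theta> - cos \<theta> c' t\<^sup>2 / 2\<close> over \<open>t\<close> gives the bound.\<close>

lemma supp_excess_upper:
  assumes c': "0 < c'" "c' < curv"
  shows "\<forall>\<^sub>F \<theta> in at_right 0. supp (Ob j) (perp \<theta>) - \<gamma> j r \<bullet> perp \<theta> \<le> \<theta>\<^sup>2 / (2 * c' * cos \<theta>)"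
proof -
  have "\<forall>\<^sub>F s in at r. (\<gamma> j s \<bullet> n - \<gamma> j r \<bullet> n) / (s - r)\<^sup>2 < - c' / 2"
    using height_rate c' by (intro order_tendstoD(2)[where y = "- curv / 2"]) auto
  then obtain d where d: "d > 0"
    "\<And>s. s \<noteq> r \<Longrightarrow> dist s r < d \<Longrightarrow> (\<gamma> j s \<bullet> n - \<gamma> j r \<bullet> n) / (s - r)\<^sup>2 < - c' / 2"
    unfolding eventually_at by blast
  have near: "\<gamma> j s \<bullet> n - \<gamma> j r \<bullet> n \<le> - c' * (s - r)\<^sup>2 / 2" if "\<bar>s - r\<bar> < d" for s
  proof (cases "s = r")
    case False
    then have "(\<gamma> j s \<bullet> n - \<gamma> j r \<bullet> n) / (s - r)\<^sup>2 < - c' / 2" using d that by (simp add: dist_real_def)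
    then show ?thesis using False by (simp add: pos_divide_less_eq)
  qed simp
  \<comment> \<open>The parameters of one period away from the top. By compactness the height stays
    below the maximum there by a fixed amount \<open>m\<close>.\<close>
  define C where "C = {s. d \<le> \<bar>s - r\<bar> \<and> \<bar>s - r\<bar> \<le> len j / 2}"
  have "compact C"
  proof (rule compact_eq_bounded_closed[THEN iffD2], intro conjI)
    show "bounded C" by (rule bounded_subset[of "cball r (len j / 2)"]) (auto simp: C_def dist_real_def abs_minus_commute)
    show "closed C" unfolding C_def by (intro closed_Collect_conj closed_Collect_le continuous_intros)
  qed
  obtain m where m: "m > 0" "\<And>s. s \<in> C \<Longrightarrow> \<gamma> j s \<bullet> n - \<gamma> j r \<bullet> n \<le> - m"
  proof (cases "C = {}")
    case True then show ?thesis using that[of 1] by auto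
  next
    case False
    then obtain s0 where s0: "s0 \<in> C" "\<And>s. s \<in> C \<Longrightarrow> \<gamma> j s \<bullet> n \<le> \<gamma> j s0 \<bullet> n"
      using continuous_attains_sup[OF \<open>compact C\<close> False
          continuous_on_inner[OF continuous_gamma[OF j] continuous_on_const], of n] by blast
    have "\<gamma> j s0 \<bullet> n < \<gamma> j r \<bullet> n" using s0(1) d(1) by (intro height_drop) (auto simp: C_def)
    then show ?thesis using s0(2) that[of "\<gamma> j r \<bullet> n - \<gamma> j s0 \<bullet> n"] by force
  qed
  \<comment> \<open>For small \<theta>, tilting gains at most \<theta> times half the perimeter,
    which cannot make up for the loss of height on \<open>C\<close>.\<close>
  have "((\<lambda>\<theta>. \<theta> * (len j / 2) - cos \<theta> * m) \<longlongrightarrow> 0 * (len j / 2) - cos 0 * m) (at_right (0::real))"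
    by (intro tendsto_intros)
  then have ev1: "\<forall>\<^sub>F \<theta> in at_right (0::real). \<theta> * (len j / 2) - cos \<theta> * m < 0"
    using m(1) by (intro order_tendstoD(2)) auto
  have ev2: "\<forall>\<^sub>F \<theta> in at_right (0::real). 0 < \<theta> \<and> \<theta> < 1"
    by (auto simp: eventually_at_right_field intro!: exI[of _ 1])
  show ?thesis using ev1 ev2
  proof eventually_elim
    case (elim \<theta>)
    have cos: "cos \<theta> > 0" using elim pi_gt3 by (intro cos_gt_zero) auto
    have sn: "0 < sin \<theta>" "sin \<theta> \<le> \<theta>" using elim pi_gt3 by (auto intro: sin_gt_zero sin_x_le_x)
    have bound: "\<gamma> j s \<bullet> perp \<theta> - \<gamma> j r \<bullet> perp \<theta> \<le> \<theta>\<^sup>2 / (2 * c' * cos \<theta>)" if s: "\<bar>s - r\<bar> \<le> len j / 2" for s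
    proof -
      let ?t = "\<bar>s - r\<bar>"
      have "\<bar>(\<gamma> j s - \<gamma> j r) \<bullet> u\<bar> \<le> ?t"
        using Cauchy_Schwarz_ineq2[of "\<gamma> j s - \<gamma> j r" u] gamma_lipschitz[OF j, of s r] u by simp
      then have "- sin \<theta> * ((\<gamma> j s - \<gamma> j r) \<bullet> u) \<le> sin \<theta> * ?t"
        using sn(1) by (metis abs_le_D2 mult_le_cancel_left_pos mult_minus_left mult_minus_right)
      also have "\<dots> \<le> \<theta> * ?t" using sn by (intro mult_right_mono) auto
      finally have 1: "\<gamma> j s \<bullet> perp \<theta> - \<gamma> j r \<bullet> perp \<theta> \<le> \<theta> * ?t + cos \<theta> * (\<gamma> j s \<bullet> n - \<gamma> j r \<bullet> n)"
        by (simp add: perp_dir_def inner_add_right inner_diff_left algebra_simps)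
      show ?thesis
      proof (cases "?t < d")
        case True
        have "cos \<theta> * (\<gamma> j s \<bullet> n - \<gamma> j r \<bullet> n) \<le> cos \<theta> * (- c' * ?t\<^sup>2 / 2)"
          using near[OF True] cos by (intro mult_left_mono) auto
        moreover have "\<theta> * ?t + cos \<theta> * (- c' * ?t\<^sup>2 / 2) \<le> \<theta>\<^sup>2 / (2 * c' * cos \<theta>)"
        proof -
          \<comment> \<open>Completing the square gives the maximum of the concave quadratic over
            all distances at once.\<close>
          have "0 \<le> (\<theta> - c' * cos \<theta> * ?t)\<^sup>2 / (2 * c' * cos \<theta>)" using c' cos by simp
          also have "\<dots> = \<theta>\<^sup>2 / (2 * c' * cos \<theta>) - (\<theta> * ?t + cos \<theta> * (- c' * ?t\<^sup>2 / 2))"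
            using c' cos by (simp add: field_simps power2_eq_square)
          finally show ?thesis by simp
        qed
        ultimately show ?thesis using 1 by linarith
      next
        case False
        then have "cos \<theta> * (\<gamma> j s \<bullet> n - \<gamma> j r \<bullet> n) \<le> cos \<theta> * (- m)"
          using s cos by (intro mult_left_mono m) (auto simp: C_def)
        moreover have "\<theta> * ?t \<le> \<theta> * (len j / 2)" using s elim by (intro mult_left_mono) auto
        moreover have "0 \<le> \<theta>\<^sup>2 / (2 * c' * cos \<theta>)" using c' cos by simp
        ultimately show ?thesis using 1 elim by linarith
      qed
    qed
    obtain s0 where s0: "\<gamma> j s0 = top0 (perp \<theta>) j"
    proof -
      have "norm (perp \<theta>) = 1"
        by (rule dir_perp_orthonormal(2)[OF u n un])
      then show ?thesis using top0_gamma[OF j] that by metis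
    qed
    \<comment> \<open>The maximiser for the tilted direction is brought by periodicity into the
      window of length \<open>len j\<close> centred at \<open>r\<close>, where the bound
      applies.\<close>
    obtain m' where m': "r - len j / 2 \<le> s0 + of_int m' * len j" "s0 + of_int m' * len j < r - len j / 2 + len j"
      using period_reduce[OF j] .
    have "supp (Ob j) (perp \<theta>) = \<gamma> j (s0 + of_int m' * len j) \<bullet> perp \<theta>"
      using supp_top0[OF j] s0 gamma_period_int[OF j] by simp
    moreover have "\<bar>(s0 + of_int m' * len j) - r\<bar> \<le> len j / 2" using m' by linarith
    ultimately show ?case using bound[of "s0 + of_int m' * len j"] by simp
  qed
qed

text \<open>From above, the parabola bound is used with openings arbitrarily close to the curvature.
  From below, the support function is tested on the single boundary point where the quadratic model
  attains its maximum.\<close>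

lemma supp_excess_limit:
  "((\<lambda>\<theta>. (supp (Ob j) (perp \<theta>) - \<gamma> j r \<bullet> perp \<theta>) / \<theta>\<^sup>2) \<longlongrightarrow> 1 / (2 * curv)) (at_right 0)"
proof (rule order_tendstoI)
  fix a assume a: "1 / (2 * curv) < a"
  have a0: "0 < a" using a curv_pos by (metis divide_pos_pos less_trans mult_pos_pos zero_less_numeral zero_less_one)
  \<comment> \<open>The midpoint of 1 / (2 a) and the curvature: below the curvature, so the
    parabola bound holds, and above 1 / (2 a), so that bound beats \<open>a\<close>.\<close>
  define c' where "c' = (1 / (2 * a) + curv) / 2"
  have "1 / (2 * a) < curv" using a a0 curv_pos by (simp add: field_simps)
  then have c': "0 < c'" "c' < curv" "1 / (2 * a) < c'" using a0 curv_pos add_pos_pos[of "1 / (2 * a)" curv]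
    unfolding c'_def by auto
  have "((\<lambda>\<theta>. 1 / (2 * c' * cos \<theta>)) \<longlongrightarrow> 1 / (2 * c' * cos 0)) (at_right (0::real))"
    using c' by (intro tendsto_intros) auto
  then have "\<forall>\<^sub>F \<theta> in at_right (0::real). 1 / (2 * c' * cos \<theta>) < a"
    by (rule order_tendstoD(2)) (use c' a0 in \<open>auto simp: field_simps\<close>)
  moreover have "\<forall>\<^sub>F \<theta> in at_right (0::real). 0 < \<theta>" by (simp add: eventually_at_right_less)
  ultimately show "\<forall>\<^sub>F \<theta> in at_right 0. (supp (Ob j) (perp \<theta>) - \<gamma> j r \<bullet> perp \<theta>) / \<theta>\<^sup>2 < a"
    using supp_excess_upper[OF c'(1,2)]
  proof eventually_elim
    case (elim \<theta>)
    then have "(supp (Ob j) (perp \<theta>) - \<gamma> j r \<bullet> perp \<theta>) / \<theta>\<^sup>2 \<le> (\<theta>\<^sup>2 / (2 * c' * cos \<theta>)) / \<theta>\<^sup>2"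
      by (intro divide_right_mono) auto
    also have "\<dots> = 1 / (2 * c' * cos \<theta>)" using elim by simp
    finally show ?case using elim by linarith
  qed
next
  fix a assume a: "a < 1 / (2 * curv)"
  \<comment> \<open>To first order the tilted maximum sits at parameter r + \<sigma> \<theta>: this
    maximises minus \<theta> t times the tangential component, minus curvature times
    \<open>t\<^sup>2 / 2\<close>. The tangential component is 1 or -1 according to the orientation
    of the parametrization.\<close>
  define \<sigma> where "\<sigma> = - (vderiv (\<gamma> j) r \<bullet> u) / curv"
  have \<sigma>: "\<sigma> \<noteq> 0" "(vderiv (\<gamma> j) r \<bullet> u) * \<sigma> = - 1 / curv" "\<sigma>\<^sup>2 = 1 / curv\<^sup>2"
  proof -
    have "(vderiv (\<gamma> j) r \<bullet> u) * (vderiv (\<gamma> j) r \<bullet> u) = 1"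
      using gamma'_u_top by (metis abs_mult_self_eq mult_1)
    then show "\<sigma> \<noteq> 0" "(vderiv (\<gamma> j) r \<bullet> u) * \<sigma> = - 1 / curv" "\<sigma>\<^sup>2 = 1 / curv\<^sup>2"
      using curv_pos by (auto simp: \<sigma>_def power2_eq_square field_simps)
  qed
  have fl: "filterlim (\<lambda>\<theta>. r + \<sigma> * \<theta>) (at r) (at_right 0)"
    unfolding filterlim_at using \<sigma>(1)
    by (auto intro!: tendsto_eq_intros simp: eventually_at_right_field intro: exI[of _ 1])
  have "((\<lambda>s. (\<gamma> j s \<bullet> u - \<gamma> j r \<bullet> u) / (s - r)) \<longlongrightarrow> vderiv (\<gamma> j) r \<bullet> u) (at r)"
    using gamma_inner_deriv(1)[OF j] by (simp add: has_field_derivative_iff)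
  from filterlim_compose[OF this fl] have l1:
    "((\<lambda>\<theta>. (\<gamma> j (r + \<sigma> * \<theta>) \<bullet> u - \<gamma> j r \<bullet> u) / (\<sigma> * \<theta>) * \<sigma>) \<longlongrightarrow> vderiv (\<gamma> j) r \<bullet> u * \<sigma>) (at_right 0)"
    by (intro tendsto_mult tendsto_const) simp
  from filterlim_compose[OF height_rate fl] have l2:
    "((\<lambda>\<theta>. (\<gamma> j (r + \<sigma> * \<theta>) \<bullet> n - \<gamma> j r \<bullet> n) / (\<sigma> * \<theta>)\<^sup>2 * \<sigma>\<^sup>2) \<longlongrightarrow> - curv / 2 * \<sigma>\<^sup>2) (at_right 0)"
    by (intro tendsto_mult tendsto_const) simp
  have l3: "((\<lambda>\<theta>. sin \<theta> / \<theta>) \<longlongrightarrow> 1) (at_right (0::real))"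
    using DERIV_sin[of "0::real"] by (auto simp: has_field_derivative_iff intro: tendsto_mono[OF at_le])
  have l4: "((\<lambda>\<theta>. cos \<theta>) \<longlongrightarrow> 1) (at_right (0::real))" by (auto intro!: tendsto_eq_intros)
  have "((\<lambda>\<theta>. - (sin \<theta> / \<theta>) * ((\<gamma> j (r + \<sigma> * \<theta>) \<bullet> u - \<gamma> j r \<bullet> u) / (\<sigma> * \<theta>) * \<sigma>) +
      cos \<theta> * ((\<gamma> j (r + \<sigma> * \<theta>) \<bullet> n - \<gamma> j r \<bullet> n) / (\<sigma> * \<theta>)\<^sup>2 * \<sigma>\<^sup>2))
      \<longlongrightarrow> - 1 * (vderiv (\<gamma> j) r \<bullet> u * \<sigma>) + 1 * (- curv / 2 * \<sigma>\<^sup>2)) (at_right 0)"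
    by (intro tendsto_intros l1 l2 l3 l4)
  moreover have "- 1 * (vderiv (\<gamma> j) r \<bullet> u * \<sigma>) + 1 * (- curv / 2 * \<sigma>\<^sup>2) = 1 / (2 * curv)"
    unfolding \<sigma>(2,3) using curv_pos by (simp add: power2_eq_square field_simps)
  ultimately have "\<forall>\<^sub>F \<theta> in at_right 0. a < - (sin \<theta> / \<theta>) * ((\<gamma> j (r + \<sigma> * \<theta>) \<bullet> u - \<gamma> j r \<bullet> u) / (\<sigma> * \<theta>) * \<sigma>) +
      cos \<theta> * ((\<gamma> j (r + \<sigma> * \<theta>) \<bullet> n - \<gamma> j r \<bullet> n) / (\<sigma> * \<theta>)\<^sup>2 * \<sigma>\<^sup>2)"
    using a by (intro order_tendstoD(1)) auto
  moreover have "\<forall>\<^sub>F \<theta> in at_right (0::real). 0 < \<theta>" by (simp add: eventually_at_right_less)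
  ultimately show "\<forall>\<^sub>F \<theta> in at_right 0. a < (supp (Ob j) (perp \<theta>) - \<gamma> j r \<bullet> perp \<theta>) / \<theta>\<^sup>2"
  proof eventually_elim
    case (elim \<theta>)
    let ?s = "r + \<sigma> * \<theta>"
    have "\<gamma> j ?s \<bullet> perp \<theta> \<le> supp (Ob j) (perp \<theta>)"
      using gamma_frontier[OF j] by (intro supp_upper_closure bounded_Ob j) (simp add: frontier_def)
    then have "(\<gamma> j ?s \<bullet> perp \<theta> - \<gamma> j r \<bullet> perp \<theta>) / \<theta>\<^sup>2 \<le> (supp (Ob j) (perp \<theta>) - \<gamma> j r \<bullet> perp \<theta>) / \<theta>\<^sup>2"
      by (intro divide_right_mono) auto
    moreover have "(\<gamma> j ?s \<bullet> perp \<theta> - \<gamma> j r \<bullet> perp \<theta>) / \<theta>\<^sup>2 =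
       - (sin \<theta> / \<theta>) * ((\<gamma> j ?s \<bullet> u - \<gamma> j r \<bullet> u) / (\<sigma> * \<theta>) * \<sigma>) +
      cos \<theta> * ((\<gamma> j ?s \<bullet> n - \<gamma> j r \<bullet> n) / (\<sigma> * \<theta>)\<^sup>2 * \<sigma>\<^sup>2)"
    proof -
      have "\<gamma> j ?s \<bullet> perp \<theta> - \<gamma> j r \<bullet> perp \<theta> =
        - sin \<theta> * (\<gamma> j ?s \<bullet> u - \<gamma> j r \<bullet> u) + cos \<theta> * (\<gamma> j ?s \<bullet> n - \<gamma> j r \<bullet> n)"
        by (simp add: perp_dir_def inner_add_right algebra_simps)
      moreover have "(- A * P + B * Q) / \<theta>\<^sup>2 = - (A / \<theta>) * (P / (\<sigma> * \<theta>) * \<sigma>) + B * (Q / (\<sigma> * \<theta>)\<^sup>2 * \<sigma>\<^sup>2)" for A B P Q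
        using elim \<sigma>(1) by (simp add: field_simps power2_eq_square)
      ultimately show ?thesis by metis
    qed
    ultimately show ?case using elim by linarith
  qed
qed

end

end

lemma dir_minus: "dir (- u) (- n) \<theta> = - dir u n \<theta>"
  by (simp add: dir_def)

lemma perp_dir_minus: "perp_dir (- u) (- n) \<theta> = - perp_dir u n \<theta>"
  by (simp add: perp_dir_def)

lemma perp_dir_zero [simp]: "perp_dir u n 0 = n"
  by (simp add: perp_dir_def)

text \<open>With f the fractional part of c / s, the terms closest to 0 are f s and (f - 1) s; when
  f = 0 the term 0 itself is excluded and the distance is s.\<close>

lemma arith_progression_discrete:
  assumes "s > 0"
  shows "\<exists>\<eta>>0. \<forall>k::int. c + of_int k * s \<noteq> 0 \<longrightarrow> \<eta> \<le> \<bar>c + of_int k * (s::real)\<bar>"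
proof -
  define f where "f = c / s - of_int \<lfloor>c / s\<rfloor>"
  have f: "0 \<le> f" "f < 1" unfolding f_def by linarith+
  have eq: "c + of_int k * s = s * (f + of_int (\<lfloor>c / s\<rfloor> + k))" for k
    using assms by (simp add: f_def field_simps)
  define \<eta> where "\<eta> = s * (if f = 0 then 1 else min f (1 - f))"
  have "\<eta> > 0" using f assms by (auto simp: \<eta>_def)
  moreover have "\<eta> \<le> \<bar>c + of_int k * s\<bar>" if "c + of_int k * s \<noteq> 0" for k
  proof -
    define i where "i = \<lfloor>c / s\<rfloor> + k"
    have ne: "f + of_int i \<noteq> 0" using that eq[of k] by (auto simp: i_def)
    have "(if f = 0 then 1 else min f (1 - f)) \<le> \<bar>f + of_int i\<bar>"
    proof (cases "i \<ge> 0")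
      case True
      then have "real_of_int i \<ge> 0" by simp
      moreover have "f = 0 \<longrightarrow> real_of_int i \<ge> 1"
        using ne True by (metis add_0 int_one_le_iff_zero_less le_less of_int_0 of_int_1_le_iff)
      ultimately show ?thesis using f by auto
    next
      case False
      then have "real_of_int i \<le> - 1" by linarith
      then show ?thesis using f by auto
    qed
    then show ?thesis unfolding eq[of k] \<eta>_def i_def[symmetric] using assms
      by (simp add: abs_mult)
  qed
  ultimately show ?thesis by blast
qed

text \<open>The means by which a threshold found for each shape of obstacle becomes one threshold
  for all.\<close>

lemma uniform_gap_finite:
  assumes "finite V" "\<And>x. x \<in> V \<Longrightarrow> \<exists>\<eta>>0. P x (\<eta>::real)"
    and mono: "\<And>x \<eta> \<eta>'. P x \<eta> \<Longrightarrow> 0 < \<eta>' \<Longrightarrow> \<eta>' \<le> \<eta> \<Longrightarrow> P x \<eta>'"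
  shows "\<exists>\<eta>>0. \<forall>x\<in>V. P x \<eta>"
  using assms(1,2)
proof (induction V rule: finite_induct)
  case empty then show ?case by (auto intro: exI[of _ 1])
next
  case (insert x V)
  then obtain \<eta> \<eta>' where "\<eta> > 0" "P x \<eta>" "\<eta>' > 0" "\<forall>x\<in>V. P x \<eta>'" by blast
  then have "P x (min \<eta> \<eta>')" "\<forall>x\<in>V. P x (min \<eta> \<eta>')"
    using mono[of x \<eta> "min \<eta> \<eta>'"] mono[of _ \<eta>' "min \<eta> \<eta>'"] by auto
  then show ?case using \<open>\<eta> > 0\<close> \<open>\<eta>' > 0\<close> by (intro exI[of _ "min \<eta> \<eta>'"]) auto
qed

lemma int_translate:
  assumes "(W::real) > 0" obtains m :: int where "c < x + of_int m * W" "x + of_int m * W \<le> c + W"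
proof -
  define m where "m = \<lfloor>(c - x) / W\<rfloor> + 1"
  have "of_int (m - 1) * W \<le> c - x" "c - x < (of_int (m - 1) + 1) * W"
    using assms floor_divide_lower[of W "c - x"] floor_divide_upper[of W "c - x"] by (auto simp: m_def)
  then show ?thesis by (intro that[of m]) (auto simp: algebra_simps)
qed

lemma abs_inner_unit: "norm z = 1 \<Longrightarrow> \<bar>x \<bullet> z\<bar> \<le> norm x"
  using Cauchy_Schwarz_ineq2[of x z] by simp

lemma cos_ge_half: "0 \<le> (\<theta>::real) \<Longrightarrow> \<theta> \<le> 1 \<Longrightarrow> 1/2 \<le> cos \<theta>"
  using cos_monotone_0_pi_le[of \<theta> "pi/3"] pi_gt3 by (simp add: cos_60)

lemma sin_bounds: "0 < (\<theta>::real) \<Longrightarrow> \<theta> \<le> 1 \<Longrightarrow> 0 < sin \<theta> \<and> sin \<theta> \<le> \<theta>"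
  using pi_gt3 sin_x_le_x[of \<theta>] by (auto intro: sin_gt_zero)

subsection \<open>Long free flights\<close>

text \<open>\<open>n\<close> may be either of the two unit normals to w. One choice covers the
  flights whose direction lies on one side of w, the opposite choice covers those on the other
  side.\<close>

locale frame = billiard_table J Ob \<gamma> len
  for J :: "'j set" and Ob \<gamma> len +
  fixes w :: "int ^ 2" and n :: "real ^ 2"
  assumes w_nonzero: "lat w \<noteq> 0" and norm_n: "norm n = 1" and w_orth: "lat w \<bullet> n = 0"
begin

text \<open>A half-turn of the frame. It exchanges tops and bottoms and reverses the direction of
  flight, so each statement about starts and tops yields one about ends and bottoms.\<close>

lemma flip_frame: "frame J Ob \<gamma> len (- w) (- n)"
proof (intro frame.intro frame_axioms.intro)
  show "billiard_table J Ob \<gamma> len" by (rule billiard_table_axioms)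
  show "lat (- w) \<noteq> 0" "norm (- n) = 1" "lat (- w) \<bullet> - n = 0"
    using w_nonzero norm_n w_orth by (simp_all add: lat_minus)
qed

abbreviation u :: "real ^ 2" where "u \<equiv> sgn (lat w)"
abbreviation W :: real where "W \<equiv> norm (lat w)"
abbreviation v :: "real \<Rightarrow> real ^ 2" where "v \<equiv> dir u n"
abbreviation p' :: "real \<Rightarrow> real ^ 2" where "p' \<equiv> perp_dir u n"
abbreviation top :: "'j \<times> (int ^ 2) \<Rightarrow> real ^ 2" where "top a \<equiv> top0 n (fst a) + lat (snd a)"
abbreviation bot :: "'j \<times> (int ^ 2) \<Rightarrow> real ^ 2" where "bot a \<equiv> top0 (- n) (fst a) + lat (snd a)"
text \<open>\<open>G a \<theta>\<close> and \<open>H a \<theta>\<close> are the ends of the shadow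
  of the obstacle along direction \<open>v \<theta>\<close>: the lines of that direction that meet
  the open obstacle are those with offset strictly between them.\<close>

abbreviation H :: "'j \<times> (int ^ 2) \<Rightarrow> real \<Rightarrow> real" where "H a \<theta> \<equiv> supp (obs a) (p' \<theta>)"
abbreviation G :: "'j \<times> (int ^ 2) \<Rightarrow> real \<Rightarrow> real" where "G a \<theta> \<equiv> - supp (obs a) (- p' \<theta>)"
abbreviation shift :: "'j \<times> (int ^ 2) \<Rightarrow> int \<Rightarrow> 'j \<times> (int ^ 2)" where "shift a m \<equiv> (fst a, snd a + m *s w)"

lemma W_pos: "W > 0" using w_nonzero by simp
lemma lat_w: "lat w = W *\<^sub>R u" using w_nonzero by (simp add: sgn_div_norm)
lemma norm_u: "norm u = 1" using w_nonzero by (simp add: norm_sgn)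
lemma u_n: "u \<bullet> n = 0" using w_orth by (simp add: sgn_div_norm)
lemma inner_un [simp]: "u \<bullet> u = 1" "n \<bullet> n = 1" "u \<bullet> n = 0" "n \<bullet> u = 0"
  using norm_u norm_n u_n by (simp_all add: norm_eq_1 inner_commute)
lemma lat_w_inner: "lat w \<bullet> u = W" "lat w \<bullet> n = 0" "lat w \<bullet> p' \<theta> = - W * sin \<theta>"
proof -
  have *: "lat w \<bullet> x = W * (u \<bullet> x)" for x
    using arg_cong[OF lat_w, of "\<lambda>y. y \<bullet> x"] by (simp only: inner_scaleR_left)
  show "lat w \<bullet> u = W" "lat w \<bullet> n = 0" "lat w \<bullet> p' \<theta> = - W * sin \<theta>"
    unfolding * by (simp_all add: perp_dir_def inner_diff_right)
qed

lemmas norm_v = dir_perp_orthonormal(1)[OF norm_u norm_n u_n]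
lemmas norm_p' = dir_perp_orthonormal(2)[OF norm_u norm_n u_n]
lemmas v_p' = dir_perp_orthonormal(3)[OF norm_u norm_n u_n]
lemmas decomp_un = orthonormal2_decomp[OF norm_u norm_n u_n]

lemma inner_p': "x \<bullet> p' \<theta> = - sin \<theta> * (x \<bullet> u) + cos \<theta> * (x \<bullet> n)"
  by (simp add: perp_dir_def inner_diff_right)

lemma v_inner: "v \<theta> \<bullet> u = cos \<theta>" "v \<theta> \<bullet> n = sin \<theta>" "v \<theta> \<bullet> p' \<theta> = 0"
  by (simp_all add: dir_def inner_add_left perp_dir_def inner_diff_right)

lemma on_line:
  assumes "y \<bullet> p' \<theta> = q \<bullet> p' \<theta>"
  shows "y = q + ((y - q) \<bullet> v \<theta>) *\<^sub>R v \<theta>" "(y - q) \<bullet> u = ((y - q) \<bullet> v \<theta>) * cos \<theta>"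
    "(y - q) \<bullet> n = ((y - q) \<bullet> v \<theta>) * sin \<theta>"
proof -
  have d: "y - q = ((y - q) \<bullet> v \<theta>) *\<^sub>R v \<theta> + ((y - q) \<bullet> p' \<theta>) *\<^sub>R p' \<theta>"
    by (rule orthonormal2_decomp[OF norm_v norm_p' v_p'])
  have z: "(y - q) \<bullet> p' \<theta> = 0" using assms by (simp add: inner_diff_left)
  have e: "y - q = ((y - q) \<bullet> v \<theta>) *\<^sub>R v \<theta>" using d by (simp only: z scaleR_zero_left add_0_right)
  show "y = q + ((y - q) \<bullet> v \<theta>) *\<^sub>R v \<theta>" using e by (metis add.commute diff_add_cancel)
  show "(y - q) \<bullet> u = ((y - q) \<bullet> v \<theta>) * cos \<theta>" "(y - q) \<bullet> n = ((y - q) \<bullet> v \<theta>) * sin \<theta>"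
    using arg_cong[OF e, of "\<lambda>x. x \<bullet> u"] arg_cong[OF e, of "\<lambda>x. x \<bullet> n"] by (simp_all only: inner_scaleR_left v_inner)
qed

lemma top_closure: "a \<in> idx \<Longrightarrow> top a \<in> closure (obs a)"
  and top_max: "a \<in> idx \<Longrightarrow> y \<in> closure (obs a) \<Longrightarrow> y \<bullet> n \<le> top a \<bullet> n"
  and top_unique: "a \<in> idx \<Longrightarrow> y \<in> closure (obs a) \<Longrightarrow> y \<bullet> n = top a \<bullet> n \<Longrightarrow> y = top a"
proof -
  assume a: "a \<in> idx"
  note j = idx_fst[OF a]
  show "top a \<in> closure (obs a)" using top0(1)[OF j] by (simp add: mem_closure_obstacle_iff)
  assume y: "y \<in> closure (obs a)"
  then have y': "y - lat (snd a) \<in> closure (Ob (fst a))" by (simp add: mem_closure_obstacle_iff)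
  show "y \<bullet> n \<le> top a \<bullet> n" using top0(2)[OF j y', of n] by (simp add: inner_add_left inner_diff_left)
  assume "y \<bullet> n = top a \<bullet> n"
  then have "y - lat (snd a) = top0 n (fst a)"
    using y' by (intro top0_unique[OF j norm_n]) (auto simp: inner_add_left inner_diff_left)
  then show "y = top a" by (simp add: algebra_simps)
qed

lemma top_frontier: "a \<in> idx \<Longrightarrow> top a \<in> frontier (obs a)"
  using maximal_in_frontier[OF idx_fst norm_n top0] by (auto simp: mem_frontier_obstacle_iff idx_fst)

lemma bot_closure: "a \<in> idx \<Longrightarrow> bot a \<in> closure (obs a)"
  and bot_min: "a \<in> idx \<Longrightarrow> y \<in> closure (obs a) \<Longrightarrow> bot a \<bullet> n \<le> y \<bullet> n"
  and bot_unique: "a \<in> idx \<Longrightarrow> y \<in> closure (obs a) \<Longrightarrow> y \<bullet> n = bot a \<bullet> n \<Longrightarrow> y = bot a"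
  and bot_frontier: "a \<in> idx \<Longrightarrow> bot a \<in> frontier (obs a)"
  using frame.top_closure[OF flip_frame] frame.top_max[OF flip_frame] frame.top_unique[OF flip_frame]
    frame.top_frontier[OF flip_frame] by auto

lemma H_upper: "a \<in> idx \<Longrightarrow> y \<in> closure (obs a) \<Longrightarrow> y \<bullet> p' \<theta> \<le> H a \<theta>"
  by (rule supp_upper_closure[OF bounded_obs])

lemma G_lower: "a \<in> idx \<Longrightarrow> y \<in> closure (obs a) \<Longrightarrow> G a \<theta> \<le> y \<bullet> p' \<theta>"
  using supp_upper_closure[OF bounded_obs, of a y "- p' \<theta>"] by simp

lemma supp_obs: "a \<in> idx \<Longrightarrow> supp (obs a) x = supp (Ob (fst a)) x + lat (snd a) \<bullet> x"
  using supp_translation[OF Ob_nonempty bounded_Ob, of "fst a"] idx_fst by (simp add: obstacle_def)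

lemma H_shift: "a \<in> idx \<Longrightarrow> H (shift a m) \<theta> = H a \<theta> - of_int m * W * sin \<theta>"
  and G_shift: "a \<in> idx \<Longrightarrow> G (shift a m) \<theta> = G a \<theta> - of_int m * W * sin \<theta>"
  using supp_obs[of a] supp_obs[of "shift a m"] by (simp_all add: mem_idx_iff lat_add lat_scale inner_add_left lat_w_inner)

lemma shift_idx: "a \<in> idx \<Longrightarrow> shift a m \<in> idx" by (simp add: mem_idx_iff)

lemma shift_top: "top (shift a m) \<bullet> n = top a \<bullet> n" "top (shift a m) \<bullet> u = top a \<bullet> u + of_int m * W"
  "bot (shift a m) \<bullet> n = bot a \<bullet> n" "bot (shift a m) \<bullet> u = bot a \<bullet> u + of_int m * W"
  by (simp_all add: lat_add lat_scale inner_add_left lat_w_inner)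

lemma meets:
  assumes "a \<in> idx" "y \<in> closure (obs a)" "y \<bullet> p' \<theta> < p" "p < H a \<theta>"
  obtains x where "x \<in> obs a" "x \<bullet> p' \<theta> = p"
  using open_convex_meets_level[OF convex_obs bounded_obs] assms by metis

lemma thickness: "\<exists>d>0. \<forall>a\<in>idx. bot a \<bullet> n + d \<le> top a \<bullet> n"
proof -
  have "\<exists>d>0. \<forall>j\<in>J. top0 (- n) j \<bullet> n + d \<le> top0 n j \<bullet> n"
  proof (rule uniform_gap_finite[OF finite_J])
    fix j assume j: "j \<in> J"
    obtain y where y: "y \<in> Ob j" using Ob_nonempty[OF j] by blast
    then obtain e where e: "e > 0" "ball y e \<subseteq> Ob j" using open_convex[OF j] open_contains_ball by blast
    have "y + (e/2) *\<^sub>R n \<in> closure (Ob j)" "y - (e/2) *\<^sub>R n \<in> closure (Ob j)"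
      using e norm_n by (auto intro!: closure_subset[THEN subsetD] e(2)[THEN subsetD] simp: dist_norm)
    from top0(2)[OF j this(1), of n] top0(2)[OF j this(2), of "- n"]
    show "\<exists>d>0. top0 (- n) j \<bullet> n + d \<le> top0 n j \<bullet> n"
      using e by (intro exI[of _ e]) (simp add: inner_add_left inner_diff_left)
  qed auto
  then show ?thesis by (auto simp: mem_idx_iff inner_add_left)
qed

text \<open>The height of a lattice point z is a determinant of the integer vectors z and w, divided
  by |w|. Tops and bottoms therefore have heights in finitely many arithmetic progressions of step 1
  / |w|, and so do the differences of two of them.\<close>

lemma heights_discrete:
  "\<exists>\<eta>>0. \<forall>a\<in>idx. \<forall>c\<in>idx. \<forall>x\<in>{top a \<bullet> n, bot a \<bullet> n}. \<forall>y\<in>{top c \<bullet> n, bot c \<bullet> n}. x < y \<longrightarrow> x + \<eta> \<le> y"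
proof -
  have unit: "\<exists>k::int. lat z \<bullet> n = of_int k * (1 / W)" for z
  proof -
    have "n = rot u \<or> n = - rot u"
      using norm_u norm_n u_n by (intro orth_unit_cases[of u "rot u"]) (auto simp: inner_commute)
    moreover have "rot u = (1 / W) *\<^sub>R rot (lat w)"
      by (simp add: vec_eq_iff forall_2 sgn_div_norm divide_inverse mult.commute)
    moreover have "lat z \<bullet> rot (lat w) = of_int (z $ 2 * w $ 1 - z $ 1 * w $ 2)"
      by (simp add: lat_def inner_vec_def sum_2)
    then have "lat z \<bullet> rot u = of_int (z $ 2 * w $ 1 - z $ 1 * w $ 2) * (1 / W)"
      using \<open>rot u = (1 / W) *\<^sub>R rot (lat w)\<close> by (simp only: inner_scaleR_right mult.commute)
    ultimately have "lat z \<bullet> n = of_int (z $ 2 * w $ 1 - z $ 1 * w $ 2) * (1 / W) \<or>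
       lat z \<bullet> n = of_int (- (z $ 2 * w $ 1 - z $ 1 * w $ 2)) * (1 / W)"
      by (metis inner_minus_right mult_minus_left of_int_minus)
    then show ?thesis by blast
  qed
  define V where "V = (\<lambda>j. top0 n j \<bullet> n) ` J \<union> (\<lambda>j. top0 (- n) j \<bullet> n) ` J"
  have "finite (V \<times> V)" using finite_J by (simp add: V_def)
  then have "\<exists>\<eta>>0. \<forall>x\<in>V \<times> V. \<forall>k::int. (fst x - snd x) + of_int k * (1 / W) \<noteq> 0 \<longrightarrow> \<eta> \<le> \<bar>(fst x - snd x) + of_int k * (1 / W)\<bar>"
  proof (rule uniform_gap_finite)
    show "\<exists>\<eta>>0. \<forall>k::int. (fst x - snd x) + of_int k * (1 / W) \<noteq> 0 \<longrightarrow> \<eta> \<le> \<bar>(fst x - snd x) + of_int k * (1 / W)\<bar>" for x :: "real \<times> real"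
      using W_pos by (intro arith_progression_discrete) simp
  qed force
  then obtain \<eta> where \<eta>: "\<eta> > 0" "\<And>x y k. x \<in> V \<Longrightarrow> y \<in> V \<Longrightarrow> (x - y) + of_int k * (1 / W) \<noteq> 0 \<Longrightarrow> \<eta> \<le> \<bar>(x - y) + of_int k * (1 / W)\<bar>"
    by force
  show ?thesis
  proof (intro exI[of _ \<eta>] conjI ballI impI)
    fix a c x y assume a: "a \<in> idx" "c \<in> idx" "x \<in> {top a \<bullet> n, bot a \<bullet> n}" "y \<in> {top c \<bullet> n, bot c \<bullet> n}" "x < y"
    obtain k where k: "lat (snd a) \<bullet> n = of_int k * (1 / W)" using unit by blast
    obtain m where m: "lat (snd c) \<bullet> n = of_int m * (1 / W)" using unit by blast
    obtain x0 where x0: "x0 \<in> V" "x = x0 + of_int k * (1 / W)"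
      using a idx_fst[OF a(1)] k by (auto simp: V_def inner_add_left)
    obtain y0 where y0: "y0 \<in> V" "y = y0 + of_int m * (1 / W)"
      using a idx_fst[OF a(2)] m by (auto simp: V_def inner_add_left)
    have "y - x = (y0 - x0) + of_int (m - k) * (1 / W)" using x0 y0 by (simp add: algebra_simps diff_divide_distrib)
    then show "x + \<eta> \<le> y" using \<eta>(2)[OF y0(1) x0(1), of "m - k"] a(5) by auto
  qed (rule \<eta>)
qed

text \<open>The cap of an obstacle cut off near its top is small, uniformly over the obstacles.\<close>

lemma small_cap:
  assumes "\<epsilon> > 0"
  shows "\<exists>\<delta>>0. \<forall>a\<in>idx. \<forall>y\<in>closure (obs a). \<forall>\<theta>. 0 \<le> \<theta> \<and> \<theta> \<le> \<delta> \<and> - \<delta> \<le> (y - top a) \<bullet> p' \<theta> \<longrightarrow> dist y (top a) < \<epsilon>"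
proof -
  have "\<exists>\<delta>>0. \<forall>j\<in>J. \<forall>y\<in>closure (Ob j). top0 n j \<bullet> n - \<delta> \<le> y \<bullet> n \<longrightarrow> dist y (top0 n j) < \<epsilon>"
  proof (rule uniform_gap_finite[OF finite_J])
    fix j assume j: "j \<in> J"
    define C where "C = closure (Ob j) - ball (top0 n j) \<epsilon>"
    have C: "compact C" unfolding C_def by (intro compact_diff compact_closure_Ob j) simp
    show "\<exists>\<delta>>0. \<forall>y\<in>closure (Ob j). top0 n j \<bullet> n - \<delta> \<le> y \<bullet> n \<longrightarrow> dist y (top0 n j) < \<epsilon>"
    proof (cases "C = {}")
      case True
      then show ?thesis by (intro exI[of _ 1]) (auto simp: C_def dist_commute)
    next
      case False
      obtain y0 where y0: "y0 \<in> C" "\<forall>y\<in>C. y \<bullet> n \<le> y0 \<bullet> n"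
        using continuous_attains_sup[OF C False continuous_on_inner[OF continuous_on_id continuous_on_const], of n] by auto
      have "y0 \<noteq> top0 n j" "y0 \<in> closure (Ob j)" using y0(1) assms by (auto simp: C_def)
      then have lt: "y0 \<bullet> n < top0 n j \<bullet> n"
        using top0(2)[OF j, of y0 n] top0_unique[OF j norm_n, of y0] by force
      show ?thesis
      proof (intro exI[of _ "(top0 n j \<bullet> n - y0 \<bullet> n) / 2"] conjI ballI impI)
        fix y assume y: "y \<in> closure (Ob j)" "top0 n j \<bullet> n - (top0 n j \<bullet> n - y0 \<bullet> n) / 2 \<le> y \<bullet> n"
        show "dist y (top0 n j) < \<epsilon>"
        proof (rule ccontr)
          assume "\<not> dist y (top0 n j) < \<epsilon>"
          then have "y \<in> C" using y by (simp add: C_def dist_commute)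
          then have "y \<bullet> n \<le> y0 \<bullet> n" using y0 by blast
          then show False using y(2) lt by (simp add: field_simps)
        qed
      qed (use lt in simp)
    qed
  qed auto
  then obtain \<delta> where \<delta>: "\<delta> > 0" "\<And>j y. j \<in> J \<Longrightarrow> y \<in> closure (Ob j) \<Longrightarrow> top0 n j \<bullet> n - \<delta> \<le> y \<bullet> n \<Longrightarrow> dist y (top0 n j) < \<epsilon>"
    by blast
  obtain D where D: "D > 0" "\<And>j. j \<in> J \<Longrightarrow> closure (Ob j) \<subseteq> ball 0 D" using diameter_bound by blast
  \<comment> \<open>Tilting changes the offset by at most \<delta>' times 2 D, and cos \<theta> is
    at least 1/2. The height deficit is therefore at most 2 \<delta>' (1 + 2 D), which the choice
    keeps below \<delta>.\<close>
  define \<delta>' where "\<delta>' = min 1 (\<delta> / (2 * (1 + 2 * D)))"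
  have \<delta>': "\<delta>' > 0" "\<delta>' \<le> 1" "2 * (\<delta>' * (1 + 2 * D)) \<le> \<delta>"
  proof -
    show "\<delta>' > 0" "\<delta>' \<le> 1" using \<delta>(1) D(1) by (auto simp: \<delta>'_def)
    have "\<delta>' \<le> \<delta> / (2 * (1 + 2 * D))" by (simp add: \<delta>'_def)
    then show "2 * (\<delta>' * (1 + 2 * D)) \<le> \<delta>" using D(1) by (simp add: pos_le_divide_eq algebra_simps)
  qed
  show ?thesis
  proof (intro exI[of _ \<delta>'] conjI ballI allI impI)
    fix a y \<theta> assume a: "a \<in> idx" and y: "y \<in> closure (obs a)"
      and \<theta>: "0 \<le> \<theta> \<and> \<theta> \<le> \<delta>' \<and> - \<delta>' \<le> (y - top a) \<bullet> p' \<theta>"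
    note j = idx_fst[OF a]
    define x where "x = y - lat (snd a)"
    have x: "x \<in> closure (Ob (fst a))" using y by (simp add: x_def mem_closure_obstacle_iff)
    have yx: "y - top a = x - top0 n (fst a)" by (simp add: x_def)
    have "norm x < D" "norm (top0 n (fst a)) < D" using D(2)[OF j] x top0(1)[OF j] by (auto simp: subset_iff)
    then have "norm (x - top0 n (fst a)) \<le> 2 * D" by norm
    then have nu: "\<bar>(x - top0 n (fst a)) \<bullet> u\<bar> \<le> 2 * D"
      using Cauchy_Schwarz_ineq2[of "x - top0 n (fst a)" u] norm_u by simp
    have le: "(x - top0 n (fst a)) \<bullet> n \<le> 0" using top0(2)[OF j x, of n] by (simp add: inner_diff_left)
    have c: "1/2 \<le> cos \<theta>"
    proof -
      have "cos (pi/3) \<le> cos \<theta>" using \<theta> \<delta>'(2) pi_gt3 by (intro cos_monotone_0_pi_le) auto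
      then show ?thesis by (simp add: cos_60)
    qed
    have s: "0 \<le> sin \<theta>" "sin \<theta> \<le> \<delta>'" using \<theta> \<delta>'(2) pi_gt3 sin_x_le_x[of \<theta>] by (auto intro: sin_ge_zero)
    have "- sin \<theta> * ((x - top0 n (fst a)) \<bullet> u) \<le> sin \<theta> * (2 * D)"
      using nu s(1) by (metis abs_le_D2 mult_left_mono mult_minus_left mult_minus_right)
    also have "\<dots> \<le> \<delta>' * (2 * D)" using s D(1) by (intro mult_right_mono) auto
    finally have 1: "- sin \<theta> * ((x - top0 n (fst a)) \<bullet> u) \<le> \<delta>' * (2 * D)" .
    have 2: "cos \<theta> * ((x - top0 n (fst a)) \<bullet> n) \<le> 1/2 * ((x - top0 n (fst a)) \<bullet> n)"
      using c le by (intro mult_right_mono_neg)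
    have "- \<delta>' \<le> - sin \<theta> * ((x - top0 n (fst a)) \<bullet> u) + cos \<theta> * ((x - top0 n (fst a)) \<bullet> n)"
      using \<theta> unfolding yx inner_p' by simp
    then have "- \<delta> \<le> (x - top0 n (fst a)) \<bullet> n" using 1 2 \<delta>'(3) by (simp add: algebra_simps)
    then have "dist x (top0 n (fst a)) < \<epsilon>" by (intro \<delta>(2)[OF j x]) (simp add: inner_diff_left)
    then show "dist y (top a) < \<epsilon>" unfolding dist_norm yx by simp
  qed (rule \<delta>')
qed

text \<open>An offset slightly below that of the top and below the end of the shadow lies between
  the offsets of the bottom and of the support point, so the line meets the obstacle, and only in
  the small cap.\<close>

lemma meets_near_top:
  assumes "\<epsilon> > 0"
  shows "\<exists>\<delta>>0. \<forall>a\<in>idx. \<forall>\<theta> p. 0 \<le> \<theta> \<and> \<theta> \<le> \<delta> \<and> top a \<bullet> p' \<theta> - \<delta> \<le> p \<and> p < H a \<theta> \<longrightarrow>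
    (\<exists>y\<in>obs a. y \<bullet> p' \<theta> = p \<and> dist y (top a) < \<epsilon>)"
proof -
  obtain \<delta> where \<delta>: "\<delta> > 0" "\<And>a y \<theta>. a \<in> idx \<Longrightarrow> y \<in> closure (obs a) \<Longrightarrow> 0 \<le> \<theta> \<Longrightarrow> \<theta> \<le> \<delta> \<Longrightarrow> - \<delta> \<le> (y - top a) \<bullet> p' \<theta> \<Longrightarrow> dist y (top a) < \<epsilon>"
    using small_cap[OF assms] by meson
  obtain d where d: "d > 0" "\<And>a. a \<in> idx \<Longrightarrow> bot a \<bullet> n + d \<le> top a \<bullet> n" using thickness by blast
  \<comment> \<open>A cap of radius \<open>d\<close>, the minimal thickness, cannot contain the
    bottom; this puts the bottom strictly below the level \<open>p\<close>.\<close>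
  obtain \<delta>2 where \<delta>2: "\<delta>2 > 0" "\<And>a y \<theta>. a \<in> idx \<Longrightarrow> y \<in> closure (obs a) \<Longrightarrow> 0 \<le> \<theta> \<Longrightarrow> \<theta> \<le> \<delta>2 \<Longrightarrow> - \<delta>2 \<le> (y - top a) \<bullet> p' \<theta> \<Longrightarrow> dist y (top a) < d"
    using small_cap[OF d(1)] by meson
  show ?thesis
  proof (intro exI[of _ "min (\<delta> / 2) (\<delta>2 / 2)"] conjI ballI allI impI)
    fix a \<theta> p assume a: "a \<in> idx" and H: "0 \<le> \<theta> \<and> \<theta> \<le> min (\<delta> / 2) (\<delta>2 / 2) \<and> top a \<bullet> p' \<theta> - min (\<delta> / 2) (\<delta>2 / 2) \<le> p \<and> p < H a \<theta>"
    have "bot a \<bullet> p' \<theta> < p"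
    proof (rule ccontr)
      assume "\<not> bot a \<bullet> p' \<theta> < p"
      then have "- \<delta>2 \<le> (bot a - top a) \<bullet> p' \<theta>"
        using H \<delta>2(1) unfolding inner_diff_left by linarith
      then have "dist (bot a) (top a) < d" using H \<delta>2(1) by (intro \<delta>2(2)[OF a bot_closure[OF a], of \<theta>]) auto
      moreover have "(top a - bot a) \<bullet> n \<le> norm (top a - bot a)"
        using norm_cauchy_schwarz[of "top a - bot a" n] norm_n by simp
      then have "top a \<bullet> n - bot a \<bullet> n \<le> dist (bot a) (top a)"
        unfolding dist_norm norm_minus_commute[of "bot a"] inner_diff_left .
      ultimately show False using d(2)[OF a] by linarith
    qed
    then obtain x where x: "x \<in> obs a" "x \<bullet> p' \<theta> = p" using meets[OF a bot_closure[OF a]] H by metis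
    have "dist x (top a) < \<epsilon>"
      using x H \<delta>(1) closure_subset by (intro \<delta>(2)[OF a, of _ \<theta>]) (auto simp: inner_diff_left)
    then show "\<exists>y\<in>obs a. y \<bullet> p' \<theta> = p \<and> dist y (top a) < \<epsilon>" using x by blast
  qed (use \<delta> \<delta>2 in auto)
qed

lemma small_cap_bot:
  assumes "\<epsilon> > 0"
  shows "\<exists>\<delta>>0. \<forall>a\<in>idx. \<forall>y\<in>closure (obs a). \<forall>\<theta>. 0 \<le> \<theta> \<and> \<theta> \<le> \<delta> \<and> (y - bot a) \<bullet> p' \<theta> \<le> \<delta> \<longrightarrow> dist y (bot a) < \<epsilon>"
  using frame.small_cap[OF flip_frame assms] by (simp add: lat_minus sgn_minus perp_dir_minus)

lemma meets_near_bot: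
  assumes "\<epsilon> > 0"
  shows "\<exists>\<delta>>0. \<forall>a\<in>idx. \<forall>\<theta> p. 0 \<le> \<theta> \<and> \<theta> \<le> \<delta> \<and> p \<le> bot a \<bullet> p' \<theta> + \<delta> \<and> G a \<theta> < p \<longrightarrow>
    (\<exists>y\<in>obs a. y \<bullet> p' \<theta> = p \<and> dist y (bot a) < \<epsilon>)"
proof -
  obtain \<delta> where \<delta>: "\<delta> > 0" "\<forall>a\<in>idx. \<forall>\<theta> p. 0 \<le> \<theta> \<and> \<theta> \<le> \<delta> \<and> bot a \<bullet> (- p' \<theta>) - \<delta> \<le> p \<and> p < supp (obs a) (- p' \<theta>) \<longrightarrow>
    (\<exists>y\<in>obs a. y \<bullet> (- p' \<theta>) = p \<and> dist y (bot a) < \<epsilon>)"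
    using frame.meets_near_top[OF flip_frame assms] by (auto simp: lat_minus sgn_minus perp_dir_minus)
  show ?thesis
  proof (intro exI[of _ \<delta>] conjI ballI allI impI)
    fix a \<theta> p assume "a \<in> idx" "0 \<le> \<theta> \<and> \<theta> \<le> \<delta> \<and> p \<le> bot a \<bullet> p' \<theta> + \<delta> \<and> G a \<theta> < p"
    then show "\<exists>y\<in>obs a. y \<bullet> p' \<theta> = p \<and> dist y (bot a) < \<epsilon>"
      using \<delta>(2)[rule_format, of a \<theta> "- p"] by simp
  qed (rule \<delta>)
qed

text \<open>Two balls in the obstacle, near its bottom and near its top, span balls of the same radius at all
  intermediate heights.\<close>

lemma hit:
  assumes "\<epsilon> > 0"
  shows "\<exists>\<delta>>0. \<forall>a\<in>idx. \<forall>\<theta> q. 0 \<le> \<theta> \<and> \<theta> \<le> \<delta> \<and> bot a \<bullet> n + \<epsilon> \<le> q \<bullet> n \<and> q \<bullet> n \<le> top a \<bullet> n - \<epsilon> \<longrightarrow>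
    (\<exists>m t. 0 < t \<and> t \<le> W \<and> q + t *\<^sub>R v \<theta> \<in> obs (shift a m))"
proof -
  have "\<exists>\<rho>>0. \<forall>j\<in>J. \<forall>h. top0 (- n) j \<bullet> n + \<epsilon> \<le> h \<and> h \<le> top0 n j \<bullet> n - \<epsilon> \<longrightarrow> (\<exists>z. z \<bullet> n = h \<and> ball z \<rho> \<subseteq> Ob j)"
  proof (rule uniform_gap_finite[OF finite_J])
    fix j assume j: "j \<in> J"
    have near: "\<exists>y\<in>Ob j. dist y x < \<epsilon>" if "x \<in> closure (Ob j)" for x
      using that assms by (simp add: closure_approachable)
    obtain y1 where y1: "y1 \<in> Ob j" "dist y1 (top0 (- n) j) < \<epsilon>" using near[OF top0(1)[OF j]] by blast
    obtain y2 where y2: "y2 \<in> Ob j" "dist y2 (top0 n j) < \<epsilon>" using near[OF top0(1)[OF j]] by blast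
    have h1: "y1 \<bullet> n < top0 (- n) j \<bullet> n + \<epsilon>"
      using norm_cauchy_schwarz[of "y1 - top0 (- n) j" n] y1(2) norm_n by (simp add: dist_norm inner_diff_left)
    have h2: "top0 n j \<bullet> n - \<epsilon> < y2 \<bullet> n"
      using norm_cauchy_schwarz[of "top0 n j - y2" n] y2(2) norm_n by (simp add: dist_norm inner_diff_left norm_minus_commute)
    obtain e1 e2 where e: "e1 > 0" "ball y1 e1 \<subseteq> Ob j" "e2 > 0" "ball y2 e2 \<subseteq> Ob j"
      using open_convex[OF j] y1(1) y2(1) open_contains_ball by metis
    show "\<exists>\<rho>>0. \<forall>h. top0 (- n) j \<bullet> n + \<epsilon> \<le> h \<and> h \<le> top0 n j \<bullet> n - \<epsilon> \<longrightarrow> (\<exists>z. z \<bullet> n = h \<and> ball z \<rho> \<subseteq> Ob j)"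
    proof (intro exI[of _ "min e1 e2"] conjI allI impI)
      fix h assume h: "top0 (- n) j \<bullet> n + \<epsilon> \<le> h \<and> h \<le> top0 n j \<bullet> n - \<epsilon>"
      define l where "l = (h - y1 \<bullet> n) / (y2 \<bullet> n - y1 \<bullet> n)"
      have l: "0 \<le> l" "l \<le> 1" using h h1 h2 by (auto simp: l_def)
      define z where "z = (1 - l) *\<^sub>R y1 + l *\<^sub>R y2"
      have "z \<bullet> n = y1 \<bullet> n + l * (y2 \<bullet> n - y1 \<bullet> n)" by (simp add: z_def inner_add_left algebra_simps)
      then have zn: "z \<bullet> n = h" using h h1 h2 by (simp add: l_def)
      have "x \<in> Ob j" if "x \<in> ball z (min e1 e2)" for x
      proof -
        have "y1 + (x - z) \<in> Ob j" "y2 + (x - z) \<in> Ob j"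
          using that e by (auto simp: dist_norm norm_minus_commute subset_iff)
        then have "(1 - l) *\<^sub>R (y1 + (x - z)) + l *\<^sub>R (y2 + (x - z)) \<in> Ob j"
          using open_convex[OF j] l by (intro convexD) auto
        also have "(1 - l) *\<^sub>R (y1 + (x - z)) + l *\<^sub>R (y2 + (x - z)) = z + (x - z)"
          by (simp add: z_def algebra_simps)
        finally show ?thesis by simp
      qed
      then show "\<exists>z. z \<bullet> n = h \<and> ball z (min e1 e2) \<subseteq> Ob j" using zn by blast
    qed (use e in auto)
  next
    fix j \<eta> \<eta>' assume "\<forall>h. top0 (- n) j \<bullet> n + \<epsilon> \<le> h \<and> h \<le> top0 n j \<bullet> n - \<epsilon> \<longrightarrow> (\<exists>z. z \<bullet> n = h \<and> ball z \<eta> \<subseteq> Ob j)" "\<eta>' \<le> \<eta>"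
    then show "\<forall>h. top0 (- n) j \<bullet> n + \<epsilon> \<le> h \<and> h \<le> top0 n j \<bullet> n - \<epsilon> \<longrightarrow> (\<exists>z. z \<bullet> n = h \<and> ball z \<eta>' \<subseteq> Ob j)"
      using subset_ball[of \<eta>' \<eta>] by blast
  qed
  then obtain \<rho> where \<rho>: "\<rho> > 0" "\<And>j h. j \<in> J \<Longrightarrow> top0 (- n) j \<bullet> n + \<epsilon> \<le> h \<Longrightarrow> h \<le> top0 n j \<bullet> n - \<epsilon> \<Longrightarrow> \<exists>z. z \<bullet> n = h \<and> ball z \<rho> \<subseteq> Ob j"
    by meson
  \<comment> \<open>Over a distance of one period, a nearly horizontal line departs from the
    horizontal by less than the radius of the inscribed balls.\<close>
  have vc: "((\<lambda>\<theta>. W * norm (v \<theta> - u)) \<longlongrightarrow> W * norm (v 0 - u)) (at 0)"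
    unfolding dir_def by (intro tendsto_intros)
  have "v 0 - u = 0" by (simp add: dir_def)
  then have "\<forall>\<^sub>F \<theta> in at 0. W * norm (v \<theta> - u) < \<rho>" using vc \<rho>(1) by (intro order_tendstoD(2)[OF vc]) simp
  then obtain \<delta> where \<delta>: "\<delta> > 0" "\<And>\<theta>. \<theta> \<noteq> 0 \<Longrightarrow> \<bar>\<theta>\<bar> < \<delta> \<Longrightarrow> W * norm (v \<theta> - u) < \<rho>"
    unfolding eventually_at by (auto simp: dist_real_def)
  have \<delta>': "W * norm (v \<theta> - u) < \<rho>" if "0 \<le> \<theta>" "\<theta> \<le> \<delta> / 2" for \<theta>
    using \<delta>(2)[of \<theta>] \<delta>(1) that \<rho>(1) \<open>v 0 - u = 0\<close> by (cases "\<theta> = 0") auto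
  show ?thesis
  proof (intro exI[of _ "\<delta> / 2"] conjI ballI allI impI)
    fix a \<theta> q assume a: "a \<in> idx" and q: "0 \<le> \<theta> \<and> \<theta> \<le> \<delta> / 2 \<and> bot a \<bullet> n + \<epsilon> \<le> q \<bullet> n \<and> q \<bullet> n \<le> top a \<bullet> n - \<epsilon>"
    obtain z where z: "z \<bullet> n = (q - lat (snd a)) \<bullet> n" "ball z \<rho> \<subseteq> Ob (fst a)"
      using \<rho>(2)[OF idx_fst[OF a], of "(q - lat (snd a)) \<bullet> n"] q by (auto simp: inner_diff_left inner_add_left)
    define y where "y = z + lat (snd a)"
    \<comment> \<open>The translate whose ball has its centre strictly ahead of \<open>q\<close>, at
      most one period away.\<close>
    define m where "m = \<lfloor>(q \<bullet> u - y \<bullet> u) / W\<rfloor> + 1"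
    define s where "s = y \<bullet> u + of_int m * W - q \<bullet> u"
    have "of_int (m - 1) * W \<le> q \<bullet> u - y \<bullet> u" "q \<bullet> u - y \<bullet> u < (of_int (m - 1) + 1) * W"
      using W_pos floor_divide_lower[of W "q \<bullet> u - y \<bullet> u"] floor_divide_upper[of W "q \<bullet> u - y \<bullet> u"] by (auto simp: m_def)
    then have s: "0 < s" "s \<le> W" by (auto simp: s_def algebra_simps)
    have yn: "y \<bullet> n = q \<bullet> n" using z(1) by (simp add: y_def inner_add_left inner_diff_left)
    have "y + of_int m *\<^sub>R lat w - q = s *\<^sub>R u"
      using decomp_un[of "y + of_int m *\<^sub>R lat w - q"] yn
      by (simp add: inner_add_left inner_diff_left lat_w_inner s_def)
    then have e: "q = y + of_int m *\<^sub>R lat w - s *\<^sub>R u" by (simp add: algebra_simps)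
    have "q + s *\<^sub>R v \<theta> - lat (snd (shift a m)) = z + s *\<^sub>R (v \<theta> - u)"
      by (simp add: e y_def lat_add lat_scale algebra_simps)
    moreover have "norm (s *\<^sub>R (v \<theta> - u)) < \<rho>"
      using s \<delta>'[of \<theta>] q mult_right_mono[OF s(2), of "norm (v \<theta> - u)"] by simp
    ultimately have "q + s *\<^sub>R v \<theta> - lat (snd (shift a m)) \<in> Ob (fst a)" using z(2) by (auto simp: subset_iff dist_norm)
    then show "\<exists>m t. 0 < t \<and> t \<le> W \<and> q + t *\<^sub>R v \<theta> \<in> obs (shift a m)"
      using s by (intro exI[of _ m] exI[of _ s]) (simp add: mem_obstacle_iff)
  qed (use \<delta> in simp)
qed

text \<open>The form in which freeness of a flight is exploited below: a line of small slope cannot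
  meet an obstacle a short horizontal distance ahead. The factor 2 converts horizontal distance to
  travelled length, as cos \<theta> is at least 1/2.\<close>

lemma no_cross:
  assumes free: "\<And>t. 0 < t \<Longrightarrow> t < T \<Longrightarrow> q + t *\<^sub>R v \<theta> \<in> table J Ob"
    and c: "c \<in> idx" "y \<in> obs c" "y \<bullet> p' \<theta> = q \<bullet> p' \<theta>"
    and cos: "1/2 \<le> cos \<theta>" and u: "0 < (y - q) \<bullet> u" "2 * ((y - q) \<bullet> u) < T"
  shows False
proof -
  define t where "t = (y - q) \<bullet> v \<theta>"
  have y: "y = q + t *\<^sub>R v \<theta>" "(y - q) \<bullet> u = t * cos \<theta>" unfolding t_def by (rule on_line[OF c(3)])+
  have "t > 0" using u(1) cos unfolding y(2) by (simp add: zero_less_mult_iff)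
  moreover have "t \<le> 2 * (t * cos \<theta>)" using mult_left_mono[OF cos, of t] \<open>t > 0\<close> by simp
  ultimately have "y \<in> table J Ob" using free[of t] u(2) unfolding y(2) y(1)[symmetric] by linarith
  then show False using c mem_table by blast
qed

lemma same_height_gap:
  assumes g: "\<And>a b x y. a \<in> idx \<Longrightarrow> b \<in> idx \<Longrightarrow> a \<noteq> b \<Longrightarrow> x \<in> closure (obs a) \<Longrightarrow> y \<in> closure (obs b) \<Longrightarrow> g \<le> dist x y"
    and "a \<in> idx" "c \<in> idx" "top c \<bullet> n = top a \<bullet> n" "top a \<bullet> u < top c \<bullet> u"
  shows "g \<le> top c \<bullet> u - top a \<bullet> u"
proof -
  have "top c - top a = (top c \<bullet> u - top a \<bullet> u) *\<^sub>R u"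
    using decomp_un[of "top c - top a"] assms(4) by (simp only: inner_diff_left) simp
  then have "dist (top c) (top a) = top c \<bullet> u - top a \<bullet> u"
    using assms(5) norm_u by (simp only: dist_norm norm_scaleR) simp
  moreover have "c \<noteq> a" using assms(5) by auto
  ultimately show ?thesis using g[of c a "top c" "top a"] assms top_closure by simp
qed

text \<open>A long free flight of small slope that leaves the obstacle \<open>a\<close> starts near its top, the line at
  the height of that top is free with free space directly above, and the flight passes above the
  obstacles touching that line within the next period: any other obstacle would be hit by the line
  of the flight near an extremal point.\<close>

lemma long_flight_start:
  assumes \<epsilon>: "\<epsilon> > 0"
  shows "\<exists>\<delta>>0. \<forall>a\<in>idx. \<forall>\<theta> q T. 0 < \<theta> \<and> \<theta> \<le> \<delta> \<and> 8 * W + 1 \<le> T \<and> q \<in> closure (obs a) \<and>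
      (\<exists>y\<in>obs a. y \<bullet> p' \<theta> = q \<bullet> p' \<theta>) \<and> (\<forall>t. 0 < t \<and> t < T \<longrightarrow> q + t *\<^sub>R v \<theta> \<in> table J Ob) \<longrightarrow>
    dist q (top a) < \<epsilon> \<and> (\<forall>c\<in>idx. top c \<bullet> n \<le> top a \<bullet> n \<or> top a \<bullet> n < bot c \<bullet> n) \<and>
    (\<forall>c\<in>idx. top c \<bullet> n = top a \<bullet> n \<and> top a \<bullet> u < top c \<bullet> u \<and> top c \<bullet> u \<le> top a \<bullet> u + W \<longrightarrow> H c \<theta> \<le> q \<bullet> p' \<theta>)"
proof -
  obtain g where g: "g > 0" "\<And>a b x y. a \<in> idx \<Longrightarrow> b \<in> idx \<Longrightarrow> a \<noteq> b \<Longrightarrow> x \<in> closure (obs a) \<Longrightarrow> y \<in> closure (obs b) \<Longrightarrow> g \<le> dist x y"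
    using gap by blast
  obtain \<eta> where \<eta>: "\<eta> > 0" "\<And>a c x y. a \<in> idx \<Longrightarrow> c \<in> idx \<Longrightarrow> x \<in> {top a \<bullet> n, bot a \<bullet> n} \<Longrightarrow>
     y \<in> {top c \<bullet> n, bot c \<bullet> n} \<Longrightarrow> x < y \<Longrightarrow> x + \<eta> \<le> y"
    using heights_discrete by blast
  \<comment> \<open>Small compared with the gap and the period, so that replacing points of
    collision by nearby contact points cannot upset their order along w.\<close>
  define \<epsilon>1 where "\<epsilon>1 = min \<epsilon> (min (g / 4) (W / 4))"
  have e1: "\<epsilon>1 > 0" "\<epsilon>1 \<le> \<epsilon>" "\<epsilon>1 \<le> g / 4" "\<epsilon>1 \<le> W / 4" using \<epsilon> g(1) W_pos by (auto simp: \<epsilon>1_def)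
  obtain \<delta>t where \<delta>t: "\<delta>t > 0" "\<And>a \<theta> p. a \<in> idx \<Longrightarrow> 0 \<le> \<theta> \<Longrightarrow> \<theta> \<le> \<delta>t \<Longrightarrow> top a \<bullet> p' \<theta> - \<delta>t \<le> p \<Longrightarrow> p < H a \<theta> \<Longrightarrow>
    \<exists>y\<in>obs a. y \<bullet> p' \<theta> = p \<and> dist y (top a) < \<epsilon>1" using meets_near_top[OF e1(1)] by meson
  obtain \<delta>b where \<delta>b: "\<delta>b > 0" "\<And>a \<theta> p. a \<in> idx \<Longrightarrow> 0 \<le> \<theta> \<Longrightarrow> \<theta> \<le> \<delta>b \<Longrightarrow> p \<le> bot a \<bullet> p' \<theta> + \<delta>b \<Longrightarrow> G a \<theta> < p \<Longrightarrow>
    \<exists>y\<in>obs a. y \<bullet> p' \<theta> = p \<and> dist y (bot a) < \<epsilon>1" using meets_near_bot[OF e1(1)] by meson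
  define \<epsilon>0 where "\<epsilon>0 = min \<epsilon>1 (min (\<delta>t / 2) (\<delta>b / 4))"
  have e0: "\<epsilon>0 > 0" "\<epsilon>0 \<le> \<epsilon>1" "\<epsilon>0 \<le> \<delta>t / 2" "\<epsilon>0 \<le> \<delta>b / 4" using e1 \<delta>t(1) \<delta>b(1) by (auto simp: \<epsilon>0_def)
  obtain \<kappa>t where \<kappa>t: "\<kappa>t > 0" "\<And>a y \<theta>. a \<in> idx \<Longrightarrow> y \<in> closure (obs a) \<Longrightarrow> 0 \<le> \<theta> \<Longrightarrow> \<theta> \<le> \<kappa>t \<Longrightarrow> - \<kappa>t \<le> (y - top a) \<bullet> p' \<theta> \<Longrightarrow> dist y (top a) < \<epsilon>0"
    using small_cap[OF e0(1)] by meson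
  obtain \<kappa>b where \<kappa>b: "\<kappa>b > 0" "\<And>a y \<theta>. a \<in> idx \<Longrightarrow> y \<in> closure (obs a) \<Longrightarrow> 0 \<le> \<theta> \<Longrightarrow> \<theta> \<le> \<kappa>b \<Longrightarrow> (y - bot a) \<bullet> p' \<theta> \<le> \<kappa>b \<Longrightarrow> dist y (bot a) < \<epsilon>0"
    using small_cap_bot[OF e0(1)] by meson
  define \<epsilon>h where "\<epsilon>h = min \<kappa>t (min \<kappa>b (\<eta> / 2))"
  have eh: "\<epsilon>h > 0" "\<epsilon>h \<le> \<kappa>t" "\<epsilon>h \<le> \<kappa>b" "\<epsilon>h \<le> \<eta> / 2" using \<kappa>t(1) \<kappa>b(1) \<eta>(1) by (auto simp: \<epsilon>h_def)
  obtain \<delta>h where \<delta>h: "\<delta>h > 0" "\<And>a \<theta> q. a \<in> idx \<Longrightarrow> 0 \<le> \<theta> \<Longrightarrow> \<theta> \<le> \<delta>h \<Longrightarrow> bot a \<bullet> n + \<epsilon>h \<le> q \<bullet> n \<Longrightarrow> q \<bullet> n \<le> top a \<bullet> n - \<epsilon>h \<Longrightarrow>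
    \<exists>m t. 0 < t \<and> t \<le> W \<and> q + t *\<^sub>R v \<theta> \<in> obs (shift a m)" using hit[OF eh(1)] by meson
  define \<delta> where "\<delta> = min 1 (min \<delta>t (min \<delta>b (min \<delta>h (\<delta>b / (8 * W)))))"
  have \<delta>: "\<delta> > 0" "\<delta> \<le> 1" "\<delta> \<le> \<delta>t" "\<delta> \<le> \<delta>b" "\<delta> \<le> \<delta>h" "\<delta> \<le> \<delta>b / (8 * W)"
    using \<delta>t(1) \<delta>b(1) \<delta>h(1) W_pos by (auto simp: \<delta>_def)
  show ?thesis
  proof (intro exI[of _ \<delta>] conjI ballI allI impI; (elim conjE)?)
    show "\<delta> > 0" by (rule \<delta>)
    fix a \<theta> q T assume a: "a \<in> idx" and \<theta>: "0 < \<theta>" "\<theta> \<le> \<delta>" and T: "8 * W + 1 \<le> T" and q: "q \<in> closure (obs a)"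
      and "\<exists>y\<in>obs a. y \<bullet> p' \<theta> = q \<bullet> p' \<theta>"
      and "\<forall>t. 0 < t \<and> t < T \<longrightarrow> q + t *\<^sub>R v \<theta> \<in> table J Ob"
    then obtain y0 where y0: "y0 \<in> obs a" "y0 \<bullet> p' \<theta> = q \<bullet> p' \<theta>"
      and free: "\<And>t. 0 < t \<Longrightarrow> t < T \<Longrightarrow> q + t *\<^sub>R v \<theta> \<in> table J Ob" by blast
    have sn: "0 < sin \<theta>" "sin \<theta> \<le> \<theta>" and cs: "1/2 \<le> cos \<theta>"
      using sin_bounds[of \<theta>] cos_ge_half[of \<theta>] \<theta> \<delta>(2) by auto
    have W\<theta>: "W * sin \<theta> \<le> \<delta>b / 8"
    proof -
      have "W * sin \<theta> \<le> W * (\<delta>b / (8 * W))" using sn \<theta> \<delta>(6) W_pos by (intro mult_left_mono) auto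
      then show ?thesis using W_pos by simp
    qed
    \<comment> \<open>The length 8 W + 1 rules out crossings up to a horizontal distance of 4 W. All
      obstacles produced below are met within 5 W / 2.\<close>
    have nc: False if "c \<in> idx" "y \<in> obs c" "y \<bullet> p' \<theta> = q \<bullet> p' \<theta>" "0 < (y - q) \<bullet> u" "2 * ((y - q) \<bullet> u) < T" for c y
      by (rule no_cross[where T = T and q = q and \<theta> = \<theta> and c = c and y = y]) (use free that cs in auto)
    \<comment> \<open>At a height well inside the vertical range of an obstacle, some translate of
      that obstacle would stop the flight within one period.\<close>
    have nohit: "\<not> (bot c \<bullet> n + \<epsilon>h \<le> q \<bullet> n \<and> q \<bullet> n \<le> top c \<bullet> n - \<epsilon>h)" if c: "c \<in> idx" for c
    proof
      assume "bot c \<bullet> n + \<epsilon>h \<le> q \<bullet> n \<and> q \<bullet> n \<le> top c \<bullet> n - \<epsilon>h"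
      then obtain m t where mt: "0 < t" "t \<le> W" "q + t *\<^sub>R v \<theta> \<in> obs (shift c m)"
        using \<delta>h(2)[OF c, of \<theta> q] \<theta> \<delta>(5) by auto
      then have "q + t *\<^sub>R v \<theta> \<in> table J Ob" using free[of t] T W_pos by auto
      then show False using mt(3) shift_idx[OF c] mem_table by blast
    qed
    have u_diff: "\<bar>(x - y) \<bullet> u\<bar> \<le> dist x y" for x y
      using abs_inner_unit[OF norm_u, of "x - y"] by (simp add: dist_norm)
    have p_diff: "\<bar>(x - y) \<bullet> p' \<theta>\<bar> \<le> dist x y" for x y
      using abs_inner_unit[OF norm_p', of "x - y"] by (simp add: dist_norm)
    \<comment> \<open>By \<open>nohit\<close> the start is near the bottom or near the top of
      \<open>a\<close>. Near the bottom, the flight would be stopped by the translate of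
      \<open>a\<close> one period ahead: its shadow begins at a lower offset, so the line meets it
      near its bottom.\<close>
    have qn: "top a \<bullet> n - \<epsilon>h < q \<bullet> n"
    proof (rule ccontr)
      assume "\<not> top a \<bullet> n - \<epsilon>h < q \<bullet> n"
      then have "q \<bullet> n < bot a \<bullet> n + \<epsilon>h" using nohit[OF a] by auto
      then have db: "dist q (bot a) < \<epsilon>0"
        using \<kappa>b(1) eh by (intro \<kappa>b(2)[OF a q, of 0]) (auto simp: inner_diff_left)
      let ?c = "shift a 1"
      have c: "?c \<in> idx" by (rule shift_idx[OF a])
      have bc: "bot ?c \<bullet> p' \<theta> = bot a \<bullet> p' \<theta> - W * sin \<theta>" unfolding inner_p' shift_top by (simp add: algebra_simps)
      have "G ?c \<theta> < q \<bullet> p' \<theta>"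
      proof -
        have "G a \<theta> \<le> q \<bullet> p' \<theta>" using G_lower[OF a] y0 closure_subset by (metis subsetD)
        then show ?thesis using G_shift[OF a, of 1 \<theta>] sn W_pos by (smt (verit) mult_pos_pos mult_1 of_int_1)
      qed
      moreover have "q \<bullet> p' \<theta> \<le> bot ?c \<bullet> p' \<theta> + \<delta>b"
        using p_diff[of q "bot a"] db e0 W\<theta> \<delta>b(1) unfolding bc inner_diff_left by linarith
      ultimately obtain y where y: "y \<in> obs ?c" "y \<bullet> p' \<theta> = q \<bullet> p' \<theta>" "dist y (bot ?c) < \<epsilon>1"
        using \<delta>b(2)[OF c, of \<theta>] \<theta> \<delta>(4) by auto
      have "\<bar>(y - bot ?c) \<bullet> u\<bar> \<le> \<epsilon>1" "\<bar>(q - bot a) \<bullet> u\<bar> \<le> \<epsilon>1"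
        using u_diff[of y "bot ?c"] u_diff[of q "bot a"] y(3) db e0(2) by linarith+
      moreover have "bot ?c \<bullet> u = bot a \<bullet> u + W" using shift_top(4)[of a 1] by simp
      ultimately have "W - 2 * \<epsilon>1 \<le> (y - q) \<bullet> u" "(y - q) \<bullet> u \<le> W + 2 * \<epsilon>1" unfolding inner_diff_left by linarith+
      then show False using nc[OF c y(1,2)] T e1 W_pos by linarith
    qed
    have dq: "dist q (top a) < \<epsilon>0"
      using \<kappa>t(1) eh qn by (intro \<kappa>t(2)[OF a q, of 0]) (auto simp: inner_diff_left)
    then show "dist q (top a) < \<epsilon>" using e0 e1 by linarith
    have pq: "\<bar>(q - top a) \<bullet> p' \<theta>\<bar> \<le> \<epsilon>0" "\<bar>(q - top a) \<bullet> u\<bar> \<le> \<epsilon>1"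
      using p_diff[of q "top a"] u_diff[of q "top a"] dq e0 by linarith+
    show above: "H c \<theta> \<le> q \<bullet> p' \<theta>"
      if c: "c \<in> idx" and c': "top c \<bullet> n = top a \<bullet> n" "top a \<bullet> u < top c \<bullet> u" "top c \<bullet> u \<le> top a \<bullet> u + W" for c
    proof (rule ccontr)
      assume "\<not> H c \<theta> \<le> q \<bullet> p' \<theta>"
      moreover have "top c \<bullet> p' \<theta> - \<delta>t \<le> q \<bullet> p' \<theta>"
      proof -
        have "top c \<bullet> p' \<theta> \<le> top a \<bullet> p' \<theta>" using c' sn(1) by (simp add: inner_p')
        then show ?thesis using pq(1) e0(3) \<delta>t(1) unfolding inner_diff_left by linarith
      qed
      ultimately obtain y where y: "y \<in> obs c" "y \<bullet> p' \<theta> = q \<bullet> p' \<theta>" "dist y (top c) < \<epsilon>1"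
        using \<delta>t(2)[OF c, of \<theta> "q \<bullet> p' \<theta>"] \<theta> \<delta>(3) by auto
      have "g \<le> top c \<bullet> u - top a \<bullet> u" by (rule same_height_gap[OF g(2) a c c'(1,2)])
      moreover have "\<bar>(y - top c) \<bullet> u\<bar> < \<epsilon>1" using u_diff[of y "top c"] y(3) by linarith
      ultimately have "g - 2 * \<epsilon>1 < (y - q) \<bullet> u" "(y - q) \<bullet> u \<le> W + 2 * \<epsilon>1"
        using pq(2) c'(3) unfolding inner_diff_left by linarith+
      then show False using nc[OF c y(1,2)] T e1 W_pos by linarith
    qed
    show "top c \<bullet> n \<le> top a \<bullet> n \<or> top a \<bullet> n < bot c \<bullet> n" if c: "c \<in> idx" for c
    proof (rule ccontr)
      assume "\<not> (top c \<bullet> n \<le> top a \<bullet> n \<or> top a \<bullet> n < bot c \<bullet> n)"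
      then have lt: "top a \<bullet> n < top c \<bullet> n" "bot c \<bullet> n \<le> top a \<bullet> n" by auto
      have up: "top a \<bullet> n + \<eta> \<le> top c \<bullet> n" using \<eta>(2)[OF a c _ _ lt(1)] by simp
      show False
      proof (cases "bot c \<bullet> n < top a \<bullet> n")
        case True
        then have "bot c \<bullet> n + \<eta> \<le> top a \<bullet> n" using \<eta>(2)[OF c a _ _ True] by simp
        then show False using nohit[OF c] qn top_max[OF a q] up eh by linarith
      next
        case False
        then have bc: "bot c \<bullet> n = top a \<bullet> n" using lt(2) by simp
        \<comment> \<open>Here \<open>c\<close> stands on the line from above. Its translate in the
          second period ahead is used: the flight passes above the top of \<open>a\<close> shifted
          by one period, hence above the contact point of that translate, and so runs into it near
          its bottom.\<close>
        obtain m where m: "top a \<bullet> u + W < bot c \<bullet> u + of_int m * W" "bot c \<bullet> u + of_int m * W \<le> top a \<bullet> u + W + W"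
          using int_translate[OF W_pos] by metis
        let ?c = "shift c m"
        have c': "?c \<in> idx" by (rule shift_idx[OF c])
        have X: "bot ?c \<bullet> u = bot c \<bullet> u + of_int m * W" "bot ?c \<bullet> n = top a \<bullet> n" using bc shift_top[of c m] by auto
        have Hs: "H (shift a 1) \<theta> \<le> q \<bullet> p' \<theta>"
          using W_pos shift_top[of a 1] by (intro above shift_idx a) auto
        have "top (shift a 1) \<bullet> p' \<theta> \<le> H (shift a 1) \<theta>" by (rule H_upper[OF shift_idx[OF a] top_closure[OF shift_idx[OF a]]])
        moreover have "bot ?c \<bullet> p' \<theta> < top (shift a 1) \<bullet> p' \<theta>"
        proof -
          have "sin \<theta> * (top a \<bullet> u + W) < sin \<theta> * (bot c \<bullet> u + of_int m * W)" using m(1) sn(1) by simp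
          then show ?thesis using shift_top[of a 1] unfolding inner_p' X by simp
        qed
        moreover have "G ?c \<theta> \<le> bot ?c \<bullet> p' \<theta>" by (rule G_lower[OF c' bot_closure[OF c']])
        ultimately have 1: "G ?c \<theta> < q \<bullet> p' \<theta>" using Hs by linarith
        have "top a \<bullet> p' \<theta> - bot ?c \<bullet> p' \<theta> = sin \<theta> * (bot c \<bullet> u + of_int m * W - top a \<bullet> u)"
          unfolding inner_p' X by (simp add: algebra_simps)
        also have "\<dots> \<le> sin \<theta> * (2 * W)" using m sn by (intro mult_left_mono) auto
        finally have "q \<bullet> p' \<theta> \<le> bot ?c \<bullet> p' \<theta> + \<delta>b"
          using pq(1) W\<theta> e0 \<delta>b(1) unfolding inner_diff_left by (simp add: mult.commute)
        then obtain y where y: "y \<in> obs ?c" "y \<bullet> p' \<theta> = q \<bullet> p' \<theta>" "dist y (bot ?c) < \<epsilon>1"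
          using \<delta>b(2)[OF c', of \<theta> "q \<bullet> p' \<theta>"] 1 \<theta> \<delta>(4) by auto
        have "\<bar>(y - bot ?c) \<bullet> u\<bar> < \<epsilon>1" using u_diff[of y "bot ?c"] y(3) by linarith
        then have "W - 2 * \<epsilon>1 < (y - q) \<bullet> u" "(y - q) \<bullet> u \<le> 2 * W + 2 * \<epsilon>1"
          using pq(2) m X(1) unfolding inner_diff_left by linarith+
        then show False using nc[OF c' y(1,2)] T e1 W_pos by linarith
      qed
    qed
  qed
qed

end

lemma sin_ge_half: "0 \<le> (\<theta>::real) \<Longrightarrow> \<theta> \<le> 1 \<Longrightarrow> \<theta> / 2 \<le> sin \<theta>"
proof -
  assume t: "0 \<le> \<theta>" "\<theta> \<le> 1"
  have "sin 0 - 0 / 2 \<le> sin \<theta> - \<theta> / 2"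
  proof (rule DERIV_nonneg_imp_nondecreasing[OF t(1), of "\<lambda>x. sin x - x / 2"])
    fix x :: real assume x: "0 \<le> x" "x \<le> \<theta>"
    then show "\<exists>y. ((\<lambda>x. sin x - x / 2) has_real_derivative y) (at x) \<and> 0 \<le> y"
      using cos_ge_half[of x] t by (intro exI[of _ "cos x - 1/2"]) (auto intro!: derivative_eq_intros)
  qed
  then show ?thesis by simp
qed

context frame
begin

lemmas flip_simps = lat_minus sgn_minus dir_minus perp_dir_minus

text \<open>The statement on starts, read in the half-turned frame along the reversed
  flight.\<close>

lemma long_flight_end:
  assumes \<epsilon>: "\<epsilon> > 0"
  shows "\<exists>\<delta>>0. \<forall>b\<in>idx. \<forall>\<theta> q T. 0 < \<theta> \<and> \<theta> \<le> \<delta> \<and> 8 * W + 1 \<le> T \<and> q \<in> closure (obs b) \<and>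
      (\<exists>y\<in>obs b. y \<bullet> p' \<theta> = q \<bullet> p' \<theta>) \<and> (\<forall>t. 0 < t \<and> t < T \<longrightarrow> q - t *\<^sub>R v \<theta> \<in> table J Ob) \<longrightarrow>
    dist q (bot b) < \<epsilon> \<and> (\<forall>c\<in>idx. bot b \<bullet> n \<le> bot c \<bullet> n \<or> top c \<bullet> n < bot b \<bullet> n) \<and>
    (\<forall>c\<in>idx. bot c \<bullet> n = bot b \<bullet> n \<and> bot c \<bullet> u < bot b \<bullet> u \<and> bot b \<bullet> u \<le> bot c \<bullet> u + W \<longrightarrow> q \<bullet> p' \<theta> \<le> G c \<theta>)"
proof -
  obtain \<delta> where \<delta>: "\<delta> > 0" "\<forall>a\<in>idx. \<forall>\<theta> q T. 0 < \<theta> \<and> \<theta> \<le> \<delta> \<and> 8 * W + 1 \<le> T \<and> q \<in> closure (obs a) \<and>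
      (\<exists>y\<in>obs a. y \<bullet> (- p' \<theta>) = q \<bullet> (- p' \<theta>)) \<and> (\<forall>t. 0 < t \<and> t < T \<longrightarrow> q + t *\<^sub>R (- v \<theta>) \<in> table J Ob) \<longrightarrow>
    dist q (bot a) < \<epsilon> \<and> (\<forall>c\<in>idx. bot c \<bullet> - n \<le> bot a \<bullet> - n \<or> bot a \<bullet> - n < top c \<bullet> - n) \<and>
    (\<forall>c\<in>idx. bot c \<bullet> - n = bot a \<bullet> - n \<and> bot a \<bullet> - u < bot c \<bullet> - u \<and> bot c \<bullet> - u \<le> bot a \<bullet> - u + W \<longrightarrow> supp (obs c) (- p' \<theta>) \<le> q \<bullet> (- p' \<theta>))"
    using frame.long_flight_start[OF flip_frame \<epsilon>] unfolding flip_simps minus_minus norm_minus_cancel by blast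
  show ?thesis
  proof (intro exI[of _ \<delta>] conjI ballI allI impI; (elim conjE)?)
    fix b \<theta> q T
    assume H: "b \<in> idx" "0 < \<theta>" "\<theta> \<le> \<delta>" "8 * W + 1 \<le> T" "q \<in> closure (obs b)"
      "\<exists>y\<in>obs b. y \<bullet> p' \<theta> = q \<bullet> p' \<theta>" "\<forall>t. 0 < t \<and> t < T \<longrightarrow> q - t *\<^sub>R v \<theta> \<in> table J Ob"
    have *: "dist q (bot b) < \<epsilon> \<and> (\<forall>c\<in>idx. bot c \<bullet> - n \<le> bot b \<bullet> - n \<or> bot b \<bullet> - n < top c \<bullet> - n) \<and>
    (\<forall>c\<in>idx. bot c \<bullet> - n = bot b \<bullet> - n \<and> bot b \<bullet> - u < bot c \<bullet> - u \<and> bot c \<bullet> - u \<le> bot b \<bullet> - u + W \<longrightarrow> supp (obs c) (- p' \<theta>) \<le> q \<bullet> (- p' \<theta>))"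
      by (rule \<delta>(2)[rule_format, of b \<theta> T q]) (use H in auto)
    from * show "dist q (bot b) < \<epsilon>" by blast
    from * show "bot b \<bullet> n \<le> bot c \<bullet> n \<or> top c \<bullet> n < bot b \<bullet> n" if "c \<in> idx" for c
      using that unfolding inner_minus_right neg_le_iff_le neg_less_iff_less by blast
    from * show "q \<bullet> p' \<theta> \<le> G c \<theta>" if "c \<in> idx" "bot c \<bullet> n = bot b \<bullet> n" "bot c \<bullet> u < bot b \<bullet> u" "bot b \<bullet> u \<le> bot c \<bullet> u + W" for c
    proof -
      have "supp (obs c) (- p' \<theta>) \<le> q \<bullet> (- p' \<theta>)"
        using *[THEN conjunct2, THEN conjunct2, rule_format, OF that(1)] that(2-) unfolding inner_minus_right by linarith
      then show ?thesis by simp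
    qed
  qed (rule \<delta>)
qed

subsection \<open>Corridors\<close>

definition corridor :: "'j \<times> (int ^ 2) \<Rightarrow> 'j \<times> (int ^ 2) \<Rightarrow> bool" where
  "corridor a b \<longleftrightarrow> top a \<bullet> n < bot b \<bullet> n \<and> (\<forall>c\<in>idx. top c \<bullet> n \<le> top a \<bullet> n \<or> bot b \<bullet> n \<le> bot c \<bullet> n)"

text \<open>A bounded gain of height over a great length forces a small slope. The analysis of both
  ends then gives free space just above the top of \<open>a\<close> and just below the bottom of
  \<open>b\<close>; an obstacle strictly between these levels would be hit on the way, since the
  flight sweeps its heights slowly.\<close>

lemma long_flight:
  assumes \<delta>0: "\<delta>0 > 0"
  shows "\<exists>R. \<forall>a\<in>idx. \<forall>b\<in>idx. \<forall>\<theta> q q' T. 0 < \<theta> \<and> \<theta> < pi / 2 \<and> R \<le> T \<and> \<bar>(q' - q) \<bullet> n\<bar> \<le> M \<and>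
      q \<in> closure (obs a) \<and> (\<exists>y\<in>obs a. y \<bullet> p' \<theta> = q \<bullet> p' \<theta>) \<and>
      q' \<in> closure (obs b) \<and> (\<exists>y\<in>obs b. y \<bullet> p' \<theta> = q \<bullet> p' \<theta>) \<and>
      q' = q + T *\<^sub>R v \<theta> \<and> (\<forall>t. 0 < t \<and> t < T \<longrightarrow> q + t *\<^sub>R v \<theta> \<in> table J Ob) \<longrightarrow>
    \<theta> < \<delta>0 \<and> corridor a b \<and>
    (\<forall>c\<in>idx. top c \<bullet> n = top a \<bullet> n \<and> top a \<bullet> u < top c \<bullet> u \<and> top c \<bullet> u \<le> top a \<bullet> u + W \<longrightarrow> H c \<theta> \<le> q \<bullet> p' \<theta>) \<and>
    (\<forall>c\<in>idx. bot c \<bullet> n = bot b \<bullet> n \<and> bot c \<bullet> u < bot b \<bullet> u \<and> bot b \<bullet> u \<le> bot c \<bullet> u + W \<longrightarrow> q \<bullet> p' \<theta> \<le> G c \<theta>)"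
proof -
  obtain d where d: "d > 0" "\<And>a. a \<in> idx \<Longrightarrow> bot a \<bullet> n + d \<le> top a \<bullet> n" using thickness by blast
  define \<epsilon> where "\<epsilon> = d / 4"
  have e: "\<epsilon> > 0" using d by (simp add: \<epsilon>_def)
  note start = long_flight_start[OF e] and end_ = long_flight_end[OF e]
  obtain \<delta>1 where \<delta>1: "\<delta>1 > 0" "\<forall>a\<in>idx. \<forall>\<theta> q T. 0 < \<theta> \<and> \<theta> \<le> \<delta>1 \<and> 8 * W + 1 \<le> T \<and> q \<in> closure (obs a) \<and>
      (\<exists>y\<in>obs a. y \<bullet> p' \<theta> = q \<bullet> p' \<theta>) \<and> (\<forall>t. 0 < t \<and> t < T \<longrightarrow> q + t *\<^sub>R v \<theta> \<in> table J Ob) \<longrightarrow>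
    dist q (top a) < \<epsilon> \<and> (\<forall>c\<in>idx. top c \<bullet> n \<le> top a \<bullet> n \<or> top a \<bullet> n < bot c \<bullet> n) \<and>
    (\<forall>c\<in>idx. top c \<bullet> n = top a \<bullet> n \<and> top a \<bullet> u < top c \<bullet> u \<and> top c \<bullet> u \<le> top a \<bullet> u + W \<longrightarrow> H c \<theta> \<le> q \<bullet> p' \<theta>)"
    using start by blast
  obtain \<delta>2 where \<delta>2: "\<delta>2 > 0" "\<forall>b\<in>idx. \<forall>\<theta> q T. 0 < \<theta> \<and> \<theta> \<le> \<delta>2 \<and> 8 * W + 1 \<le> T \<and> q \<in> closure (obs b) \<and>
      (\<exists>y\<in>obs b. y \<bullet> p' \<theta> = q \<bullet> p' \<theta>) \<and> (\<forall>t. 0 < t \<and> t < T \<longrightarrow> q - t *\<^sub>R v \<theta> \<in> table J Ob) \<longrightarrow>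
    dist q (bot b) < \<epsilon> \<and> (\<forall>c\<in>idx. bot b \<bullet> n \<le> bot c \<bullet> n \<or> top c \<bullet> n < bot b \<bullet> n) \<and>
    (\<forall>c\<in>idx. bot c \<bullet> n = bot b \<bullet> n \<and> bot c \<bullet> u < bot b \<bullet> u \<and> bot b \<bullet> u \<le> bot c \<bullet> u + W \<longrightarrow> q \<bullet> p' \<theta> \<le> G c \<theta>)"
    using end_ by blast
  obtain \<delta>h where \<delta>h: "\<delta>h > 0" "\<And>a \<theta> q. a \<in> idx \<Longrightarrow> 0 \<le> \<theta> \<Longrightarrow> \<theta> \<le> \<delta>h \<Longrightarrow> bot a \<bullet> n + d / 2 \<le> q \<bullet> n \<Longrightarrow> q \<bullet> n \<le> top a \<bullet> n - d / 2 \<Longrightarrow>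
    \<exists>m t. 0 < t \<and> t \<le> W \<and> q + t *\<^sub>R v \<theta> \<in> obs (shift a m)" using hit[OF half_gt_zero[OF d(1)]] by meson
  \<comment> \<open>The last entry makes the rise over one period at most d / 8, small against the
    thickness \<open>d\<close>.\<close>
  define \<delta> where "\<delta> = min \<delta>0 (min 1 (min \<delta>1 (min \<delta>2 (min \<delta>h (d / (8 * W))))))"
  have \<delta>: "\<delta> > 0" "\<delta> \<le> \<delta>0" "\<delta> \<le> 1" "\<delta> \<le> \<delta>1" "\<delta> \<le> \<delta>2" "\<delta> \<le> \<delta>h" "\<delta> \<le> d / (8 * W)"
    using \<delta>0 \<delta>1(1) \<delta>2(1) \<delta>h(1) divide_pos_pos[OF d(1), of "8 * W"] W_pos
    unfolding \<delta>_def by (simp_all add: min_le_iff_disj del: zero_less_divide_iff zero_less_norm_iff)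
  \<comment> \<open>A flight this long at an angle of at least \<delta> would rise by |M| + 1, more
    than the permitted M.\<close>
  define R where "R = max (8 * W + 1) ((\<bar>M\<bar> + 1) / sin \<delta>)"
  have sd: "sin \<delta> > 0" using sin_bounds[OF \<delta>(1,3)] by simp
  show ?thesis
  proof (intro exI[of _ R] ballI allI impI; elim conjE; intro conjI)
    fix a b \<theta> q q' T
    assume a: "a \<in> idx" and b: "b \<in> idx" and \<theta>: "0 < \<theta>" "\<theta> < pi / 2" and T: "R \<le> T" and M: "\<bar>(q' - q) \<bullet> n\<bar> \<le> M"
      and q: "q \<in> closure (obs a)" "\<exists>y\<in>obs a. y \<bullet> p' \<theta> = q \<bullet> p' \<theta>"
      and q': "q' \<in> closure (obs b)" "\<exists>y\<in>obs b. y \<bullet> p' \<theta> = q \<bullet> p' \<theta>"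
      and eq: "q' = q + T *\<^sub>R v \<theta>" and free: "\<forall>t. 0 < t \<and> t < T \<longrightarrow> q + t *\<^sub>R v \<theta> \<in> table J Ob"
    have TR: "8 * W + 1 \<le> T" "(\<bar>M\<bar> + 1) / sin \<delta> \<le> T" using T by (auto simp: R_def)
    have Tn: "(q' - q) \<bullet> n = T * sin \<theta>" by (simp add: eq v_inner)
    have th: "\<theta> < \<delta>"
    proof (rule ccontr)
      assume "\<not> \<theta> < \<delta>"
      then have "sin \<delta> \<le> sin \<theta>" using \<delta>(1) \<theta> by (intro sin_monotone_2pi_le) auto
      moreover have "0 \<le> T" using TR(1) W_pos by linarith
      ultimately have "T * sin \<delta> \<le> T * sin \<theta>" by (rule mult_left_mono)
      moreover have "\<bar>M\<bar> + 1 \<le> T * sin \<delta>" using TR(2) sd by (simp add: pos_divide_le_eq)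
      ultimately show False using M Tn by linarith
    qed
    then show "\<theta> < \<delta>0" using \<delta>(2) by linarith
    have sn: "0 < sin \<theta>" "sin \<theta> \<le> \<theta>" and cs: "1/2 \<le> cos \<theta>"
      using sin_bounds[of \<theta>] cos_ge_half[of \<theta>] \<theta> \<delta>(3) th by auto
    have A: "dist q (top a) < \<epsilon> \<and> (\<forall>c\<in>idx. top c \<bullet> n \<le> top a \<bullet> n \<or> top a \<bullet> n < bot c \<bullet> n) \<and>
      (\<forall>c\<in>idx. top c \<bullet> n = top a \<bullet> n \<and> top a \<bullet> u < top c \<bullet> u \<and> top c \<bullet> u \<le> top a \<bullet> u + W \<longrightarrow> H c \<theta> \<le> q \<bullet> p' \<theta>)"
      by (rule \<delta>1(2)[rule_format, of a \<theta> T q]) (use a \<theta> th \<delta>(4) TR(1) q free in auto)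
    have pq: "q' \<bullet> p' \<theta> = q \<bullet> p' \<theta>" by (simp add: eq inner_add_left v_inner)
    have B: "dist q' (bot b) < \<epsilon> \<and> (\<forall>c\<in>idx. bot b \<bullet> n \<le> bot c \<bullet> n \<or> top c \<bullet> n < bot b \<bullet> n) \<and>
      (\<forall>c\<in>idx. bot c \<bullet> n = bot b \<bullet> n \<and> bot c \<bullet> u < bot b \<bullet> u \<and> bot b \<bullet> u \<le> bot c \<bullet> u + W \<longrightarrow> q' \<bullet> p' \<theta> \<le> G c \<theta>)"
    proof (rule \<delta>2(2)[rule_format, of b \<theta> T q'])
      have "q' - t *\<^sub>R v \<theta> = q + (T - t) *\<^sub>R v \<theta>" for t by (simp add: eq algebra_simps)
      then have "q' - t *\<^sub>R v \<theta> \<in> table J Ob" if "0 < t \<and> t < T" for t using that free by simp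
      then show "0 < \<theta> \<and> \<theta> \<le> \<delta>2 \<and> 8 * W + 1 \<le> T \<and> q' \<in> closure (obs b) \<and> (\<exists>y\<in>obs b. y \<bullet> p' \<theta> = q' \<bullet> p' \<theta>) \<and>
         (\<forall>t. 0 < t \<and> t < T \<longrightarrow> q' - t *\<^sub>R v \<theta> \<in> table J Ob)"
        using \<theta> th \<delta>(5) TR(1) q' pq by auto
    qed (rule b)
    have n_diff: "\<bar>x \<bullet> n - y \<bullet> n\<bar> \<le> dist x y" for x y
      using abs_inner_unit[OF norm_n, of "x - y"] by (simp add: dist_norm inner_diff_left)
    have qn: "top a \<bullet> n - \<epsilon> < q \<bullet> n" "q \<bullet> n \<le> top a \<bullet> n"
      using n_diff[of q "top a"] A top_max[OF a q(1)] by linarith+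
    have q'n: "q' \<bullet> n < bot b \<bullet> n + \<epsilon>" "bot b \<bullet> n \<le> q' \<bullet> n"
      using n_diff[of q' "bot b"] B bot_min[OF b q'(1)] by linarith+
    have qq': "q \<bullet> n < q' \<bullet> n" using Tn sn TR(1) W_pos unfolding inner_diff_left by (smt (verit) mult_pos_pos)
    \<comment> \<open>Otherwise \<open>b\<close> lies entirely at or below the top of
      \<open>a\<close>, its bottom deeper by the thickness, and a flight from near that top to near
      that bottom would have to descend.\<close>
    have lt: "top a \<bullet> n < bot b \<bullet> n"
    proof (rule ccontr)
      assume n: "\<not> top a \<bullet> n < bot b \<bullet> n"
      then have "top b \<bullet> n \<le> top a \<bullet> n" using A b by blast
      then have "bot b \<bullet> n + d \<le> top a \<bullet> n" using d(2)[OF b] by linarith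
      then show False using qn q'n qq' d(1) by (simp add: \<epsilon>_def)
    qed
    show "corridor a b"
      unfolding corridor_def
    proof (intro conjI ballI lt)
      fix c assume c: "c \<in> idx"
      show "top c \<bullet> n \<le> top a \<bullet> n \<or> bot b \<bullet> n \<le> bot c \<bullet> n"
      proof (rule ccontr)
        assume neg: "\<not> ?thesis"
        then have c1: "top a \<bullet> n < bot c \<bullet> n" "top c \<bullet> n < bot b \<bullet> n" using A B c by auto
        \<comment> \<open>A height inside \<open>c\<close>, at distance at least d / 2 from its
          bottom and its top. The flight reaches it at time \<open>t0\<close> and still has to rise
          by d / 2, so more than one period of flight remains, enough for a translate of
          \<open>c\<close> to be hit.\<close>
        define h where "h = bot c \<bullet> n + d / 2"
        define t0 where "t0 = (h - q \<bullet> n) / sin \<theta>"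
        have t0: "t0 * sin \<theta> = h - q \<bullet> n" using sn by (simp add: t0_def)
        have "0 < t0" using c1(1) qn d(1) sn by (simp add: t0_def h_def)
        have "h + d / 2 \<le> q' \<bullet> n" using d(2)[OF c] c1(2) q'n by (simp add: h_def)
        then have "d / 2 \<le> (T - t0) * sin \<theta>" using Tn t0 by (simp add: inner_diff_left left_diff_distrib)
        moreover have "sin \<theta> * W < d / 4"
        proof -
          have "sin \<theta> * W \<le> d / (8 * W) * W" using sn th \<delta>(7) W_pos by (intro mult_right_mono) auto
          also have "\<dots> = d / 8" using W_pos by simp
          finally show ?thesis using d(1) by simp
        qed
        ultimately have "W * sin \<theta> < (T - t0) * sin \<theta>" using d(1) by (simp add: mult.commute)
        then have Tt: "W < T - t0" using sn(1) by (metis mult_less_cancel_right_pos)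
        have "bot c \<bullet> n + d / 2 \<le> (q + t0 *\<^sub>R v \<theta>) \<bullet> n" "(q + t0 *\<^sub>R v \<theta>) \<bullet> n \<le> top c \<bullet> n - d / 2"
          using t0 d(2)[OF c] by (simp_all add: inner_add_left v_inner h_def)
        then obtain m t where mt: "0 < t" "t \<le> W" "q + t0 *\<^sub>R v \<theta> + t *\<^sub>R v \<theta> \<in> obs (shift c m)"
          using \<delta>h(2)[OF c, of \<theta> "q + t0 *\<^sub>R v \<theta>"] \<theta> th \<delta>(6) by auto
        have "q + (t0 + t) *\<^sub>R v \<theta> \<in> table J Ob" using free mt \<open>0 < t0\<close> Tt by auto
        then have "q + (t0 + t) *\<^sub>R v \<theta> \<notin> obs (shift c m)" using shift_idx[OF c, of m] unfolding mem_table by blast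
        then show False using mt(3) by (simp add: scaleR_add_left add.assoc)
      qed
    qed
    show "\<forall>c\<in>idx. top c \<bullet> n = top a \<bullet> n \<and> top a \<bullet> u < top c \<bullet> u \<and> top c \<bullet> u \<le> top a \<bullet> u + W \<longrightarrow> H c \<theta> \<le> q \<bullet> p' \<theta>"
      using A by blast
    show "\<forall>c\<in>idx. bot c \<bullet> n = bot b \<bullet> n \<and> bot c \<bullet> u < bot b \<bullet> u \<and> bot b \<bullet> u \<le> bot c \<bullet> u + W \<longrightarrow> q \<bullet> p' \<theta> \<le> G c \<theta>"
      using B unfolding pq by blast
  qed
qed

text \<open>With free space above, an obstacle can touch the line only at its top. Distinct contact
  points are separated by the gap, so the infimum in the definition of the flight time is positive
  and attained; the translate of \<open>a\<close> by w shows that it is at most 1, the parameter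
  being counted in multiples of w.\<close>

lemma next_point_on_line:
  assumes a: "a \<in> idx" and above: "\<And>c. c \<in> idx \<Longrightarrow> top c \<bullet> n \<le> top a \<bullet> n \<or> top a \<bullet> n < bot c \<bullet> n"
  obtains c where "c \<in> idx" "next_point J Ob (top a) (lat w) = top c" "top c \<bullet> n = top a \<bullet> n"
    "top a \<bullet> u < top c \<bullet> u" "top c \<bullet> u \<le> top a \<bullet> u + W"
    "\<And>c'. c' \<in> idx \<Longrightarrow> top c' \<bullet> n = top a \<bullet> n \<Longrightarrow> top a \<bullet> u < top c' \<bullet> u \<Longrightarrow> top c \<bullet> u \<le> top c' \<bullet> u"
proof -
  obtain g where g: "g > 0" "\<And>a b x y. a \<in> idx \<Longrightarrow> b \<in> idx \<Longrightarrow> a \<noteq> b \<Longrightarrow> x \<in> closure (obs a) \<Longrightarrow> y \<in> closure (obs b) \<Longrightarrow> g \<le> dist x y"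
    using gap by blast
  define S where "S = {t. 0 < t \<and> top a + t *\<^sub>R lat w \<in> frontier (table J Ob)}"
  have S_iff: "t \<in> S \<longleftrightarrow> 0 < t \<and> (\<exists>c\<in>idx. top c = top a + t *\<^sub>R lat w)" for t
  proof
    assume "t \<in> S"
    then obtain c where c: "c \<in> idx" "top a + t *\<^sub>R lat w \<in> frontier (obs c)" "0 < t" by (auto simp: S_def frontier_table)
    have cl: "top a + t *\<^sub>R lat w \<in> closure (obs c)" using c(2) by (simp add: frontier_def)
    have h: "(top a + t *\<^sub>R lat w) \<bullet> n = top a \<bullet> n" by (simp only: inner_add_left inner_scaleR_left lat_w_inner mult_zero_right add_0_right)
    have "bot c \<bullet> n \<le> top a \<bullet> n" "top a \<bullet> n \<le> top c \<bullet> n" using bot_min[OF c(1) cl] top_max[OF c(1) cl] unfolding h by auto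
    then have "top a \<bullet> n = top c \<bullet> n" using above[OF c(1)] by linarith
    then have "top a + t *\<^sub>R lat w = top c" by (intro top_unique[OF c(1) cl]) (simp only: h)
    then show "0 < t \<and> (\<exists>c\<in>idx. top c = top a + t *\<^sub>R lat w)" using c by auto
  next
    assume "0 < t \<and> (\<exists>c\<in>idx. top c = top a + t *\<^sub>R lat w)"
    then obtain c where "0 < t" "c \<in> idx" "top c = top a + t *\<^sub>R lat w" by blast
    then show "t \<in> S" using top_frontier[of c] unfolding S_def frontier_table by auto
  qed
  have tc: "(top a + t *\<^sub>R lat w) \<bullet> n = top a \<bullet> n" "(top a + t *\<^sub>R lat w) \<bullet> u = top a \<bullet> u + t * W" for t
    by (simp_all only: inner_add_left[of _ "_ *\<^sub>R lat w"] inner_scaleR_left lat_w_inner mult_zero_right add_0_right)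
  have S_lower: "g / W \<le> t" if tS: "t \<in> S" for t
  proof -
    obtain c where c: "c \<in> idx" "top c = top a + t *\<^sub>R lat w" "0 < t" using S_iff[THEN iffD1, OF tS] by (elim conjE bexE)
    have "g \<le> top c \<bullet> u - top a \<bullet> u"
      using c W_pos tc[of t] by (intro same_height_gap[OF g(2) a c(1)]) auto
    then show ?thesis using c tc[of t] W_pos by (simp add: pos_divide_le_eq)
  qed
  have one: "1 \<in> S" unfolding S_iff using shift_idx[OF a, of 1] by (intro conjI bexI[of _ "shift a 1"]) (auto simp: lat_add)
  have "S = {g / W..} \<inter> (\<lambda>t. top a + t *\<^sub>R lat w) -` frontier (table J Ob)"
    using S_lower g(1) W_pos unfolding S_def by (auto intro: less_le_trans[of 0 "g / W"])
  then have "closed S" by (auto intro!: continuous_closed_preimage continuous_intros)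
  moreover have bdd: "bdd_below S" using S_lower by (auto intro!: bdd_belowI)
  ultimately have IS: "Inf S \<in> S" using closed_contains_Inf one by blast
  obtain c where c: "c \<in> idx" "top c = top a + Inf S *\<^sub>R lat w" "0 < Inf S"
    using S_iff[THEN iffD1, OF IS] by (elim conjE bexE)
  have le: "Inf S \<le> t" if "t \<in> S" for t using that bdd by (rule cInf_lower)
  show ?thesis
  proof (rule that[OF c(1)])
    show "next_point J Ob (top a) (lat w) = top c"
      unfolding next_point_def flight_time_def c(2) S_def by simp
    show "top c \<bullet> n = top a \<bullet> n" "top a \<bullet> u < top c \<bullet> u" using tc[of "Inf S"] c W_pos by simp_all
    show "top c \<bullet> u \<le> top a \<bullet> u + W" using tc[of "Inf S"] c(2) le[OF one] W_pos by simp
    fix c' assume c': "c' \<in> idx" "top c' \<bullet> n = top a \<bullet> n" "top a \<bullet> u < top c' \<bullet> u"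
    define t where "t = (top c' \<bullet> u - top a \<bullet> u) / W"
    have "top c' - (top a + t *\<^sub>R lat w) = 0"
      using decomp_un[of "top c' - (top a + t *\<^sub>R lat w)"] c'(2) tc[of t] W_pos unfolding inner_diff_left
      by (simp add: t_def)
    then have "t \<in> S" using c' W_pos unfolding S_iff by (auto simp: t_def)
    then have "Inf S * W \<le> t * W" using le W_pos by (intro mult_right_mono) auto
    then show "top c \<bullet> u \<le> top c' \<bullet> u" using tc[of "Inf S"] c(2) W_pos by (simp add: t_def)
  qed
qed

lemma prev_point_on_line:
  assumes b: "b \<in> idx" and below: "\<And>c. c \<in> idx \<Longrightarrow> bot b \<bullet> n \<le> bot c \<bullet> n \<or> top c \<bullet> n < bot b \<bullet> n"
  obtains c where "c \<in> idx" "next_point J Ob (bot b) (- lat w) = bot c" "bot c \<bullet> n = bot b \<bullet> n"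
    "bot c \<bullet> u < bot b \<bullet> u" "bot b \<bullet> u \<le> bot c \<bullet> u + W"
    "\<And>c'. c' \<in> idx \<Longrightarrow> bot c' \<bullet> n = bot b \<bullet> n \<Longrightarrow> bot c' \<bullet> u < bot b \<bullet> u \<Longrightarrow> bot c' \<bullet> u \<le> bot c \<bullet> u"
proof -
  have *: "bot c \<bullet> - n \<le> bot b \<bullet> - n \<or> bot b \<bullet> - n < top c \<bullet> - n" if "c \<in> idx" for c
    using below[OF that] by auto
  obtain c where c: "c \<in> idx" "next_point J Ob (bot b) (- lat w) = bot c" "bot c \<bullet> - n = bot b \<bullet> - n"
    "bot b \<bullet> - u < bot c \<bullet> - u" "bot c \<bullet> - u \<le> bot b \<bullet> - u + W"
    "\<And>c'. c' \<in> idx \<Longrightarrow> bot c' \<bullet> - n = bot b \<bullet> - n \<Longrightarrow> bot b \<bullet> - u < bot c' \<bullet> - u \<Longrightarrow> bot c \<bullet> - u \<le> bot c' \<bullet> - u"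
    using frame.next_point_on_line[OF flip_frame b] * unfolding flip_simps minus_minus norm_minus_cancel by metis
  show ?thesis
  proof (rule that[OF c(1,2)])
    show "bot c \<bullet> n = bot b \<bullet> n" "bot c \<bullet> u < bot b \<bullet> u" "bot b \<bullet> u \<le> bot c \<bullet> u + W"
      using c(3-5) unfolding inner_minus_right by linarith+
    fix c' assume "c' \<in> idx" "bot c' \<bullet> n = bot b \<bullet> n" "bot c' \<bullet> u < bot b \<bullet> u"
    then show "bot c' \<bullet> u \<le> bot c \<bullet> u" using c(6)[of c'] unfolding inner_minus_right by linarith
  qed
qed

lemma excess_limit:
  assumes "a \<in> idx"
  shows "((\<lambda>\<theta>. (H a \<theta> - top a \<bullet> p' \<theta>) / \<theta>\<^sup>2) \<longlongrightarrow> 1 / (2 * curvature J \<gamma> (top a))) (at_right 0)"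
proof -
  note j = idx_fst[OF assms]
  obtain r where r: "r \<in> {0..<len (fst a)}" "\<gamma> (fst a) r = top0 n (fst a)" using top0_gamma[OF j norm_n] by blast
  have "curvature J \<gamma> (top a) = norm (vderiv (vderiv (\<gamma> (fst a))) r)" using curvature_eq[OF j, of r "snd a"] r by simp
  then show ?thesis
    using supp_excess_limit[OF j norm_u norm_n u_n r(2)] r(2) supp_obs[OF assms] by (simp add: inner_add_left)
qed

text \<open>The excess is the same for all translates of an obstacle, so the finitely many limits in
  the cell 0 give a bound for all obstacles.\<close>

lemma excess_small:
  assumes "\<kappa> > 0"
  shows "\<exists>\<delta>>0. \<forall>a\<in>idx. \<forall>\<theta>. 0 < \<theta> \<and> \<theta> < \<delta> \<longrightarrow> H a \<theta> \<le> top a \<bullet> p' \<theta> + \<kappa> * \<theta>"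
proof -
  have "\<forall>\<^sub>F \<theta> in at_right 0. H (j, 0) \<theta> - top (j, 0) \<bullet> p' \<theta> \<le> \<kappa> * \<theta>" if j: "j \<in> J" for j
  proof -
    have "((\<lambda>\<theta>. (H (j, 0) \<theta> - top (j, 0) \<bullet> p' \<theta>) / \<theta>\<^sup>2 * \<theta>) \<longlongrightarrow> 1 / (2 * curvature J \<gamma> (top (j, 0))) * 0) (at_right 0)"
      using j by (intro tendsto_mult excess_limit tendsto_ident_at) simp
    then have "\<forall>\<^sub>F \<theta> in at_right 0. (H (j, 0) \<theta> - top (j, 0) \<bullet> p' \<theta>) / \<theta>\<^sup>2 * \<theta> < \<kappa>"
      using assms by (intro order_tendstoD(2)) auto
    moreover have "\<forall>\<^sub>F \<theta> in at_right (0::real). 0 < \<theta>" by (simp add: eventually_at_right_less)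
    ultimately show ?thesis
    proof eventually_elim
      case (elim \<theta>)
      have "(H (j, 0) \<theta> - top (j, 0) \<bullet> p' \<theta>) / \<theta> < \<kappa>" using elim by (simp add: power2_eq_square)
      then show ?case using elim by (simp only: pos_divide_less_eq less_imp_le)
    qed
  qed
  then have "\<forall>\<^sub>F \<theta> in at_right 0. \<forall>j\<in>J. H (j, 0) \<theta> - top (j, 0) \<bullet> p' \<theta> \<le> \<kappa> * \<theta>"
    using finite_J by (simp add: eventually_ball_finite)
  then obtain \<delta> where \<delta>: "\<delta> > 0" "\<And>\<theta> j. 0 < \<theta> \<Longrightarrow> \<theta> < \<delta> \<Longrightarrow> j \<in> J \<Longrightarrow> H (j, 0) \<theta> - top (j, 0) \<bullet> p' \<theta> \<le> \<kappa> * \<theta>"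
    unfolding eventually_at_right_field by auto
  show ?thesis
  proof (intro exI[of _ \<delta>] conjI ballI allI impI)
    fix a \<theta> assume a: "a \<in> idx" and "0 < \<theta> \<and> \<theta> < \<delta>"
    then show "H a \<theta> \<le> top a \<bullet> p' \<theta> + \<kappa> * \<theta>"
      using \<delta>(2)[of \<theta> "fst a"] idx_fst[OF a] supp_obs[OF a] by (simp add: inner_add_left)
  qed (rule \<delta>)
qed

text \<open>Contact points on one line are at least g apart, so tilting by \<theta> lowers the
  offset of the later one by at least g \<theta> / 2, whereas its excess is at most g \<theta> / 4.
  Hence passing above the next obstacle implies passing above all later ones.\<close>

lemma top_order:
  "\<exists>\<delta>>0. \<forall>a\<in>idx. \<forall>c\<in>idx. \<forall>\<theta>. 0 < \<theta> \<and> \<theta> < \<delta> \<and> top c \<bullet> n = top a \<bullet> n \<and> top a \<bullet> u < top c \<bullet> u \<longrightarrow> H c \<theta> < H a \<theta>"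
proof -
  obtain g where g: "g > 0" "\<And>a b x y. a \<in> idx \<Longrightarrow> b \<in> idx \<Longrightarrow> a \<noteq> b \<Longrightarrow> x \<in> closure (obs a) \<Longrightarrow> y \<in> closure (obs b) \<Longrightarrow> g \<le> dist x y"
    using gap by blast
  obtain \<delta> where \<delta>: "\<delta> > 0" "\<forall>a\<in>idx. \<forall>\<theta>. 0 < \<theta> \<and> \<theta> < \<delta> \<longrightarrow> H a \<theta> \<le> top a \<bullet> p' \<theta> + g / 4 * \<theta>"
    using excess_small[of "g / 4"] g(1) by auto
  show ?thesis
  proof (intro exI[of _ "min 1 \<delta>"] conjI ballI allI impI; (elim conjE)?)
    fix a c \<theta> assume a: "a \<in> idx" and c: "c \<in> idx" and \<theta>: "0 < \<theta>" "\<theta> < min 1 \<delta>" and h: "top c \<bullet> n = top a \<bullet> n" "top a \<bullet> u < top c \<bullet> u"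
    have "H c \<theta> \<le> top c \<bullet> p' \<theta> + g / 4 * \<theta>" using \<delta>(2) c \<theta> by auto
    moreover have "top a \<bullet> p' \<theta> \<le> H a \<theta>" by (rule H_upper[OF a top_closure[OF a]])
    moreover have "top a \<bullet> p' \<theta> - top c \<bullet> p' \<theta> = sin \<theta> * (top c \<bullet> u - top a \<bullet> u)"
      unfolding inner_p' h by (simp add: algebra_simps)
    moreover have "\<theta> / 2 * g \<le> sin \<theta> * (top c \<bullet> u - top a \<bullet> u)"
      using same_height_gap[OF g(2) a c h] sin_ge_half[of \<theta>] \<theta> g(1) by (intro mult_mono) auto
    moreover have "g / 4 * \<theta> < \<theta> / 2 * g" using g(1) \<theta> by simp
    ultimately show "H c \<theta> < H a \<theta>" by linarith
  qed (use \<delta> in auto)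
qed

lemma bot_order:
  "\<exists>\<delta>>0. \<forall>a\<in>idx. \<forall>c\<in>idx. \<forall>\<theta>. 0 < \<theta> \<and> \<theta> < \<delta> \<and> bot c \<bullet> n = bot a \<bullet> n \<and> bot c \<bullet> u < bot a \<bullet> u \<longrightarrow> G a \<theta> < G c \<theta>"
proof -
  obtain \<delta> where \<delta>: "\<delta> > 0" "\<forall>a\<in>idx. \<forall>c\<in>idx. \<forall>\<theta>. 0 < \<theta> \<and> \<theta> < \<delta> \<and> bot c \<bullet> - n = bot a \<bullet> - n \<and> bot a \<bullet> - u < bot c \<bullet> - u \<longrightarrow>
     supp (obs c) (- p' \<theta>) < supp (obs a) (- p' \<theta>)"
    using frame.top_order[OF flip_frame] unfolding flip_simps by blast
  then show ?thesis by (intro exI[of _ \<delta>]) auto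
qed

text \<open>The converse of \<open>long_flight\<close>: the four inequalities suffice. The first
  obstacle met must reach the level of one side of the corridor, by discreteness of heights, and the
  order of shadows excludes every one other than \<open>b\<close>. The ray condition on
  \<open>q\<close> says that it is the exit point of its line from \<open>a\<close>.\<close>

lemma corridor_flight:
  shows "\<exists>\<delta>>0. \<forall>a\<in>idx. \<forall>b\<in>idx. \<forall>c\<in>idx. \<forall>c'\<in>idx. \<forall>\<theta> p. 0 < \<theta> \<and> \<theta> < \<delta> \<and> corridor a b \<and>
      top c \<bullet> n = top a \<bullet> n \<and> top a \<bullet> u < top c \<bullet> u \<and> top c \<bullet> u \<le> top a \<bullet> u + W \<and>
      (\<forall>e\<in>idx. top e \<bullet> n = top a \<bullet> n \<and> top a \<bullet> u < top e \<bullet> u \<longrightarrow> top c \<bullet> u \<le> top e \<bullet> u) \<and>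
      bot c' \<bullet> n = bot b \<bullet> n \<and> bot c' \<bullet> u < bot b \<bullet> u \<and> bot b \<bullet> u \<le> bot c' \<bullet> u + W \<and>
      (\<forall>e\<in>idx. bot e \<bullet> n = bot b \<bullet> n \<and> bot e \<bullet> u < bot b \<bullet> u \<longrightarrow> bot e \<bullet> u \<le> bot c' \<bullet> u) \<and>
      H c \<theta> < p \<and> p < H a \<theta> \<and> G b \<theta> < p \<and> p < G c' \<theta> \<longrightarrow>
    (\<exists>y\<in>obs a. y \<bullet> p' \<theta> = p) \<and>
    (\<forall>q\<in>closure (obs a). q \<bullet> p' \<theta> = p \<and> (\<forall>t>0. q + t *\<^sub>R v \<theta> \<notin> closure (obs a)) \<longrightarrow>
       next_point J Ob q (v \<theta>) \<in> frontier (obs b))"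
proof -
  obtain g where g: "g > 0" "\<And>a b x y. a \<in> idx \<Longrightarrow> b \<in> idx \<Longrightarrow> a \<noteq> b \<Longrightarrow> x \<in> closure (obs a) \<Longrightarrow> y \<in> closure (obs b) \<Longrightarrow> g \<le> dist x y"
    using gap by blast
  obtain \<eta> where \<eta>: "\<eta> > 0" "\<And>a c x y. a \<in> idx \<Longrightarrow> c \<in> idx \<Longrightarrow> x \<in> {top a \<bullet> n, bot a \<bullet> n} \<Longrightarrow>
     y \<in> {top c \<bullet> n, bot c \<bullet> n} \<Longrightarrow> x < y \<Longrightarrow> x + \<eta> \<le> y"
    using heights_discrete by blast
  have g4: "g / 4 > 0" using g(1) by simp
  obtain \<kappa>1 where \<kappa>1: "\<kappa>1 > 0" "\<And>a y \<theta>. a \<in> idx \<Longrightarrow> y \<in> closure (obs a) \<Longrightarrow> 0 \<le> \<theta> \<Longrightarrow> \<theta> \<le> \<kappa>1 \<Longrightarrow> - \<kappa>1 \<le> (y - top a) \<bullet> p' \<theta> \<Longrightarrow> dist y (top a) < g / 4"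
    using small_cap[OF g4] by meson
  obtain \<kappa>2 where \<kappa>2: "\<kappa>2 > 0" "\<And>a y \<theta>. a \<in> idx \<Longrightarrow> y \<in> closure (obs a) \<Longrightarrow> 0 \<le> \<theta> \<Longrightarrow> \<theta> \<le> \<kappa>2 \<Longrightarrow> (y - bot a) \<bullet> p' \<theta> \<le> \<kappa>2 \<Longrightarrow> dist y (bot a) < g / 4"
    using small_cap_bot[OF g4] by meson
  define \<epsilon> where "\<epsilon> = min (g / 4) (min \<kappa>1 (min \<kappa>2 \<eta>))"
  have e: "\<epsilon> > 0" "\<epsilon> \<le> g / 4" "\<epsilon> \<le> \<kappa>1" "\<epsilon> \<le> \<kappa>2" "\<epsilon> \<le> \<eta>" using g(1) \<kappa>1(1) \<kappa>2(1) \<eta>(1) by (auto simp: \<epsilon>_def)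
  obtain \<kappa> where \<kappa>: "\<kappa> > 0" "\<And>a y \<theta>. a \<in> idx \<Longrightarrow> y \<in> closure (obs a) \<Longrightarrow> 0 \<le> \<theta> \<Longrightarrow> \<theta> \<le> \<kappa> \<Longrightarrow> - \<kappa> \<le> (y - top a) \<bullet> p' \<theta> \<Longrightarrow> dist y (top a) < \<epsilon>"
    using small_cap[OF e(1)] by meson
  obtain \<delta>t where \<delta>t: "\<delta>t > 0" "\<And>a \<theta> p. a \<in> idx \<Longrightarrow> 0 \<le> \<theta> \<Longrightarrow> \<theta> \<le> \<delta>t \<Longrightarrow> top a \<bullet> p' \<theta> - \<delta>t \<le> p \<Longrightarrow> p < H a \<theta> \<Longrightarrow>
    \<exists>y\<in>obs a. y \<bullet> p' \<theta> = p \<and> dist y (top a) < \<epsilon>" using meets_near_top[OF e(1)] by meson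
  obtain \<delta>b where \<delta>b: "\<delta>b > 0" "\<And>a \<theta> p. a \<in> idx \<Longrightarrow> 0 \<le> \<theta> \<Longrightarrow> \<theta> \<le> \<delta>b \<Longrightarrow> p \<le> bot a \<bullet> p' \<theta> + \<delta>b \<Longrightarrow> G a \<theta> < p \<Longrightarrow>
    \<exists>y\<in>obs a. y \<bullet> p' \<theta> = p \<and> dist y (bot a) < \<epsilon>" using meets_near_bot[OF e(1)] by meson
  obtain \<delta>o where \<delta>o: "\<delta>o > 0" "\<And>a c \<theta>. a \<in> idx \<Longrightarrow> c \<in> idx \<Longrightarrow> 0 < \<theta> \<Longrightarrow> \<theta> < \<delta>o \<Longrightarrow> top c \<bullet> n = top a \<bullet> n \<Longrightarrow> top a \<bullet> u < top c \<bullet> u \<Longrightarrow> H c \<theta> < H a \<theta>"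
    using top_order by blast
  obtain \<delta>p where \<delta>p: "\<delta>p > 0" "\<And>a c \<theta>. a \<in> idx \<Longrightarrow> c \<in> idx \<Longrightarrow> 0 < \<theta> \<Longrightarrow> \<theta> < \<delta>p \<Longrightarrow> bot c \<bullet> n = bot a \<bullet> n \<Longrightarrow> bot c \<bullet> u < bot a \<bullet> u \<Longrightarrow> G a \<theta> < G c \<theta>"
    using bot_order by blast
  \<comment> \<open>Passing \<open>c\<close> and \<open>c'\<close>, each within one period, places
    the line within W sin \<theta> of the contact points of \<open>a\<close> and \<open>b\<close>.
    The bound m / W on the angle keeps this within the reach of the cap lemmas.\<close>
  define m where "m = min \<kappa> (min \<delta>t \<delta>b)"
  have m: "m > 0" "m \<le> \<kappa>" "m \<le> \<delta>t" "m \<le> \<delta>b" using \<kappa>(1) \<delta>t(1) \<delta>b(1) by (auto simp: m_def)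
  define \<delta> where "\<delta> = min 1 (min m (min (m / W) (min \<delta>o \<delta>p)))"
  have \<delta>: "\<delta> > 0" "\<delta> \<le> 1" "\<delta> \<le> m" "\<delta> \<le> m / W" "\<delta> \<le> \<delta>o" "\<delta> \<le> \<delta>p"
    using m(1) W_pos \<delta>o(1) \<delta>p(1) by (auto simp: \<delta>_def)
  show ?thesis
  proof (intro exI[of _ \<delta>] conjI ballI allI impI; (elim conjE)?)
    show "\<delta> > 0" by (rule \<delta>)
    fix a b c c' \<theta> p
    assume a: "a \<in> idx" and b: "b \<in> idx" and c: "c \<in> idx" and c': "c' \<in> idx" and \<theta>: "0 < \<theta>" "\<theta> < \<delta>"
      and cor: "corridor a b"
      and cn: "top c \<bullet> n = top a \<bullet> n" "top a \<bullet> u < top c \<bullet> u" "top c \<bullet> u \<le> top a \<bullet> u + W"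
      and cmin: "\<forall>e\<in>idx. top e \<bullet> n = top a \<bullet> n \<and> top a \<bullet> u < top e \<bullet> u \<longrightarrow> top c \<bullet> u \<le> top e \<bullet> u"
      and c'n: "bot c' \<bullet> n = bot b \<bullet> n" "bot c' \<bullet> u < bot b \<bullet> u" "bot b \<bullet> u \<le> bot c' \<bullet> u + W"
      and c'max: "\<forall>e\<in>idx. bot e \<bullet> n = bot b \<bullet> n \<and> bot e \<bullet> u < bot b \<bullet> u \<longrightarrow> bot e \<bullet> u \<le> bot c' \<bullet> u"
      and p: "H c \<theta> < p" "p < H a \<theta>" "G b \<theta> < p" "p < G c' \<theta>"
    have sn: "0 < sin \<theta>" "sin \<theta> \<le> \<theta>" and cs: "1/2 \<le> cos \<theta>"
      using sin_bounds[of \<theta>] cos_ge_half[of \<theta>] \<theta> \<delta>(2) by auto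
    have W\<theta>: "sin \<theta> * W \<le> m"
    proof -
      have "sin \<theta> * W \<le> m / W * W" using sn \<theta> \<delta>(4) W_pos by (intro mult_right_mono) auto
      then show ?thesis using W_pos by simp
    qed
    have lt: "top a \<bullet> n < bot b \<bullet> n" and dich: "\<And>e. e \<in> idx \<Longrightarrow> top e \<bullet> n \<le> top a \<bullet> n \<or> bot b \<bullet> n \<le> bot e \<bullet> n"
      using cor by (auto simp: corridor_def)
    have pa: "top a \<bullet> p' \<theta> - m \<le> p"
    proof -
      have "top a \<bullet> p' \<theta> - top c \<bullet> p' \<theta> = sin \<theta> * (top c \<bullet> u - top a \<bullet> u)"
        unfolding inner_p' cn(1) by (simp add: algebra_simps)
      also have "\<dots> \<le> sin \<theta> * W" using cn sn by (intro mult_left_mono) auto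
      finally show ?thesis using H_upper[OF c top_closure[OF c], of \<theta>] p W\<theta> by linarith
    qed
    have pb: "p \<le> bot b \<bullet> p' \<theta> + m"
    proof -
      have "bot c' \<bullet> p' \<theta> - bot b \<bullet> p' \<theta> = sin \<theta> * (bot b \<bullet> u - bot c' \<bullet> u)"
        unfolding inner_p' c'n(1) by (simp add: algebra_simps)
      also have "\<dots> \<le> sin \<theta> * W" using c'n sn by (intro mult_left_mono) auto
      finally show ?thesis using G_lower[OF c' bot_closure[OF c'], of \<theta>] p W\<theta> by linarith
    qed
    obtain y where y: "y \<in> obs a" "y \<bullet> p' \<theta> = p"
      using \<delta>t(2)[OF a, of \<theta> p] pa p m \<theta> \<delta> by auto
    then show "\<exists>y\<in>obs a. y \<bullet> p' \<theta> = p" by blast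
    fix q assume q: "q \<in> closure (obs a)" "q \<bullet> p' \<theta> = p" and out: "\<forall>t>0. q + t *\<^sub>R v \<theta> \<notin> closure (obs a)"
    obtain y' where y': "y' \<in> obs b" "y' \<bullet> p' \<theta> = p" "dist y' (bot b) < \<epsilon>"
      using \<delta>b(2)[OF b, of \<theta> p] pb p m \<theta> \<delta> by auto
    have dq: "dist q (top a) < \<epsilon>"
      by (rule \<kappa>(2)[OF a q(1), of \<theta>]) (use q(2) pa m \<theta> \<delta> in \<open>auto simp: inner_diff_left\<close>)
    have n_diff: "\<bar>x \<bullet> n - y \<bullet> n\<bar> \<le> dist x y" for x y
      using abs_inner_unit[OF norm_n, of "x - y"] by (simp add: dist_norm inner_diff_left)
    have u_diff: "\<bar>x \<bullet> u - y \<bullet> u\<bar> \<le> dist x y" for x y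
      using abs_inner_unit[OF norm_u, of "x - y"] by (simp add: dist_norm inner_diff_left)
    have qn: "top a \<bullet> n - \<epsilon> < q \<bullet> n" "q \<bullet> n \<le> top a \<bullet> n" using n_diff[of q "top a"] dq top_max[OF a q(1)] by linarith+
    have y'n: "y' \<bullet> n < bot b \<bullet> n + \<epsilon>" "bot b \<bullet> n \<le> y' \<bullet> n"
      using n_diff[of y' "bot b"] y'(3) bot_min[OF b, of y'] y'(1) closure_subset by (linarith, blast)
    define t' where "t' = (y' - q) \<bullet> v \<theta>"
    have y't: "y' = q + t' *\<^sub>R v \<theta>" "(y' - q) \<bullet> n = t' * sin \<theta>"
      unfolding t'_def using on_line(1,3)[of y' \<theta> q] y'(2) q(2) by auto
    have "0 < t' * sin \<theta>" using y't(2) y'n qn lt by (simp add: inner_diff_left)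
    then have t'0: "0 < t'" using sn by (simp add: zero_less_mult_iff)
    have ne: "a \<noteq> b"
    proof
      assume "a = b"
      then have "bot a \<bullet> n > top a \<bullet> n" using lt by simp
      then show False using bot_min[OF a top_closure[OF a]] by linarith
    qed
    define F where "F = (\<Union>e\<in>idx - {a}. frontier (obs e))"
    have clF: "closed F" unfolding F_def by (intro closed_locally_finite_union) (auto simp: frontier_def)
    define S where "S = {t. 0 < t \<and> q + t *\<^sub>R v \<theta> \<in> frontier (table J Ob)}"
    have qF: "q \<notin> F"
      unfolding F_def using disjoint_closures[OF a _ q(1)] by (auto simp: frontier_def)
    \<comment> \<open>The ray never returns to \<open>a\<close>, and \<open>q\<close> is on no other
      obstacle, so the time 0 may be included: \<open>S\<close> is closed and its infimum is a
      genuine collision.\<close>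
    have "S = {0..} \<inter> (\<lambda>t. q + t *\<^sub>R v \<theta>) -` F"
    proof (intro set_eqI iffI)
      fix t assume "t \<in> S"
      then obtain e where e: "0 < t" "e \<in> idx" "q + t *\<^sub>R v \<theta> \<in> frontier (obs e)" unfolding S_def frontier_table by blast
      then have "e \<noteq> a" using out by (auto simp: frontier_def)
      then show "t \<in> {0..} \<inter> (\<lambda>t. q + t *\<^sub>R v \<theta>) -` F" using e unfolding F_def by auto
    next
      fix t assume t: "t \<in> {0..} \<inter> (\<lambda>t. q + t *\<^sub>R v \<theta>) -` F"
      then have "t \<noteq> 0" using qF by auto
      then show "t \<in> S" using t unfolding S_def F_def frontier_table by auto
    qed
    then have "closed S" using clF by (auto intro!: continuous_closed_preimage continuous_intros)
    moreover have bdd: "bdd_below S" by (auto simp: S_def intro!: bdd_belowI[of _ 0])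
    \<comment> \<open>The flight enters \<open>b\<close> at \<open>y'\<close> at the latest, so the
      first collision cannot come after that.\<close>
    moreover have "\<exists>t1\<in>S. t1 \<le> t'"
    proof -
      have qb: "q \<notin> closure (obs b)" using disjoint_closures[OF a b q(1)] ne by blast
      then have "q \<notin> obs b" using closure_subset by blast
      then obtain x where x: "x \<in> closed_segment q y'" "x \<in> frontier (obs b)"
        using connected_Int_frontier[of "closed_segment q y'" "obs b"] y'(1) by auto
      then obtain l where l: "0 \<le> l" "l \<le> 1" "x = (1 - l) *\<^sub>R q + l *\<^sub>R y'" by (auto simp: in_segment)
      then have xt: "x = q + (l * t') *\<^sub>R v \<theta>" unfolding y't(1) by (simp add: algebra_simps)
      have "l \<noteq> 0" using l qb x(2) by (auto simp: frontier_def)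
      then have "l * t' \<in> S" using l t'0 x(2) b xt unfolding S_def frontier_table by auto
      moreover have "l * t' \<le> t'" using l t'0 by (simp add: mult_left_le_one_le)
      ultimately show ?thesis by blast
    qed
    ultimately have S: "Inf S \<in> S" "Inf S \<le> t'"
      using closed_contains_Inf[of S] cInf_lower[OF _ bdd] by fastforce+
    define z where "z = q + Inf S *\<^sub>R v \<theta>"
    have \<tau>: "0 < Inf S" "z \<in> frontier (table J Ob)" using S(1) unfolding S_def z_def by blast+
    then obtain e where e: "e \<in> idx" "z \<in> frontier (obs e)" unfolding frontier_table by blast
    have ze: "z \<in> closure (obs e)" using e(2) by (simp add: frontier_def)
    have ea: "e \<noteq> a" using out \<tau>(1) ze unfolding z_def by blast
    have zp: "z \<bullet> p' \<theta> = p" using q(2) by (simp add: z_def inner_add_left v_inner)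
    have zn: "q \<bullet> n \<le> z \<bullet> n" "z \<bullet> n \<le> y' \<bullet> n" "q \<bullet> u < z \<bullet> u" "z \<bullet> u \<le> y' \<bullet> u"
      using \<tau>(1) sn cs S(2) unfolding z_def y't(1) by (auto simp: inner_add_left v_inner)
    have zq: "z = next_point J Ob q (v \<theta>)" by (simp add: z_def next_point_def flight_time_def S_def)
    have qu: "\<bar>q \<bullet> u - top a \<bullet> u\<bar> < \<epsilon>" "\<bar>y' \<bullet> u - bot b \<bullet> u\<bar> < \<epsilon>"
      using u_diff[of q "top a"] dq u_diff[of y' "bot b"] y'(3) by linarith+
    note eps = \<open>\<epsilon> > 0\<close> \<open>\<epsilon> \<le> g / 4\<close> \<open>\<epsilon> \<le> \<kappa>1\<close> \<open>\<epsilon> \<le> \<kappa>2\<close> \<open>\<epsilon> \<le> \<eta>\<close>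
    have "e = b"
      using dich[OF e(1)]
    proof
      assume le: "top e \<bullet> n \<le> top a \<bullet> n"
      have same: "top e \<bullet> n = top a \<bullet> n"
      proof (rule ccontr)
        assume "top e \<bullet> n \<noteq> top a \<bullet> n"
        then have "top e \<bullet> n + \<eta> \<le> top a \<bullet> n" using le by (intro \<eta>(2)[OF e(1) a]) auto
        then show False using top_max[OF e(1) ze] zn(1) qn(1) eps by linarith
      qed
      \<comment> \<open>An obstacle on the lower side is either behind the start, where the forward
        ray cannot reach its cap, or is \<open>a\<close> itself, or stands at or beyond
        \<open>c\<close>, and then its shadow ends no higher than that of \<open>c\<close>, below
        the line.\<close>
      consider "top e \<bullet> u < top a \<bullet> u" | "top e \<bullet> u = top a \<bullet> u" | "top a \<bullet> u < top e \<bullet> u" by linarith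
      then show "e = b"
      proof cases
        case 1
        have "g \<le> top a \<bullet> u - top e \<bullet> u" by (rule same_height_gap[OF g(2) e(1) a same[symmetric] 1])
        moreover have "dist z (top e) < g / 4"
          by (rule \<kappa>1(2)[OF e(1) ze, of 0]) (use \<kappa>1(1) same zn(1) qn(1) eps in \<open>auto simp: inner_diff_left\<close>)
        then have "\<bar>z \<bullet> u - top e \<bullet> u\<bar> < g / 4" using u_diff[of z "top e"] by linarith
        ultimately show ?thesis using zn(3) qu eps g(1) by linarith
      next
        case 2
        have "top e = top a" using decomp_un[of "top e"] decomp_un[of "top a"] same 2 by metis
        then show ?thesis using disjoint_closures[OF e(1) a top_closure[OF e(1)]] top_closure[OF a] ea by metis
      next
        case 3
        then have "top c \<bullet> u \<le> top e \<bullet> u" using cmin e(1) same by blast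
        have "H e \<theta> \<le> H c \<theta>"
        proof (cases "top c \<bullet> u = top e \<bullet> u")
          case True
          have "top e = top c" using decomp_un[of "top e"] decomp_un[of "top c"] same cn(1) True by metis
          then have "e = c" using disjoint_closures[OF e(1) c top_closure[OF e(1)]] top_closure[OF c] by metis
          then show ?thesis by simp
        next
          case False
          then show ?thesis using \<delta>o(2)[OF c e(1), of \<theta>] \<theta> \<delta>(5) same cn(1) \<open>top c \<bullet> u \<le> top e \<bullet> u\<close> by auto
        qed
        then show ?thesis using p(1) zp H_upper[OF e(1) ze, of \<theta>] by linarith
      qed
    next
      assume le: "bot b \<bullet> n \<le> bot e \<bullet> n"
      have same: "bot e \<bullet> n = bot b \<bullet> n"
      proof (rule ccontr)
        assume "bot e \<bullet> n \<noteq> bot b \<bullet> n"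
        then have "bot b \<bullet> n + \<eta> \<le> bot e \<bullet> n" using le by (intro \<eta>(2)[OF b e(1)]) auto
        then show False using bot_min[OF e(1) ze] zn(2) y'n(1) eps by linarith
      qed
      consider "bot e \<bullet> u < bot b \<bullet> u" | "bot e \<bullet> u = bot b \<bullet> u" | "bot b \<bullet> u < bot e \<bullet> u" by linarith
      then show "e = b"
      proof cases
        case 1
        then have "bot e \<bullet> u \<le> bot c' \<bullet> u" using c'max e(1) same by blast
        have "G c' \<theta> \<le> G e \<theta>"
        proof (cases "bot c' \<bullet> u = bot e \<bullet> u")
          case True
          have "bot e = bot c'" using decomp_un[of "bot e"] decomp_un[of "bot c'"] same c'n(1) True by metis
          then have "e = c'" using disjoint_closures[OF e(1) c' bot_closure[OF e(1)]] bot_closure[OF c'] by metis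
          then show ?thesis by simp
        next
          case False
          then show ?thesis using \<delta>p(2)[OF c' e(1), of \<theta>] \<theta> \<delta>(6) same c'n(1) \<open>bot e \<bullet> u \<le> bot c' \<bullet> u\<close> by auto
        qed
        then show ?thesis using p(4) zp G_lower[OF e(1) ze, of \<theta>] by linarith
      next
        case 2
        have "bot e = bot b" using decomp_un[of "bot e"] decomp_un[of "bot b"] same 2 by metis
        then show ?thesis using disjoint_closures[OF e(1) b bot_closure[OF e(1)]] bot_closure[OF b] by metis
      next
        case 3
        have "g \<le> bot e \<bullet> u - bot b \<bullet> u"
          using frame.same_height_gap[OF flip_frame g(2) e(1) b] same 3 unfolding flip_simps inner_minus_right by auto
        moreover have "dist z (bot e) < g / 4"
          by (rule \<kappa>2(2)[OF e(1) ze, of 0]) (use \<kappa>2(1) same zn(2) y'n(1) eps in \<open>auto simp: inner_diff_left\<close>)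
        then have "\<bar>z \<bullet> u - bot e \<bullet> u\<bar> < g / 4" using u_diff[of z "bot e"] by linarith
        ultimately show ?thesis using zn(4) qu eps g(1) by linarith
      qed
    qed
    then show "next_point J Ob q (v \<theta>) \<in> frontier (obs b)" using e(2) zq by simp
  qed
qed

end

section \<open>Angles, measurability and outgoing vectors\<close>

lemma continuous_rot: "continuous_on S f \<Longrightarrow> continuous_on S (\<lambda>x. rot (f x))"
proof -
  have "linear rot" by (rule linearI) (simp_all add: vec_eq_iff forall_2)
  then have "continuous_on UNIV rot" by (simp add: linear_continuous_on linear_conv_bounded_linear)
  then show "continuous_on S f \<Longrightarrow> continuous_on S (\<lambda>x. rot (f x))" by (auto intro: continuous_on_compose2)
qed

lemma cos_pos_imp:
  assumes "0 < cos x" "\<bar>x\<bar> \<le> 3 * pi / 2" shows "\<bar>x\<bar> < pi / 2"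
proof (rule ccontr)
  assume "\<not> \<bar>x\<bar> < pi / 2"
  then have "0 \<le> cos (\<bar>x\<bar> - pi)" using assms(2) by (intro cos_ge_zero) auto
  then show False using assms(1) by (cases "x \<ge> 0") (auto simp: cos_diff cos_add)
qed

lemma dir_inner_dir:
  assumes "norm u = 1" "norm n = 1" "u \<bullet> n = 0"
  shows "dir u n \<alpha> \<bullet> dir u n \<beta> = cos (\<beta> - \<alpha>)"
proof -
  have *: "u \<bullet> u = 1" "n \<bullet> n = 1" "n \<bullet> u = 0" using assms by (simp_all add: norm_eq_1 inner_commute)
  show ?thesis by (simp add: dir_def inner_add_left inner_add_right * assms(3) cos_diff algebra_simps)
qed

lemma dir_angle_add:
  "cos \<phi> *\<^sub>R dir u n \<beta> + sin \<phi> *\<^sub>R perp_dir u n \<beta> = dir u n (\<beta> + \<phi>)"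
  by (simp add: dir_def perp_dir_def cos_add sin_add algebra_simps)

lemma unit_as_dir:
  assumes "norm u = 1" "norm n = 1" "u \<bullet> n = 0" "norm x = 1"
  obtains \<beta> where "\<bar>\<beta>\<bar> \<le> pi" "x = dir u n \<beta>"
proof -
  have *: "u \<bullet> u = 1" "n \<bullet> n = 1" "n \<bullet> u = 0" using assms by (simp_all add: norm_eq_1 inner_commute)
  have x: "x = (x \<bullet> u) *\<^sub>R u + (x \<bullet> n) *\<^sub>R n" by (rule orthonormal2_decomp[OF assms(1-3)])
  have "x \<bullet> x = (x \<bullet> u)\<^sup>2 + (x \<bullet> n)\<^sup>2"
    using arg_cong[OF x, of "\<lambda>y. y \<bullet> x"] by (simp only: inner_add_left inner_scaleR_left power2_eq_square inner_commute[of u x] inner_commute[of n x])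
  then have "(x \<bullet> u)\<^sup>2 + (x \<bullet> n)\<^sup>2 = 1" using assms(4) by (simp add: norm_eq_1)
  then obtain s where s: "x \<bullet> u = cos s" "x \<bullet> n = sin s" using sincos_total_2pi by metis
  obtain t where t: "- pi < t" "t \<le> pi" "sin t = sin s" "cos t = cos s" using sincos_principal_value by metis
  show ?thesis
  proof (rule that[of t])
    show "\<bar>t\<bar> \<le> pi" using t by linarith
    show "x = dir u n t" using x unfolding dir_def t(3,4) s .
  qed
qed

definition hits :: "(real ^ 2) set \<Rightarrow> real \<Rightarrow> ((real ^ 2) \<times> (real ^ 2)) set" where
  "hits C c = {(q, v). \<exists>t. 0 < t \<and> t \<le> c \<and> q + t *\<^sub>R v \<in> C}"

text \<open>For times between 1 / (m + 1) and c the incidence set is compact and so is its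
  projection. The union over m recovers all positive times up to c.\<close>

lemma borel_hits:
  assumes "compact X" "closed C"
  shows "X \<inter> hits C c \<in> sets borel"
proof -
  define Y where "Y = (\<lambda>m::nat. (X \<times> {1 / real (Suc m)..c}) \<inter> (\<lambda>(x, t). fst x + t *\<^sub>R snd x) -` C)"
  have cont: "continuous_on A (\<lambda>(x, t). fst x + t *\<^sub>R snd x)" for A :: "(((real^2) \<times> (real^2)) \<times> real) set"
    unfolding case_prod_unfold by (intro continuous_intros)
  have "compact (Y m)" for m
  proof -
    have "closed (Y m)"
      unfolding Y_def by (intro continuous_closed_preimage cont closed_Times compact_imp_closed assms) auto
    moreover have "compact (X \<times> {1 / real (Suc m)..c})" by (intro compact_Times assms compact_Icc)
    ultimately have "compact ((X \<times> {1 / real (Suc m)..c}) \<inter> Y m)" by (intro compact_Int_closed)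
    moreover have "(X \<times> {1 / real (Suc m)..c}) \<inter> Y m = Y m" unfolding Y_def by blast
    ultimately show ?thesis by simp
  qed
  then have "closed (fst ` Y m)" for m
    by (intro compact_imp_closed compact_continuous_image continuous_on_fst continuous_on_id)
  then have "(\<Union>m. fst ` Y m) \<in> sets borel" by (intro sets.countable_UN) auto
  also have "(\<Union>m. fst ` Y m) = X \<inter> hits C c"
  proof (intro set_eqI iffI)
    fix x assume "x \<in> (\<Union>m. fst ` Y m)"
    then obtain m t where "(x, t) \<in> Y m" by auto
    then have "x \<in> X" "1 / real (Suc m) \<le> t" "t \<le> c" "fst x + t *\<^sub>R snd x \<in> C" by (auto simp: Y_def)
    moreover have "0 < 1 / real (Suc m)" by simp
    ultimately show "x \<in> X \<inter> hits C c" unfolding hits_def case_prod_unfold using less_le_trans by blast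
  next
    fix x assume x: "x \<in> X \<inter> hits C c"
    then obtain t where t: "0 < t" "t \<le> c" "fst x + t *\<^sub>R snd x \<in> C" by (auto simp: hits_def)
    obtain m where "inverse (real (Suc m)) < t" using reals_Archimedean[OF t(1)] by blast
    then have "(x, t) \<in> Y m" using t x by (auto simp: Y_def inverse_eq_divide)
    then show "x \<in> (\<Union>m. fst ` Y m)" by (metis UN_I UNIV_I fst_conv image_eqI)
  qed
  finally show ?thesis .
qed

context billiard_table
begin

text \<open>If the line missed the obstacle, a separating form would be constant on it and
  supporting at the boundary point. By uniqueness of the normal, \<open>v\<close> would then be
  tangent.\<close>

lemma line_meets_obstacle:
  assumes j: "j \<in> J" and v: "nrm j r \<bullet> v \<noteq> 0"
  obtains s where "\<gamma> j r + s *\<^sub>R v \<in> Ob j"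
proof (rule ccontr)
  assume neg: "\<not> thesis"
  let ?L = "range (\<lambda>s. \<gamma> j r + s *\<^sub>R v)"
  have disj: "Ob j \<inter> ?L = {}" using neg that by auto
  have cL: "convex ?L"
  proof (rule convexI)
    fix x y and a b :: real assume "x \<in> ?L" "y \<in> ?L" and ab: "0 \<le> a" "0 \<le> b" "a + b = 1"
    then obtain s t where "x = \<gamma> j r + s *\<^sub>R v" "y = \<gamma> j r + t *\<^sub>R v" by auto
    then have "a *\<^sub>R x + b *\<^sub>R y = (a + b) *\<^sub>R \<gamma> j r + (a * s + b * t) *\<^sub>R v" by (simp add: algebra_simps)
    then show "a *\<^sub>R x + b *\<^sub>R y \<in> ?L" using ab by auto
  qed
  obtain a b where ab: "a \<noteq> 0" "\<forall>x\<in>Ob j. a \<bullet> x \<le> b" "\<forall>x\<in>?L. b \<le> a \<bullet> x"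
    using separating_hyperplane_sets[OF conjunct2[OF open_convex[OF j]] cL Ob_nonempty[OF j] _ disj] by auto
  have "a \<bullet> \<gamma> j r \<le> b"
    using ab(2) gamma_frontier[OF j, of r] closure_support[of "Ob j" a b "\<gamma> j r"] by (auto simp: frontier_def inner_commute)
  have "a \<bullet> v = 0"
  proof (rule ccontr)
    assume av: "a \<bullet> v \<noteq> 0"
    have "b \<le> a \<bullet> (\<gamma> j r + (- 1 / (a \<bullet> v)) *\<^sub>R v)" using ab(3) by blast
    then show False using av \<open>a \<bullet> \<gamma> j r \<le> b\<close> by (simp add: inner_diff_right)
  qed
  have "b \<le> a \<bullet> (\<gamma> j r + 0 *\<^sub>R v)" using ab(3) by blast
  then have br: "b \<le> a \<bullet> \<gamma> j r" by simp
  have neg: "sgn a \<bullet> (y - \<gamma> j r) \<le> 0" if y: "y \<in> Ob j" for y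
  proof -
    have "a \<bullet> (y - \<gamma> j r) \<le> 0" using ab(2) y br by (force simp: inner_diff_right)
    then show ?thesis by (simp add: sgn_div_norm mult_nonneg_nonpos)
  qed
  then have "nrm j r = sgn a" using ab(1) by (intro table_normal_unique(1)[OF j]) (auto simp: norm_sgn)
  then show False using v \<open>a \<bullet> v = 0\<close> by (simp add: sgn_div_norm)
qed

lemma exit_point:
  assumes j: "j \<in> J" and y: "y \<in> Ob j" and v: "norm v = 1"
  obtains r s where "r \<in> {0..<len j}" "0 < s" "\<gamma> j r = y + s *\<^sub>R v" "0 < nrm j r \<bullet> v"
proof -
  obtain D where D: "\<And>x. x \<in> Ob j \<Longrightarrow> norm x \<le> D" using bounded_Ob[OF j] by (auto simp: bounded_iff)
  define x where "x = y + (D + norm y + 1) *\<^sub>R v"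
  have "norm ((D + norm y + 1) *\<^sub>R v) - norm y \<le> norm x"
    unfolding x_def using norm_diff_ineq[of "(D + norm y + 1) *\<^sub>R v" y] by (simp add: add.commute)
  moreover have "0 \<le> D" using D[OF y] norm_ge_zero order_trans by blast
  ultimately have "x \<notin> Ob j" using D[of x] v by auto
  then obtain z where z: "z \<in> closed_segment y x" "z \<in> frontier (Ob j)"
    using connected_Int_frontier[of "closed_segment y x" "Ob j"] y by auto
  then obtain l where l: "0 \<le> l" "z = (1 - l) *\<^sub>R y + l *\<^sub>R x" by (auto simp: in_segment)
  define s where "s = l * (D + norm y + 1)"
  have zs: "z = y + s *\<^sub>R v" using l(2) by (simp add: x_def s_def algebra_simps)
  have "z \<noteq> y" using z(2) y open_convex[OF j] by (auto simp: frontier_def interior_open)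
  then have s: "0 < s" using l(1) \<open>0 \<le> D\<close> zs unfolding s_def by (cases "l = 0") (auto intro!: mult_pos_pos add_nonneg_pos)
  obtain r where r: "r \<in> {0..<len j}" "\<gamma> j r = z" using z(2) gamma_image[OF j] by (metis imageE)
  have "nrm j r \<bullet> (y - \<gamma> j r) < 0" by (rule normal_neg[OF j y])
  then have "0 < nrm j r \<bullet> v" using s by (simp add: r(2) zs zero_less_mult_iff)
  then show ?thesis using that r s zs by blast
qed

lemma leaves_obstacle:
  assumes j: "j \<in> J" and v: "0 < nrm j r \<bullet> v" and t: "0 < t"
  shows "\<gamma> j r + t *\<^sub>R v \<notin> closure (Ob j)"
proof
  assume "\<gamma> j r + t *\<^sub>R v \<in> closure (Ob j)"
  moreover have "y \<bullet> nrm j r \<le> \<gamma> j r \<bullet> nrm j r" if "y \<in> Ob j" for y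
    using normal_neg[OF j that, of r] unfolding inner_commute[of "nrm j r"] inner_diff_left by simp
  ultimately have "(\<gamma> j r + t *\<^sub>R v) \<bullet> nrm j r \<le> \<gamma> j r \<bullet> nrm j r" using closure_support by blast
  then have "t * (nrm j r \<bullet> v) \<le> 0" unfolding inner_commute[of _ "nrm j r"] inner_add_right by simp
  then show False using v t by (simp add: mult_le_0_iff)
qed

text \<open>A vector with base point on the boundary of a convex obstacle is post-collisional iff its ray
  avoids the obstacle; this makes the phase space compact.\<close>

lemma phase_space_iff:
  "(q, v) \<in> phase_space J Ob \<longleftrightarrow> norm v = 1 \<and> (\<exists>j\<in>J. q \<in> frontier (Ob j) \<and> (\<forall>t>0. q + t *\<^sub>R v \<notin> Ob j))"
proof -
  have "0 \<le> table_normal (Ob j) q \<bullet> v \<longleftrightarrow> (\<forall>t>0. q + t *\<^sub>R v \<notin> Ob j)" if j: "j \<in> J" and q: "q \<in> frontier (Ob j)" for j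
  proof -
    obtain r where r: "\<gamma> j r = q" using q gamma_image[OF j] by (metis imageE)
    show ?thesis
    proof
      assume nv: "0 \<le> table_normal (Ob j) q \<bullet> v"
      show "\<forall>t>0. q + t *\<^sub>R v \<notin> Ob j"
      proof (intro allI impI notI)
        fix t :: real assume t: "0 < t" "q + t *\<^sub>R v \<in> Ob j"
        have "nrm j r \<bullet> ((q + t *\<^sub>R v) - \<gamma> j r) < 0" by (rule normal_neg[OF j t(2)])
        then show False using nv t(1) r by (simp add: mult_less_0_iff)
      qed
    next
      assume out: "\<forall>t>0. q + t *\<^sub>R v \<notin> Ob j"
      show "0 \<le> table_normal (Ob j) q \<bullet> v"
      proof (rule ccontr)
        assume "\<not> ?thesis"
        then have neg: "nrm j r \<bullet> v < 0" using r by simp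
        then obtain s where s: "\<gamma> j r + s *\<^sub>R v \<in> Ob j" using line_meets_obstacle[OF j, of r v] by auto
        have "nrm j r \<bullet> ((\<gamma> j r + s *\<^sub>R v) - \<gamma> j r) < 0" by (rule normal_neg[OF j s])
        then have "0 < s" using neg by (simp add: mult_less_0_iff)
        then show False using out s r by auto
      qed
    qed
  qed
  then show ?thesis unfolding phase_space_def by auto
qed

lemma compact_phase_space: "compact (phase_space J Ob)"
proof -
  have "compact ((frontier (Ob j) \<times> sphere 0 1) - (\<Union>t\<in>{0<..}. {(q, v). q + t *\<^sub>R v \<in> Ob j}))" if j: "j \<in> J" for j
  proof (rule compact_diff)
    show "compact (frontier (Ob j) \<times> sphere (0::real^2) 1)"
      using compact_frontier_bounded[OF bounded_Ob[OF j]] by (intro compact_Times) auto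
    have "open ((\<lambda>x. fst x + t *\<^sub>R snd x) -` Ob j)" for t
      using open_convex[OF j] by (intro open_vimage continuous_intros) auto
    moreover have "{(q, v). q + t *\<^sub>R v \<in> Ob j} = (\<lambda>x. fst x + t *\<^sub>R snd x) -` Ob j" for t by auto
    ultimately show "open (\<Union>t\<in>{0<..}. {(q, v). q + t *\<^sub>R v \<in> Ob j})" by auto
  qed
  then have "compact (\<Union>j\<in>J. (frontier (Ob j) \<times> sphere 0 1) - (\<Union>t\<in>{0<..}. {(q, v). q + t *\<^sub>R v \<in> Ob j}))"
    using finite_J by (intro compact_UN) auto
  also have "\<dots> = phase_space J Ob"
  proof (intro set_eqI)
    fix x :: "(real ^ 2) \<times> (real ^ 2)"
    obtain q v where x: "x = (q, v)" by fastforce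
    show "x \<in> (\<Union>j\<in>J. (frontier (Ob j) \<times> sphere 0 1) - (\<Union>t\<in>{0<..}. {(q, v). q + t *\<^sub>R v \<in> Ob j})) \<longleftrightarrow> x \<in> phase_space J Ob"
      unfolding x phase_space_iff by (simp add: Ball_def) blast
  qed
  finally show ?thesis .
qed

subsection \<open>The invariant measure as a measure on lines\<close>

definition cell_frontier :: "int ^ 2 \<Rightarrow> (real ^ 2) set" where
  "cell_frontier z = (\<Union>j\<in>J. frontier (obs (j, z)))"

definition other_frontier :: "int ^ 2 \<Rightarrow> (real ^ 2) set" where
  "other_frontier z = (\<Union>a\<in>{a\<in>idx. snd a \<noteq> z}. frontier (obs a))"

lemma closed_frontiers: "closed (cell_frontier z)" "closed (other_frontier z)" "closed (frontier (table J Ob))"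
proof -
  have "closed (\<Union>a\<in>J \<times> {z}. frontier (obs a))"
    by (rule closed_locally_finite_union) (auto simp: frontier_def)
  then show "closed (cell_frontier z)" by (simp add: cell_frontier_def Sigma_def)
  show "closed (other_frontier z)"
    unfolding other_frontier_def by (rule closed_locally_finite_union) (auto simp: frontier_def)
qed simp

lemma frontier_table_split: "frontier (table J Ob) = cell_frontier z \<union> other_frontier z"
proof (intro set_eqI iffI)
  fix x assume "x \<in> frontier (table J Ob)"
  then obtain j y where "j \<in> J" "x \<in> frontier (obs (j, y))" by (auto simp: frontier_table idx_def)
  then show "x \<in> cell_frontier z \<union> other_frontier z"
    by (cases "y = z") (auto simp: cell_frontier_def other_frontier_def)
next
  fix x assume "x \<in> cell_frontier z \<union> other_frontier z"
  then obtain a where "a \<in> idx" "x \<in> frontier (obs a)"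
    unfolding cell_frontier_def other_frontier_def by (auto simp: idx_def)
  then show "x \<in> frontier (table J Ob)" unfolding frontier_table by blast
qed

lemma frontiers_disjoint: "x \<in> cell_frontier z \<Longrightarrow> x \<notin> other_frontier z"
  using disjoint_closures[of "(_, z)"] unfolding cell_frontier_def other_frontier_def by (fastforce simp: frontier_def)

lemma cell_change_eq:
  assumes "next_point J Ob q v \<in> cell_frontier z"
  shows "cell_change J Ob (q, v) = z"
  unfolding cell_change_def prod.case
proof (rule the_equality)
  show "\<exists>j\<in>J. next_point J Ob q v \<in> frontier (obstacle Ob j z)" using assms by (auto simp: cell_frontier_def)
  fix z' assume "\<exists>j\<in>J. next_point J Ob q v \<in> frontier (obstacle Ob j z')"
  then show "z' = z" using frontiers_disjoint[OF assms] by (auto simp: other_frontier_def idx_def)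
qed

text \<open>For a far away cell, the cell change records a genuine collision: the junk values of the
  infimum of an empty set and of an undefined description stay in a bounded region.\<close>

lemma far_cell_change:
  "\<exists>B. \<forall>z. B < norm (lat z) \<longrightarrow> (\<forall>q v. (q, v) \<in> phase_space J Ob \<longrightarrow> cell_change J Ob (q, v) = z \<longrightarrow>
    0 < flight_time J Ob q v \<and> next_point J Ob q v \<in> cell_frontier z \<and>
    (\<forall>t. 0 < t \<and> t < flight_time J Ob q v \<longrightarrow> q + t *\<^sub>R v \<notin> frontier (table J Ob)))"
proof -
  obtain D where D: "D > 0" "\<And>j. j \<in> J \<Longrightarrow> closure (Ob j) \<subseteq> ball 0 D" using diameter_bound by blast
  define c0 where "c0 = Inf ({} :: real set)"
  define z0 where "z0 = (THE z::int^2. False)"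
  \<comment> \<open>A junk flight time \<open>c0\<close> leads to cells of norm below 2 D + |c0|, a
    zero infimum to norm below 2 D, and a junk description to the cell \<open>z0\<close>; all of
    these stay below \<open>B\<close>.\<close>
  define B where "B = 2 * D + \<bar>c0\<bar> + norm (lat z0)"
  have bound: "norm (lat z) < 2 * D + \<bar>t\<bar>"
    if ps: "(q, v) \<in> phase_space J Ob" and cf: "q + t *\<^sub>R v \<in> cell_frontier z" for q v t z
  proof -
    obtain i where i: "i \<in> J" "q \<in> frontier (Ob i)" "norm v = 1" using ps unfolding phase_space_iff by blast
    obtain k where k: "k \<in> J" "q + t *\<^sub>R v - lat z \<in> frontier (Ob k)"
      using cf by (auto simp: cell_frontier_def mem_frontier_obstacle_iff)
    have "norm q < D" "norm (q + t *\<^sub>R v - lat z) < D"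
      using D(2)[OF i(1)] D(2)[OF k(1)] i k by (auto simp: frontier_def subset_iff)
    moreover have "norm (t *\<^sub>R v) = \<bar>t\<bar>" using i by simp
    moreover have "norm (lat z) \<le> norm q + norm (t *\<^sub>R v) + norm (q + t *\<^sub>R v - lat z)"
      using norm_triangle_ineq4[of "q + t *\<^sub>R v" "q + t *\<^sub>R v - lat z"] norm_triangle_ineq[of q "t *\<^sub>R v"] by simp
    ultimately show ?thesis by linarith
  qed
  show ?thesis
  proof (intro exI[of _ B] allI impI)
    fix z q v assume z: "B < norm (lat z)" and x: "(q, v) \<in> phase_space J Ob" and cc: "cell_change J Ob (q, v) = z"
    define S where "S = {t. 0 < t \<and> q + t *\<^sub>R v \<in> frontier (table J Ob)}"
    have ft: "flight_time J Ob q v = Inf S" by (simp add: flight_time_def S_def)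
    have np: "next_point J Ob q v = q + Inf S *\<^sub>R v" by (simp add: next_point_def ft)
    have ex: "next_point J Ob q v \<in> cell_frontier z"
    proof (rule ccontr)
      assume n: "next_point J Ob q v \<notin> cell_frontier z"
      have "\<nexists>y. next_point J Ob q v \<in> cell_frontier y" using cell_change_eq cc n by blast
      then have "(\<lambda>z. \<exists>j\<in>J. next_point J Ob q v \<in> frontier (obstacle Ob j z)) = (\<lambda>z. False)"
        by (auto simp: cell_frontier_def)
      then have "z = z0" using cc by (simp add: cell_change_def z0_def)
      then show False using z D(1) by (simp add: B_def)
    qed
    have ne: "S \<noteq> {}"
    proof
      assume "S = {}"
      then have "norm (lat z) < 2 * D + \<bar>c0\<bar>" using bound[OF x, of "Inf S" z] ex np by (simp add: c0_def)
      then show False using z norm_ge_zero[of "lat z0"] by (simp add: B_def)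
    qed
    have bdd: "bdd_below S" by (auto simp: S_def intro!: bdd_belowI[of _ 0])
    have "0 \<le> Inf S" using ne by (intro cInf_greatest) (auto simp: S_def)
    moreover have "Inf S \<noteq> 0"
    proof
      assume "Inf S = 0"
      then have "norm (lat z) < 2 * D" using bound[OF x, of "Inf S" z] ex np by simp
      then show False using z norm_ge_zero[of "lat z0"] abs_ge_zero[of c0] unfolding B_def by linarith
    qed
    ultimately have pos: "0 < Inf S" by simp
    show "0 < flight_time J Ob q v \<and> next_point J Ob q v \<in> cell_frontier z \<and>
      (\<forall>t. 0 < t \<and> t < flight_time J Ob q v \<longrightarrow> q + t *\<^sub>R v \<notin> frontier (table J Ob))"
    proof (intro conjI allI impI ex)
      show "0 < flight_time J Ob q v" using pos ft by simp
      fix t assume t: "0 < t \<and> t < flight_time J Ob q v"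
      show "q + t *\<^sub>R v \<notin> frontier (table J Ob)"
      proof
        assume "q + t *\<^sub>R v \<in> frontier (table J Ob)"
        then have "t \<in> S" using t by (simp add: S_def)
        then show False using cInf_lower[OF _ bdd] t ft by force
      qed
    qed
  qed
qed

text \<open>The next collision is in the cell z exactly when, for some rational time c, the flight
  has met the boundary of that cell by time c and that of no other cell. This is a countable union
  of differences of hitting sets.\<close>

lemma borel_cell_change:
  "\<exists>B. \<forall>z. B < norm (lat z) \<longrightarrow> {x \<in> phase_space J Ob. cell_change J Ob x = z} \<in> sets borel"
proof -
  obtain B where B: "\<And>z q v. B < norm (lat z) \<Longrightarrow> (q, v) \<in> phase_space J Ob \<Longrightarrow> cell_change J Ob (q, v) = z \<Longrightarrow>
    0 < flight_time J Ob q v \<and> next_point J Ob q v \<in> cell_frontier z \<and>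
    (\<forall>t. 0 < t \<and> t < flight_time J Ob q v \<longrightarrow> q + t *\<^sub>R v \<notin> frontier (table J Ob))"
    using far_cell_change by meson
  show ?thesis
  proof (intro exI[of _ "max B 0"] allI impI)
    fix z assume z: "max B 0 < norm (lat z)"
    \<comment> \<open>The base point lies on an obstacle of the cell 0, hence not in the cell z.
      This separates collision times with that cell from 0 and makes the infimum below
      attained.\<close>
    then have z0: "z \<noteq> 0" by auto
    let ?X = "phase_space J Ob"
    have "{x \<in> ?X. cell_change J Ob x = z} = (\<Union>c\<in>\<rat> \<inter> {0<..}. (?X \<inter> hits (cell_frontier z) c) - (?X \<inter> hits (other_frontier z) c))"
    proof (intro set_eqI iffI)
      fix x assume "x \<in> {x \<in> ?X. cell_change J Ob x = z}"
      then obtain q v where x: "x = (q, v)" "(q, v) \<in> ?X" "cell_change J Ob (q, v) = z" by (cases x) auto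
      define T where "T = flight_time J Ob q v"
      have T: "0 < T" "q + T *\<^sub>R v \<in> cell_frontier z" "\<And>t. 0 < t \<Longrightarrow> t < T \<Longrightarrow> q + t *\<^sub>R v \<notin> frontier (table J Ob)"
        using B[OF _ x(2,3)] z unfolding T_def next_point_def by auto
      \<comment> \<open>The boundaries of the other cells form a closed set that avoids the
        collision point, so none of them is met during a short time after the collision; a rational
        time is picked there.\<close>
      have "open ((\<lambda>t. q + t *\<^sub>R v) -` (- other_frontier z))"
        using closed_frontiers(2) by (intro open_vimage continuous_intros) auto
      moreover have "T \<in> (\<lambda>t. q + t *\<^sub>R v) -` (- other_frontier z)" using frontiers_disjoint[OF T(2)] by simp
      ultimately obtain e where e: "e > 0" "ball T e \<subseteq> (\<lambda>t. q + t *\<^sub>R v) -` (- other_frontier z)"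
        using open_contains_ball by blast
      obtain c where c: "c \<in> \<rat>" "T < c" "c < T + e" using Rats_dense_in_real[of T "T + e"] e(1) by auto
      have "q + t *\<^sub>R v \<notin> other_frontier z" if "0 < t" "t \<le> c" for t
      proof (cases "t < T")
        case True
        then show ?thesis using T(3) that frontier_table_split by blast
      next
        case False
        then have "t \<in> ball T e" using that c by (simp add: dist_real_def)
        then show ?thesis using e(2) by auto
      qed
      then have "x \<in> (?X \<inter> hits (cell_frontier z) c) - (?X \<inter> hits (other_frontier z) c)"
        using x T c by (auto simp: hits_def intro: less_imp_le)
      then show "x \<in> (\<Union>c\<in>\<rat> \<inter> {0<..}. (?X \<inter> hits (cell_frontier z) c) - (?X \<inter> hits (other_frontier z) c))"
        using c T(1) by (intro UN_I[of c]) auto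
    next
      fix x assume "x \<in> (\<Union>c\<in>\<rat> \<inter> {0<..}. (?X \<inter> hits (cell_frontier z) c) - (?X \<inter> hits (other_frontier z) c))"
      then obtain c where c: "x \<in> ?X" "x \<in> hits (cell_frontier z) c" "x \<notin> hits (other_frontier z) c" by blast
      obtain q v where x: "x = (q, v)" "(q, v) \<in> ?X" using c(1) by (cases x) auto
      obtain t0 where t0: "0 < t0" "t0 \<le> c" "q + t0 *\<^sub>R v \<in> cell_frontier z" using c(2) x by (auto simp: hits_def)
      have no: "\<And>t. 0 < t \<Longrightarrow> t \<le> c \<Longrightarrow> q + t *\<^sub>R v \<notin> other_frontier z" using c(3) x by (auto simp: hits_def)
      define S where "S = {t. 0 < t \<and> q + t *\<^sub>R v \<in> frontier (table J Ob)}"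
      have bdd: "bdd_below S" by (auto simp: S_def intro!: bdd_belowI[of _ 0])
      have t0S: "t0 \<in> S" using t0 frontier_table_split by (auto simp: S_def)
      obtain i where i: "i \<in> J" "q \<in> frontier (Ob i)" using x(2) unfolding phase_space_iff by blast
      have "q \<in> other_frontier z" unfolding other_frontier_def using i z0 by (intro UN_I[of "(i, 0)"]) auto
      then have qz: "q \<notin> cell_frontier z" using frontiers_disjoint by blast
      have eq: "S \<inter> {..c} = {0..c} \<inter> (\<lambda>t. q + t *\<^sub>R v) -` cell_frontier z"
      proof (intro set_eqI iffI)
        fix t assume "t \<in> S \<inter> {..c}"
        then show "t \<in> {0..c} \<inter> (\<lambda>t. q + t *\<^sub>R v) -` cell_frontier z"
          using no[of t] frontier_table_split[of z] by (auto simp: S_def)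
      next
        fix t assume t: "t \<in> {0..c} \<inter> (\<lambda>t. q + t *\<^sub>R v) -` cell_frontier z"
        then have "t \<noteq> 0" using qz by auto
        then show "t \<in> S \<inter> {..c}" using t frontier_table_split[of z] by (auto simp: S_def)
      qed
      have "closed (S \<inter> {..c})" unfolding eq
        using closed_frontiers(1) by (auto intro!: continuous_closed_preimage continuous_intros)
      moreover have "S \<inter> {..c} \<noteq> {}" "bdd_below (S \<inter> {..c})" using t0S t0 bdd by (auto intro: bdd_below_mono)
      ultimately have I: "Inf (S \<inter> {..c}) \<in> S \<inter> {..c}" by (intro closed_contains_Inf)
      have "Inf S = Inf (S \<inter> {..c})"
      proof (rule antisym)
        show "Inf S \<le> Inf (S \<inter> {..c})" using I cInf_lower[OF _ bdd] by blast
        show "Inf (S \<inter> {..c}) \<le> Inf S"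
        proof (rule cInf_greatest)
          fix t assume t: "t \<in> S"
          show "Inf (S \<inter> {..c}) \<le> t"
          proof (cases "t \<le> c")
            case True
            then show ?thesis using t bdd by (intro cInf_lower) (auto intro: bdd_below_mono)
          next
            case False
            then show ?thesis using I by auto
          qed
        qed (use t0S in auto)
      qed
      then have "next_point J Ob q v \<in> cell_frontier z"
        using I eq by (auto simp: next_point_def flight_time_def S_def)
      then show "x \<in> {x \<in> ?X. cell_change J Ob x = z}" using x cell_change_eq by auto
    qed
    moreover have "countable (\<rat> \<inter> {0<..} :: real set)" by (simp add: countable_rat)
    ultimately show "{x \<in> ?X. cell_change J Ob x = z} \<in> sets borel"
      using borel_hits[OF compact_phase_space] closed_frontiers by (auto intro!: sets.countable_UN' sets.Diff)
  qed
qed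

section \<open>Flux through an obstacle in a fixed direction\<close>

text \<open>The inner product of normal and \<open>v\<close> is the cosine of the reflection angle,
  so this is the mass per unit angle emitted in direction \<open>v\<close>, without the factor 1 /
  (2 perimeter). The maximum discards vectors pointing into the obstacle.\<close>

definition flux :: "'j \<Rightarrow> ((real ^ 2) \<times> (real ^ 2)) set \<Rightarrow> real ^ 2 \<Rightarrow> ennreal" where
  "flux j S v = (\<integral>\<^sup>+r. ennreal (if 0 \<le> r \<and> r < len j then max 0 (nrm j r \<bullet> v) else 0) * indicator S (\<gamma> j r, v) \<partial>lborel)"

lemma measurable_gamma [measurable]: "j \<in> J \<Longrightarrow> \<gamma> j \<in> borel_measurable borel"
  "j \<in> J \<Longrightarrow> vderiv (\<gamma> j) \<in> borel_measurable borel"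
  using continuous_gamma continuous_gamma' by (simp_all add: borel_measurable_continuous_onI)

text \<open>Replaces the description of the normal by a formula in the tangent, with a sign decided
  by an inner point, from which measurability is evident.\<close>

lemma normal_eq_rot:
  assumes j: "j \<in> J" and c: "c \<in> Ob j"
  shows "nrm j r = (if rot (vderiv (\<gamma> j) r) \<bullet> (c - \<gamma> j r) < 0 then rot (vderiv (\<gamma> j) r) else - rot (vderiv (\<gamma> j) r))"
proof -
  have "nrm j r = rot (vderiv (\<gamma> j) r) \<or> nrm j r = - rot (vderiv (\<gamma> j) r)"
    by (rule orth_unit_cases[OF norm_gamma'[OF j, of r]]) (use norm_gamma'[OF j] norm_normal[OF j] normal_orth[OF j] in auto)
  then show ?thesis using normal_neg[OF j c, of r] by auto
qed

lemma measurable_normal [measurable]: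
  assumes j: "j \<in> J" shows "nrm j \<in> borel_measurable borel"
proof -
  obtain c where c: "c \<in> Ob j" using Ob_nonempty[OF j] by blast
  have [measurable]: "(\<lambda>r. rot (vderiv (\<gamma> j) r)) \<in> borel_measurable borel"
    by (intro borel_measurable_continuous_onI continuous_rot continuous_gamma' j)
  have "(\<lambda>r. if rot (vderiv (\<gamma> j) r) \<bullet> (c - \<gamma> j r) < 0 then rot (vderiv (\<gamma> j) r) else - rot (vderiv (\<gamma> j) r)) \<in> borel_measurable borel"
    using j by measurable
  then show ?thesis using normal_eq_rot[OF j c] by simp
qed

abbreviation out_vec :: "'j \<Rightarrow> real \<Rightarrow> real \<Rightarrow> real ^ 2" where
  "out_vec j r \<phi> \<equiv> cos \<phi> *\<^sub>R nrm j r + sin \<phi> *\<^sub>R vderiv (\<gamma> j) r"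

lemma emeasure_billiard:
  assumes S: "S \<in> sets borel"
  shows "emeasure (billiard_measure J Ob \<gamma> len) S = (\<Sum>j\<in>J. \<integral>\<^sup>+r. \<integral>\<^sup>+\<phi>.
     (if 0 \<le> r \<and> r < len j \<and> \<bar>\<phi>\<bar> \<le> pi / 2 then ennreal (cos \<phi> / (2 * perimeter J len)) else 0) *
     indicator S (\<gamma> j r, out_vec j r \<phi>) \<partial>lborel \<partial>lborel)"
proof -
  let ?M = "count_space J \<Otimes>\<^sub>M (lborel \<Otimes>\<^sub>M lborel) :: ('j \<times> real \<times> real) measure"
  let ?d = "\<lambda>(j, r, \<phi>). if 0 \<le> r \<and> r < len j \<and> \<bar>\<phi>\<bar> \<le> pi / 2 then ennreal (cos \<phi> / (2 * perimeter J len)) else 0"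
  let ?f = "\<lambda>(j, r, \<phi>). (\<gamma> j r, out_vec j r \<phi>)"
  note [measurable] = S
  have d: "?d \<in> borel_measurable ?M"
    using finite_J by (intro measurable_pair_measure_countable1) (auto simp: countable_finite)
  have f: "?f \<in> measurable ?M borel"
    using finite_J by (intro measurable_pair_measure_countable1) (auto simp: countable_finite)
  note [measurable] = d f
  have fS: "?f -` S \<inter> space ?M \<in> sets ?M" by measurable
  have sf: "sigma_finite_measure (lborel \<Otimes>\<^sub>M lborel :: (real \<times> real) measure)"
    by (rule sigma_finite_pair_measure) (rule lborel.sigma_finite_measure_axioms)+
  have "emeasure (billiard_measure J Ob \<gamma> len) S = emeasure (density ?M ?d) (?f -` S \<inter> space ?M)"
    unfolding billiard_measure_def by (subst emeasure_distr) auto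
  also have "\<dots> = (\<integral>\<^sup>+x. ?d x * indicator (?f -` S \<inter> space ?M) x \<partial>?M)"
    by (rule emeasure_density[OF d fS])
  also have "\<dots> = (\<integral>\<^sup>+x. ?d x * indicator S (?f x) \<partial>?M)"
    by (intro nn_integral_cong) (auto split: split_indicator)
  also have "\<dots> = (\<integral>\<^sup>+j. \<integral>\<^sup>+y. ?d (j, y) * indicator S (?f (j, y)) \<partial>(lborel \<Otimes>\<^sub>M lborel) \<partial>count_space J)"
    by (subst sigma_finite_measure.nn_integral_fst[OF sf]) measurable
  also have "\<dots> = (\<Sum>j\<in>J. \<integral>\<^sup>+y. ?d (j, y) * indicator S (?f (j, y)) \<partial>(lborel \<Otimes>\<^sub>M lborel))"
    using finite_J by (rule nn_integral_count_space_finite)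
  also have "\<dots> = (\<Sum>j\<in>J. \<integral>\<^sup>+r. \<integral>\<^sup>+\<phi>. ?d (j, r, \<phi>) * indicator S (?f (j, r, \<phi>)) \<partial>lborel \<partial>lborel)"
    by (intro sum.cong refl lborel.nn_integral_fst[symmetric]) auto
  finally show ?thesis by simp
qed

text \<open>Passes from the angle \<phi> with the normal to the angle with \<open>u\<close>, namely
  \<theta> = \<beta> + \<tau> \<phi>. Here \<beta> is the direction of the normal and the sign
  \<tau> records the orientation of the parametrization. The condition \<open>Su\<close> restricts
  \<theta> to the open half-turn around \<open>u\<close>.\<close>

lemma rotate_angle:
  assumes j: "j \<in> J" and un: "norm u = 1" "norm n = 1" "u \<bullet> n = 0" and S: "S \<in> sets borel"
    and Su: "\<And>q v. (q, v) \<in> S \<Longrightarrow> 0 < v \<bullet> u"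
  shows "(\<integral>\<^sup>+\<phi>. (if \<bar>\<phi>\<bar> \<le> pi / 2 then ennreal (cos \<phi> * c) else 0) * indicator S (\<gamma> j r, out_vec j r \<phi>) \<partial>lborel) =
    (\<integral>\<^sup>+\<theta>. (if \<bar>\<theta>\<bar> < pi / 2 then ennreal (max 0 (nrm j r \<bullet> dir u n \<theta>) * c) else 0) * indicator S (\<gamma> j r, dir u n \<theta>) \<partial>lborel)"
proof -
  note [measurable] = S
  obtain \<beta> where \<beta>: "\<bar>\<beta>\<bar> \<le> pi" "nrm j r = dir u n \<beta>" using unit_as_dir[OF un norm_normal[OF j]] .
  have "vderiv (\<gamma> j) r = perp_dir u n \<beta> \<or> vderiv (\<gamma> j) r = - perp_dir u n \<beta>"
    using normal_orth[OF j, of r] norm_gamma'[OF j] dir_perp_orthonormal[OF un, of \<beta>] \<beta>(2)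
    by (intro orth_unit_cases[of "dir u n \<beta>"]) (auto simp: inner_commute)
  then obtain \<tau> :: real where \<tau>: "\<tau> = 1 \<or> \<tau> = - 1" "vderiv (\<gamma> j) r = \<tau> *\<^sub>R perp_dir u n \<beta>"
    by (metis scaleR_one scaleR_minus1_left)
  have ov: "out_vec j r \<phi> = dir u n (\<beta> + \<tau> * \<phi>)" for \<phi>
  proof -
    have "out_vec j r \<phi> = cos (\<tau> * \<phi>) *\<^sub>R dir u n \<beta> + sin (\<tau> * \<phi>) *\<^sub>R perp_dir u n \<beta>"
      using \<tau>(1) unfolding \<beta>(2) \<tau>(2) by auto
    then show ?thesis by (simp add: dir_angle_add)
  qed
  have cont: "continuous_on A (\<lambda>\<theta>. dir u n \<theta>)" for A unfolding dir_def by (intro continuous_intros)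
  have [measurable]: "(\<lambda>\<theta>. dir u n \<theta>) \<in> borel_measurable borel" by (rule borel_measurable_continuous_onI[OF cont])
  let ?g = "\<lambda>\<phi>. (if \<bar>\<phi>\<bar> \<le> pi / 2 then ennreal (cos \<phi> * c) else 0) * indicator S (\<gamma> j r, dir u n (\<beta> + \<tau> * \<phi>))"
  have "(\<integral>\<^sup>+\<phi>. ?g \<phi> \<partial>lborel) = \<bar>\<tau>\<bar> * (\<integral>\<^sup>+\<theta>. ?g (- \<tau> * \<beta> + \<tau> * \<theta>) \<partial>lborel)"
    using \<tau>(1) by (intro nn_integral_real_affine) auto
  also have "\<dots> = (\<integral>\<^sup>+\<theta>. ?g (- \<tau> * \<beta> + \<tau> * \<theta>) \<partial>lborel)" using \<tau>(1) by auto
  also have "\<dots> = (\<integral>\<^sup>+\<theta>. (if \<bar>\<theta>\<bar> < pi / 2 then ennreal (max 0 (nrm j r \<bullet> dir u n \<theta>) * c) else 0) * indicator S (\<gamma> j r, dir u n \<theta>) \<partial>lborel)"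
  proof (rule nn_integral_cong)
    fix \<theta> :: real
    have e: "- \<tau> * \<beta> + \<tau> * \<theta> = \<tau> * (\<theta> - \<beta>)" "\<beta> + \<tau> * (\<tau> * (\<theta> - \<beta>)) = \<theta>" using \<tau>(1) by (auto simp: algebra_simps)
    have e2: "\<bar>\<tau> * (\<theta> - \<beta>)\<bar> = \<bar>\<theta> - \<beta>\<bar>" "cos (\<tau> * (\<theta> - \<beta>)) = cos (\<theta> - \<beta>)" using \<tau>(1) by (auto simp: cos_minus[of "\<theta> - \<beta>", symmetric] simp del: cos_minus)
    have nd: "nrm j r \<bullet> dir u n \<theta> = cos (\<theta> - \<beta>)" unfolding \<beta>(2) by (rule dir_inner_dir[OF un])
    show "?g (- \<tau> * \<beta> + \<tau> * \<theta>) = (if \<bar>\<theta>\<bar> < pi / 2 then ennreal (max 0 (nrm j r \<bullet> dir u n \<theta>) * c) else 0) * indicator S (\<gamma> j r, dir u n \<theta>)"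
    proof (cases "(\<gamma> j r, dir u n \<theta>) \<in> S")
      case False
      then show ?thesis unfolding e by simp
    next
      case True
      have "u \<bullet> u = 1" "n \<bullet> u = 0" using un by (simp_all add: norm_eq_1 inner_commute)
      then have cp: "0 < cos \<theta>" using Su[OF True] by (simp add: dir_def inner_add_left)
      show ?thesis
      proof (cases "\<bar>\<theta> - \<beta>\<bar> \<le> pi / 2")
        case True2: True
        \<comment> \<open>With |\<beta>| at most pi and |\<phi>| at most pi / 2, the angle \<theta>
          could lie outside its principal range; positivity of its cosine selects the right
          branch.\<close>
        then have "\<bar>\<theta>\<bar> \<le> 3 * pi / 2" using \<beta>(1) by linarith
        then have "\<bar>\<theta>\<bar> < pi / 2" by (rule cos_pos_imp[OF cp])
        moreover have "0 \<le> cos (\<theta> - \<beta>)" using True2 by (intro cos_ge_zero; linarith)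
        ultimately show ?thesis using True True2 unfolding e e2 nd by simp
      next
        case False
        have "\<bar>\<theta>\<bar> < pi / 2 \<Longrightarrow> cos (\<theta> - \<beta>) \<le> 0"
        proof (rule ccontr)
          assume t: "\<bar>\<theta>\<bar> < pi / 2" and "\<not> cos (\<theta> - \<beta>) \<le> 0"
          moreover have "\<bar>\<theta> - \<beta>\<bar> \<le> 3 * pi / 2" using t \<beta>(1) by linarith
          ultimately have "\<bar>\<theta> - \<beta>\<bar> < pi / 2" by (intro cos_pos_imp) auto
          then show False using False by simp
        qed
        then show ?thesis using False True unfolding e e2 nd by auto
      qed
    qed
  qed
  finally show ?thesis unfolding ov .
qed

lemma measurable_dir [measurable]: "(\<lambda>\<theta>. dir u n \<theta>) \<in> borel_measurable borel"
  unfolding dir_def by (intro borel_measurable_continuous_onI continuous_intros)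

lemma measurable_flux [measurable]:
  assumes j: "j \<in> J" and S: "S \<in> sets borel"
  shows "(\<lambda>\<theta>. flux j S (dir u n \<theta>)) \<in> borel_measurable borel"
proof -
  note [measurable] = j S
  have "(\<lambda>\<theta>. \<integral>\<^sup>+r. ennreal (if 0 \<le> r \<and> r < len j then max 0 (nrm j r \<bullet> dir u n \<theta>) else 0) * indicator S (\<gamma> j r, dir u n \<theta>) \<partial>lborel) \<in> borel_measurable lborel"
    by (intro lborel.borel_measurable_nn_integral) measurable
  then show ?thesis unfolding flux_def by simp
qed

text \<open>Exchanging the integrals over position and angle and splitting at the null angle 0
  yields rising and descending directions; the latter are written with -n so that both are treated
  alike.\<close>

lemma emeasure_billiard_flux:
  assumes un: "norm u = 1" "norm n = 1" "u \<bullet> n = 0" and S: "S \<in> sets borel"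
    and Su: "\<And>q v. (q, v) \<in> S \<Longrightarrow> 0 < v \<bullet> u"
  shows "emeasure (billiard_measure J Ob \<gamma> len) S = ennreal (1 / (2 * perimeter J len)) *
    (\<Sum>j\<in>J. (\<integral>\<^sup>+\<theta>. flux j S (dir u n \<theta>) * indicator {0<..<pi/2} \<theta> \<partial>lborel) +
      (\<integral>\<^sup>+\<theta>. flux j S (dir u (- n) \<theta>) * indicator {0<..<pi/2} \<theta> \<partial>lborel))"
proof -
  define c where "c = 1 / (2 * perimeter J len)"
  have P: "0 \<le> perimeter J len" unfolding perimeter_def using len_pos by (intro sum_nonneg) (auto intro: less_imp_le)
  then have c: "0 \<le> c" by (simp add: c_def)
  note [measurable] = S
  have "(\<integral>\<^sup>+r. \<integral>\<^sup>+\<phi>. (if 0 \<le> r \<and> r < len j \<and> \<bar>\<phi>\<bar> \<le> pi / 2 then ennreal (cos \<phi> / (2 * perimeter J len)) else 0) *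
     indicator S (\<gamma> j r, out_vec j r \<phi>) \<partial>lborel \<partial>lborel) =
     ennreal c * ((\<integral>\<^sup>+\<theta>. flux j S (dir u n \<theta>) * indicator {0<..<pi/2} \<theta> \<partial>lborel) +
      (\<integral>\<^sup>+\<theta>. flux j S (dir u (- n) \<theta>) * indicator {0<..<pi/2} \<theta> \<partial>lborel))" (is "?L = ?R") if j: "j \<in> J" for j
  proof -
    note [measurable] = j
    let ?k = "\<lambda>r \<theta>. (if 0 \<le> r \<and> r < len j \<and> \<bar>\<theta>\<bar> < pi / 2 then ennreal (max 0 (nrm j r \<bullet> dir u n \<theta>) * c) else 0) * indicator S (\<gamma> j r, dir u n \<theta>)"
    have "?L = (\<integral>\<^sup>+r. \<integral>\<^sup>+\<theta>. ?k r \<theta> \<partial>lborel \<partial>lborel)"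
    proof (rule nn_integral_cong)
      fix r :: real
      show "(\<integral>\<^sup>+\<phi>. (if 0 \<le> r \<and> r < len j \<and> \<bar>\<phi>\<bar> \<le> pi / 2 then ennreal (cos \<phi> / (2 * perimeter J len)) else 0) *
        indicator S (\<gamma> j r, out_vec j r \<phi>) \<partial>lborel) = (\<integral>\<^sup>+\<theta>. ?k r \<theta> \<partial>lborel)"
      proof (cases "0 \<le> r \<and> r < len j")
        case True
        have rot: "(\<integral>\<^sup>+\<phi>. (if \<bar>\<phi>\<bar> \<le> pi / 2 then ennreal (cos \<phi> * c) else 0) * indicator S (\<gamma> j r, out_vec j r \<phi>) \<partial>lborel) =
          (\<integral>\<^sup>+\<theta>. (if \<bar>\<theta>\<bar> < pi / 2 then ennreal (max 0 (nrm j r \<bullet> dir u n \<theta>) * c) else 0) * indicator S (\<gamma> j r, dir u n \<theta>) \<partial>lborel)"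
          by (rule rotate_angle[OF j un S]) (use Su in auto)
        have cd: "cos \<phi> / (2 * perimeter J len) = cos \<phi> * c" for \<phi> by (simp add: c_def)
        show ?thesis unfolding cd using rot True by simp
      next
        case False
        then have z: "(0 \<le> r \<and> r < len j \<and> Q) = False" for Q by blast
        show ?thesis by (simp only: z if_False mult_zero_left nn_integral_const)
      qed
    qed
    also have "\<dots> = (\<integral>\<^sup>+\<theta>. \<integral>\<^sup>+r. ?k r \<theta> \<partial>lborel \<partial>lborel)"
      by (rule lborel_pair.Fubini'[symmetric]) measurable
    also have "\<dots> = (\<integral>\<^sup>+\<theta>. ennreal c * (flux j S (dir u n \<theta>) * indicator {-(pi/2)<..<pi/2} \<theta>) \<partial>lborel)"
    proof (rule nn_integral_cong)
      fix \<theta> :: real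
      have "(\<integral>\<^sup>+r. ?k r \<theta> \<partial>lborel) = (\<integral>\<^sup>+r. (ennreal c * indicator {-(pi/2)<..<pi/2} \<theta>) *
          (ennreal (if 0 \<le> r \<and> r < len j then max 0 (nrm j r \<bullet> dir u n \<theta>) else 0) * indicator S (\<gamma> j r, dir u n \<theta>)) \<partial>lborel)"
        using c by (intro nn_integral_cong) (auto split: split_indicator simp: ennreal_mult' mult.commute abs_less_iff)
      also have "\<dots> = (ennreal c * indicator {-(pi/2)<..<pi/2} \<theta>) * flux j S (dir u n \<theta>)"
        unfolding flux_def by (rule nn_integral_cmult) measurable
      finally show "(\<integral>\<^sup>+r. ?k r \<theta> \<partial>lborel) = ennreal c * (flux j S (dir u n \<theta>) * indicator {-(pi/2)<..<pi/2} \<theta>)"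
        by (simp add: ac_simps)
    qed
    also have "\<dots> = ennreal c * (\<integral>\<^sup>+\<theta>. flux j S (dir u n \<theta>) * indicator {-(pi/2)<..<pi/2} \<theta> \<partial>lborel)"
      by (rule nn_integral_cmult) measurable
    also have "(\<integral>\<^sup>+\<theta>. flux j S (dir u n \<theta>) * indicator {-(pi/2)<..<pi/2} \<theta> \<partial>lborel) =
       (\<integral>\<^sup>+\<theta>. flux j S (dir u n \<theta>) * indicator {0<..<pi/2} \<theta> + flux j S (dir u n \<theta>) * indicator {-(pi/2)<..<0} \<theta> \<partial>lborel)"
    proof (rule nn_integral_cong_AE)
      have "AE \<theta> in lborel. \<theta> \<noteq> (0::real)" by (rule AE_lborel_singleton)
      then show "AE \<theta> in lborel. flux j S (dir u n \<theta>) * indicator {-(pi/2)<..<pi/2} \<theta> =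
         flux j S (dir u n \<theta>) * indicator {0<..<pi/2} \<theta> + flux j S (dir u n \<theta>) * indicator {-(pi/2)<..<0} \<theta>"
        by eventually_elim (auto split: split_indicator)
    qed
    also have "\<dots> = (\<integral>\<^sup>+\<theta>. flux j S (dir u n \<theta>) * indicator {0<..<pi/2} \<theta> \<partial>lborel) +
        (\<integral>\<^sup>+\<theta>. flux j S (dir u n \<theta>) * indicator {-(pi/2)<..<0} \<theta> \<partial>lborel)"
      by (rule nn_integral_add) measurable
    also have "(\<integral>\<^sup>+\<theta>. flux j S (dir u n \<theta>) * indicator {-(pi/2)<..<0} \<theta> \<partial>lborel) =
        (\<integral>\<^sup>+\<theta>. flux j S (dir u (- n) \<theta>) * indicator {0<..<pi/2} \<theta> \<partial>lborel)"
    proof -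
      have "(\<integral>\<^sup>+\<theta>. flux j S (dir u n \<theta>) * indicator {-(pi/2)<..<0} \<theta> \<partial>lborel) =
        ennreal \<bar>- 1\<bar> * (\<integral>\<^sup>+\<theta>. flux j S (dir u n (0 + - 1 * \<theta>)) * indicator {-(pi/2)<..<0} (0 + - 1 * \<theta>) \<partial>lborel)"
      proof (rule nn_integral_real_affine)
        have "{-(pi/2)<..<0::real} \<in> sets borel" by simp
        then show "(\<lambda>\<theta>. flux j S (dir u n \<theta>) * indicator {-(pi/2)<..<0} \<theta>) \<in> borel_measurable borel"
          using measurable_flux[OF j S, of u n] by (intro borel_measurable_times_ennreal borel_measurable_indicator)
      qed simp
      also have "\<dots> = (\<integral>\<^sup>+\<theta>. flux j S (dir u (- n) \<theta>) * indicator {0<..<pi/2} \<theta> \<partial>lborel)"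
        by (simp add: dir_def) (intro nn_integral_cong, auto split: split_indicator)
      finally show ?thesis .
    qed
    finally show ?thesis .
  qed
  then show ?thesis unfolding emeasure_billiard[OF S] c_def[symmetric] by (simp add: sum_distrib_left)
qed

text \<open>Each oriented line leaves the obstacle at one point, and moving that point along the boundary
  changes the offset of the line at speed \<open>n \<bullet> v\<close>.\<close>

lemma flux_eq:
  assumes j: "j \<in> J" and S: "S \<in> sets borel" and v: "norm v = 1" "norm v' = 1" "v \<bullet> v' = 0"
  shows "flux j S v = emeasure lebesgue ((\<lambda>r. \<gamma> j r \<bullet> v') ` {r \<in> {0..<len j}. 0 < nrm j r \<bullet> v \<and> (\<gamma> j r, v) \<in> S})"
    and "(\<lambda>r. \<gamma> j r \<bullet> v') ` {r \<in> {0..<len j}. 0 < nrm j r \<bullet> v \<and> (\<gamma> j r, v) \<in> S} \<in> sets lebesgue"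
proof -
  define R where "R = {r \<in> {0..<len j}. 0 < nrm j r \<bullet> v \<and> (\<gamma> j r, v) \<in> S}"
  note [measurable] = j S
  have R: "R \<in> sets borel" unfolding R_def by measurable
  have speed: "\<bar>vderiv (\<gamma> j) r \<bullet> v'\<bar> = \<bar>nrm j r \<bullet> v\<bar>" for r
  proof -
    \<comment> \<open>The normal turned by a right angle, in coordinates with respect to
      \<open>v\<close> and \<open>v'\<close>. The tangent is this vector up to sign, so its
      component along \<open>v'\<close> has the absolute value of the normal component along
      \<open>v\<close>.\<close>
    define m where "m = (- (nrm j r \<bullet> v')) *\<^sub>R v + (nrm j r \<bullet> v) *\<^sub>R v'"
    have vv: "v \<bullet> v = 1" "v' \<bullet> v' = 1" "v' \<bullet> v = 0" using v by (simp_all add: norm_eq_1 inner_commute)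
    have dec: "nrm j r = (nrm j r \<bullet> v) *\<^sub>R v + (nrm j r \<bullet> v') *\<^sub>R v'" by (rule orthonormal2_decomp[OF v])
    have "nrm j r \<bullet> nrm j r = (nrm j r \<bullet> v) * (nrm j r \<bullet> v) + (nrm j r \<bullet> v') * (nrm j r \<bullet> v')"
      using arg_cong[OF dec, of "\<lambda>y. y \<bullet> nrm j r"]
      by (simp only: inner_add_left inner_scaleR_left inner_commute[of v] inner_commute[of v'])
    then have "(nrm j r \<bullet> v) * (nrm j r \<bullet> v) + (nrm j r \<bullet> v') * (nrm j r \<bullet> v') = 1"
      using norm_normal[OF j, of r] by (simp add: norm_eq_1)
    then have "norm m = 1"
      unfolding norm_eq_1 m_def inner_add_left inner_add_right inner_scaleR_left inner_scaleR_right vv v(3) by simp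
    moreover have "nrm j r \<bullet> m = 0" unfolding m_def inner_add_right inner_scaleR_right by simp
    ultimately have "vderiv (\<gamma> j) r = m \<or> vderiv (\<gamma> j) r = - m"
      using orth_unit_cases[OF norm_normal[OF j, of r], of m] norm_gamma'[OF j] normal_orth[OF j, of r] by (simp add: inner_commute)
    moreover have "m \<bullet> v' = nrm j r \<bullet> v" unfolding m_def inner_add_left inner_scaleR_left vv v(3) by simp
    ultimately show ?thesis by auto
  qed
  \<comment> \<open>Two boundary points on one line of direction \<open>v\<close> are ordered along
    it, and the ray from the earlier one, which is outgoing, would have to return to the
    obstacle.\<close>
  have inj: "inj_on (\<lambda>r. \<gamma> j r \<bullet> v') R"
  proof (rule inj_onI)
    have no: "\<not> 0 < (\<gamma> j s - \<gamma> j r) \<bullet> v" if r: "r \<in> R" and eq: "\<gamma> j r \<bullet> v' = \<gamma> j s \<bullet> v'" for r s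
    proof
      assume pos: "0 < (\<gamma> j s - \<gamma> j r) \<bullet> v"
      have "\<gamma> j s - \<gamma> j r = ((\<gamma> j s - \<gamma> j r) \<bullet> v) *\<^sub>R v"
        using orthonormal2_decomp[OF v, of "\<gamma> j s - \<gamma> j r"] eq by (simp only: inner_diff_left[of _ _ v']) simp
      then have "\<gamma> j s = \<gamma> j r + ((\<gamma> j s - \<gamma> j r) \<bullet> v) *\<^sub>R v" by (metis add.commute diff_add_cancel)
      moreover have "\<gamma> j s \<in> closure (Ob j)" using gamma_frontier[OF j] by (simp add: frontier_def)
      moreover have "\<gamma> j r + ((\<gamma> j s - \<gamma> j r) \<bullet> v) *\<^sub>R v \<notin> closure (Ob j)"
        using r by (intro leaves_obstacle[OF j _ pos]) (simp add: R_def)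
      ultimately show False by metis
    qed
    fix r s assume rs: "r \<in> R" "s \<in> R" "\<gamma> j r \<bullet> v' = \<gamma> j s \<bullet> v'"
    have "(\<gamma> j s - \<gamma> j r) \<bullet> v = 0"
      using no[OF rs(1,3)] no[OF rs(2) rs(3)[symmetric]] by (simp add: inner_diff_left)
    then have "\<gamma> j s - \<gamma> j r = 0"
      using orthonormal2_decomp[OF v, of "\<gamma> j s - \<gamma> j r"] rs(3) by (simp only: inner_diff_left[of _ _ v']) simp
    then show "r = s" using inj_onD[OF gamma_inj[OF j]] rs by (auto simp: R_def)
  qed
  have int: "(\<lambda>r. \<bar>vderiv (\<gamma> j) r \<bullet> v'\<bar>) absolutely_integrable_on R"
  proof (rule measurable_bounded_by_integrable_imp_absolutely_integrable)
    have "(\<lambda>r. \<bar>vderiv (\<gamma> j) r \<bullet> v'\<bar>) \<in> borel_measurable borel" by measurable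
    then show "(\<lambda>r. \<bar>vderiv (\<gamma> j) r \<bullet> v'\<bar>) \<in> borel_measurable (lebesgue_on R)"
      by (intro measurable_restrict_space1 measurable_completion) simp
    show "R \<in> sets lebesgue" using R by simp
    have "R \<subseteq> {0..len j}" by (auto simp: R_def)
    then have "R \<in> lmeasurable" using R by (intro bounded_set_imp_lmeasurable bounded_subset[OF bounded_closed_interval]) auto
    then show "(\<lambda>r. 1::real) integrable_on R" by (simp add: lmeasurable_iff_integrable_on)
    show "norm \<bar>vderiv (\<gamma> j) r \<bullet> v'\<bar> \<le> 1" for r
      using abs_inner_unit[OF v(2), of "vderiv (\<gamma> j) r"] norm_gamma'[OF j] by simp
  qed
  define b where "b = integral R (\<lambda>r. \<bar>vderiv (\<gamma> j) r \<bullet> v'\<bar>)"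
  \<comment> \<open>The integrand of the change-of-variables formula with the constant function 1:
    the integral of the speed is the measure of the image.\<close>
  have "(\<lambda>r. \<bar>vderiv (\<gamma> j) r \<bullet> v'\<bar> * 1) absolutely_integrable_on R \<and> integral R (\<lambda>r. \<bar>vderiv (\<gamma> j) r \<bullet> v'\<bar> * 1) = b"
    using int by (simp add: b_def)
  then have *: "(\<lambda>_. 1::real) absolutely_integrable_on ((\<lambda>r. \<gamma> j r \<bullet> v') ` R) \<and> integral ((\<lambda>r. \<gamma> j r \<bullet> v') ` R) (\<lambda>_. 1) = b"
    using R gamma_inner_deriv(1)[OF j, THEN has_field_derivative_at_within]
    by (subst (asm) has_absolute_integral_change_of_variables_1'[OF _ _ inj]) auto
  then have lm: "(\<lambda>r. \<gamma> j r \<bullet> v') ` R \<in> lmeasurable"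
    by (simp add: lmeasurable_iff_integrable_on set_lebesgue_integral_eq_integral(1))
  then have "emeasure lebesgue ((\<lambda>r. \<gamma> j r \<bullet> v') ` R) = ennreal b"
    using * by (simp add: emeasure_eq_measure2 lmeasure_integral)
  moreover have "flux j S v = ennreal b"
  proof -
    have "((\<lambda>r. \<bar>vderiv (\<gamma> j) r \<bullet> v'\<bar>) has_integral b) R"
      using int unfolding b_def by (intro integrable_integral set_lebesgue_integral_eq_integral(1))
    then have "(\<integral>\<^sup>+r. ennreal \<bar>vderiv (\<gamma> j) r \<bullet> v'\<bar> * indicator R r \<partial>lborel) = ennreal b"
      by (intro nn_integral_has_integral_lebesgue') auto
    moreover have "flux j S v = (\<integral>\<^sup>+r. ennreal \<bar>vderiv (\<gamma> j) r \<bullet> v'\<bar> * indicator R r \<partial>lborel)"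
      unfolding flux_def speed by (intro nn_integral_cong) (auto simp: R_def split: split_indicator)
    ultimately show ?thesis by simp
  qed
  ultimately show "flux j S v = emeasure lebesgue ((\<lambda>r. \<gamma> j r \<bullet> v') ` {r \<in> {0..<len j}. 0 < nrm j r \<bullet> v \<and> (\<gamma> j r, v) \<in> S})"
    unfolding R_def by simp
  show "(\<lambda>r. \<gamma> j r \<bullet> v') ` {r \<in> {0..<len j}. 0 < nrm j r \<bullet> v \<and> (\<gamma> j r, v) \<in> S} \<in> sets lebesgue"
    using lm unfolding R_def by (rule fmeasurableD)
qed

text \<open>An obstacle can be entered only through its boundary, and the obstacle of departure is
  never met again. Thus absence of boundary points along the flight means that the flight stays in
  the table.\<close>

lemma free_flight:
  assumes j: "j \<in> J" and v: "0 < nrm j r \<bullet> v"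
    and no: "\<And>t. 0 < t \<Longrightarrow> t < T \<Longrightarrow> \<gamma> j r + t *\<^sub>R v \<notin> frontier (table J Ob)"
    and t: "0 < t" "t < T"
  shows "\<gamma> j r + t *\<^sub>R v \<in> table J Ob"
  unfolding mem_table
proof (intro ballI notI)
  fix c assume c: "c \<in> idx" "\<gamma> j r + t *\<^sub>R v \<in> obs c"
  have q: "\<gamma> j r \<in> closure (obs (j, 0))" using gamma_frontier[OF j] by (simp add: frontier_def)
  have "c \<noteq> (j, 0)" using leaves_obstacle[OF j v t(1)] c(2) by (auto dest: subsetD[OF closure_subset])
  then have qc: "\<gamma> j r \<notin> closure (obs c)" using disjoint_closures[OF _ c(1) q] j by auto
  then have "\<gamma> j r \<notin> obs c" using closure_subset by blast
  then obtain x where x: "x \<in> closed_segment (\<gamma> j r) (\<gamma> j r + t *\<^sub>R v)" "x \<in> frontier (obs c)"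
    using connected_Int_frontier[of "closed_segment (\<gamma> j r) (\<gamma> j r + t *\<^sub>R v)" "obs c"] c(2) by auto
  then obtain l where l: "0 \<le> l" "l \<le> 1" "x = (1 - l) *\<^sub>R \<gamma> j r + l *\<^sub>R (\<gamma> j r + t *\<^sub>R v)" by (auto simp: in_segment)
  then have xt: "x = \<gamma> j r + (l * t) *\<^sub>R v" by (simp add: algebra_simps)
  have "l \<noteq> 0" using l qc x(2) by (auto simp: frontier_def)
  then have "0 < l * t" using l t by simp
  moreover have "l * t \<le> 1 * t" using l t by (intro mult_right_mono) auto
  then have "l * t < T" using t(2) by linarith
  ultimately have "x \<notin> frontier (table J Ob)" unfolding xt by (intro no)
  then show False using x(2) c(1) unfolding frontier_table by blast
qed

lemma frontier_table_translate: "x + lat z \<in> frontier (table J Ob) \<longleftrightarrow> x \<in> frontier (table J Ob)"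
proof -
  have imp: "x + lat z \<in> frontier (table J Ob)" if x: "x \<in> frontier (table J Ob)" for x z
  proof -
    obtain j y where jy: "j \<in> J" "x \<in> frontier (obs (j, y))" using x unfolding frontier_table idx_def by auto
    then have "x + lat z \<in> frontier (obs (j, y + z))" by (simp add: mem_frontier_obstacle_iff lat_add)
    then show ?thesis using jy(1) unfolding frontier_table by (intro UN_I[of "(j, y + z)"]) auto
  qed
  show ?thesis using imp[of x z] imp[of "x + lat z" "- z"] by (auto simp: lat_minus)
qed

lemma next_point_translate: "next_point J Ob (q + lat z) v = next_point J Ob q v + lat z"
proof -
  have "q + lat z + t *\<^sub>R v \<in> frontier (table J Ob) \<longleftrightarrow> q + t *\<^sub>R v \<in> frontier (table J Ob)" for t
    using frontier_table_translate[of "q + t *\<^sub>R v" z] by (simp add: ac_simps)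
  then show ?thesis by (simp add: next_point_def flight_time_def)
qed

end

lemma emeasure_lebesgue_interval:
  fixes l m :: real
  shows "emeasure lebesgue {l..m} = ennreal (max 0 (m - l))" "emeasure lebesgue {l<..<m} = ennreal (max 0 (m - l))"
  by (cases "l \<le> m"; simp add: max_def)+

lemma (in billiard_table) curvature_translate:
  assumes "a \<in> idx" "x \<in> frontier (obs a)"
  shows "curvature J \<gamma> (x + lat z) = curvature J \<gamma> x"
proof -
  note j = idx_fst[OF assms(1)]
  have "x - lat (snd a) \<in> frontier (Ob (fst a))" using assms(2) by (simp add: mem_frontier_obstacle_iff)
  then obtain s where s: "x - lat (snd a) = \<gamma> (fst a) s" using gamma_image[OF j] by (metis imageE)
  have x: "x = \<gamma> (fst a) s + lat (snd a)" "x + lat z = \<gamma> (fst a) s + lat (snd a + z)" using s by (simp_all add: lat_add algebra_simps)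
  show ?thesis unfolding x(2) curvature_eq[OF j] unfolding x(1) curvature_eq[OF j] ..
qed

context frame
begin

subsection \<open>Asymptotics along a corridor\<close>

definition top_excess :: "'j \<times> (int ^ 2) \<Rightarrow> real \<Rightarrow> real" where
  "top_excess a \<theta> = H a \<theta> - top a \<bullet> p' \<theta>"

definition bot_excess :: "'j \<times> (int ^ 2) \<Rightarrow> real \<Rightarrow> real" where
  "bot_excess a \<theta> = bot a \<bullet> p' \<theta> - G a \<theta>"

lemma continuous_excess:
  assumes "a \<in> idx" shows "continuous_on UNIV (top_excess a)" "continuous_on UNIV (bot_excess a)"
proof -
  have p: "continuous_on UNIV p'" unfolding perp_dir_def by (intro continuous_intros)
  have s: "continuous_on UNIV (supp (obs a))" by (rule continuous_on_supp[OF obs_nonempty bounded_obs]) (rule assms)+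
  show "continuous_on UNIV (top_excess a)" "continuous_on UNIV (bot_excess a)"
    unfolding top_excess_def bot_excess_def
    by (intro continuous_intros continuous_on_compose2[OF s] p; simp)+
qed

lemma top_excess_limit: "a \<in> idx \<Longrightarrow> ((\<lambda>\<theta>. top_excess a \<theta> / \<theta>\<^sup>2) \<longlongrightarrow> 1 / (2 * curvature J \<gamma> (top a))) (at_right 0)"
  unfolding top_excess_def by (rule excess_limit)

lemma bot_excess_limit: "a \<in> idx \<Longrightarrow> ((\<lambda>\<theta>. bot_excess a \<theta> / \<theta>\<^sup>2) \<longlongrightarrow> 1 / (2 * curvature J \<gamma> (bot a))) (at_right 0)"
  using frame.excess_limit[OF flip_frame, of a] unfolding flip_simps bot_excess_def by (simp add: algebra_simps)

lemma excess_le_sin: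
  "\<exists>\<delta>>0. \<forall>a\<in>idx. \<forall>\<theta>. 0 < \<theta> \<and> \<theta> < \<delta> \<longrightarrow> 0 \<le> top_excess a \<theta> \<and> top_excess a \<theta> \<le> sin \<theta> \<and> 0 \<le> bot_excess a \<theta> \<and> bot_excess a \<theta> \<le> sin \<theta>"
proof -
  obtain \<delta>1 where 1: "\<delta>1 > 0" "\<forall>a\<in>idx. \<forall>\<theta>. 0 < \<theta> \<and> \<theta> < \<delta>1 \<longrightarrow> H a \<theta> \<le> top a \<bullet> p' \<theta> + 1/2 * \<theta>"
    using excess_small[of "1/2"] by auto
  obtain \<delta>2 where 2: "\<delta>2 > 0" "\<forall>a\<in>idx. \<forall>\<theta>. 0 < \<theta> \<and> \<theta> < \<delta>2 \<longrightarrow> supp (obs a) (- p' \<theta>) \<le> bot a \<bullet> (- p' \<theta>) + 1/2 * \<theta>"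
    using frame.excess_small[OF flip_frame, of "1/2"] unfolding flip_simps by auto
  show ?thesis
  proof (intro exI[of _ "min 1 (min \<delta>1 \<delta>2)"] conjI ballI allI impI; (elim conjE)?)
    fix a \<theta> assume a: "a \<in> idx" and \<theta>: "0 < \<theta>" "\<theta> < min 1 (min \<delta>1 \<delta>2)"
    have s: "\<theta> / 2 \<le> sin \<theta>" using \<theta> by (intro sin_ge_half) auto
    show "0 \<le> top_excess a \<theta>" using H_upper[OF a top_closure[OF a]] by (simp add: top_excess_def)
    show "0 \<le> bot_excess a \<theta>" using G_lower[OF a bot_closure[OF a], of \<theta>] by (simp add: bot_excess_def)
    have "H a \<theta> \<le> top a \<bullet> p' \<theta> + 1/2 * \<theta>" "supp (obs a) (- p' \<theta>) \<le> bot a \<bullet> (- p' \<theta>) + 1/2 * \<theta>" using 1(2) 2(2) a \<theta> by auto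
    then show "top_excess a \<theta> \<le> sin \<theta>" "bot_excess a \<theta> \<le> sin \<theta>" using s unfolding top_excess_def bot_excess_def inner_minus_right by linarith+
  qed (use 1 2 in auto)
qed

definition is_next :: "'j \<times> (int ^ 2) \<Rightarrow> 'j \<times> (int ^ 2) \<Rightarrow> bool" where
  "is_next a c \<longleftrightarrow> c \<in> idx \<and> next_point J Ob (top a) (lat w) = top c \<and> top c \<bullet> n = top a \<bullet> n \<and>
    top a \<bullet> u < top c \<bullet> u \<and> top c \<bullet> u \<le> top a \<bullet> u + W \<and>
    (\<forall>e\<in>idx. top e \<bullet> n = top a \<bullet> n \<and> top a \<bullet> u < top e \<bullet> u \<longrightarrow> top c \<bullet> u \<le> top e \<bullet> u)"

definition is_prev :: "'j \<times> (int ^ 2) \<Rightarrow> 'j \<times> (int ^ 2) \<Rightarrow> bool" where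
  "is_prev b c \<longleftrightarrow> c \<in> idx \<and> next_point J Ob (bot b) (- lat w) = bot c \<and> bot c \<bullet> n = bot b \<bullet> n \<and>
    bot c \<bullet> u < bot b \<bullet> u \<and> bot b \<bullet> u \<le> bot c \<bullet> u + W \<and>
    (\<forall>e\<in>idx. bot e \<bullet> n = bot b \<bullet> n \<and> bot e \<bullet> u < bot b \<bullet> u \<longrightarrow> bot e \<bullet> u \<le> bot c \<bullet> u)"

definition nxt :: "'j \<times> (int ^ 2) \<Rightarrow> 'j \<times> (int ^ 2)" where "nxt a = (SOME c. is_next a c)"
definition prv :: "'j \<times> (int ^ 2) \<Rightarrow> 'j \<times> (int ^ 2)" where "prv b = (SOME c. is_prev b c)"

lemma is_next_nxt:
  assumes "a \<in> idx" "corridor a b" shows "is_next a (nxt a)"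
proof -
  have ab: "top c \<bullet> n \<le> top a \<bullet> n \<or> top a \<bullet> n < bot c \<bullet> n" if "c \<in> idx" for c
    using assms(2) that unfolding corridor_def by force
  have "\<exists>c. is_next a c"
    by (rule next_point_on_line[OF assms(1) ab]) (auto simp only: is_next_def)
  then show ?thesis unfolding nxt_def by (rule someI_ex)
qed

lemma is_prev_prv:
  assumes "b \<in> idx" "corridor a b" shows "is_prev b (prv b)"
proof -
  have ab: "bot b \<bullet> n \<le> bot c \<bullet> n \<or> top c \<bullet> n < bot b \<bullet> n" if "c \<in> idx" for c
    using assms(2) that unfolding corridor_def by force
  have "\<exists>c. is_prev b c"
    by (rule prev_point_on_line[OF assms(1) ab]) (auto simp only: is_prev_def)
  then show ?thesis unfolding prv_def by (rule someI_ex)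
qed

lemma corridor_shift: "corridor a (shift b m) \<longleftrightarrow> corridor a b"
  unfolding corridor_def shift_top ..

text \<open>\<open>b\<close> and its predecessor stay in their original cells; their displacement by
  N periods enters only through the last length argument of \<open>strip_width\<close>, evaluated at
  N W.\<close>

definition cwidth :: "'j \<times> (int ^ 2) \<Rightarrow> 'j \<times> (int ^ 2) \<Rightarrow> real \<Rightarrow> real \<Rightarrow> real" where
  "cwidth a b = strip_width (top a \<bullet> n) (bot b \<bullet> n - top a \<bullet> n) (top a \<bullet> u) (top (nxt a) \<bullet> u) (bot b \<bullet> u) (bot (prv b) \<bullet> u)
     (top_excess a) (top_excess (nxt a)) (bot_excess b) (bot_excess (prv b))"

lemma cwidth_eq:
  assumes a: "a \<in> idx" and b: "b \<in> idx" and cor: "corridor a b"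
  shows "cwidth a b (of_int m * W) \<theta> =
    max 0 (min (H a \<theta>) (G (shift (prv b) m) \<theta>) - max (H (nxt a) \<theta>) (G (shift b m) \<theta>))"
proof -
  note nx = is_next_nxt[OF a cor, unfolded is_next_def] and pv = is_prev_prv[OF b cor, unfolded is_prev_def]
  have 1: "H e \<theta> = top a \<bullet> n * cos \<theta> - top e \<bullet> u * sin \<theta> + top_excess e \<theta>" if "top e \<bullet> n = top a \<bullet> n" for e
    unfolding top_excess_def inner_p' that by (simp add: algebra_simps)
  have 2: "G (shift e m) \<theta> = (top a \<bullet> n + (bot b \<bullet> n - top a \<bullet> n)) * cos \<theta> - (bot e \<bullet> u + of_int m * W) * sin \<theta> - bot_excess e \<theta>"
    if "e \<in> idx" "bot e \<bullet> n = bot b \<bullet> n" for e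
    using G_shift[OF that(1), of m \<theta>] unfolding bot_excess_def inner_p' that by (simp add: algebra_simps)
  have "H (nxt a) \<theta> = top a \<bullet> n * cos \<theta> - top (nxt a) \<bullet> u * sin \<theta> + top_excess (nxt a) \<theta>" by (rule 1) (use nx in blast)
  moreover have "G (shift (prv b) m) \<theta> = (top a \<bullet> n + (bot b \<bullet> n - top a \<bullet> n)) * cos \<theta> - (bot (prv b) \<bullet> u + of_int m * W) * sin \<theta> - bot_excess (prv b) \<theta>"
    by (rule 2) (use pv in blast)+
  ultimately show ?thesis unfolding cwidth_def strip_width_def 1[of a, OF refl] 2[OF b refl] by (simp only:)
qed

lemma continuous_cwidth:
  assumes "a \<in> idx" "b \<in> idx" "corridor a b"
  shows "continuous_on A (cwidth a b M)"
proof -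
  have "nxt a \<in> idx" "prv b \<in> idx" using is_next_nxt[OF assms(1,3)] is_prev_prv[OF assms(2,3)] by (auto simp: is_next_def is_prev_def)
  then show ?thesis
    unfolding cwidth_def strip_width_def using assms
    by (intro continuous_intros continuous_on_subset[OF continuous_excess(1)] continuous_on_subset[OF continuous_excess(2)]) auto
qed

text \<open>Outside a countable set of offsets (the lines tangent to an obstacle), the flights from \<open>j\<close> to
  the cell \<open>L + N w\<close> are described by the corridors.\<close>

lemma flux_corridors:
  shows "\<exists>\<theta>1>0. \<theta>1 \<le> 1 \<and> (\<forall>a\<in>idx. \<forall>\<theta>. 0 < \<theta> \<and> \<theta> < \<theta>1 \<longrightarrow> 0 \<le> top_excess a \<theta> \<and> top_excess a \<theta> \<le> sin \<theta> \<and> 0 \<le> bot_excess a \<theta> \<and> bot_excess a \<theta> \<le> sin \<theta>) \<and>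
    (\<forall>\<^sub>F N in sequentially. {x \<in> phase_space J Ob. cell_change J Ob x = L + int N *s w} \<in> sets borel \<longrightarrow>
      (\<forall>j\<in>J. \<forall>\<theta>. 0 < \<theta> \<and> \<theta> < pi / 2 \<longrightarrow>
        flux j {x \<in> phase_space J Ob. cell_change J Ob x = L + int N *s w} (v \<theta>) =
          (if \<theta> < \<theta>1 then \<Sum>k\<in>{k\<in>J. corridor (j, 0) (k, L)}. ennreal (cwidth (j, 0) (k, L) (real N * W) \<theta>) else 0)))"
proof -
  obtain \<delta>1 where \<delta>1: "\<delta>1 > 0" "\<forall>a\<in>idx. \<forall>\<theta>. 0 < \<theta> \<and> \<theta> < \<delta>1 \<longrightarrow> 0 \<le> top_excess a \<theta> \<and> top_excess a \<theta> \<le> sin \<theta> \<and> 0 \<le> bot_excess a \<theta> \<and> bot_excess a \<theta> \<le> sin \<theta>"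
    using excess_le_sin by blast
  obtain \<delta>2 where \<delta>2: "\<delta>2 > 0" "\<forall>a\<in>idx. \<forall>b\<in>idx. \<forall>c\<in>idx. \<forall>c'\<in>idx. \<forall>\<theta> p. 0 < \<theta> \<and> \<theta> < \<delta>2 \<and> corridor a b \<and>
      top c \<bullet> n = top a \<bullet> n \<and> top a \<bullet> u < top c \<bullet> u \<and> top c \<bullet> u \<le> top a \<bullet> u + W \<and>
      (\<forall>e\<in>idx. top e \<bullet> n = top a \<bullet> n \<and> top a \<bullet> u < top e \<bullet> u \<longrightarrow> top c \<bullet> u \<le> top e \<bullet> u) \<and>
      bot c' \<bullet> n = bot b \<bullet> n \<and> bot c' \<bullet> u < bot b \<bullet> u \<and> bot b \<bullet> u \<le> bot c' \<bullet> u + W \<and>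
      (\<forall>e\<in>idx. bot e \<bullet> n = bot b \<bullet> n \<and> bot e \<bullet> u < bot b \<bullet> u \<longrightarrow> bot e \<bullet> u \<le> bot c' \<bullet> u) \<and>
      H c \<theta> < p \<and> p < H a \<theta> \<and> G b \<theta> < p \<and> p < G c' \<theta> \<longrightarrow>
    (\<exists>y\<in>obs a. y \<bullet> p' \<theta> = p) \<and>
    (\<forall>q\<in>closure (obs a). q \<bullet> p' \<theta> = p \<and> (\<forall>t>0. q + t *\<^sub>R v \<theta> \<notin> closure (obs a)) \<longrightarrow>
       next_point J Ob q (v \<theta>) \<in> frontier (obs b))"
    using corridor_flight by blast
  define \<theta>1 where "\<theta>1 = min 1 (min \<delta>1 \<delta>2)"
  have \<theta>1: "\<theta>1 > 0" "\<theta>1 \<le> 1" "\<theta>1 \<le> \<delta>1" "\<theta>1 \<le> \<delta>2" using \<delta>1(1) \<delta>2(1) by (auto simp: \<theta>1_def)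
  obtain D where D: "D > 0" "\<And>j. j \<in> J \<Longrightarrow> closure (Ob j) \<subseteq> ball 0 D" using diameter_bound by blast
  \<comment> \<open>Since w is orthogonal to \<open>n\<close>, the height gained by a flight to the
    cell L + N w is bounded independently of N, while its horizontal progress is N W up to the same
    bound.\<close>
  define M where "M = norm (lat L) + 2 * D"
  obtain R where R: "\<forall>a\<in>idx. \<forall>b\<in>idx. \<forall>\<theta> q q' T. 0 < \<theta> \<and> \<theta> < pi / 2 \<and> R \<le> T \<and> \<bar>(q' - q) \<bullet> n\<bar> \<le> M \<and>
      q \<in> closure (obs a) \<and> (\<exists>y\<in>obs a. y \<bullet> p' \<theta> = q \<bullet> p' \<theta>) \<and>
      q' \<in> closure (obs b) \<and> (\<exists>y\<in>obs b. y \<bullet> p' \<theta> = q \<bullet> p' \<theta>) \<and>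
      q' = q + T *\<^sub>R v \<theta> \<and> (\<forall>t. 0 < t \<and> t < T \<longrightarrow> q + t *\<^sub>R v \<theta> \<in> table J Ob) \<longrightarrow>
    \<theta> < \<theta>1 \<and> corridor a b \<and>
    (\<forall>c\<in>idx. top c \<bullet> n = top a \<bullet> n \<and> top a \<bullet> u < top c \<bullet> u \<and> top c \<bullet> u \<le> top a \<bullet> u + W \<longrightarrow> H c \<theta> \<le> q \<bullet> p' \<theta>) \<and>
    (\<forall>c\<in>idx. bot c \<bullet> n = bot b \<bullet> n \<and> bot c \<bullet> u < bot b \<bullet> u \<and> bot b \<bullet> u \<le> bot c \<bullet> u + W \<longrightarrow> q \<bullet> p' \<theta> \<le> G c \<theta>)"
    using long_flight[OF \<theta>1(1), of M] by blast
  obtain B where B: "\<And>z q v. B < norm (lat z) \<Longrightarrow> (q, v) \<in> phase_space J Ob \<Longrightarrow> cell_change J Ob (q, v) = z \<Longrightarrow>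
    0 < flight_time J Ob q v \<and> next_point J Ob q v \<in> cell_frontier z \<and>
    (\<forall>t. 0 < t \<and> t < flight_time J Ob q v \<longrightarrow> q + t *\<^sub>R v \<notin> frontier (table J Ob))"
    using far_cell_change by meson
  have fl: "filterlim (\<lambda>N. real N * W) at_top sequentially"
    using filterlim_tendsto_pos_mult_at_top[OF tendsto_const W_pos filterlim_real_sequentially] by (simp only: mult.commute)
  have "\<forall>\<^sub>F N in sequentially. \<bar>B\<bar> + \<bar>R\<bar> + M + norm (lat L) + 1 \<le> real N * W"
    using fl by (simp add: filterlim_at_top)
  then have "\<forall>\<^sub>F N in sequentially. {x \<in> phase_space J Ob. cell_change J Ob x = L + int N *s w} \<in> sets borel \<longrightarrow>
      (\<forall>j\<in>J. \<forall>\<theta>. 0 < \<theta> \<and> \<theta> < pi / 2 \<longrightarrow>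
        flux j {x \<in> phase_space J Ob. cell_change J Ob x = L + int N *s w} (v \<theta>) =
          (if \<theta> < \<theta>1 then \<Sum>k\<in>{k\<in>J. corridor (j, 0) (k, L)}. ennreal (cwidth (j, 0) (k, L) (real N * W) \<theta>) else 0))"
  proof (eventually_elim, intro impI ballI allI, elim conjE)
    fix N j \<theta>
    assume N: "\<bar>B\<bar> + \<bar>R\<bar> + M + norm (lat L) + 1 \<le> real N * W" and j: "j \<in> J" and \<theta>: "0 < \<theta>" "\<theta> < pi / 2"
      and Sb: "{x \<in> phase_space J Ob. cell_change J Ob x = L + int N *s w} \<in> sets borel"
    define z where "z = L + int N *s w"
    define S where "S = {x \<in> phase_space J Ob. cell_change J Ob x = z}"
    define Q where "Q = (\<lambda>r. \<gamma> j r \<bullet> p' \<theta>) ` {r \<in> {0..<len j}. 0 < nrm j r \<bullet> v \<theta> \<and> (\<gamma> j r, v \<theta>) \<in> S}"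
    define KS where "KS = {k\<in>J. corridor (j, 0) (k, L)}"
    let ?a = "(j, 0 :: int ^ 2)"
    let ?b = "\<lambda>k. (k, L)"
    have SB: "S \<in> sets borel" using Sb by (simp add: S_def z_def)
    have flQ: "flux j S (v \<theta>) = emeasure lebesgue Q" "Q \<in> sets lebesgue"
      unfolding Q_def by (rule flux_eq[OF j SB norm_v norm_p' v_p'])+
    have a: "?a \<in> idx" using j by simp
    have "real N *\<^sub>R lat w = (real N * W) *\<^sub>R u"
      using arg_cong[OF lat_w, of "(*\<^sub>R) (real N)"] by (simp only: scaleR_scaleR)
    then have latz: "lat z = lat L + (real N * W) *\<^sub>R u" by (simp add: z_def lat_add lat_scale)
    have zbig: "B < norm (lat z)"
    proof -
      have "norm ((real N * W) *\<^sub>R u) \<le> norm (lat z) + norm (lat L)"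
        using norm_triangle_ineq4[of "lat z" "lat L"] unfolding latz by simp
      moreover have "norm ((real N * W) *\<^sub>R u) = real N * W" using norm_u by simp
      ultimately show ?thesis using N D(1) norm_ge_zero[of "lat L"] unfolding M_def by linarith
    qed
    have shiftz: "shift (k, L) (int N) = (k, z)" for k by (simp add: z_def)
    \<comment> \<open>Offsets of lines tangent to some obstacle. Such a line could end on a boundary
      point without meeting the open obstacle, which the analysis of flights requires.\<close>
    define Bad where "Bad = (\<lambda>e. H e \<theta>) ` idx \<union> (\<lambda>e. G e \<theta>) ` idx"
    have "countable idx"
      unfolding idx_def
    proof (intro countable_SIGMA)
      have "countable (\<Union>m::nat. {z. norm (lat z) \<le> real m})"
        by (rule countable_UN) (simp_all add: countable_finite finite_lat_bounded)
      moreover have "(\<Union>m::nat. {z. norm (lat z) \<le> real m}) = UNIV" using real_arch_simple by auto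
      ultimately show "countable (UNIV :: (int ^ 2) set)" by simp
    qed (simp add: countable_finite finite_J)
    then have "countable Bad" unfolding Bad_def by auto
    then have "Bad \<in> null_sets lebesgue" by (intro null_sets_completionI countable_imp_null_set_lborel)
    then have Bad: "Bad \<in> sets lebesgue" "emeasure lebesgue Bad = 0" by (auto dest: null_setsD1 null_setsD2)
    have into: "\<theta> < \<theta>1 \<and> (\<exists>k\<in>KS. p \<in> {max (H (nxt ?a) \<theta>) (G (k, z) \<theta>)..min (H ?a \<theta>) (G (shift (prv (?b k)) (int N)) \<theta>)})"
      if pQ: "p \<in> Q" and pB: "p \<notin> Bad" for p
    proof -
      obtain r where r: "r \<in> {0..<len j}" "0 < nrm j r \<bullet> v \<theta>" "(\<gamma> j r, v \<theta>) \<in> S" "p = \<gamma> j r \<bullet> p' \<theta>" using pQ by (auto simp: Q_def)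
      define q where "q = \<gamma> j r"
      define T where "T = flight_time J Ob q (v \<theta>)"
      define q' where "q' = q + T *\<^sub>R v \<theta>"
      have ps: "(q, v \<theta>) \<in> phase_space J Ob" "cell_change J Ob (q, v \<theta>) = z" using r(3) by (auto simp: S_def q_def)
      have T: "0 < T" "q' \<in> cell_frontier z" "\<And>t. 0 < t \<Longrightarrow> t < T \<Longrightarrow> q + t *\<^sub>R v \<theta> \<notin> frontier (table J Ob)"
        using B[OF zbig ps] by (auto simp: T_def q'_def next_point_def)
      obtain k where k: "k \<in> J" "q' \<in> frontier (obs (k, z))" using T(2) by (auto simp: cell_frontier_def)
      have b: "(k, z) \<in> idx" using k by simp
      have qc: "q \<in> closure (obs ?a)" using gamma_frontier[OF j] by (simp add: q_def frontier_def)
      have q'c: "q' \<in> closure (obs (k, z))" using k(2) by (simp add: frontier_def)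
      have pq': "q' \<bullet> p' \<theta> = p" using r(4) by (simp add: q'_def q_def inner_add_left v_inner)
      obtain s where s: "\<gamma> j r + s *\<^sub>R v \<theta> \<in> Ob j" using line_meets_obstacle[OF j, of r "v \<theta>"] r(2) by auto
      have m1: "\<exists>y\<in>obs ?a. y \<bullet> p' \<theta> = q \<bullet> p' \<theta>"
        using s by (intro bexI[of _ "\<gamma> j r + s *\<^sub>R v \<theta>"]) (auto simp: q_def inner_add_left v_inner)
      have "H (k, z) \<theta> \<noteq> p" "G (k, z) \<theta> \<noteq> p" using pB b unfolding Bad_def by blast+
      then have "G (k, z) \<theta> < p" "p < H (k, z) \<theta>" using H_upper[OF b q'c, of \<theta>] G_lower[OF b q'c, of \<theta>] pq' by linarith+
      then have m2: "\<exists>y\<in>obs (k, z). y \<bullet> p' \<theta> = q \<bullet> p' \<theta>"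
      proof -
        have "- p < supp (obs (k, z)) (- p' \<theta>)" using \<open>G (k, z) \<theta> < p\<close> by simp
        then obtain y where y: "y \<in> obs (k, z)" "- p < y \<bullet> (- p' \<theta>)" using less_suppD[OF obs_nonempty[OF b] bounded_obs[OF b]] by metis
        then have y2: "y \<bullet> p' \<theta> < p" by simp
        have "y \<in> closure (obs (k, z))" using y(1) closure_subset by blast
        then show ?thesis using meets[OF b _ y2 \<open>p < H (k, z) \<theta>\<close>] r(4) q_def by metis
      qed
      have free: "\<forall>t. 0 < t \<and> t < T \<longrightarrow> q + t *\<^sub>R v \<theta> \<in> table J Ob"
        using free_flight[OF j r(2), of T] T(3) unfolding q_def by blast
      have diff: "norm (q' - q - lat z) \<le> 2 * D"
      proof -
        have "norm q < D" "norm (q' - lat z) < D"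
          using D(2)[OF j] D(2)[OF k(1)] qc q'c by (auto simp: subset_iff mem_closure_obstacle_iff)
        moreover have e: "q' - q - lat z = (q' - lat z) - q" by simp
        ultimately show ?thesis using norm_triangle_ineq4[of "q' - lat z" q] unfolding e by linarith
      qed
      have "\<bar>(q' - q) \<bullet> n\<bar> \<le> M"
      proof -
        have "(q' - q) \<bullet> n = (q' - q - lat z) \<bullet> n + lat L \<bullet> n" by (simp add: inner_diff_left latz inner_add_left)
        moreover have "\<bar>(q' - q - lat z) \<bullet> n\<bar> \<le> 2 * D" using abs_inner_unit[OF norm_n] diff order_trans by blast
        moreover have "\<bar>lat L \<bullet> n\<bar> \<le> norm (lat L)" by (rule abs_inner_unit[OF norm_n])
        ultimately show ?thesis unfolding M_def by linarith
      qed
      moreover have "R \<le> T"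
      proof -
        have "(q' - q) \<bullet> u = (q' - q - lat z) \<bullet> u + lat L \<bullet> u + real N * W" by (simp add: inner_diff_left latz inner_add_left)
        moreover have "\<bar>(q' - q - lat z) \<bullet> u\<bar> \<le> 2 * D" using abs_inner_unit[OF norm_u] diff order_trans by blast
        moreover have "\<bar>lat L \<bullet> u\<bar> \<le> norm (lat L)" by (rule abs_inner_unit[OF norm_u])
        moreover have "(q' - q) \<bullet> u \<le> T" using T(1) by (simp add: q'_def v_inner mult_left_le)
        ultimately show ?thesis using N unfolding M_def by linarith
      qed
      ultimately have "\<theta> < \<theta>1 \<and> corridor ?a (k, z) \<and>
        (\<forall>c\<in>idx. top c \<bullet> n = top ?a \<bullet> n \<and> top ?a \<bullet> u < top c \<bullet> u \<and> top c \<bullet> u \<le> top ?a \<bullet> u + W \<longrightarrow> H c \<theta> \<le> q \<bullet> p' \<theta>) \<and>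
        (\<forall>c\<in>idx. bot c \<bullet> n = bot (k, z) \<bullet> n \<and> bot c \<bullet> u < bot (k, z) \<bullet> u \<and> bot (k, z) \<bullet> u \<le> bot c \<bullet> u + W \<longrightarrow> q \<bullet> p' \<theta> \<le> G c \<theta>)"
        by (intro R[rule_format, OF a b, where q' = q' and T = T]) (use \<theta> qc q'c m1 m2 free q'_def in blast)
      then have cor: "\<theta> < \<theta>1" "corridor ?a (k, z)"
        and up: "\<And>c. c \<in> idx \<Longrightarrow> top c \<bullet> n = top ?a \<bullet> n \<Longrightarrow> top ?a \<bullet> u < top c \<bullet> u \<Longrightarrow> top c \<bullet> u \<le> top ?a \<bullet> u + W \<Longrightarrow> H c \<theta> \<le> q \<bullet> p' \<theta>"
        and dn: "\<And>c. c \<in> idx \<Longrightarrow> bot c \<bullet> n = bot (k, z) \<bullet> n \<Longrightarrow> bot c \<bullet> u < bot (k, z) \<bullet> u \<Longrightarrow> bot (k, z) \<bullet> u \<le> bot c \<bullet> u + W \<Longrightarrow> q \<bullet> p' \<theta> \<le> G c \<theta>"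
        by blast+
      have corL: "corridor ?a (k, L)" using cor(2) corridor_shift[of ?a "(k, L)" "int N"] shiftz by simp
      have bL: "(k, L) \<in> idx" using k by simp
      note nx = is_next_nxt[OF a corL, unfolded is_next_def] and pv = is_prev_prv[OF bL corL, unfolded is_prev_def]
      have "H (nxt ?a) \<theta> \<le> q \<bullet> p' \<theta>" by (rule up) (use nx in blast)+
      moreover have "q \<bullet> p' \<theta> \<le> G (shift (prv (k, L)) (int N)) \<theta>"
      proof (rule dn)
        have e: "bot (k, z) \<bullet> n = bot (k, L) \<bullet> n" "bot (k, z) \<bullet> u = bot (k, L) \<bullet> u + of_int (int N) * W"
          using shift_top(3,4)[of "(k, L)" "int N"] shiftz[of k] by simp_all
        show "bot (shift (prv (k, L)) (int N)) \<bullet> n = bot (k, z) \<bullet> n" "bot (shift (prv (k, L)) (int N)) \<bullet> u < bot (k, z) \<bullet> u"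
          "bot (k, z) \<bullet> u \<le> bot (shift (prv (k, L)) (int N)) \<bullet> u + W"
          unfolding e shift_top using pv by auto
        show "shift (prv (k, L)) (int N) \<in> idx" by (rule shift_idx) (use pv in blast)
      qed
      moreover have "q \<bullet> p' \<theta> \<le> H ?a \<theta>" by (rule H_upper[OF a qc])
      ultimately show ?thesis using cor(1) corL k(1) \<open>G (k, z) \<theta> < p\<close> r(4) unfolding KS_def q_def by auto
    qed
    have flight: "(\<exists>y\<in>obs ?a. y \<bullet> p' \<theta> = p) \<and> (\<forall>q\<in>closure (obs ?a). q \<bullet> p' \<theta> = p \<and> (\<forall>t>0. q + t *\<^sub>R v \<theta> \<notin> closure (obs ?a)) \<longrightarrow>
         next_point J Ob q (v \<theta>) \<in> frontier (obs (k, z)))"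
      if th: "\<theta> < \<theta>1" and k: "k \<in> KS" and p: "p \<in> {max (H (nxt ?a) \<theta>) (G (k, z) \<theta>)<..<min (H ?a \<theta>) (G (shift (prv (?b k)) (int N)) \<theta>)}" for k p
    proof -
      have kJ: "k \<in> J" "corridor ?a (k, L)" using k by (auto simp: KS_def)
      have bL: "(k, L) \<in> idx" and bz: "(k, z) \<in> idx" using kJ by simp_all
      note nx = is_next_nxt[OF a kJ(2), unfolded is_next_def] and pv = is_prev_prv[OF bL kJ(2), unfolded is_prev_def]
      have e: "bot (k, z) \<bullet> n = bot (k, L) \<bullet> n" "bot (k, z) \<bullet> u = bot (k, L) \<bullet> u + of_int (int N) * W"
        using shift_top(3,4)[of "(k, L)" "int N"] shiftz[of k] by simp_all
      have corz: "corridor ?a (k, z)" using kJ(2) corridor_shift[of ?a "(k, L)" "int N"] shiftz by simp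
      have c': "shift (prv (k, L)) (int N) \<in> idx" by (rule shift_idx) (use pv in blast)
      \<comment> \<open>The extremality of the predecessor is known in the cell L and is transported
        from there by N periods.\<close>
      have mx: "bot f \<bullet> u \<le> bot (shift (prv (k, L)) (int N)) \<bullet> u"
        if f: "f \<in> idx" "bot f \<bullet> n = bot (k, z) \<bullet> n" "bot f \<bullet> u < bot (k, z) \<bullet> u" for f
      proof -
        have "bot (shift f (- int N)) \<bullet> n = bot (k, L) \<bullet> n" "bot (shift f (- int N)) \<bullet> u < bot (k, L) \<bullet> u"
          using f(2,3) unfolding e shift_top by simp_all
        then have "bot (shift f (- int N)) \<bullet> u \<le> bot (prv (k, L)) \<bullet> u" using pv shift_idx[OF f(1)] by blast
        then show ?thesis unfolding shift_top by simp
      qed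
      show ?thesis
      proof (rule \<delta>2(2)[rule_format, OF a bz _ c', where c = "nxt ?a"])
        show "nxt ?a \<in> idx" using nx by blast
        show "0 < \<theta> \<and> \<theta> < \<delta>2 \<and> corridor ?a (k, z) \<and>
      top (nxt ?a) \<bullet> n = top ?a \<bullet> n \<and> top ?a \<bullet> u < top (nxt ?a) \<bullet> u \<and> top (nxt ?a) \<bullet> u \<le> top ?a \<bullet> u + W \<and>
      (\<forall>e\<in>idx. top e \<bullet> n = top ?a \<bullet> n \<and> top ?a \<bullet> u < top e \<bullet> u \<longrightarrow> top (nxt ?a) \<bullet> u \<le> top e \<bullet> u) \<and>
      bot (shift (prv (k, L)) (int N)) \<bullet> n = bot (k, z) \<bullet> n \<and> bot (shift (prv (k, L)) (int N)) \<bullet> u < bot (k, z) \<bullet> u \<and>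
      bot (k, z) \<bullet> u \<le> bot (shift (prv (k, L)) (int N)) \<bullet> u + W \<and>
      (\<forall>e\<in>idx. bot e \<bullet> n = bot (k, z) \<bullet> n \<and> bot e \<bullet> u < bot (k, z) \<bullet> u \<longrightarrow> bot e \<bullet> u \<le> bot (shift (prv (k, L)) (int N)) \<bullet> u) \<and>
      H (nxt ?a) \<theta> < p \<and> p < H ?a \<theta> \<and> G (k, z) \<theta> < p \<and> p < G (shift (prv (k, L)) (int N)) \<theta>"
        proof (intro conjI)
          show "bot (shift (prv (k, L)) (int N)) \<bullet> n = bot (k, z) \<bullet> n" "bot (shift (prv (k, L)) (int N)) \<bullet> u < bot (k, z) \<bullet> u"
            "bot (k, z) \<bullet> u \<le> bot (shift (prv (k, L)) (int N)) \<bullet> u + W"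
            unfolding e shift_top using pv by auto
          show "\<forall>e\<in>idx. bot e \<bullet> n = bot (k, z) \<bullet> n \<and> bot e \<bullet> u < bot (k, z) \<bullet> u \<longrightarrow> bot e \<bullet> u \<le> bot (shift (prv (k, L)) (int N)) \<bullet> u"
            using mx by blast
          show "0 < \<theta>" "\<theta> < \<delta>2" "corridor ?a (k, z)" using \<theta> th \<theta>1(4) corz by auto
          show "H (nxt ?a) \<theta> < p" "p < H ?a \<theta>" "G (k, z) \<theta> < p" "p < G (shift (prv (k, L)) (int N)) \<theta>" using p by auto
        qed (use nx in blast)+
      qed
    qed
    let ?I = "\<lambda>k. {max (H (nxt ?a) \<theta>) (G (k, z) \<theta>)<..<min (H ?a \<theta>) (G (shift (prv (?b k)) (int N)) \<theta>)}"
    let ?C = "\<lambda>k. {max (H (nxt ?a) \<theta>) (G (k, z) \<theta>)..min (H ?a \<theta>) (G (shift (prv (?b k)) (int N)) \<theta>)}"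
    have ex: "\<exists>r\<in>{0..<len j}. \<gamma> j r \<bullet> p' \<theta> = p \<and> 0 < nrm j r \<bullet> v \<theta> \<and> next_point J Ob (\<gamma> j r) (v \<theta>) \<in> frontier (obs (k, z))"
      if th: "\<theta> < \<theta>1" and k: "k \<in> KS" and p: "p \<in> ?I k" for k p
    proof -
      obtain y where y: "y \<in> Ob j" "y \<bullet> p' \<theta> = p" using flight[OF th k p] by auto
      obtain r s where r: "r \<in> {0..<len j}" "0 < s" "\<gamma> j r = y + s *\<^sub>R v \<theta>" "0 < nrm j r \<bullet> v \<theta>"
        by (rule exit_point[OF j y(1) norm_v])
      have gp: "\<gamma> j r \<bullet> p' \<theta> = p" using r(3) y(2) by (simp add: inner_add_left v_inner)
      have gc: "\<gamma> j r \<in> closure (obs ?a)" using gamma_frontier[OF j] by (simp add: frontier_def)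
      have "\<forall>t>0. \<gamma> j r + t *\<^sub>R v \<theta> \<notin> closure (obs ?a)" using leaves_obstacle[OF j r(4)] by simp
      then have "next_point J Ob (\<gamma> j r) (v \<theta>) \<in> frontier (obs (k, z))" using flight[OF th k p] gp gc by blast
      then show ?thesis using r gp by blast
    qed
    have IQ: "p \<in> Q" if th: "\<theta> < \<theta>1" and k: "k \<in> KS" and p: "p \<in> ?I k" for k p
    proof -
      obtain r where r: "r \<in> {0..<len j}" "\<gamma> j r \<bullet> p' \<theta> = p" "0 < nrm j r \<bullet> v \<theta>" "next_point J Ob (\<gamma> j r) (v \<theta>) \<in> frontier (obs (k, z))"
        using ex[OF th k p] by blast
      have "k \<in> J" using k by (simp add: KS_def)
      then have "cell_change J Ob (\<gamma> j r, v \<theta>) = z" using r(4) by (intro cell_change_eq) (auto simp: cell_frontier_def)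
      moreover have "(\<gamma> j r, v \<theta>) \<in> phase_space J Ob"
        using j r(3) norm_v gamma_frontier[OF j] unfolding phase_space_def by (auto intro: less_imp_le)
      ultimately show ?thesis using r unfolding Q_def S_def by auto
    qed
    \<comment> \<open>A common offset would give one exit point whose next collision lies on two
      different obstacles.\<close>
    have disj: "disjoint_family_on ?I KS" if th: "\<theta> < \<theta>1"
    proof (unfold disjoint_family_on_def, intro ballI impI, rule ccontr)
      fix k k' assume k: "k \<in> KS" "k' \<in> KS" "k \<noteq> k'" and "?I k \<inter> ?I k' \<noteq> {}"
      then obtain p where p: "p \<in> ?I k" "p \<in> ?I k'" by blast
      obtain r where r: "\<gamma> j r \<bullet> p' \<theta> = p" "0 < nrm j r \<bullet> v \<theta>" "next_point J Ob (\<gamma> j r) (v \<theta>) \<in> frontier (obs (k, z))"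
        using ex[OF th k(1) p(1)] by blast
      have gc: "\<gamma> j r \<in> closure (obs ?a)" using gamma_frontier[OF j] by (simp add: frontier_def)
      have "\<forall>t>0. \<gamma> j r + t *\<^sub>R v \<theta> \<notin> closure (obs ?a)" using leaves_obstacle[OF j r(2)] by simp
      then have "next_point J Ob (\<gamma> j r) (v \<theta>) \<in> frontier (obs (k', z))" using flight[OF th k(2) p(2)] r(1) gc by blast
      then have "(k, z) = (k', z)"
        using r(3) k by (intro disjoint_closures[of _ _ "next_point J Ob (\<gamma> j r) (v \<theta>)"]) (auto simp: frontier_def KS_def)
      then show False using k by simp
    qed
    have fin: "finite KS" using finite_J by (simp add: KS_def)
    have w: "ennreal (cwidth ?a (?b k) (real N * W) \<theta>) = emeasure lebesgue (?I k)" "ennreal (cwidth ?a (?b k) (real N * W) \<theta>) = emeasure lebesgue (?C k)"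
      if k: "k \<in> KS" for k
    proof -
      have c: "cwidth ?a (?b k) (real N * W) \<theta> = max 0 (min (H ?a \<theta>) (G (shift (prv (?b k)) (int N)) \<theta>) - max (H (nxt ?a) \<theta>) (G (k, z) \<theta>))"
        using cwidth_eq[OF a _ , of "?b k" "int N" \<theta>] k shiftz[of k] by (simp add: KS_def)
      show "ennreal (cwidth ?a (?b k) (real N * W) \<theta>) = emeasure lebesgue (?I k)" "ennreal (cwidth ?a (?b k) (real N * W) \<theta>) = emeasure lebesgue (?C k)"
        unfolding c emeasure_lebesgue_interval by simp_all
    qed
    \<comment> \<open>For angles below \<open>\<theta>1\<close>, \<open>Q\<close> is squeezed
      between the disjoint union of the open intervals and the union of the closed ones with the
      null set \<open>Bad\<close>. Both bounds have the same measure. For larger angles only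
      \<open>Bad\<close> remains.\<close>
    have "emeasure lebesgue Q = (if \<theta> < \<theta>1 then \<Sum>k\<in>KS. ennreal (cwidth ?a (?b k) (real N * W) \<theta>) else 0)"
    proof (cases "\<theta> < \<theta>1")
      case False
      then have "Q \<subseteq> Bad" using into by blast
      then have "emeasure lebesgue Q \<le> 0" using emeasure_mono[OF _ Bad(1)] Bad(2) by metis
      then show ?thesis using False by simp
    next
      case True
      have "Q \<subseteq> Bad \<union> (\<Union>k\<in>KS. ?C k)" using into by blast
      then have "emeasure lebesgue Q \<le> emeasure lebesgue (Bad \<union> (\<Union>k\<in>KS. ?C k))"
        using Bad(1) fin by (intro emeasure_mono) (auto intro!: sets.Un sets.finite_UN)
      also have "\<dots> \<le> emeasure lebesgue Bad + emeasure lebesgue (\<Union>k\<in>KS. ?C k)"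
        using Bad(1) fin by (intro emeasure_subadditive) (auto intro!: sets.finite_UN)
      also have "emeasure lebesgue (\<Union>k\<in>KS. ?C k) \<le> (\<Sum>k\<in>KS. emeasure lebesgue (?C k))"
        using fin by (intro emeasure_subadditive_finite) auto
      also have "emeasure lebesgue Bad + (\<Sum>k\<in>KS. emeasure lebesgue (?C k)) = (\<Sum>k\<in>KS. ennreal (cwidth ?a (?b k) (real N * W) \<theta>))"
        using w(2) Bad(2) by simp
      finally have le: "emeasure lebesgue Q \<le> (\<Sum>k\<in>KS. ennreal (cwidth ?a (?b k) (real N * W) \<theta>))" by simp
      have "(\<Sum>k\<in>KS. ennreal (cwidth ?a (?b k) (real N * W) \<theta>)) = (\<Sum>k\<in>KS. emeasure lebesgue (?I k))" using w(1) by simp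
      also have "\<dots> = emeasure lebesgue (\<Union>k\<in>KS. ?I k)"
        using fin disj[OF True] by (intro sum_emeasure) auto
      also have "\<dots> \<le> emeasure lebesgue Q" using IQ[OF True] flQ(2) by (intro emeasure_mono) auto
      finally show ?thesis using le True by simp
    qed
    then show "flux j {x \<in> phase_space J Ob. cell_change J Ob x = L + int N *s w} (v \<theta>) =
          (if \<theta> < \<theta>1 then \<Sum>k\<in>{k\<in>J. corridor (j, 0) (k, L)}. ennreal (cwidth (j, 0) (k, L) (real N * W) \<theta>) else 0)"
      using flQ(1) unfolding S_def z_def KS_def by simp
  qed
  then show ?thesis using \<theta>1 \<delta>1(2) by (intro exI[of _ \<theta>1]) auto
qed

lemma flux_integral:
  assumes \<theta>1: "0 < \<theta>1" "\<theta>1 \<le> 1" and j: "j \<in> J"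
    and fl: "\<And>\<theta>. 0 < \<theta> \<Longrightarrow> \<theta> < pi / 2 \<Longrightarrow> flux j S (v \<theta>) =
          (if \<theta> < \<theta>1 then \<Sum>k\<in>{k\<in>J. corridor (j, 0) (k, L)}. ennreal (cwidth (j, 0) (k, L) M \<theta>) else 0)"
  shows "(\<integral>\<^sup>+\<theta>. flux j S (v \<theta>) * indicator {0<..<pi/2} \<theta> \<partial>lborel) =
    ennreal (\<Sum>k\<in>{k\<in>J. corridor (j, 0) (k, L)}. integral {0..\<theta>1} (cwidth (j, 0) (k, L) M))"
proof -
  let ?K = "{k\<in>J. corridor (j, 0) (k, L)}"
  have cont: "continuous_on A (cwidth (j, 0) (k, L) M)" if "k \<in> ?K" for k A
    using that j by (intro continuous_cwidth) auto
  have nn: "0 \<le> cwidth (j, 0) (k, L) M \<theta>" for k \<theta> by (simp add: cwidth_def strip_width_def)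
  have int: "(\<integral>\<^sup>+\<theta>. ennreal (cwidth (j, 0) (k, L) M \<theta>) * indicator {0<..<\<theta>1} \<theta> \<partial>lborel) = ennreal (integral {0..\<theta>1} (cwidth (j, 0) (k, L) M))"
    if k: "k \<in> ?K" for k
  proof -
    have "(cwidth (j, 0) (k, L) M has_integral integral {0..\<theta>1} (cwidth (j, 0) (k, L) M)) {0..\<theta>1}"
      using cont[OF k] by (intro integrable_integral integrable_continuous_interval)
    then have "(cwidth (j, 0) (k, L) M has_integral integral {0..\<theta>1} (cwidth (j, 0) (k, L) M)) {0<..<\<theta>1}"
      using has_integral_Icc_iff_Ioo by blast
    then show ?thesis using nn by (intro nn_integral_has_integral_lebesgue')
  qed
  have "(\<integral>\<^sup>+\<theta>. flux j S (v \<theta>) * indicator {0<..<pi/2} \<theta> \<partial>lborel) =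
    (\<integral>\<^sup>+\<theta>. (\<Sum>k\<in>?K. ennreal (cwidth (j, 0) (k, L) M \<theta>) * indicator {0<..<\<theta>1} \<theta>) \<partial>lborel)"
  proof (rule nn_integral_cong)
    fix \<theta> :: real
    have "\<theta>1 < pi / 2" using \<theta>1(2) pi_gt3 by linarith
    then show "flux j S (v \<theta>) * indicator {0<..<pi/2} \<theta> = (\<Sum>k\<in>?K. ennreal (cwidth (j, 0) (k, L) M \<theta>) * indicator {0<..<\<theta>1} \<theta>)"
      using fl[of \<theta>] by (auto split: split_indicator)
  qed
  also have "\<dots> = (\<Sum>k\<in>?K. \<integral>\<^sup>+\<theta>. ennreal (cwidth (j, 0) (k, L) M \<theta>) * indicator {0<..<\<theta>1} \<theta> \<partial>lborel)"
  proof (rule nn_integral_sum)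
    fix k assume k: "k \<in> ?K"
    have "cwidth (j, 0) (k, L) M \<in> borel_measurable borel" by (rule borel_measurable_continuous_onI[OF cont[OF k]])
    moreover have "{0<..<\<theta>1} \<in> sets borel" by simp
    ultimately show "(\<lambda>\<theta>. ennreal (cwidth (j, 0) (k, L) M \<theta>) * indicator {0<..<\<theta>1} \<theta>) \<in> borel_measurable lborel"
      by (intro borel_measurable_times_ennreal borel_measurable_indicator) simp_all
  qed
  also have "\<dots> = (\<Sum>k\<in>?K. ennreal (integral {0..\<theta>1} (cwidth (j, 0) (k, L) M)))"
    by (intro sum.cong refl int)
  also have "\<dots> = ennreal (\<Sum>k\<in>?K. integral {0..\<theta>1} (cwidth (j, 0) (k, L) M))"
    by (intro sum_ennreal integral_nonneg integrable_continuous_interval cont nn)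
  finally show ?thesis .
qed

section \<open>Corridors as pairs of boundary points, and their coefficients\<close>

lemma same_height_dist:
  assumes "x \<bullet> n = y \<bullet> n" "y \<bullet> u \<le> x \<bullet> u"
  shows "dist x y = x \<bullet> u - y \<bullet> u"
proof -
  have "x - y = (x \<bullet> u - y \<bullet> u) *\<^sub>R u"
    using decomp_un[of "x - y"] assms(1) by (simp only: inner_diff_left) simp
  then have "norm (x - y) = \<bar>x \<bullet> u - y \<bullet> u\<bar> * norm u" by (metis norm_scaleR)
  then show ?thesis using assms(2) norm_u by (simp add: dist_norm)
qed

lemma line_height: "y \<in> line x (lat w) \<Longrightarrow> y \<bullet> n = x \<bullet> n"
  by (auto simp: line_def inner_add_left lat_w_inner)

lemma mem_line_iff: "y \<in> line x (lat w) \<longleftrightarrow> y \<bullet> n = x \<bullet> n"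
proof
  assume h: "y \<bullet> n = x \<bullet> n"
  define t where "t = (y \<bullet> u - x \<bullet> u) / W"
  have z: "(y - (x + t *\<^sub>R lat w)) \<bullet> u = 0" "(y - (x + t *\<^sub>R lat w)) \<bullet> n = 0"
    using h W_pos by (simp_all only: inner_diff_left inner_add_left inner_scaleR_left lat_w_inner t_def) simp_all
  have "y - (x + t *\<^sub>R lat w) = 0" using decomp_un[of "y - (x + t *\<^sub>R lat w)"] unfolding z by simp
  then have "y = x + t *\<^sub>R lat w" by simp
  then show "y \<in> line x (lat w)" unfolding line_def by (rule range_eqI)
qed (rule line_height)

lemma strip_in_hull:
  assumes "A \<bullet> n < B \<bullet> n" "A \<bullet> n \<le> y \<bullet> n" "y \<bullet> n \<le> B \<bullet> n"
  shows "y \<in> convex hull (line A (lat w) \<union> line B (lat w))"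
proof -
  define l where "l = (y \<bullet> n - A \<bullet> n) / (B \<bullet> n - A \<bullet> n)"
  have l: "0 \<le> l" "l \<le> 1" using assms by (auto simp: l_def)
  define x1 where "x1 = y + (A \<bullet> n - y \<bullet> n) *\<^sub>R n"
  define x2 where "x2 = y + (B \<bullet> n - y \<bullet> n) *\<^sub>R n"
  have "x1 \<in> line A (lat w)" "x2 \<in> line B (lat w)" unfolding mem_line_iff by (simp_all add: x1_def x2_def inner_add_left)
  then have x: "x1 \<in> convex hull (line A (lat w) \<union> line B (lat w))" "x2 \<in> convex hull (line A (lat w) \<union> line B (lat w))"
    by (auto intro: hull_inc)
  have "(1 - l) * (A \<bullet> n - y \<bullet> n) + l * (B \<bullet> n - y \<bullet> n) = 0"
  proof -
    have "l * (B \<bullet> n - A \<bullet> n) = y \<bullet> n - A \<bullet> n" using assms by (simp add: l_def)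
    then show ?thesis by (simp add: algebra_simps)
  qed
  moreover have "(1 - l) *\<^sub>R x1 + l *\<^sub>R x2 = y + ((1 - l) * (A \<bullet> n - y \<bullet> n) + l * (B \<bullet> n - y \<bullet> n)) *\<^sub>R n"
    by (simp add: x1_def x2_def algebra_simps)
  ultimately have "(1 - l) *\<^sub>R x1 + l *\<^sub>R x2 = y" by simp
  then show ?thesis using convexD[OF convex_convex_hull x, of "1 - l" l] l by simp
qed

lemma hull_in_strip:
  assumes "y \<in> convex hull (line A (lat w) \<union> line B (lat w))" "A \<bullet> n \<le> B \<bullet> n"
  shows "A \<bullet> n \<le> y \<bullet> n" "y \<bullet> n \<le> B \<bullet> n"
proof -
  have "convex hull (line A (lat w) \<union> line B (lat w)) \<subseteq> {y. A \<bullet> n \<le> n \<bullet> y} \<inter> {y. n \<bullet> y \<le> B \<bullet> n}"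
    using assms(2) line_height
    by (intro hull_minimal convex_Int convex_halfspace_ge convex_halfspace_le) (auto simp: inner_commute[of n])
  then show "A \<bullet> n \<le> y \<bullet> n" "y \<bullet> n \<le> B \<bullet> n" using assms(1) by (auto simp: inner_commute[of n])
qed

lemma obs_strict_height:
  assumes "c \<in> idx" "y \<in> obs c"
  shows "y \<bullet> n < top c \<bullet> n" "bot c \<bullet> n < y \<bullet> n"
proof -
  have y: "y \<in> closure (obs c)" using assms(2) closure_subset by blast
  have "y \<notin> frontier (obs c)" using assms frontier_obs_eq by blast
  then have "y \<noteq> top c" "y \<noteq> bot c" using top_frontier[OF assms(1)] bot_frontier[OF assms(1)] by metis+
  then show "y \<bullet> n < top c \<bullet> n" "bot c \<bullet> n < y \<bullet> n"
    using top_max[OF assms(1) y] top_unique[OF assms(1) y] bot_min[OF assms(1) y] bot_unique[OF assms(1) y] by force+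
qed

text \<open>An obstacle reaching strictly between the two levels would, by convexity, contain a
  point of the strip. So every obstacle lies on one side, and a boundary point at the level of a
  side is the unique extremal point of its obstacle. The inequality selects corridors with
  \<open>A\<close> on the lower side; the others belong to -n.\<close>

lemma corridor_pairs_oriented:
  "{(A, B) \<in> corridor_pairs J Ob L w. A \<bullet> n < (B + lat L) \<bullet> n} =
    (\<lambda>(j, k). (top0 n j, top0 (- n) k)) ` (SIGMA j:J. {k\<in>J. corridor (j, 0) (k, L)})" (is "?E = ?F")
proof (intro set_eqI iffI)
  fix x assume "x \<in> ?F"
  then obtain j k where x: "x = (top0 n j, top0 (- n) k)" and jk: "j \<in> J" "k \<in> J" and cor: "corridor (j, 0) (k, L)" by auto
  have a: "(j, 0) \<in> idx" "(k, 0) \<in> idx" using jk by auto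
  have lt: "top0 n j \<bullet> n < (top0 (- n) k + lat L) \<bullet> n" using cor by (simp add: corridor_def)
  have "top0 n j \<in> frontier (Ob j)" "top0 (- n) k \<in> frontier (Ob k)" using top_frontier[OF a(1)] bot_frontier[OF a(2)] by simp_all
  moreover have "line (top0 n j) (lat w) \<noteq> line (top0 (- n) k + lat L) (lat w)"
    using mem_line_iff[of "top0 n j" "top0 n j"] mem_line_iff[of "top0 n j" "top0 (- n) k + lat L"] lt by auto
  moreover have "convex hull (line (top0 n j) (lat w) \<union> line (top0 (- n) k + lat L) (lat w)) \<subseteq> table J Ob"
  proof
    fix y assume "y \<in> convex hull (line (top0 n j) (lat w) \<union> line (top0 (- n) k + lat L) (lat w))"
    then have y: "top0 n j \<bullet> n \<le> y \<bullet> n" "y \<bullet> n \<le> (top0 (- n) k + lat L) \<bullet> n" using hull_in_strip lt by (meson less_imp_le)+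
    show "y \<in> table J Ob"
      unfolding mem_table
    proof (intro ballI notI)
      fix c assume c: "c \<in> idx" "y \<in> obs c"
      have "top c \<bullet> n \<le> top (j, 0) \<bullet> n \<or> bot (k, L) \<bullet> n \<le> bot c \<bullet> n" using cor c(1) unfolding corridor_def by blast
      moreover have "top (j, 0) = top0 n j" "bot (k, L) = top0 (- n) k + lat L" by simp_all
      ultimately have "top c \<bullet> n \<le> top0 n j \<bullet> n \<or> (top0 (- n) k + lat L) \<bullet> n \<le> bot c \<bullet> n" by metis
      then show False using obs_strict_height[OF c] y by linarith
    qed
  qed
  ultimately show "x \<in> ?E" using lt jk unfolding x corridor_pairs_def by blast
next
  fix x assume "x \<in> ?E"
  then obtain A B where x: "x = (A, B)" and AB: "(A, B) \<in> corridor_pairs J Ob L w" and lt: "A \<bullet> n < (B + lat L) \<bullet> n" by blast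
  obtain j k where jk: "j \<in> J" "k \<in> J" "A \<in> frontier (Ob j)" "B \<in> frontier (Ob k)"
    and sub: "convex hull (line A (lat w) \<union> line (B + lat L) (lat w)) \<subseteq> table J Ob"
    using AB unfolding corridor_pairs_def by blast
  define hA hB where "hA = A \<bullet> n" and "hB = (B + lat L) \<bullet> n"
  have h: "hA < hB" using lt by (simp add: hA_def hB_def)
  have dich: "top c \<bullet> n \<le> hA \<or> hB \<le> bot c \<bullet> n" if c: "c \<in> idx" for c
  proof (rule ccontr)
    assume "\<not> ?thesis"
    then have n: "hA < top c \<bullet> n" "bot c \<bullet> n < hB" by auto
    have bt: "bot c \<bullet> n < top c \<bullet> n" using thickness c by fastforce
    \<comment> \<open>The middle of the overlap of the two ranges of heights, so strictly inside the
      range of the obstacle.\<close>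
    define t where "t = (max hA (bot c \<bullet> n) + min hB (top c \<bullet> n)) / 2"
    have t: "hA \<le> t" "t \<le> hB" "bot c \<bullet> n < t" "t < top c \<bullet> n" using n h bt by (auto simp: t_def max_def min_def)
    have "t < supp (obs c) n" using t(4) supp_upper_closure[OF bounded_obs[OF c] top_closure[OF c], of n] by linarith
    then obtain y where y: "y \<in> obs c" "y \<bullet> n = t"
      using open_convex_meets_level[OF convex_obs[OF c] bounded_obs[OF c] bot_closure[OF c] t(3)] by metis
    have "y \<in> convex hull (line A (lat w) \<union> line (B + lat L) (lat w))"
      using lt t y(2) by (intro strip_in_hull) (auto simp: hA_def hB_def)
    then show False using sub y(1) c mem_table by blast
  qed
  have a: "(j, 0) \<in> idx" and b: "(k, L) \<in> idx" using jk by auto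
  have Ac: "A \<in> closure (obs (j, 0))" and Bc: "B + lat L \<in> closure (obs (k, L))"
    using jk by (simp_all add: frontier_def mem_closure_obstacle_iff)
  have "top (j, 0) \<bullet> n = A \<bullet> n"
    using dich[OF a] bot_min[OF a Ac] top_max[OF a Ac] h unfolding hA_def by linarith
  then have A: "A = top (j, 0)" using top_unique[OF a Ac] by simp
  have "bot (k, L) \<bullet> n = (B + lat L) \<bullet> n"
    using dich[OF b] bot_min[OF b Bc] top_max[OF b Bc] h unfolding hB_def by linarith
  then have B: "B + lat L = bot (k, L)" using bot_unique[OF b Bc] by simp
  have "corridor (j, 0) (k, L)" unfolding corridor_def A[symmetric] B[symmetric] using h dich by (simp add: hA_def hB_def)
  moreover have "x = (top0 n j, top0 (- n) k)" using A B by (simp add: x)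
  ultimately show "x \<in> ?F" using jk(1,2) by force
qed

lemma inj_tops: "inj_on (\<lambda>(j, k). (top0 n j, top0 (- n) k)) (J \<times> J)"
proof (rule inj_onI, clarify)
  fix i k i' k' assume J: "i \<in> J" "k \<in> J" "i' \<in> J" "k' \<in> J" and e: "top0 n i = top0 n i'" "top0 (- n) k = top0 (- n) k'"
  have "(i, 0 :: int ^ 2) = (i', 0)" using J e top0(1)[of i n] top0(1)[of i' n] by (intro disjoint_closures[of _ _ "top0 n i"]) auto
  moreover have "(k, 0 :: int ^ 2) = (k', 0)" using J e top0(1)[of k "- n"] top0(1)[of k' "- n"] by (intro disjoint_closures[of _ _ "top0 (- n) k"]) auto
  ultimately show "i = i' \<and> k = k'" by simp
qed

text \<open>Matches the geometric data of the statement with the parameters of the width integral.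
  The quadratic excess coefficients are 1 / (2 curvature), and the sum of abscissas is rewritten
  through the two gaps and the displacement from A to B + L.\<close>

lemma corridor_coefficients:
  assumes jk: "j \<in> J" "k \<in> J" and cor: "corridor (j, 0) (k, L)"
  defines "A \<equiv> top0 n j" and "B \<equiv> top0 (- n) k"
    and "d \<equiv> bot (k, L) \<bullet> n - top (j, 0) \<bullet> n"
    and "\<Delta>x \<equiv> top (nxt (j, 0)) \<bullet> u - top (j, 0) \<bullet> u" and "\<Delta>y \<equiv> bot (k, L) \<bullet> u - bot (prv (k, L)) \<bullet> u"
  shows "corridor_width L w A B = d"
    and "coeff_a J Ob w A B = \<Delta>x * \<Delta>y / W\<^sup>2"
    and "coeff_a' J Ob \<gamma> L w A B = d\<^sup>2 * (d * (\<Delta>y * (1 / (2 * curvature J \<gamma> (top (j, 0))) - 1 / (2 * curvature J \<gamma> (top (nxt (j, 0))))) +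
        \<Delta>x * (1 / (2 * curvature J \<gamma> (bot (k, L))) - 1 / (2 * curvature J \<gamma> (bot (prv (k, L)))))) +
      3 * \<Delta>x * \<Delta>y * (top (j, 0) \<bullet> u + top (nxt (j, 0)) \<bullet> u - bot (k, L) \<bullet> u - bot (prv (k, L)) \<bullet> u) / 2)"
proof -
  let ?a = "(j, 0 :: int ^ 2)" and ?b = "(k, L)"
  have a: "?a \<in> idx" and b: "?b \<in> idx" using jk by auto
  note nx = is_next_nxt[OF a cor, unfolded is_next_def] and pv = is_prev_prv[OF b cor, unfolded is_prev_def]
  have A: "A = top ?a" by (simp add: A_def)
  have B: "B + lat L = bot ?b" "B = bot ?b + lat (- L)" by (simp_all add: B_def lat_minus)
  have d0: "0 < d" using cor by (simp add: d_def corridor_def)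
  show W: "corridor_width L w A B = d"
    unfolding corridor_width_def
  proof -
    define y where "y = A + d *\<^sub>R n"
    have yn: "y \<bullet> n = (B + lat L) \<bullet> n" unfolding B(1) by (simp only: y_def inner_add_left inner_scaleR_left A d_def inner_un) simp
    have m: "A \<in> line A (lat w)" "y \<in> line (B + lat L) (lat w)" using yn by (simp_all only: mem_line_iff)
    have y: "dist A y = d" using d0 norm_n by (simp add: y_def dist_norm)
    have "setdist (line A (lat w)) (line (B + lat L) (lat w)) = dist A y"
    proof (rule setdist_unique[OF m])
      fix x1 x2 assume "x1 \<in> line A (lat w) \<and> x2 \<in> line (B + lat L) (lat w)"
      then have "x1 \<bullet> n = A \<bullet> n" "x2 \<bullet> n = (B + lat L) \<bullet> n" by (simp_all only: mem_line_iff)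
      then have "d = (x2 - x1) \<bullet> n" unfolding B(1) A d_def inner_diff_left by simp
      also have "\<dots> \<le> norm (x2 - x1)" using abs_inner_unit[OF norm_n, of "x2 - x1"] by linarith
      finally show "dist A y \<le> dist x1 x2" unfolding y by (simp add: dist_norm norm_minus_commute)
    qed
    then show "setdist (line A (lat w)) (line (B + lat L) (lat w)) = d" using y by simp
  qed
  have A': "next_point J Ob A (lat w) = top (nxt ?a)" unfolding A using nx by blast
  \<comment> \<open>\<open>B\<close> belongs to the cell 0 whereas the upper side is touched in the
    cell L; the preceding point is therefore translated back by L, which changes neither distances
    nor curvatures.\<close>
  have B'': "next_point J Ob B (- lat w) = bot (prv ?b) + lat (- L)"
  proof -
    have "next_point J Ob (bot ?b) (- lat w) = bot (prv ?b)" using pv by blast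
    then show ?thesis unfolding B(2) next_point_translate by (rule arg_cong)
  qed
  have dA: "dist A (top (nxt ?a)) = \<Delta>x"
    using same_height_dist[of "top (nxt ?a)" "top ?a"] nx unfolding A \<Delta>x_def dist_commute[of "top ?a"] by simp
  have dB: "dist (bot (prv ?b) + lat (- L)) B = \<Delta>y"
    using same_height_dist[of "bot ?b" "bot (prv ?b)"] pv unfolding B(2) \<Delta>y_def dist_commute[of _ "bot ?b + _"] by (simp add: dist_norm)
  show ca: "coeff_a J Ob w A B = \<Delta>x * \<Delta>y / W\<^sup>2" unfolding coeff_a_def A' B'' dA dB ..
  have cA: "curvature J \<gamma> A = curvature J \<gamma> (top ?a)" by (simp only: A)
  have cB: "curvature J \<gamma> B = curvature J \<gamma> (bot ?b)" unfolding B(2) by (rule curvature_translate[OF b bot_frontier[OF b]])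
  have p: "prv ?b \<in> idx" using pv by blast
  have cB'': "curvature J \<gamma> (bot (prv ?b) + lat (- L)) = curvature J \<gamma> (bot (prv ?b))" by (rule curvature_translate[OF p bot_frontier[OF p]])
  have in_w: "lat w \<bullet> x = W * (x \<bullet> u)" for x
    using arg_cong[OF lat_w, of "\<lambda>y. y \<bullet> x"] by (simp only: inner_scaleR_left inner_commute[of u x])
  have "lat w \<bullet> (B + lat L - A) = W * (bot ?b \<bullet> u - top ?a \<bullet> u)"
    unfolding B(1) A in_w inner_diff_left ..
  then have \<delta>: "lat w \<bullet> (B + lat L - A) / W = bot ?b \<bullet> u - top ?a \<bullet> u" using W_pos by simp
  have half: "1 / (2 * c) = (1 / c) / 2" for c :: real by simp
  show "coeff_a' J Ob \<gamma> L w A B = d\<^sup>2 * (d * (\<Delta>y * (1 / (2 * curvature J \<gamma> (top (j, 0))) - 1 / (2 * curvature J \<gamma> (top (nxt (j, 0))))) +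
        \<Delta>x * (1 / (2 * curvature J \<gamma> (bot (k, L))) - 1 / (2 * curvature J \<gamma> (bot (prv (k, L)))))) +
      3 * \<Delta>x * \<Delta>y * (top (j, 0) \<bullet> u + top (nxt (j, 0)) \<bullet> u - bot (k, L) \<bullet> u - bot (prv (k, L)) \<bullet> u) / 2)"
  proof -
    have s: "top ?a \<bullet> u + top (nxt ?a) \<bullet> u - bot ?b \<bullet> u - bot (prv ?b) \<bullet> u = \<Delta>x + \<Delta>y - 2 * (bot ?b \<bullet> u - top ?a \<bullet> u)"
    proof -
      have "p + q - r - t = q - p + (r - t) - 2 * (r - p)" for p q r t :: real by simp
      then show ?thesis unfolding \<Delta>x_def \<Delta>y_def .
    qed
    show ?thesis
      unfolding coeff_a'_def Let_def A' B'' dA dB W cA cB cB'' \<delta> s half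
      by (simp add: power2_eq_square power3_eq_cube algebra_simps)
  qed
qed

text \<open>The width asymptotics along M = N W, multiplied by 1 / (2 P W^4), where \<open>P\<close>
  will be the perimeter.\<close>

lemma corridor_asymptotics:
  assumes jk: "j \<in> J" "k \<in> J" and cor: "corridor (j, 0) (k, L)" and \<theta>1: "0 < \<theta>1" "\<theta>1 \<le> 1"
    and small: "\<forall>a\<in>idx. \<forall>\<theta>. 0 < \<theta> \<and> \<theta> < \<theta>1 \<longrightarrow> 0 \<le> top_excess a \<theta> \<and> top_excess a \<theta> \<le> sin \<theta> \<and> 0 \<le> bot_excess a \<theta> \<and> bot_excess a \<theta> \<le> sin \<theta>"
  defines "A \<equiv> top0 n j" and "B \<equiv> top0 (- n) k"
  shows "((\<lambda>N. real N ^ 4 * (integral {0..\<theta>1} (cwidth (j, 0) (k, L) (real N * W)) / (2 * P) -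
     ((corridor_width L w A B)\<^sup>2 * coeff_a J Ob w A B / (2 * P * W * real N ^ 3) + coeff_a' J Ob \<gamma> L w A B / (2 * P * (W * real N) ^ 4)))) \<longlongrightarrow> 0) sequentially"
proof -
  let ?a = "(j, 0 :: int ^ 2)" and ?b = "(k, L)"
  have a: "?a \<in> idx" and b: "?b \<in> idx" using jk by auto
  note nx = is_next_nxt[OF a cor, unfolded is_next_def] and pv = is_prev_prv[OF b cor, unfolded is_prev_def]
  have c: "nxt ?a \<in> idx" and c': "prv ?b \<in> idx" using nx pv by blast+
  define d where "d = bot ?b \<bullet> n - top ?a \<bullet> n"
  define \<Delta>x where "\<Delta>x = top (nxt ?a) \<bullet> u - top ?a \<bullet> u"
  define \<Delta>y where "\<Delta>y = bot ?b \<bullet> u - bot (prv ?b) \<bullet> u"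
  note co = corridor_coefficients[OF jk cor, folded A_def B_def d_def \<Delta>x_def \<Delta>y_def]
  have "((\<lambda>M. M ^ 4 * integral {0..\<theta>1} (cwidth ?a ?b M) - M * (d\<^sup>2 * \<Delta>x * \<Delta>y)) \<longlongrightarrow> coeff_a' J Ob \<gamma> L w A B) at_top"
    unfolding cwidth_def co(3) d_def \<Delta>x_def \<Delta>y_def
  proof (rule width_integral_asymptotics)
    show "0 < bot ?b \<bullet> n - top ?a \<bullet> n" using cor by (simp add: corridor_def)
    show "top ?a \<bullet> u < top (nxt ?a) \<bullet> u" "bot (prv ?b) \<bullet> u < bot ?b \<bullet> u" using nx pv by blast+
    fix \<theta> e assume "0 < \<theta>" "\<theta> < \<theta>1" "e \<in> {top_excess ?a, top_excess (nxt ?a), bot_excess ?b, bot_excess (prv ?b)}"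
    then show "0 \<le> e \<theta> \<and> e \<theta> \<le> sin \<theta>" using small a b c c' by blast
  qed (use a b c c' \<theta>1 continuous_excess top_excess_limit bot_excess_limit in blast)+
  moreover have "filterlim (\<lambda>N. real N * W) at_top sequentially"
    using filterlim_tendsto_pos_mult_at_top[OF tendsto_const W_pos filterlim_real_sequentially] by (simp only: mult.commute)
  ultimately have "((\<lambda>N. (real N * W) ^ 4 * integral {0..\<theta>1} (cwidth ?a ?b (real N * W)) - (real N * W) * (d\<^sup>2 * \<Delta>x * \<Delta>y)) \<longlongrightarrow> coeff_a' J Ob \<gamma> L w A B) sequentially"
    by (rule filterlim_compose)
  then have "((\<lambda>N. ((real N * W) ^ 4 * integral {0..\<theta>1} (cwidth ?a ?b (real N * W)) - (real N * W) * (d\<^sup>2 * \<Delta>x * \<Delta>y) - coeff_a' J Ob \<gamma> L w A B) * (1 / (2 * P * W ^ 4)))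
      \<longlongrightarrow> (coeff_a' J Ob \<gamma> L w A B - coeff_a' J Ob \<gamma> L w A B) * (1 / (2 * P * W ^ 4))) sequentially"
    by (intro tendsto_intros)
  then have lim: "((\<lambda>N. ((real N * W) ^ 4 * integral {0..\<theta>1} (cwidth ?a ?b (real N * W)) - (real N * W) * (d\<^sup>2 * \<Delta>x * \<Delta>y) - coeff_a' J Ob \<gamma> L w A B) * (1 / (2 * P * W ^ 4)))
      \<longlongrightarrow> 0) sequentially" by simp
  \<comment> \<open>\<open>P\<close> is an arbitrary real here, so the identities are verified for q
    = 0 as well, where both sides vanish by the convention on division by zero.\<close>
  have alg: "(x * y) ^ 4 * i * (1 / (2 * q * y ^ 4)) = x ^ 4 * (i / (2 * q))"
    "x * y * (D * E * F) * (1 / (2 * q * y ^ 4)) = x ^ 4 * (D * (E * F / y\<^sup>2) / (2 * q * y * x ^ 3))"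
    "g * (1 / (2 * q * y ^ 4)) = x ^ 4 * (g / (2 * q * (y * x) ^ 4))"
    if "0 < x" "0 < y" for x y i q D E F g :: real
    using that by (cases "q = 0"; simp add: field_simps power2_eq_square power3_eq_cube power4_eq_xxxx)+
  have "\<forall>\<^sub>F N in sequentially. 0 < real N" using eventually_gt_at_top[of "0 :: nat"] by eventually_elim simp
  then have "\<forall>\<^sub>F N in sequentially. ((real N * W) ^ 4 * integral {0..\<theta>1} (cwidth ?a ?b (real N * W)) - (real N * W) * (d\<^sup>2 * \<Delta>x * \<Delta>y) - coeff_a' J Ob \<gamma> L w A B) * (1 / (2 * P * W ^ 4)) =
     real N ^ 4 * (integral {0..\<theta>1} (cwidth ?a ?b (real N * W)) / (2 * P) -
     ((corridor_width L w A B)\<^sup>2 * coeff_a J Ob w A B / (2 * P * W * real N ^ 3) + coeff_a' J Ob \<gamma> L w A B / (2 * P * (W * real N) ^ 4)))"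
  proof eventually_elim
    case (elim N)
    note al = alg[OF elim W_pos]
    have "((real N * W) ^ 4 * integral {0..\<theta>1} (cwidth ?a ?b (real N * W)) - (real N * W) * (d\<^sup>2 * \<Delta>x * \<Delta>y) - coeff_a' J Ob \<gamma> L w A B) * (1 / (2 * P * W ^ 4)) =
      (real N * W) ^ 4 * integral {0..\<theta>1} (cwidth ?a ?b (real N * W)) * (1 / (2 * P * W ^ 4)) -
      real N * W * (d\<^sup>2 * \<Delta>x * \<Delta>y) * (1 / (2 * P * W ^ 4)) - coeff_a' J Ob \<gamma> L w A B * (1 / (2 * P * W ^ 4))"
      by (simp only: left_diff_distrib)
    also have "(real N * W) ^ 4 * integral {0..\<theta>1} (cwidth ?a ?b (real N * W)) * (1 / (2 * P * W ^ 4)) =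
      real N ^ 4 * (integral {0..\<theta>1} (cwidth ?a ?b (real N * W)) / (2 * P))" by (rule al(1))
    also have "real N * W * (d\<^sup>2 * \<Delta>x * \<Delta>y) * (1 / (2 * P * W ^ 4)) =
      real N ^ 4 * (d\<^sup>2 * (\<Delta>x * \<Delta>y / W\<^sup>2) / (2 * P * W * real N ^ 3))" by (rule al(2))
    also have "coeff_a' J Ob \<gamma> L w A B * (1 / (2 * P * W ^ 4)) = real N ^ 4 * (coeff_a' J Ob \<gamma> L w A B / (2 * P * (W * real N) ^ 4))"
      by (rule al(3))
    finally show ?case unfolding co(1,2) by (simp only: right_diff_distrib distrib_left diff_diff_eq)
  qed
  then show ?thesis using tendsto_cong lim by fastforce
qed

text \<open>The horizontal displacement is N W up to a bounded error, so for large N the velocity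
  has a positive component along w. This confines the angles to one half-turn.\<close>

lemma cell_change_direction:
  "\<forall>\<^sub>F N in sequentially. \<forall>q v. (q, v) \<in> phase_space J Ob \<longrightarrow> cell_change J Ob (q, v) = L + int N *s w \<longrightarrow> 0 < v \<bullet> u"
  "\<forall>\<^sub>F N in sequentially. {x \<in> phase_space J Ob. cell_change J Ob x = L + int N *s w} \<in> sets borel"
proof -
  have fl: "filterlim (\<lambda>N. real N * W) at_top sequentially"
    using filterlim_tendsto_pos_mult_at_top[OF tendsto_const W_pos filterlim_real_sequentially] by (simp only: mult.commute)
  have latz: "lat (L + int N *s w) = lat L + (real N * W) *\<^sub>R u" for N
  proof -
    have "real N *\<^sub>R lat w = (real N * W) *\<^sub>R u"
      using arg_cong[OF lat_w, of "(*\<^sub>R) (real N)"] by (simp only: scaleR_scaleR)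
    then show ?thesis by (simp add: lat_add lat_scale)
  qed
  have big: "\<forall>\<^sub>F N in sequentially. K < norm (lat (L + int N *s w))" for K
  proof -
    have "\<forall>\<^sub>F N in sequentially. K + norm (lat L) + 1 \<le> real N * W" using fl by (simp add: filterlim_at_top)
    then show ?thesis
    proof eventually_elim
      case (elim N)
      have "norm ((real N * W) *\<^sub>R u) \<le> norm (lat (L + int N *s w)) + norm (lat L)"
        using norm_triangle_ineq4[of "lat (L + int N *s w)" "lat L"] unfolding latz by simp
      moreover have "norm ((real N * W) *\<^sub>R u) = real N * W" using norm_u by simp
      ultimately show ?case using elim by linarith
    qed
  qed
  obtain B where "\<And>z. B < norm (lat z) \<Longrightarrow> {x \<in> phase_space J Ob. cell_change J Ob x = z} \<in> sets borel"
    using borel_cell_change by blast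
  then show "\<forall>\<^sub>F N in sequentially. {x \<in> phase_space J Ob. cell_change J Ob x = L + int N *s w} \<in> sets borel"
    using big[of B] by (auto elim: eventually_mono)
  obtain C where C: "\<And>z q v. C < norm (lat z) \<Longrightarrow> (q, v) \<in> phase_space J Ob \<Longrightarrow> cell_change J Ob (q, v) = z \<Longrightarrow>
    0 < flight_time J Ob q v \<and> next_point J Ob q v \<in> cell_frontier z \<and>
    (\<forall>t. 0 < t \<and> t < flight_time J Ob q v \<longrightarrow> q + t *\<^sub>R v \<notin> frontier (table J Ob))"
    using far_cell_change by meson
  obtain D where D: "D > 0" "\<And>j. j \<in> J \<Longrightarrow> closure (Ob j) \<subseteq> ball 0 D" using diameter_bound by blast
  have "\<forall>\<^sub>F N in sequentially. 2 * D + norm (lat L) + 1 \<le> real N * W" using fl by (simp add: filterlim_at_top)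
  then show "\<forall>\<^sub>F N in sequentially. \<forall>q v. (q, v) \<in> phase_space J Ob \<longrightarrow> cell_change J Ob (q, v) = L + int N *s w \<longrightarrow> 0 < v \<bullet> u"
    using big[of C]
  proof (eventually_elim, intro allI impI)
    fix N q v assume N: "2 * D + norm (lat L) + 1 \<le> real N * W" and z: "C < norm (lat (L + int N *s w))"
      and ps: "(q, v) \<in> phase_space J Ob" and cc: "cell_change J Ob (q, v) = L + int N *s w"
    define T where "T = flight_time J Ob q v"
    have T: "0 < T" "q + T *\<^sub>R v \<in> cell_frontier (L + int N *s w)" using C[OF z ps cc] by (auto simp: T_def next_point_def)
    obtain k where k: "k \<in> J" "q + T *\<^sub>R v - lat (L + int N *s w) \<in> frontier (Ob k)"
      using T(2) by (auto simp: cell_frontier_def mem_frontier_obstacle_iff)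
    obtain j where j: "j \<in> J" "q \<in> frontier (Ob j)" using ps unfolding phase_space_iff by blast
    define y where "y = q + T *\<^sub>R v - lat (L + int N *s w)"
    have "norm q < D" "norm y < D" using D(2)[OF j(1)] D(2)[OF k(1)] j k by (auto simp: frontier_def subset_iff y_def)
    then have "\<bar>q \<bullet> u\<bar> < D" "\<bar>y \<bullet> u\<bar> < D" using abs_inner_unit[OF norm_u, of q] abs_inner_unit[OF norm_u, of y] by linarith+
    moreover have "\<bar>lat L \<bullet> u\<bar> \<le> norm (lat L)" by (rule abs_inner_unit[OF norm_u])
    moreover have "y \<bullet> u = q \<bullet> u + T * (v \<bullet> u) - (lat L \<bullet> u + real N * W)"
      unfolding y_def latz inner_diff_left inner_add_left inner_scaleR_left inner_un by simp
    ultimately have "0 < T * (v \<bullet> u)" using N by linarith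
    then show "0 < v \<bullet> u" using T(1) by (simp add: zero_less_mult_iff)
  qed
qed

end

section \<open>Summation over rising and descending corridors\<close>

theorem lemma4p2:
  fixes J :: "'j set"
    and Ob :: "'j \<Rightarrow> (real ^ 2) set"
    and \<gamma> :: "'j \<Rightarrow> real \<Rightarrow> real ^ 2"
    and len :: "'j \<Rightarrow> real"
    and L w :: "int ^ 2"
  assumes "finite J" and "J \<noteq> {}"
    and "\<And>j. j \<in> J \<Longrightarrow> open (Ob j) \<and> convex (Ob j)"
    and "\<And>j. j \<in> J \<Longrightarrow> arclength_param (Ob j) (\<gamma> j) (len j) \<and> Ck_on 3 (\<gamma> j) UNIV"
    and nonzero_curvature: "\<And>j s. j \<in> J \<Longrightarrow> vderiv (vderiv (\<gamma> j)) s \<noteq> 0"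
    and "disjoint_family_on (\<lambda>(j, z). closure (obstacle Ob j z)) (J \<times> UNIV)"
    and infinite_horizon: "\<exists>p v. v \<noteq> 0 \<and> line p v \<subseteq> table J Ob"
    and C4_at_corridors: "\<And>j s. j \<in> J \<Longrightarrow> line (\<gamma> j s) (vderiv (\<gamma> j) s) \<subseteq> table J Ob \<Longrightarrow>
           \<exists>e>0. Ck_on 4 (\<gamma> j) {s - e<..<s + e}"
    and "coprime (w $ 1) (w $ 2)"
  shows "(\<lambda>N::nat.
      measure (billiard_measure J Ob \<gamma> len)
        {x \<in> phase_space J Ob. cell_change J Ob x = L + int N *s w}
      - (\<Sum>(A, B)\<in>corridor_pairs J Ob L w.
           (corridor_width L w A B)\<^sup>2 * coeff_a J Ob w A B
             / (2 * perimeter J len * norm (lat w) * real N ^ 3)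
           + coeff_a' J Ob \<gamma> L w A B / (2 * perimeter J len * (norm (lat w) * real N) ^ 4)))
    \<in> o(\<lambda>N. 1 / real N ^ 4)"
proof -
  have bt: "billiard_table J Ob \<gamma> len"
    using assms(1-6) by (intro billiard_table.intro)
  have w0: "w \<noteq> 0" using assms(9) by auto
  then have lw: "lat w \<noteq> 0" using lat_eq_iff[of w 0] by simp
  \<comment> \<open>Any unit normal will do; the interpretations with \<open>n\<close> and
    \<open>- n\<close> account for the rising and the descending flights.\<close>
  define n where "n = rot (sgn (lat w))"
  have n: "norm n = 1" "sgn (lat w) \<bullet> n = 0" using lw by (simp_all add: n_def norm_sgn)
  have "lat w \<bullet> n = 0"
  proof -
    have "lat w = norm (lat w) *\<^sub>R sgn (lat w)" using lw by (simp add: sgn_div_norm)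
    then have "lat w \<bullet> n = norm (lat w) * (sgn (lat w) \<bullet> n)" by (metis inner_scaleR_left)
    then show ?thesis using n(2) by simp
  qed
  then have F1: "frame J Ob \<gamma> len w n" and F2: "frame J Ob \<gamma> len w (- n)"
    using bt lw n(1) by (simp_all add: frame_def frame_axioms_def)
  interpret F1: frame J Ob \<gamma> len w n by (rule F1)
  interpret F2: frame J Ob \<gamma> len w "- n" by (rule F2)
  define P where "P = perimeter J len"
  have P: "0 \<le> P" unfolding P_def perimeter_def using F1.len_pos by (intro sum_nonneg) (auto intro: less_imp_le)
  define S where "S N = {x \<in> phase_space J Ob. cell_change J Ob x = L + int N *s w}" for N
  define F where "F N A B = (corridor_width L w A B)\<^sup>2 * coeff_a J Ob w A B / (2 * P * norm (lat w) * real N ^ 3)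
       + coeff_a' J Ob \<gamma> L w A B / (2 * P * (norm (lat w) * real N) ^ 4)" for N A B
  define K1 where "K1 = (SIGMA j:J. {k\<in>J. F1.corridor (j, 0) (k, L)})"
  define K2 where "K2 = (SIGMA j:J. {k\<in>J. F2.corridor (j, 0) (k, L)})"
  have fK: "finite K1" "finite K2" using assms(1) by (auto simp: K1_def K2_def)
  obtain t1 where t1: "0 < t1" "t1 \<le> 1"
    "\<forall>a\<in>F1.idx. \<forall>\<theta>. 0 < \<theta> \<and> \<theta> < t1 \<longrightarrow> 0 \<le> F1.top_excess a \<theta> \<and> F1.top_excess a \<theta> \<le> sin \<theta> \<and> 0 \<le> F1.bot_excess a \<theta> \<and> F1.bot_excess a \<theta> \<le> sin \<theta>"
    "\<forall>\<^sub>F N in sequentially. S N \<in> sets borel \<longrightarrow> (\<forall>j\<in>J. \<forall>\<theta>. 0 < \<theta> \<and> \<theta> < pi / 2 \<longrightarrow> F1.flux j (S N) (dir (sgn (lat w)) n \<theta>) =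
      (if \<theta> < t1 then \<Sum>k\<in>{k\<in>J. F1.corridor (j, 0) (k, L)}. ennreal (F1.cwidth (j, 0) (k, L) (real N * norm (lat w)) \<theta>) else 0))"
    using F1.flux_corridors[of L] unfolding S_def by blast
  obtain t2 where t2: "0 < t2" "t2 \<le> 1"
    "\<forall>a\<in>F1.idx. \<forall>\<theta>. 0 < \<theta> \<and> \<theta> < t2 \<longrightarrow> 0 \<le> F2.top_excess a \<theta> \<and> F2.top_excess a \<theta> \<le> sin \<theta> \<and> 0 \<le> F2.bot_excess a \<theta> \<and> F2.bot_excess a \<theta> \<le> sin \<theta>"
    "\<forall>\<^sub>F N in sequentially. S N \<in> sets borel \<longrightarrow> (\<forall>j\<in>J. \<forall>\<theta>. 0 < \<theta> \<and> \<theta> < pi / 2 \<longrightarrow> F1.flux j (S N) (dir (sgn (lat w)) (- n) \<theta>) =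
      (if \<theta> < t2 then \<Sum>k\<in>{k\<in>J. F2.corridor (j, 0) (k, L)}. ennreal (F2.cwidth (j, 0) (k, L) (real N * norm (lat w)) \<theta>) else 0))"
    using F2.flux_corridors[of L] unfolding S_def by blast
  define I1 where "I1 N j k = integral {0..t1} (F1.cwidth (j, 0) (k, L) (real N * norm (lat w)))" for N :: nat and j k
  define I2 where "I2 N j k = integral {0..t2} (F2.cwidth (j, 0) (k, L) (real N * norm (lat w)))" for N :: nat and j k
  \<comment> \<open>An exact identity for large N: the probability is a finite sum of width
    integrals, one per oriented corridor, so only finitely many error terms have to be
    added.\<close>
  have msr: "\<forall>\<^sub>F N in sequentially. measure (billiard_measure J Ob \<gamma> len) (S N) =
     (\<Sum>(j, k)\<in>K1. I1 N j k / (2 * P)) + (\<Sum>(j, k)\<in>K2. I2 N j k / (2 * P))"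
    using t1(4) t2(4) F1.cell_change_direction[of L]
  proof eventually_elim
    case (elim N)
    have SB: "S N \<in> sets borel" using elim(4) by (simp add: S_def)
    have Su: "0 < v \<bullet> sgn (lat w)" if "(q, v) \<in> S N" for q v using elim(3) that unfolding S_def by blast
    have f1: "(\<integral>\<^sup>+\<theta>. F1.flux j (S N) (dir (sgn (lat w)) n \<theta>) * indicator {0<..<pi/2} \<theta> \<partial>lborel) = ennreal (\<Sum>k\<in>{k\<in>J. F1.corridor (j, 0) (k, L)}. I1 N j k)"
      if j: "j \<in> J" for j
      unfolding I1_def by (rule F1.flux_integral[OF t1(1,2) j]) (use elim(1) SB j in blast)
    have f2: "(\<integral>\<^sup>+\<theta>. F1.flux j (S N) (dir (sgn (lat w)) (- n) \<theta>) * indicator {0<..<pi/2} \<theta> \<partial>lborel) = ennreal (\<Sum>k\<in>{k\<in>J. F2.corridor (j, 0) (k, L)}. I2 N j k)"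
      if j: "j \<in> J" for j
      unfolding I2_def by (rule F2.flux_integral[OF t2(1,2) j]) (use elim(2) SB j in blast)
    have nn1: "0 \<le> I1 N j k" if "j \<in> J" "k \<in> J" "F1.corridor (j, 0) (k, L)" for j k
      unfolding I1_def using that
      by (intro integral_nonneg integrable_continuous_interval F1.continuous_cwidth) (auto simp: F1.cwidth_def strip_width_def)
    have nn2: "0 \<le> I2 N j k" if "j \<in> J" "k \<in> J" "F2.corridor (j, 0) (k, L)" for j k
      unfolding I2_def using that
      by (intro integral_nonneg integrable_continuous_interval F2.continuous_cwidth) (auto simp: F2.cwidth_def strip_width_def)
    let ?s = "\<lambda>j. (\<Sum>k\<in>{k\<in>J. F1.corridor (j, 0) (k, L)}. I1 N j k) + (\<Sum>k\<in>{k\<in>J. F2.corridor (j, 0) (k, L)}. I2 N j k)"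
    have s0: "0 \<le> ?s j" if "j \<in> J" for j
      using that nn1 nn2 by (intro add_nonneg_nonneg sum_nonneg) auto
    have "emeasure (billiard_measure J Ob \<gamma> len) (S N) = ennreal (1 / (2 * P)) * (\<Sum>j\<in>J. ennreal (?s j))"
    proof -
      have "(\<Sum>j\<in>J. (\<integral>\<^sup>+\<theta>. F1.flux j (S N) (dir (sgn (lat w)) n \<theta>) * indicator {0<..<pi/2} \<theta> \<partial>lborel) +
        (\<integral>\<^sup>+\<theta>. F1.flux j (S N) (dir (sgn (lat w)) (- n) \<theta>) * indicator {0<..<pi/2} \<theta> \<partial>lborel)) = (\<Sum>j\<in>J. ennreal (?s j))"
      proof (intro sum.cong refl)
        fix j assume j: "j \<in> J"
        have "0 \<le> (\<Sum>k\<in>{k\<in>J. F1.corridor (j, 0) (k, L)}. I1 N j k)" "0 \<le> (\<Sum>k\<in>{k\<in>J. F2.corridor (j, 0) (k, L)}. I2 N j k)"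
          using nn1[OF j] nn2[OF j] by (auto intro!: sum_nonneg)
        then show "(\<integral>\<^sup>+\<theta>. F1.flux j (S N) (dir (sgn (lat w)) n \<theta>) * indicator {0<..<pi/2} \<theta> \<partial>lborel) +
            (\<integral>\<^sup>+\<theta>. F1.flux j (S N) (dir (sgn (lat w)) (- n) \<theta>) * indicator {0<..<pi/2} \<theta> \<partial>lborel) = ennreal (?s j)"
          unfolding f1[OF j] f2[OF j] by (rule ennreal_plus[symmetric])
      qed
      then show ?thesis
        unfolding P_def by (subst F1.emeasure_billiard_flux[OF F1.norm_u n(1,2) SB]) (use Su in auto)
    qed
    also have "\<dots> = ennreal (1 / (2 * P) * (\<Sum>j\<in>J. ?s j))"
    proof -
      have "(\<Sum>j\<in>J. ennreal (?s j)) = ennreal (\<Sum>j\<in>J. ?s j)" by (rule sum_ennreal) (rule s0)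
      moreover have "0 \<le> 1 / (2 * P)" using P by simp
      ultimately show ?thesis by (simp only: ennreal_mult')
    qed
    finally have "measure (billiard_measure J Ob \<gamma> len) (S N) = 1 / (2 * P) * (\<Sum>j\<in>J. ?s j)"
      using s0 P by (simp add: measure_def sum_nonneg)
    also have "\<dots> = (\<Sum>(j, k)\<in>K1. I1 N j k / (2 * P)) + (\<Sum>(j, k)\<in>K2. I2 N j k / (2 * P))"
    proof -
      have "(\<Sum>(j, k)\<in>K1. I1 N j k / (2 * P)) = (\<Sum>j\<in>J. \<Sum>k\<in>{k\<in>J. F1.corridor (j, 0) (k, L)}. I1 N j k / (2 * P))"
        unfolding K1_def using assms(1) by (intro sum.Sigma[symmetric]) auto
      moreover have "(\<Sum>(j, k)\<in>K2. I2 N j k / (2 * P)) = (\<Sum>j\<in>J. \<Sum>k\<in>{k\<in>J. F2.corridor (j, 0) (k, L)}. I2 N j k / (2 * P))"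
        unfolding K2_def using assms(1) by (intro sum.Sigma[symmetric]) auto
      ultimately show ?thesis
        by (simp only: sum.distrib sum_divide_distrib[symmetric] add_divide_distrib[symmetric]) simp
    qed
    finally show ?case .
  qed
  \<comment> \<open>The pairs are split by the sign of the height difference of their lines. Equal
    heights would make the two lines coincide, which the definition of a corridor excludes.\<close>
  have pairs: "(\<Sum>(A, B)\<in>corridor_pairs J Ob L w. F N A B) =
     (\<Sum>(j, k)\<in>K1. F N (F1.top0 n j) (F1.top0 (- n) k)) + (\<Sum>(j, k)\<in>K2. F N (F1.top0 (- n) j) (F1.top0 n k))" for N
  proof -
    define E1 where "E1 = {(A, B) \<in> corridor_pairs J Ob L w. A \<bullet> n < (B + lat L) \<bullet> n}"
    define E2 where "E2 = {(A, B) \<in> corridor_pairs J Ob L w. (B + lat L) \<bullet> n < A \<bullet> n}"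
    have E1: "E1 = (\<lambda>(j, k). (F1.top0 n j, F1.top0 (- n) k)) ` K1"
      unfolding E1_def K1_def by (rule F1.corridor_pairs_oriented)
    have E2: "E2 = (\<lambda>(j, k). (F1.top0 (- n) j, F1.top0 n k)) ` K2"
      using F2.corridor_pairs_oriented[of L] unfolding E2_def K2_def inner_minus_right neg_less_iff_less minus_minus .
    have "A \<bullet> n \<noteq> (B + lat L) \<bullet> n" if "(A, B) \<in> corridor_pairs J Ob L w" for A B
    proof
      assume "A \<bullet> n = (B + lat L) \<bullet> n"
      then have "line A (lat w) = line (B + lat L) (lat w)" by (intro set_eqI) (simp only: F1.mem_line_iff)
      then show False using that by (simp add: corridor_pairs_def)
    qed
    then have cp: "corridor_pairs J Ob L w = E1 \<union> E2" unfolding E1_def E2_def by (force simp: neq_iff)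
    have dj: "E1 \<inter> E2 = {}" unfolding E1_def E2_def by (auto dest: less_asym)
    have K: "K1 \<subseteq> J \<times> J" "K2 \<subseteq> J \<times> J" by (auto simp: K1_def K2_def)
    have i1: "inj_on (\<lambda>(j, k). (F1.top0 n j, F1.top0 (- n) k)) K1"
      by (rule inj_on_subset[OF F1.inj_tops K(1)])
    have i2: "inj_on (\<lambda>(j, k). (F1.top0 (- n) j, F1.top0 n k)) K2"
      using inj_on_subset[OF F2.inj_tops K(2)] unfolding minus_minus .
    have "(\<Sum>(A, B)\<in>corridor_pairs J Ob L w. F N A B) = (\<Sum>(A, B)\<in>E1. F N A B) + (\<Sum>(A, B)\<in>E2. F N A B)"
      unfolding cp using fK dj by (intro sum.union_disjoint) (simp_all add: E1 E2)
    also have "(\<Sum>(A, B)\<in>E1. F N A B) = (\<Sum>(j, k)\<in>K1. F N (F1.top0 n j) (F1.top0 (- n) k))"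
      unfolding E1 sum.reindex[OF i1] by (simp add: case_prod_unfold)
    also have "(\<Sum>(A, B)\<in>E2. F N A B) = (\<Sum>(j, k)\<in>K2. F N (F1.top0 (- n) j) (F1.top0 n k))"
      unfolding E2 sum.reindex[OF i2] by (simp add: case_prod_unfold)
    finally show ?thesis .
  qed
  have ev: "\<forall>\<^sub>F N in sequentially. real N ^ 4 * (measure (billiard_measure J Ob \<gamma> len) (S N) - (\<Sum>(A, B)\<in>corridor_pairs J Ob L w. F N A B)) =
    (\<Sum>(j, k)\<in>K1. real N ^ 4 * (I1 N j k / (2 * P) - F N (F1.top0 n j) (F1.top0 (- n) k))) +
    (\<Sum>(j, k)\<in>K2. real N ^ 4 * (I2 N j k / (2 * P) - F N (F1.top0 (- n) j) (F1.top0 n k)))"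
    using msr
  proof eventually_elim
    case (elim N)
    have "X + Y - (Z + V) = X - Z + (Y - V)" for X Y Z V :: real by simp
    then show ?case
      unfolding elim pairs
      by (simp only: case_prod_unfold sum_distrib_left[symmetric] sum_subtractf distrib_left[symmetric])
  qed
  have "((\<lambda>N. (\<Sum>(j, k)\<in>K1. real N ^ 4 * (I1 N j k / (2 * P) - F N (F1.top0 n j) (F1.top0 (- n) k))) +
    (\<Sum>(j, k)\<in>K2. real N ^ 4 * (I2 N j k / (2 * P) - F N (F1.top0 (- n) j) (F1.top0 n k)))) \<longlongrightarrow> 0) sequentially"
  proof (intro tendsto_add_zero tendsto_null_sum)
    fix x assume "x \<in> K1"
    then obtain j k where x: "x = (j, k)" and j: "j \<in> J" "k \<in> J" "F1.corridor (j, 0) (k, L)" by (auto simp: K1_def)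
    show "((\<lambda>N. case x of (j, k) \<Rightarrow> real N ^ 4 * (I1 N j k / (2 * P) - F N (F1.top0 n j) (F1.top0 (- n) k))) \<longlongrightarrow> 0) sequentially"
      using F1.corridor_asymptotics[OF j t1(1-3)] unfolding x prod.case I1_def F_def P_def .
  next
    fix x assume "x \<in> K2"
    then obtain j k where x: "x = (j, k)" and j: "j \<in> J" "k \<in> J" "F2.corridor (j, 0) (k, L)" by (auto simp: K2_def)
    show "((\<lambda>N. case x of (j, k) \<Rightarrow> real N ^ 4 * (I2 N j k / (2 * P) - F N (F1.top0 (- n) j) (F1.top0 n k))) \<longlongrightarrow> 0) sequentially"
      using F2.corridor_asymptotics[OF j t2(1-3)] unfolding x prod.case I2_def F_def P_def minus_minus .
  qed
  then have lim: "((\<lambda>N. real N ^ 4 * (measure (billiard_measure J Ob \<gamma> len) (S N) - (\<Sum>(A, B)\<in>corridor_pairs J Ob L w. F N A B))) \<longlongrightarrow> 0) sequentially"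
    using tendsto_cong[OF ev] by blast
  have "(\<lambda>N. measure (billiard_measure J Ob \<gamma> len) (S N) - (\<Sum>(A, B)\<in>corridor_pairs J Ob L w. F N A B)) \<in> o(\<lambda>N. 1 / real N ^ 4)"
  proof (rule smalloI_tendsto)
    show "\<forall>\<^sub>F N in sequentially. 1 / real N ^ 4 \<noteq> 0"
      using eventually_gt_at_top[of 0] by eventually_elim simp
    show "((\<lambda>N. (measure (billiard_measure J Ob \<gamma> len) (S N) - (\<Sum>(A, B)\<in>corridor_pairs J Ob L w. F N A B)) / (1 / real N ^ 4)) \<longlongrightarrow> 0) sequentially"
      using lim by (simp add: mult.commute)
  qed
  then show ?thesis unfolding S_def F_def P_def .
qed

end
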